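(* There is a polynomial-time randomized algorithm for FTFP which always outputs a feasible integral solution and whose expected cost is at most $(1+2/e)\cdot\mathrm{LP}^\ast\le(1+2/e)\cdot\mathrm{OPT}$, where $\mathrm{LP}^\ast$ is the optimal value of the LP relaxation and $\mathrm{OPT}$ the optimal integral cost.
   Context: FTFP (Fault-Tolerant Facility Placement): given a finite set $\mathbb{F}$ of sites and a finite set $\mathbb{C}$ of clients, an opening cost $f_i\ge 0$ for each site $i$, connection costs $d_{ij}\ge 0$ forming a metric (symmetric, triangle inequality), and a positive integer demand $r_j$ for each client $j$. Any number of facilities may be opened at a site; a feasible integral solution consists of nonnegative integers $y_i$ (facilities opened at site $i$) and $x_{ij}$ (connections of $j$ to facilities at site $i$) with $x_{ij}\le y_i$ and $\sum_{i}x_{ij}\ge r_j$, so that each client is connected to $r_j$ distinct facilities; its cost is $\sum_i f_iy_i+\sum_{i,j}d_{ij}x_{ij}$. The LP relaxation is the same program with real $x_{ij},y_i\ge 0$. *)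

theory Defs
  imports "HOL-Probability.Probability" "HOL-Computational_Algebra.Polynomial"
    "HOL-Library.Log_Nat"
begin

section \<open>Randomized random-access programs with logarithmic cost\<close>

text \<open>
  The machine has an unbounded memory of natural numbers with indirect addressing
  (\<open>Mem e\<close> reads the cell whose address is the value of \<open>e\<close>). \<open>Sub\<close> is truncated
  subtraction and \<open>Div\<close> is integer division.
\<close>

datatype expr =
    Const nat
  | Mem expr
  | Add expr expr
  | Sub expr expr
  | Mul expr expr
  | Div expr expr

text \<open>
  \<open>Assign a e\<close> stores the value of \<open>e\<close> in the cell with address \<open>a\<close>; \<open>Draw a e\<close> stores
  there a fresh uniformly distributed element of \<open>{0..n}\<close>, where \<open>n\<close> is the value of
  \<open>e\<close> (so \<open>Draw a (Const 1)\<close> is a fair coin). A test succeeds iff its value is nonzero.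
\<close>

datatype com =
    Skip
  | Assign expr expr
  | Draw expr expr
  | Seq com com
  | Cond expr com com
  | While expr com

type_synonym memory = "nat \<Rightarrow> nat"

primrec eval :: "memory \<Rightarrow> expr \<Rightarrow> nat" where
  "eval m (Const n) = n"
| "eval m (Mem e) = m (eval m e)"
| "eval m (Add a b) = eval m a + eval m b"
| "eval m (Sub a b) = eval m a - eval m b"
| "eval m (Mul a b) = eval m a * eval m b"
| "eval m (Div a b) = eval m a div eval m b"

definition nat_size :: "nat \<Rightarrow> nat" where
  "nat_size n = 1 + floorlog 2 n"

text \<open>
  Logarithmic cost criterion: every node of an expression is charged the binary length of
  its value. Since operands and addresses are nodes themselves, their lengths are charged too.
\<close>

primrec eval_cost :: "memory \<Rightarrow> expr \<Rightarrow> nat" where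
  "eval_cost m (Const n) = nat_size n"
| "eval_cost m (Mem e) = eval_cost m e + nat_size (eval m (Mem e))"
| "eval_cost m (Add a b) = eval_cost m a + eval_cost m b + nat_size (eval m (Add a b))"
| "eval_cost m (Sub a b) = eval_cost m a + eval_cost m b + nat_size (eval m (Sub a b))"
| "eval_cost m (Mul a b) = eval_cost m a + eval_cost m b + nat_size (eval m (Mul a b))"
| "eval_cost m (Div a b) = eval_cost m a + eval_cost m b + nat_size (eval m (Div a b))"

text \<open>
  A configuration consists of the stack of commands still to be executed, the memory, and the
  time consumed so far. It is halted iff the stack is empty.
\<close>

type_synonym config = "com list \<times> memory \<times> nat"

fun step :: "config \<Rightarrow> config pmf" where
  "step ([], m, t) = return_pmf ([], m, t)"
| "step (Skip # k, m, t) = return_pmf (k, m, t + 1)"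
| "step (Assign a e # k, m, t) =
     return_pmf (k, m(eval m a := eval m e), t + 1 + eval_cost m a + eval_cost m e)"
| "step (Draw a e # k, m, t) =
     map_pmf (\<lambda>v. (k, m(eval m a := v), t + 1 + eval_cost m a + eval_cost m e))
       (pmf_of_set {0..eval m e})"
| "step (Seq c c' # k, m, t) = return_pmf (c # c' # k, m, t + 1)"
| "step (Cond e c c' # k, m, t) =
     return_pmf ((if eval m e \<noteq> 0 then c else c') # k, m, t + 1 + eval_cost m e)"
| "step (While e c # k, m, t) =
     return_pmf (if eval m e \<noteq> 0 then c # While e c # k else k, m, t + 1 + eval_cost m e)"

primrec run :: "nat \<Rightarrow> config \<Rightarrow> config pmf" where
  "run 0 s = return_pmf s"
| "run (Suc n) s = bind_pmf (step s) (run n)"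

definition init_config :: "com \<Rightarrow> nat list \<Rightarrow> config" where
  "init_config P xs = ([P], \<lambda>a. if a < length xs then xs ! a else 0, 0)"

text \<open>
  Every step takes at least one unit of time, so a computation of total time at most \<open>T\<close>
  has halted after \<open>T\<close> steps. The bound is a worst-case bound over all random choices.
\<close>

definition halts_within :: "com \<Rightarrow> nat list \<Rightarrow> nat \<Rightarrow> bool" where
  "halts_within P xs T \<longleftrightarrow>
     (\<forall>(k, m, t) \<in> set_pmf (run T (init_config P xs)). k = [] \<and> t \<le> T)"

text \<open>Distribution of the final memory, for a program that halts on \<open>xs\<close> in bounded time.\<close>

definition outcome :: "com \<Rightarrow> nat list \<Rightarrow> memory pmf" where
  "outcome P xs =
     map_pmf (\<lambda>(k, m, t). m) (run (LEAST T. halts_within P xs T) (init_config P xs))"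

definition input_size :: "nat list \<Rightarrow> nat" where
  "input_size xs = (\<Sum>x\<leftarrow>xs. nat_size x)"

definition poly_time_on :: "nat list set \<Rightarrow> com \<Rightarrow> bool" where
  "poly_time_on X P \<longleftrightarrow>
     (\<exists>p :: nat poly. \<forall>xs \<in> X. halts_within P xs (poly p (input_size xs)))"

lemma finite_set_pmf_step: "finite (set_pmf (step s))"
  by (cases s rule: step.cases) auto

text \<open>All computations have finite support, so expectations over them always exist.\<close>

lemma finite_set_pmf_run: "finite (set_pmf (run n s))"
  by (induction n arbitrary: s) (auto simp: finite_set_pmf_step)

lemma finite_set_pmf_outcome: "finite (set_pmf (outcome P xs))"
  by (simp add: outcome_def finite_set_pmf_run)


section \<open>Fault-tolerant facility placement\<close>

text \<open>
  Sites and clients are numbered from 0. The distance lives on the disjoint union of sites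
  (\<open>Inl\<close>) and clients (\<open>Inr\<close>); distinct points may be at distance 0, so that a site and a
  client can share a location.
\<close>

record ftfp =
  num_sites :: nat
  num_clients :: nat
  open_cost :: "nat \<Rightarrow> rat"
  distance :: "nat + nat \<Rightarrow> nat + nat \<Rightarrow> rat"
  demand :: "nat \<Rightarrow> nat"

definition points :: "ftfp \<Rightarrow> (nat + nat) set" where
  "points I = {..<num_sites I} <+> {..<num_clients I}"

abbreviation conn_cost :: "ftfp \<Rightarrow> nat \<Rightarrow> nat \<Rightarrow> rat" where
  "conn_cost I i j \<equiv> distance I (Inl i) (Inr j)"

definition is_metric_on :: "'p set \<Rightarrow> ('p \<Rightarrow> 'p \<Rightarrow> rat) \<Rightarrow> bool" where
  "is_metric_on S d \<longleftrightarrow>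
     (\<forall>p\<in>S. d p p = 0) \<and>
     (\<forall>p\<in>S. \<forall>q\<in>S. 0 \<le> d p q \<and> d p q = d q p) \<and>
     (\<forall>p\<in>S. \<forall>q\<in>S. \<forall>s\<in>S. d p s \<le> d p q + d q s)"

text \<open>The last condition says that the instance is feasible.\<close>

definition ftfp_instance :: "ftfp \<Rightarrow> bool" where
  "ftfp_instance I \<longleftrightarrow>
     (\<forall>i < num_sites I. 0 \<le> open_cost I i) \<and>
     is_metric_on (points I) (distance I) \<and>
     (\<forall>j < num_clients I. 0 < demand I j) \<and>
     (0 < num_clients I \<longrightarrow> 0 < num_sites I)"

text \<open>
  At type \<open>nat\<close> these are the constraints of the integer program, at type \<open>real\<close> those
  of its LP relaxation.
\<close>

definition feasible ::
    "ftfp \<Rightarrow> (nat \<Rightarrow> 'a :: linordered_semidom) \<Rightarrow> (nat \<Rightarrow> nat \<Rightarrow> 'a) \<Rightarrow> bool" where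
  "feasible I y x \<longleftrightarrow>
     (\<forall>i < num_sites I. 0 \<le> y i) \<and>
     (\<forall>i < num_sites I. \<forall>j < num_clients I. 0 \<le> x i j \<and> x i j \<le> y i) \<and>
     (\<forall>j < num_clients I. of_nat (demand I j) \<le> (\<Sum>i < num_sites I. x i j))"

definition cost :: "ftfp \<Rightarrow> (nat \<Rightarrow> real) \<Rightarrow> (nat \<Rightarrow> nat \<Rightarrow> real) \<Rightarrow> real" where
  "cost I y x =
     (\<Sum>i < num_sites I. real_of_rat (open_cost I i) * y i) +
     (\<Sum>i < num_sites I. \<Sum>j < num_clients I. real_of_rat (conn_cost I i j) * x i j)"

definition int_cost :: "ftfp \<Rightarrow> (nat \<Rightarrow> nat) \<Rightarrow> (nat \<Rightarrow> nat \<Rightarrow> nat) \<Rightarrow> real" where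
  "int_cost I y x = cost I (\<lambda>i. real (y i)) (\<lambda>i j. real (x i j))"

definition LP_opt :: "ftfp \<Rightarrow> real" where
  "LP_opt I = Inf {cost I y x | y x. feasible I y x}"

definition OPT :: "ftfp \<Rightarrow> real" where
  "OPT I = Inf {int_cost I y x | y x. feasible I y x}"


subsection \<open>Binary encoding of instances and solutions\<close>

text \<open>
  Nonnegative rationals are encoded by numerator and denominator in lowest terms. Of the
  metric, only the connection costs between sites and clients are part of the input.
\<close>

definition encode_rat :: "rat \<Rightarrow> nat list" where
  "encode_rat q = [nat (fst (quotient_of q)), nat (snd (quotient_of q))]"

definition encode :: "ftfp \<Rightarrow> nat list" where
  "encode I =
     [num_sites I, num_clients I] @
     concat (map (\<lambda>i. encode_rat (open_cost I i)) [0..<num_sites I]) @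
     concat (map (\<lambda>i. concat (map (\<lambda>j. encode_rat (conn_cost I i j)) [0..<num_clients I]))
       [0..<num_sites I]) @
     map (demand I) [0..<num_clients I]"

text \<open>
  The solution is read off the final memory from address 0 on: first all \<open>y i\<close>, then the
  matrix \<open>x i j\<close> row by row.
\<close>

definition out_y :: "ftfp \<Rightarrow> memory \<Rightarrow> nat \<Rightarrow> nat" where
  "out_y I m i = m i"

definition out_x :: "ftfp \<Rightarrow> memory \<Rightarrow> nat \<Rightarrow> nat \<Rightarrow> nat" where
  "out_x I m i j = m (num_sites I + i * num_clients I + j)"

end

theory Submission
  imports Defs
begin

text \<open>
  Scale all costs to integers. A fractional solution is a combination of stars (a site together
  with a set of clients). Multiplicative weights on the clients produce one of cost at most
  \<open>1 + \<epsilon>\<close> times \<open>LP\<^sup>*\<close>: in every round the star of least ratio of cost to weight is bought, and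
  this ratio is bounded by weak duality. The integral part of every star is opened outright. The rest
  is cut into \<open>atoms\<close> of LP mass \<open>1/N\<close>, where every client with residual demand \<open>r\<close> sees at least
  \<open>r * N\<close> of them.

  An atom is opened with probability \<open>1/L\<close>, where \<open>N/L = 19/11\<close> is just below \<open>1 + 2/e\<close>, so
  facilities cost \<open>19/11\<close> times their fractional cost. To guarantee feasibility, disjoint clusters of
  \<open>L\<close> atoms are formed greedily in the order of increasing radius, and exactly one atom of each
  cluster is opened; the demands of a client are assigned different clusters, whose atoms are at
  distance at most \<open>3 * \<beta>\<close> where \<open>\<beta>\<close> is the radius of the \<open>L\<close> nearest remaining atoms.

  A client connects each demand to the nearest open atom of a set of \<open>N\<close> atoms, or to its cluster if
  that is nearer. No atom among \<open>a\<close> given ones is open with probability at most \<open>exp (- a / L)\<close>, and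
  integrating over the distance bounds the expected connection cost again by \<open>19/11\<close> times the
  fractional one; at \<open>\<gamma> = 19/11\<close> this uses \<open>1 + 1/e + 2 * exp (- \<gamma>) \<le> \<gamma>\<close>. The margin between
  \<open>19/11\<close> and \<open>1 + 2/e\<close> absorbs \<open>\<epsilon>\<close>.

  All loops of the program have polynomially bounded ranges, and each assignment lengthens the
  numbers in memory only additively, so that the bit sizes remain polynomial.
\<close>

section \<open>Timed execution of randomized programs\<close>

lemma run_add: "run (a + b) s = bind_pmf (run a s) (run b)"
  by (induction a arbitrary: s) (auto simp: bind_return_pmf bind_assoc_pmf intro!: bind_pmf_cong)

lemma run_halted: "run n ([], m, t) = return_pmf ([], m, t)"
  by (induction n) (simp_all add: bind_return_pmf)

text \<open>
  The number \<open>s\<close> of steps may depend on the random choices, so a run of fixed length is split at a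
  random position; \<open>q\<close> is the joint distribution of the final memory, of \<open>s\<close> and of the time.
\<close>

definition exec_joint :: "com \<Rightarrow> memory \<Rightarrow> (memory \<times> nat \<times> nat) pmf \<Rightarrow> nat \<Rightarrow> bool" where
  "exec_joint c m q T \<longleftrightarrow> (\<forall>(m', s, t) \<in> set_pmf q. s \<le> t \<and> t \<le> T) \<and>
     (\<forall>k t\<^sub>0 n. T \<le> n \<longrightarrow>
        run n (c # k, m, t\<^sub>0) = bind_pmf q (\<lambda>(m', s, t). run (n - s) (k, m', t\<^sub>0 + t)))"

definition exec :: "com \<Rightarrow> memory \<Rightarrow> memory pmf \<Rightarrow> nat \<Rightarrow> bool" where
  "exec c m \<mu> T \<longleftrightarrow> (\<exists>q. map_pmf fst q = \<mu> \<and> exec_joint c m q T)"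

lemma exec_jointD:
  assumes "exec_joint c m q T"
  shows "(m', s, t) \<in> set_pmf q \<Longrightarrow> s \<le> t \<and> t \<le> T"
    and "T \<le> n \<Longrightarrow> run n (c # k, m, t\<^sub>0) = bind_pmf q (\<lambda>(m', s, t). run (n - s) (k, m', t\<^sub>0 + t))"
  using assms unfolding exec_joint_def by blast+

lemma exec_mono: "exec c m \<mu> T \<Longrightarrow> T \<le> T' \<Longrightarrow> exec c m \<mu> T'"
  unfolding exec_def exec_joint_def by (fastforce intro: order_trans)

lemma exec_run:
  assumes "exec P m \<mu> T" "T \<le> n"
  shows "map_pmf (\<lambda>(k, m, t). m) (run n ([P], m, 0)) = \<mu>"
    and "\<forall>(k, m, t) \<in> set_pmf (run n ([P], m, 0)). k = [] \<and> t \<le> n"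
proof -
  obtain q where joint: "map_pmf fst q = \<mu>" "exec_joint P m q T"
    using assms(1) unfolding exec_def by blast
  have run_joint: "run n ([P], m, 0) = map_pmf (\<lambda>(m', s, t). ([], m', t)) q"
    using exec_jointD(2)[OF joint(2) assms(2), of "[]" 0]
    by (simp add: run_halted map_pmf_def case_prod_unfold)
  from joint(1) show "map_pmf (\<lambda>(k, m, t). m) (run n ([P], m, 0)) = \<mu>"
    by (simp add: run_joint pmf.map_comp o_def case_prod_unfold)
  show "\<forall>(k, m, t) \<in> set_pmf (run n ([P], m, 0)). k = [] \<and> t \<le> n"
    using exec_jointD(1)[OF joint(2)] assms(2) by (force simp: run_joint intro: order_trans)
qed

lemma exec_unique: "exec P m \<mu> T \<Longrightarrow> exec P m \<nu> T' \<Longrightarrow> \<mu> = \<nu>"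
  using exec_run(1)[of P m \<mu> T "max T T'"] exec_run(1)[of P m \<nu> T' "max T T'"] by simp

lemma exec_single_step:
  assumes "\<And>k t\<^sub>0. step (c # k, m, t\<^sub>0) = map_pmf (\<lambda>m'. (k, m', t\<^sub>0 + t)) \<mu>" "1 \<le> t"
  shows "exec c m \<mu> t"
  unfolding exec_def exec_joint_def
proof (intro exI[of _ "map_pmf (\<lambda>m'. (m', 1, t)) \<mu>"] conjI allI impI)
  fix k t\<^sub>0 n assume "t \<le> n"
  then obtain n' where "n = Suc n'" using assms(2) by (cases n) auto
  then show "run n (c # k, m, t\<^sub>0)
      = bind_pmf (map_pmf (\<lambda>m'. (m', 1, t)) \<mu>) (\<lambda>(m', s, t). run (n - s) (k, m', t\<^sub>0 + t))"
    using assms(1) by (simp add: bind_map_pmf)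
qed (use assms(2) in \<open>auto simp: pmf.map_comp o_def\<close>)

lemma exec_Skip: "exec Skip m (return_pmf m) 1"
  by (rule exec_single_step) simp_all

lemma exec_Assign:
  "exec (Assign a e) m (return_pmf (m(eval m a := eval m e))) (1 + eval_cost m a + eval_cost m e)"
  by (rule exec_single_step) simp_all

lemma exec_Draw:
  "exec (Draw a e) m (map_pmf (\<lambda>v. m(eval m a := v)) (pmf_of_set {0..eval m e}))
     (1 + eval_cost m a + eval_cost m e)"
  by (rule exec_single_step) (simp_all add: pmf.map_comp o_def add.assoc)

lemma exec_While_False:
  "eval m e = 0 \<Longrightarrow> exec (While e c) m (return_pmf m) (1 + eval_cost m e)"
  by (rule exec_single_step) simp_all

definition joint_seq :: "nat \<Rightarrow> (memory \<times> nat \<times> nat) pmf \<Rightarrow> (memory \<Rightarrow> (memory \<times> nat \<times> nat) pmf) \<Rightarrow>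
    (memory \<times> nat \<times> nat) pmf" where
  "joint_seq u q p = bind_pmf q (\<lambda>(m', s, t).
     map_pmf (\<lambda>(m'', s', t'). (m'', 1 + s + s', u + t + t')) (p m'))"

lemma exec_joint_seq:
  assumes step: "\<And>k t\<^sub>0. step (c # k, m, t\<^sub>0) = return_pmf (c\<^sub>1 # c\<^sub>2 # k, m, t\<^sub>0 + u)" and "1 \<le> u"
    and exec1: "exec_joint c\<^sub>1 m q T"
    and exec2: "\<And>m' s t. (m', s, t) \<in> set_pmf q \<Longrightarrow> exec_joint c\<^sub>2 m' (p m') T'"
  shows "exec_joint c m (joint_seq u q p) (u + T + T')"
  unfolding exec_joint_def
proof (intro conjI allI impI)
  show "\<forall>(m', s, t) \<in> set_pmf (joint_seq u q p). s \<le> t \<and> t \<le> u + T + T'"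
  proof clarify
    fix m'' s t assume "(m'', s, t) \<in> set_pmf (joint_seq u q p)"
    then obtain m' s\<^sub>1 t\<^sub>1 s\<^sub>2 t\<^sub>2 where "(m', s\<^sub>1, t\<^sub>1) \<in> set_pmf q" "(m'', s\<^sub>2, t\<^sub>2) \<in> set_pmf (p m')"
      and sums: "s = 1 + s\<^sub>1 + s\<^sub>2" "t = u + t\<^sub>1 + t\<^sub>2"
      by (auto simp: joint_seq_def)
    with exec1 exec2 have "s\<^sub>1 \<le> t\<^sub>1 \<and> t\<^sub>1 \<le> T" "s\<^sub>2 \<le> t\<^sub>2 \<and> t\<^sub>2 \<le> T'"
      by (blast dest: exec_jointD(1))+
    with sums \<open>1 \<le> u\<close> show "s \<le> t \<and> t \<le> u + T + T'" by simp
  qed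
next
  fix k t\<^sub>0 n assume "u + T + T' \<le> n"
  then obtain n' where n_Suc: "n = Suc n'" "T + T' \<le> n'" using \<open>1 \<le> u\<close> by (cases n) auto
  have "run n (c # k, m, t\<^sub>0) = run n' (c\<^sub>1 # c\<^sub>2 # k, m, t\<^sub>0 + u)"
    by (simp add: n_Suc step bind_return_pmf)
  also have "\<dots> = bind_pmf q (\<lambda>(m', s, t). run (n' - s) (c\<^sub>2 # k, m', t\<^sub>0 + u + t))"
    by (rule exec_jointD(2)[OF exec1]) (use n_Suc in simp)
  also have "\<dots> = bind_pmf q (\<lambda>(m', s, t).
      bind_pmf (p m') (\<lambda>(m'', s', t'). run (n' - s - s') (k, m'', t\<^sub>0 + u + t + t')))"
  proof (intro bind_pmf_cong refl, clarify)
    fix m' s t assume in_q: "(m', s, t) \<in> set_pmf q"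
    with exec_jointD(1)[OF exec1 in_q] n_Suc have "T' \<le> n' - s" by linarith
    with exec2[OF in_q] show "run (n' - s) (c\<^sub>2 # k, m', t\<^sub>0 + u + t)
        = bind_pmf (p m') (\<lambda>(m'', s', t'). run (n' - s - s') (k, m'', t\<^sub>0 + u + t + t'))"
      by (rule exec_jointD(2))
  qed
  also have "\<dots> = bind_pmf (joint_seq u q p) (\<lambda>(m', s, t). run (n - s) (k, m', t\<^sub>0 + t))"
    by (simp add: joint_seq_def bind_assoc_pmf bind_map_pmf case_prod_unfold n_Suc add.assoc)
  finally show "run n (c # k, m, t\<^sub>0)
      = bind_pmf (joint_seq u q p) (\<lambda>(m', s, t). run (n - s) (k, m', t\<^sub>0 + t))" .
qed

lemma exec_push_two:
  assumes step: "\<And>k t\<^sub>0. step (c # k, m, t\<^sub>0) = return_pmf (c\<^sub>1 # c\<^sub>2 # k, m, t\<^sub>0 + u)" and "1 \<le> u"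
    and exec1: "exec c\<^sub>1 m \<mu> T" and exec2: "\<And>m'. m' \<in> set_pmf \<mu> \<Longrightarrow> exec c\<^sub>2 m' (\<nu> m') T'"
  shows "exec c m (bind_pmf \<mu> \<nu>) (u + T + T')"
proof -
  obtain q where joint1: "map_pmf fst q = \<mu>" "exec_joint c\<^sub>1 m q T"
    using exec1 unfolding exec_def by blast
  obtain p where joint2: "\<And>m'. m' \<in> set_pmf \<mu> \<Longrightarrow> map_pmf fst (p m') = \<nu> m' \<and> exec_joint c\<^sub>2 m' (p m') T'"
    using exec2 unfolding exec_def by metis
  have supp: "m' \<in> set_pmf \<mu>" if "(m', s, t) \<in> set_pmf q" for m' s t
    using that joint1(1) by force
  have "map_pmf fst (joint_seq u q p) = bind_pmf q (\<lambda>x. map_pmf fst (p (fst x)))"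
    by (simp add: joint_seq_def map_bind_pmf pmf.map_comp o_def case_prod_unfold)
  also have "\<dots> = bind_pmf q (\<lambda>x. \<nu> (fst x))"
    by (rule bind_pmf_cong) (use joint2 supp in auto)
  finally have "map_pmf fst (joint_seq u q p) = bind_pmf \<mu> \<nu>"
    by (simp add: joint1(1)[symmetric] bind_map_pmf)
  moreover have "exec_joint c m (joint_seq u q p) (u + T + T')"
    by (rule exec_joint_seq[OF step \<open>1 \<le> u\<close> joint1(2)]) (use joint2 supp in blast)
  ultimately show ?thesis unfolding exec_def by blast
qed

lemma exec_push_two_map:
  assumes step: "\<And>k t\<^sub>0. step (c # k, m, t\<^sub>0) = return_pmf (c\<^sub>1 # c\<^sub>2 # k, m, t\<^sub>0 + u)" and "1 \<le> u"
    and exec1: "exec c\<^sub>1 m (map_pmf f \<mu>) T" and exec2: "\<And>w. w \<in> set_pmf \<mu> \<Longrightarrow> exec c\<^sub>2 (f w) (\<nu> w) T'"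
  shows "exec c m (bind_pmf \<mu> \<nu>) (u + T + T')"
proof -
  define \<nu>' where "\<nu>' m' = \<nu> (SOME w. w \<in> set_pmf \<mu> \<and> f w = m')" for m'
  have chosen: "exec c\<^sub>2 (f w) (\<nu>' (f w)) T'" "\<nu>' (f w) = \<nu> w" if w_mem: "w \<in> set_pmf \<mu>" for w
  proof -
    have "\<exists>w'. w' \<in> set_pmf \<mu> \<and> f w' = f w" using w_mem by blast
    from someI_ex[OF this] show "exec c\<^sub>2 (f w) (\<nu>' (f w)) T'" unfolding \<nu>'_def using exec2 by metis
    with exec2[OF w_mem] show "\<nu>' (f w) = \<nu> w" by (rule exec_unique[rotated])
  qed
  have "exec c m (bind_pmf (map_pmf f \<mu>) \<nu>') (u + T + T')"
    by (rule exec_push_two[OF step \<open>1 \<le> u\<close> exec1]) (use chosen(1) in auto)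
  moreover have "bind_pmf (map_pmf f \<mu>) \<nu>' = bind_pmf \<mu> \<nu>"
    unfolding bind_map_pmf by (rule bind_pmf_cong) (simp_all add: chosen(2))
  ultimately show ?thesis by simp
qed

lemma exec_Seq:
  assumes "exec c m (map_pmf f \<mu>) T" "\<And>w. w \<in> set_pmf \<mu> \<Longrightarrow> exec d (f w) (\<nu> w) T'"
  shows "exec (Seq c d) m (bind_pmf \<mu> \<nu>) (1 + T + T')"
  by (rule exec_push_two_map[OF _ _ assms]) simp_all

lemma exec_Seq_return:
  "exec c m (return_pmf m') T \<Longrightarrow> exec d m' \<nu> T' \<Longrightarrow> exec (Seq c d) m \<nu> (1 + T + T')"
  using exec_Seq[of c m "\<lambda>_. m'" "return_pmf ()" T d "\<lambda>_. \<nu>" T'] by (simp add: bind_return_pmf)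

lemma exec_While_True:
  assumes "eval m e \<noteq> 0" "exec c m (map_pmf f \<mu>) T"
    "\<And>w. w \<in> set_pmf \<mu> \<Longrightarrow> exec (While e c) (f w) (\<nu> w) T'"
  shows "exec (While e c) m (bind_pmf \<mu> \<nu>) (1 + eval_cost m e + T + T')"
  by (rule exec_push_two_map[OF _ _ assms(2,3)]) (use assms(1) in simp_all)

lemma exec_While_True_return:
  assumes "eval m e \<noteq> 0" "exec c m (return_pmf m') T" "exec (While e c) m' \<nu> T'"
  shows "exec (While e c) m \<nu> (1 + eval_cost m e + T + T')"
  using exec_While_True[of m e c "\<lambda>_. m'" "return_pmf ()" T "\<lambda>_. \<nu>" T'] assms
  by (simp add: bind_return_pmf)

lemma exec_While_iterate:
  assumes "\<And>x. x < N \<Longrightarrow> eval (M x) e \<noteq> 0" "eval (M N) e = 0"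
    and body: "\<And>x. x < N \<Longrightarrow> exec c (M x) (return_pmf (M (Suc x))) T"
    and test: "\<And>x. x \<le> N \<Longrightarrow> 1 + eval_cost (M x) e \<le> T'"
  shows "exec (While e c) (M 0) (return_pmf (M N)) (N * (T + T') + T')"
proof -
  have "exec (While e c) (M x) (return_pmf (M N)) ((N - x) * (T + T') + T')" if "x \<le> N" for x
    using that
  proof (induction rule: inc_induct)
    case base
    show ?case using exec_mono[OF exec_While_False[OF assms(2)] test] by simp
  next
    case (step x)
    from step.hyps have "N - x = Suc (N - Suc x)" by simp
    hence "1 + eval_cost (M x) e + T + ((N - Suc x) * (T + T') + T') \<le> (N - x) * (T + T') + T'"
      using test[of x] step.hyps by simp
    with exec_While_True_return[OF assms(1)[OF step.hyps(2)] body[OF step.hyps(2)] step.IH]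
    show ?case by (rule exec_mono)
  qed
  from this[of 0] show ?thesis by simp
qed

lemma exec_Cond:
  assumes "exec (if eval m e \<noteq> 0 then c else d) m \<mu> T"
  shows "exec (Cond e c d) m \<mu> (1 + eval_cost m e + T)"
proof -
  obtain q where joint: "map_pmf fst q = \<mu>" "exec_joint (if eval m e \<noteq> 0 then c else d) m q T"
    using assms unfolding exec_def by blast
  define q' where "q' = map_pmf (\<lambda>(m', s, t). (m', Suc s, 1 + eval_cost m e + t)) q"
  have "exec_joint (Cond e c d) m q' (1 + eval_cost m e + T)"
    unfolding exec_joint_def
  proof (intro conjI allI impI)
    show "\<forall>(m', s, t) \<in> set_pmf q'. s \<le> t \<and> t \<le> 1 + eval_cost m e + T"
      using exec_jointD(1)[OF joint(2)] by (force simp: q'_def)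
    fix k t\<^sub>0 n assume "1 + eval_cost m e + T \<le> n"
    then obtain n' where "n = Suc n'" "T \<le> n'" by (cases n) auto
    with exec_jointD(2)[OF joint(2)] show "run n (Cond e c d # k, m, t\<^sub>0)
        = bind_pmf q' (\<lambda>(m', s, t). run (n - s) (k, m', t\<^sub>0 + t))"
      by (simp add: q'_def bind_return_pmf bind_map_pmf case_prod_unfold add.assoc)
  qed
  moreover have "map_pmf fst q' = \<mu>"
    by (simp add: q'_def joint(1)[symmetric] pmf.map_comp o_def case_prod_unfold)
  ultimately show ?thesis unfolding exec_def by blast
qed

lemma exec_halts_within:
  "exec P m \<mu> T \<Longrightarrow> init_config P xs = ([P], m, 0) \<Longrightarrow> T \<le> n \<Longrightarrow> halts_within P xs n"
  using exec_run(2) unfolding halts_within_def by simp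

lemma outcome_eq_run:
  assumes "halts_within P xs T"
  shows "outcome P xs = map_pmf (\<lambda>(k, m, t). m) (run T (init_config P xs))"
proof -
  define T\<^sub>0 where "T\<^sub>0 = (LEAST T. halts_within P xs T)"
  have halts: "halts_within P xs T\<^sub>0" unfolding T\<^sub>0_def by (rule LeastI) (rule assms)
  have "T\<^sub>0 \<le> T" unfolding T\<^sub>0_def by (rule Least_le) (rule assms)
  hence "run T (init_config P xs) = bind_pmf (run T\<^sub>0 (init_config P xs)) (run (T - T\<^sub>0))"
    using run_add[of T\<^sub>0 "T - T\<^sub>0"] by simp
  also have "\<dots> = bind_pmf (run T\<^sub>0 (init_config P xs)) return_pmf"
    by (rule bind_pmf_cong[OF refl]) (use halts in \<open>auto simp: halts_within_def run_halted\<close>)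
  finally show ?thesis by (simp add: outcome_def T\<^sub>0_def bind_return_pmf')
qed

lemma exec_outcome: "exec P m \<mu> T \<Longrightarrow> init_config P xs = ([P], m, 0) \<Longrightarrow> outcome P xs = \<mu>"
  using outcome_eq_run[OF exec_halts_within[OF _ _ order_refl]] exec_run(1) by fastforce


section \<open>Bit lengths of expressions\<close>

definition fits :: "nat \<Rightarrow> memory \<Rightarrow> bool" where
  "fits b m \<longleftrightarrow> (\<forall>a. m a \<le> 2 ^ b)"

lemma le_two_power_self: "(n :: nat) \<le> 2 ^ n"
  using less_exp[of n] by linarith

lemma le_two_power_trans: "(x :: nat) \<le> 2 ^ a \<Longrightarrow> a \<le> c \<Longrightarrow> x \<le> 2 ^ c"
  by (meson order_trans power_increasing one_le_numeral)

lemma fitsD: "fits b m \<Longrightarrow> b \<le> c \<Longrightarrow> m a \<le> 2 ^ c"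
  unfolding fits_def using le_two_power_trans by blast

lemma fits_mono: "fits b m \<Longrightarrow> b \<le> c \<Longrightarrow> fits c m"
  using fitsD unfolding fits_def by blast

lemma fits_upd: "fits b m \<Longrightarrow> v \<le> 2 ^ b \<Longrightarrow> fits b (m(a := v))"
  by (simp add: fits_def)

lemma add_le_two_power:
  assumes "(x :: nat) \<le> 2 ^ a" "y \<le> 2 ^ b" "a \<le> c" "b \<le> c"
  shows "x + y \<le> 2 ^ (c + 1)"
proof -
  have "x \<le> 2 ^ c" "y \<le> 2 ^ c" using assms le_two_power_trans by blast+
  thus ?thesis by simp
qed

lemma mult_le_two_power:
  assumes "(x :: nat) \<le> 2 ^ a" "y \<le> 2 ^ b" "a + b \<le> c"
  shows "x * y \<le> 2 ^ c"
proof -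
  have "x * y \<le> 2 ^ a * 2 ^ b" using assms by (intro mult_mono) auto
  also have "\<dots> \<le> 2 ^ c" using assms(3) by (simp add: power_add[symmetric])
  finally show ?thesis .
qed

lemma nat_size_le:
  assumes "v \<le> 2 ^ p" shows "nat_size v \<le> p + 2"
proof -
  have "v < 2 ^ (p + 1)" using assms by (simp add: less_le_trans le_less_trans)
  hence "floorlog 2 v \<le> p + 1" by (intro floorlog_leI) auto
  thus ?thesis by (simp add: nat_size_def)
qed

primrec expr_weight :: "expr \<Rightarrow> nat" where
  "expr_weight (Const c) = c + 1"
| "expr_weight (Mem e) = expr_weight e + 1"
| "expr_weight (Add a b) = expr_weight a + expr_weight b + 1"
| "expr_weight (Sub a b) = expr_weight a + expr_weight b + 1"
| "expr_weight (Mul a b) = expr_weight a + expr_weight b + 1"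
| "expr_weight (Div a b) = expr_weight a + expr_weight b + 1"

lemma eval_le:
  assumes "fits b m"
  shows "eval m e \<le> 2 ^ (expr_weight e * (b + 1))"
proof (induction e)
  case (Const c)
  have "c \<le> (c + 1) * (b + 1)" by simp
  from le_two_power_trans[OF le_two_power_self this] show ?case by simp
next
  case (Mem e)
  show ?case unfolding eval.simps by (rule fitsD[OF assms]) simp
next
  case (Add x y)
  have "eval m x + eval m y \<le> 2 ^ (expr_weight x * (b + 1) + expr_weight y * (b + 1) + 1)"
    by (rule add_le_two_power[OF Add.IH]) auto
  thus ?case unfolding eval.simps by (rule le_two_power_trans) (simp add: algebra_simps)
next
  case (Sub x y)
  have "eval m x \<le> 2 ^ (expr_weight (Sub x y) * (b + 1))"
    by (rule le_two_power_trans[OF Sub.IH(1)]) (simp add: algebra_simps)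
  thus ?case by (simp add: diff_le_self order_trans[OF diff_le_self])
next
  case (Mul x y)
  show ?case unfolding eval.simps
    by (rule mult_le_two_power[OF Mul.IH]) (simp add: algebra_simps)
next
  case (Div x y)
  have "eval m x \<le> 2 ^ (expr_weight (Div x y) * (b + 1))"
    by (rule le_two_power_trans[OF Div.IH(1)]) (simp add: algebra_simps)
  thus ?case by (simp add: order_trans[OF div_le_dividend])
qed

definition expr_cost :: "expr \<Rightarrow> nat" where
  "expr_cost e = 3 * expr_weight e ^ 2"

lemma eval_cost_le:
  assumes "fits b m" "b \<le> B"
  shows "eval_cost m e \<le> expr_cost e * (B + 1)"
proof -
  have size: "nat_size (eval m e) \<le> W * (B + 1) + 2" if "expr_weight e \<le> W" for W e
    using nat_size_le[OF eval_le[OF fits_mono[OF assms], of e]] mult_le_mono1[OF that, of "B + 1"]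
    by linarith
  have "eval_cost m e \<le> expr_weight e * (W * (B + 1) + 2)" if "expr_weight e \<le> W" for W
    using that
  proof (induction e)
    case (Const c)
    from size[OF this] show ?case by (simp add: trans_le_add1)
  next
    case (Mem e)
    with size[OF Mem.prems] show ?case by (simp add: algebra_simps)
  next
    case (Add x y)
    with size[OF Add.prems] show ?case by (simp add: algebra_simps)
  next
    case (Sub x y)
    with size[OF Sub.prems] show ?case by (simp add: algebra_simps)
  next
    case (Mul x y)
    with size[OF Mul.prems] show ?case by (simp add: algebra_simps)
  next
    case (Div x y)
    with size[OF Div.prems] show ?case by (simp add: algebra_simps)
  qed
  hence "eval_cost m e \<le> expr_weight e * (expr_weight e * (B + 1) + 2)" by blast
  moreover have "1 \<le> expr_weight e" by (cases e) auto
  hence "expr_weight e * (expr_weight e * (B + 1) + 2) \<le> expr_weight e * (3 * expr_weight e * (B + 1))"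
    by (intro mult_le_mono2) (simp add: algebra_simps)
  ultimately show ?thesis by (simp add: expr_cost_def power2_eq_square algebra_simps)
qed


section \<open>Structured programs over memory banks\<close>

datatype bexpr =
    Num nat
  | Cell nat bexpr
  | Inp bexpr
  | Plus bexpr bexpr (infixl "\<oplus>" 65)
  | Minus bexpr bexpr (infixl "\<ominus>" 65)
  | Times bexpr bexpr (infixl "\<otimes>" 70)
  | Quot bexpr bexpr (infixl "\<oslash>" 70)

datatype bcom =
    Nop
  | Store nat bexpr bexpr
  | Then bcom bcom (infixr ";;" 60)
  | Ite bexpr bcom bcom
  | For nat bexpr bcom

abbreviation Var :: "nat \<Rightarrow> bexpr" where "Var k \<equiv> Cell k (Num 0)"
abbreviation SetV :: "nat \<Rightarrow> bexpr \<Rightarrow> bcom" where "SetV k e \<equiv> Store k (Num 0) e"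
abbreviation Less :: "bexpr \<Rightarrow> bexpr \<Rightarrow> bexpr" where "Less a b \<equiv> b \<ominus> a"
abbreviation Leq :: "bexpr \<Rightarrow> bexpr \<Rightarrow> bexpr" where "Leq a b \<equiv> (b \<oplus> Num 1) \<ominus> a"
abbreviation Equ :: "bexpr \<Rightarrow> bexpr \<Rightarrow> bexpr" where "Equ a b \<equiv> Leq a b \<otimes> Leq b a"
abbreviation Neg :: "bexpr \<Rightarrow> bexpr" where "Neg a \<equiv> Num 1 \<ominus> a"
abbreviation Incr :: "nat \<Rightarrow> bexpr \<Rightarrow> bexpr \<Rightarrow> bcom" where "Incr k i e \<equiv> Store k i (Cell k i \<oplus> e)"
abbreviation When :: "bexpr \<Rightarrow> bcom \<Rightarrow> bcom" where "When e c \<equiv> Ite e c Nop"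

type_synonym banks = "nat \<Rightarrow> nat \<Rightarrow> nat"

definition num_banks :: nat where "num_banks = 64"

text \<open>The cells below \<open>base\<close> hold the encoded instance; the cells above it are dealt out to the banks in turn.\<close>

definition base :: "memory \<Rightarrow> nat" where
  "base inp = 2 + (2 * inp 0 + (2 * (inp 0 * inp 1) + inp 1))"

definition flat :: "memory \<Rightarrow> banks \<Rightarrow> memory" where
  "flat inp \<sigma> a = (if a < base inp then inp a
     else \<sigma> ((a - base inp) mod num_banks) ((a - base inp) div num_banks))"

definition put :: "nat \<Rightarrow> nat \<Rightarrow> nat \<Rightarrow> banks \<Rightarrow> banks" where
  "put k i v \<sigma> = \<sigma>(k := (\<sigma> k)(i := v))"

definition bump :: "nat \<Rightarrow> banks \<Rightarrow> banks" where
  "bump k \<sigma> = put k 0 (Suc (\<sigma> k 0)) \<sigma>"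

primrec ev :: "memory \<Rightarrow> banks \<Rightarrow> bexpr \<Rightarrow> nat" where
  "ev inp \<sigma> (Num c) = c"
| "ev inp \<sigma> (Cell k e) = \<sigma> k (ev inp \<sigma> e)"
| "ev inp \<sigma> (Inp e) = flat inp \<sigma> (ev inp \<sigma> e)"
| "ev inp \<sigma> (a \<oplus> b) = ev inp \<sigma> a + ev inp \<sigma> b"
| "ev inp \<sigma> (a \<ominus> b) = ev inp \<sigma> a - ev inp \<sigma> b"
| "ev inp \<sigma> (a \<otimes> b) = ev inp \<sigma> a * ev inp \<sigma> b"
| "ev inp \<sigma> (a \<oslash> b) = ev inp \<sigma> a div ev inp \<sigma> b"

primrec sem :: "memory \<Rightarrow> bcom \<Rightarrow> banks \<Rightarrow> banks" where
  "sem inp Nop \<sigma> = \<sigma>"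
| "sem inp (Store k i e) \<sigma> = put k (ev inp \<sigma> i) (ev inp \<sigma> e) \<sigma>"
| "sem inp (c ;; d) \<sigma> = sem inp d (sem inp c \<sigma>)"
| "sem inp (Ite e c d) \<sigma> = (if ev inp \<sigma> e \<noteq> 0 then sem inp c \<sigma> else sem inp d \<sigma>)"
| "sem inp (For k e c) \<sigma> = ((\<lambda>\<tau>. bump k (sem inp c \<tau>)) ^^ ev inp \<sigma> e) (put k 0 0 \<sigma>)"

primrec sems :: "memory \<Rightarrow> bcom list \<Rightarrow> banks \<Rightarrow> banks" where
  "sems inp [] \<sigma> = \<sigma>"
| "sems inp (c # cs) \<sigma> = sems inp cs (sem inp c \<sigma>)"

lemma put_same [simp]: "put k i v \<sigma> k = (\<sigma> k)(i := v)"
  by (simp add: put_def)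

lemma put_other [simp]: "l \<noteq> k \<Longrightarrow> put k i v \<sigma> l = \<sigma> l"
  by (simp add: put_def)

lemma bump_same [simp]: "bump k \<sigma> k = (\<sigma> k)(0 := Suc (\<sigma> k 0))"
  by (simp add: bump_def)

lemma bump_other [simp]: "l \<noteq> k \<Longrightarrow> bump k \<sigma> l = \<sigma> l"
  by (simp add: bump_def)

lemma base_ge_two: "2 \<le> base inp"
  by (simp add: base_def)

lemma flat_less [simp]: "a < base inp \<Longrightarrow> flat inp \<sigma> a = inp a"
  by (simp add: flat_def)

lemma flat_cell: "k < num_banks \<Longrightarrow> flat inp \<sigma> (base inp + (num_banks * i + k)) = \<sigma> k i"
  by (simp add: flat_def)

lemma flat_put:
  assumes "k < num_banks"
  shows "flat inp (put k i v \<sigma>) = (flat inp \<sigma>)(base inp + (num_banks * i + k) := v)"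
proof
  fix a
  have "a - base inp = num_banks * i + k
      \<longleftrightarrow> (a - base inp) mod num_banks = k \<and> (a - base inp) div num_banks = i"
    using assms mult_div_mod_eq[of num_banks "a - base inp"] by auto
  thus "flat inp (put k i v \<sigma>) a = ((flat inp \<sigma>)(base inp + (num_banks * i + k) := v)) a"
    by (cases "a < base inp") (auto simp: flat_def put_def)
qed

lemma sem_When:
  "(ev inp \<sigma> e \<noteq> 0 \<longleftrightarrow> P) \<Longrightarrow> sem inp (When e c) \<sigma> = (if P then sem inp c \<sigma> else \<sigma>)"
  by simp

lemma ev_Times_nonzero: "ev inp \<sigma> (a \<otimes> b) \<noteq> 0 \<longleftrightarrow> ev inp \<sigma> a \<noteq> 0 \<and> ev inp \<sigma> b \<noteq> 0"
  by simp

primrec banks_read :: "bexpr \<Rightarrow> nat set" where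
  "banks_read (Num c) = {}"
| "banks_read (Cell k e) = insert k (banks_read e)"
| "banks_read (Inp e) = UNIV"
| "banks_read (a \<oplus> b) = banks_read a \<union> banks_read b"
| "banks_read (a \<ominus> b) = banks_read a \<union> banks_read b"
| "banks_read (a \<otimes> b) = banks_read a \<union> banks_read b"
| "banks_read (a \<oslash> b) = banks_read a \<union> banks_read b"

primrec written :: "bcom \<Rightarrow> nat set" where
  "written Nop = {}"
| "written (Store k i e) = {k}"
| "written (c ;; d) = written c \<union> written d"
| "written (Ite e c d) = written c \<union> written d"
| "written (For k e c) = insert k (written c)"

lemma ev_cong: "(\<And>k. k \<in> banks_read e \<Longrightarrow> \<sigma> k = \<tau> k) \<Longrightarrow> ev inp \<sigma> e = ev inp \<tau> e"
proof (induction e)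
  case (Inp e)
  hence "\<sigma> = \<tau>" by auto
  thus ?case by simp
qed auto

lemma sem_unwritten: "k \<notin> written c \<Longrightarrow> sem inp c \<sigma> k = \<sigma> k"
proof (induction c arbitrary: \<sigma>)
  case (For l e c)
  have "((\<lambda>\<tau>. bump l (sem inp c \<tau>)) ^^ x) (put l 0 0 \<sigma>) k = \<sigma> k" for x
    using For by (induction x) auto
  thus ?case by simp
qed auto

lemma sems_append: "sems inp (cs @ ds) \<sigma> = sems inp ds (sems inp cs \<sigma>)"
  by (induction cs arbitrary: \<sigma>) simp_all

lemma sems_unwritten: "(\<And>c. c \<in> set cs \<Longrightarrow> k \<notin> written c) \<Longrightarrow> sems inp cs \<sigma> k = \<sigma> k"
  by (induction cs arbitrary: \<sigma>) (auto simp: sem_unwritten)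

definition loop_state :: "memory \<Rightarrow> nat \<Rightarrow> bcom \<Rightarrow> banks \<Rightarrow> nat \<Rightarrow> banks" where
  "loop_state inp k c \<sigma> x = ((\<lambda>\<tau>. bump k (sem inp c \<tau>)) ^^ x) (put k 0 0 \<sigma>)"

lemma loop_state_simps [simp]:
  "loop_state inp k c \<sigma> 0 = put k 0 0 \<sigma>"
  "loop_state inp k c \<sigma> (Suc x) = bump k (sem inp c (loop_state inp k c \<sigma> x))"
  by (simp_all add: loop_state_def)

lemma sem_For: "sem inp (For k e c) \<sigma> = loop_state inp k c \<sigma> (ev inp \<sigma> e)"
  by (simp add: loop_state_def)

lemma loop_state_counter: "k \<notin> written c \<Longrightarrow> loop_state inp k c \<sigma> x k 0 = x"
  by (induction x) (auto simp: sem_unwritten)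

lemma loop_state_unwritten: "l \<notin> insert k (written c) \<Longrightarrow> loop_state inp k c \<sigma> x l = \<sigma> l"
  by (induction x) (auto simp: sem_unwritten)

lemma sem_For_invariant [case_names bound fresh init step]:
  assumes "ev inp \<sigma> e = N" "k \<notin> written c"
    and "P 0 (put k 0 0 \<sigma>)"
    and "\<And>x \<tau>. x < N \<Longrightarrow> \<tau> k 0 = x \<Longrightarrow>
      (\<And>l. l \<notin> written (For k e c) \<Longrightarrow> \<tau> l = \<sigma> l) \<Longrightarrow> P x \<tau> \<Longrightarrow> P (Suc x) (bump k (sem inp c \<tau>))"
  shows "P N (sem inp (For k e c) \<sigma>)"
proof -
  have "P x (loop_state inp k c \<sigma> x)" if "x \<le> N" for x
    using that
  proof (induction x)
    case (Suc x)
    thus ?case using assms(4)[of x "loop_state inp k c \<sigma> x"] assms(2)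
      by (simp add: loop_state_counter loop_state_unwritten)
  qed (simp add: assms(3))
  thus ?thesis unfolding sem_For assms(1) by blast
qed

text \<open>In the following rules, \<open>\<tau>\<close> is the state before round \<open>x\<close> of a loop that starts in state \<open>\<sigma>\<close>.\<close>

lemma sem_For_sum:
  assumes "ev inp \<sigma> e = N" "k \<notin> written c" "v \<noteq> k"
    and "\<And>x \<tau>. x < N \<Longrightarrow> \<tau> k 0 = x \<Longrightarrow> (\<And>l. l \<notin> insert k (written c) \<Longrightarrow> \<tau> l = \<sigma> l) \<Longrightarrow>
      sem inp c \<tau> v i = \<tau> v i + g x"
  shows "sem inp (For k e c) \<sigma> v i = \<sigma> v i + (\<Sum>x<N. g x)"
  by (rule sem_For_invariant[OF assms(1,2)]) (use assms(3,4) in auto)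

lemma sem_For_prod:
  assumes "ev inp \<sigma> e = N" "k \<notin> written c" "v \<noteq> k"
    and "\<And>x \<tau>. x < N \<Longrightarrow> \<tau> k 0 = x \<Longrightarrow> (\<And>l. l \<notin> insert k (written c) \<Longrightarrow> \<tau> l = \<sigma> l) \<Longrightarrow>
      sem inp c \<tau> v i = \<tau> v i * g x"
  shows "sem inp (For k e c) \<sigma> v i = \<sigma> v i * (\<Prod>x<N. g x)"
  by (rule sem_For_invariant[OF assms(1,2)]) (use assms(3,4) in auto)

lemma sem_For_fill:
  assumes "ev inp \<sigma> e = N" "k \<notin> written c" "v \<noteq> k" "inj h"
    and "\<And>x \<tau>. x < N \<Longrightarrow> \<tau> k 0 = x \<Longrightarrow> (\<And>l. l \<notin> insert k (written c) \<Longrightarrow> \<tau> l = \<sigma> l) \<Longrightarrow>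
      \<tau> v (h x) = \<sigma> v (h x) \<Longrightarrow> sem inp c \<tau> v = (\<tau> v)(h x := g (h x))"
  shows "sem inp (For k e c) \<sigma> v y = (if y \<in> h ` {..<N} then g y else \<sigma> v y)"
proof -
  have "\<forall>y. sem inp (For k e c) \<sigma> v y = (if y \<in> h ` {..<N} then g y else \<sigma> v y)"
  proof (rule sem_For_invariant[OF assms(1,2)], goal_cases init step)
    case (step x \<tau>)
    have "h x \<notin> h ` {..<x}" using \<open>inj h\<close> by (auto simp: inj_def)
    hence "sem inp c \<tau> v = (\<tau> v)(h x := g (h x))" using step by (intro assms(5)) auto
    thus ?case using step(4) assms(3,4) by (auto simp: lessThan_Suc)
  qed (use assms(3) in auto)
  thus ?thesis ..
qed

lemma sem_For_fill_array:
  assumes "ev inp \<sigma> e = N" "k \<notin> written c" "v \<noteq> k"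
    and "\<And>x \<tau>. x < N \<Longrightarrow> \<tau> k 0 = x \<Longrightarrow> (\<And>l. l \<notin> insert k (written c) \<Longrightarrow> \<tau> l = \<sigma> l) \<Longrightarrow>
      \<tau> v x = \<sigma> v x \<Longrightarrow> sem inp c \<tau> v = (\<tau> v)(x := g x)"
  shows "sem inp (For k e c) \<sigma> v y = (if y < N then g y else \<sigma> v y)"
  using sem_For_fill[of inp \<sigma> e N k c v "\<lambda>x. x" g y] assms by simp


section \<open>Compilation to the machine\<close>

abbreviation mem_at :: "nat \<Rightarrow> expr" where "mem_at a \<equiv> Mem (Const a)"

definition base_expr :: expr where
  "base_expr = Add (Const 2) (Add (Mul (Const 2) (mem_at 0))
     (Add (Mul (Const 2) (Mul (mem_at 0) (mem_at 1))) (mem_at 1)))"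

definition cell_addr :: "nat \<Rightarrow> expr \<Rightarrow> expr" where
  "cell_addr k e = Add base_expr (Add (Mul (Const num_banks) e) (Const k))"

primrec compile_expr :: "bexpr \<Rightarrow> expr" where
  "compile_expr (Num c) = Const c"
| "compile_expr (Cell k e) = Mem (cell_addr k (compile_expr e))"
| "compile_expr (Inp e) = Mem (compile_expr e)"
| "compile_expr (a \<oplus> b) = Add (compile_expr a) (compile_expr b)"
| "compile_expr (a \<ominus> b) = Sub (compile_expr a) (compile_expr b)"
| "compile_expr (a \<otimes> b) = Mul (compile_expr a) (compile_expr b)"
| "compile_expr (a \<oslash> b) = Div (compile_expr a) (compile_expr b)"

definition compile_store :: "nat \<Rightarrow> bexpr \<Rightarrow> bexpr \<Rightarrow> com" where
  "compile_store k i e = Assign (cell_addr k (compile_expr i)) (compile_expr e)"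

primrec compile_com :: "bcom \<Rightarrow> com" where
  "compile_com Nop = Skip"
| "compile_com (Store k i e) = compile_store k i e"
| "compile_com (c ;; d) = Seq (compile_com c) (compile_com d)"
| "compile_com (Ite e c d) = Cond (compile_expr e) (compile_com c) (compile_com d)"
| "compile_com (For k e c) =
     Seq (compile_store k (Num 0) (Num 0))
       (While (compile_expr (Less (Var k) e))
         (Seq (compile_com c) (compile_store k (Num 0) (Var k \<oplus> Num 1))))"

primrec banks_valid :: "bexpr \<Rightarrow> bool" where
  "banks_valid (Num c) \<longleftrightarrow> True"
| "banks_valid (Cell k e) \<longleftrightarrow> k < num_banks \<and> banks_valid e"
| "banks_valid (Inp e) \<longleftrightarrow> banks_valid e"
| "banks_valid (a \<oplus> b) \<longleftrightarrow> banks_valid a \<and> banks_valid b"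
| "banks_valid (a \<ominus> b) \<longleftrightarrow> banks_valid a \<and> banks_valid b"
| "banks_valid (a \<otimes> b) \<longleftrightarrow> banks_valid a \<and> banks_valid b"
| "banks_valid (a \<oslash> b) \<longleftrightarrow> banks_valid a \<and> banks_valid b"

lemma eval_base_expr: "eval (flat inp \<sigma>) base_expr = base inp"
  using base_ge_two[of inp] by (simp add: base_expr_def) (simp add: base_def)

lemma eval_cell_addr:
  "eval (flat inp \<sigma>) (cell_addr k e) = base inp + (num_banks * eval (flat inp \<sigma>) e + k)"
  by (simp add: cell_addr_def eval_base_expr)

lemma eval_compile_expr: "banks_valid e \<Longrightarrow> eval (flat inp \<sigma>) (compile_expr e) = ev inp \<sigma> e"
  by (induction e) (simp_all add: eval_cell_addr flat_cell)

lemma exec_compile_store: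
  assumes "k < num_banks" "banks_valid i" "banks_valid e"
  shows "exec (compile_store k i e) (flat inp \<sigma>)
      (return_pmf (flat inp (put k (ev inp \<sigma> i) (ev inp \<sigma> e) \<sigma>)))
    (1 + eval_cost (flat inp \<sigma>) (cell_addr k (compile_expr i)) +
    eval_cost (flat inp \<sigma>) (compile_expr e))"
  using exec_Assign[of "cell_addr k (compile_expr i)" "compile_expr e" "flat inp \<sigma>"] assms
  by (simp add: compile_store_def flat_put eval_cell_addr eval_compile_expr)

text \<open>
  The value of an expression is at most \<open>2 ^ (bit_degree * b + O(b0))\<close> if the banks in \<open>W\<close> hold
  values below \<open>2 ^ b\<close> and the other banks values below \<open>2 ^ b0\<close>. A program that only stores
  expressions of degree at most 1 therefore lengthens the numbers in memory only additively
  in each step.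
\<close>

primrec bit_degree :: "nat set \<Rightarrow> bexpr \<Rightarrow> nat" where
  "bit_degree W (Num c) = 0"
| "bit_degree W (Cell k e) = (if k \<in> W then 1 else 0)"
| "bit_degree W (Inp e) = 1"
| "bit_degree W (a \<oplus> b) = max (bit_degree W a) (bit_degree W b)"
| "bit_degree W (a \<ominus> b) = bit_degree W a"
| "bit_degree W (a \<otimes> b) = bit_degree W a + bit_degree W b"
| "bit_degree W (a \<oslash> b) = bit_degree W a"

primrec bexpr_weight :: "bexpr \<Rightarrow> nat" where
  "bexpr_weight (Num c) = c + 1"
| "bexpr_weight (Cell k e) = bexpr_weight e + 1"
| "bexpr_weight (Inp e) = bexpr_weight e + 1"
| "bexpr_weight (a \<oplus> b) = bexpr_weight a + bexpr_weight b + 1"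
| "bexpr_weight (a \<ominus> b) = bexpr_weight a + bexpr_weight b + 1"
| "bexpr_weight (a \<otimes> b) = bexpr_weight a + bexpr_weight b + 1"
| "bexpr_weight (a \<oslash> b) = bexpr_weight a + bexpr_weight b + 1"

definition banks_fit :: "nat \<Rightarrow> banks \<Rightarrow> bool" where
  "banks_fit b \<sigma> \<longleftrightarrow> (\<forall>k. fits b (\<sigma> k))"

lemma banks_fitD: "banks_fit b \<sigma> \<Longrightarrow> b \<le> c \<Longrightarrow> \<sigma> k i \<le> 2 ^ c"
  unfolding banks_fit_def using fitsD by blast

lemma banks_fit_mono: "banks_fit b \<sigma> \<Longrightarrow> b \<le> c \<Longrightarrow> banks_fit c \<sigma>"
  unfolding banks_fit_def using fits_mono by blast

lemma banks_fit_put: "banks_fit b \<sigma> \<Longrightarrow> v \<le> 2 ^ b \<Longrightarrow> banks_fit b (put k i v \<sigma>)"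
  by (simp add: banks_fit_def fits_def put_def)

lemma flat_fits: "fits b inp \<Longrightarrow> banks_fit b \<sigma> \<Longrightarrow> fits b (flat inp \<sigma>)"
  by (simp add: banks_fit_def fits_def flat_def)

lemma ev_le:
  assumes "fits b inp" "banks_fit b \<sigma>" "\<And>k. k \<notin> W \<Longrightarrow> fits b\<^sub>0 (\<sigma> k)"
  shows "ev inp \<sigma> e \<le> 2 ^ (bit_degree W e * b + bexpr_weight e * (b\<^sub>0 + 1))"
proof (induction e)
  case (Num c)
  have "c \<le> (c + 1) * (b\<^sub>0 + 1)" by simp
  from le_two_power_trans[OF le_two_power_self this] show ?case by simp
next
  case (Cell k e)
  show ?case
    using banks_fitD[OF assms(2)] fitsD[OF assms(3)] by (cases "k \<in> W") (simp_all del: power_Suc)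
next
  case (Inp e)
  show ?case unfolding ev.simps by (rule fitsD[OF flat_fits[OF assms(1,2)]]) simp
next
  case (Plus x y)
  define c where "c = max (bit_degree W x) (bit_degree W y) * b +
      (bexpr_weight x + bexpr_weight y) * (b\<^sub>0 + 1)"
  have "bit_degree W x * b + bexpr_weight x * (b\<^sub>0 + 1) \<le> c"
    "bit_degree W y * b + bexpr_weight y * (b\<^sub>0 + 1) \<le> c"
    unfolding c_def by (intro add_le_mono mult_le_mono1; simp)+
  from add_le_two_power[OF Plus.IH this] show ?case
    unfolding ev.simps by (rule le_two_power_trans) (simp add: c_def algebra_simps)
next
  case (Minus x y)
  have "ev inp \<sigma> x \<le> 2 ^ (bit_degree W (x \<ominus> y) * b + bexpr_weight (x \<ominus> y) * (b\<^sub>0 + 1))"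
    by (rule le_two_power_trans[OF Minus.IH(1)]) (simp add: algebra_simps)
  thus ?case by (simp add: order_trans[OF diff_le_self])
next
  case (Times x y)
  show ?case unfolding ev.simps
    by (rule mult_le_two_power[OF Times.IH]) (simp add: algebra_simps)
next
  case (Quot x y)
  have "ev inp \<sigma> x \<le> 2 ^ (bit_degree W (x \<oslash> y) * b + bexpr_weight (x \<oslash> y) * (b\<^sub>0 + 1))"
    by (rule le_two_power_trans[OF Quot.IH(1)]) (simp add: algebra_simps)
  thus ?case by (simp add: order_trans[OF div_le_dividend])
qed

primrec admissible :: "nat set \<Rightarrow> bcom \<Rightarrow> bool" where
  "admissible W Nop \<longleftrightarrow> True"
| "admissible W (Store k i e) \<longleftrightarrow> k \<in> W \<and> k < num_banks \<and> banks_valid i \<and> banks_valid e \<and>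
    bit_degree W e \<le> 1"
| "admissible W (c ;; d) \<longleftrightarrow> admissible W c \<and> admissible W d"
| "admissible W (Ite e c d) \<longleftrightarrow> banks_valid e \<and> admissible W c \<and> admissible W d"
| "admissible W (For k e c) \<longleftrightarrow> k \<in> W \<and> k < num_banks \<and> k \<notin> written c \<and> banks_valid e \<and>
     banks_read e \<inter> W = {} \<and> admissible W c"

primrec loop_bounds :: "bcom \<Rightarrow> bexpr set" where
  "loop_bounds Nop = {}"
| "loop_bounds (Store k i e) = {}"
| "loop_bounds (c ;; d) = loop_bounds c \<union> loop_bounds d"
| "loop_bounds (Ite e c d) = loop_bounds c \<union> loop_bounds d"
| "loop_bounds (For k e c) = insert e (loop_bounds c)"

primrec max_stores :: "nat \<Rightarrow> bcom \<Rightarrow> nat" where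
  "max_stores U Nop = 0"
| "max_stores U (Store k i e) = 1"
| "max_stores U (c ;; d) = max_stores U c + max_stores U d"
| "max_stores U (Ite e c d) = max_stores U c + max_stores U d"
| "max_stores U (For k e c) = U * (max_stores U c + 1)"

primrec max_steps :: "nat \<Rightarrow> bcom \<Rightarrow> nat" where
  "max_steps U Nop = 1"
| "max_steps U (Store k i e) = 1"
| "max_steps U (c ;; d) = 1 + max_steps U c + max_steps U d"
| "max_steps U (Ite e c d) = 1 + max_steps U c + max_steps U d"
| "max_steps U (For k e c) = 3 + U * (max_steps U c + 3)"

primrec bit_growth :: "bcom \<Rightarrow> nat" where
  "bit_growth Nop = 0"
| "bit_growth (Store k i e) = bexpr_weight e"
| "bit_growth (c ;; d) = bit_growth c + bit_growth d"
| "bit_growth (Ite e c d) = bit_growth c + bit_growth d"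
| "bit_growth (For k e c) = 1 + bit_growth c"

definition store_cost :: "nat \<Rightarrow> bexpr \<Rightarrow> bexpr \<Rightarrow> nat" where
  "store_cost k i e = expr_cost (cell_addr k (compile_expr i)) + expr_cost (compile_expr e)"

primrec com_cost :: "bcom \<Rightarrow> nat" where
  "com_cost Nop = 0"
| "com_cost (Store k i e) = store_cost k i e"
| "com_cost (c ;; d) = com_cost c + com_cost d"
| "com_cost (Ite e c d) = expr_cost (compile_expr e) + com_cost c + com_cost d"
| "com_cost (For k e c) = store_cost k (Num 0) (Num 0) + store_cost k (Num 0) (Var k \<oplus> Num 1)
     + expr_cost (compile_expr (Less (Var k) e)) + com_cost c"

lemma admissible_written: "admissible W c \<Longrightarrow> written c \<subseteq> W"
  by (induction c) auto

lemma sem_read_only: "admissible W c \<Longrightarrow> k \<notin> W \<Longrightarrow> sem inp c \<sigma> k = \<sigma> k"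
  using sem_unwritten admissible_written by blast

lemma admissible_loop_bounds: "admissible W c \<Longrightarrow> e \<in> loop_bounds c \<Longrightarrow> banks_read e \<inter> W = {}"
  by (induction c) auto

lemma ev_loop_bound:
  assumes "admissible W c" "e \<in> loop_bounds c" "\<And>k. k \<notin> W \<Longrightarrow> \<tau> k = \<sigma> k"
  shows "ev inp \<tau> e = ev inp \<sigma> e"
  by (rule ev_cong) (use admissible_loop_bounds[OF assms(1,2)] assms(3) in auto)

text \<open>
  Read-only banks hold numbers of length \<open>b0\<close>, a store adds at most \<open>g\<close> to the current length \<open>b\<close>,
  which never exceeds \<open>B\<close>; every loop runs at most \<open>U\<close> times, and \<open>K\<close> bounds the weights of the
  expressions evaluated in one step.
\<close>

locale bit_budget =
  fixes inp :: memory and W :: "nat set" and b\<^sub>0 g B U K :: nat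
  assumes input_fits: "fits b\<^sub>0 inp"
begin

definition tick :: nat where "tick = 1 + K * (B + 1)"

definition admits :: "bcom \<Rightarrow> banks \<Rightarrow> nat \<Rightarrow> bool" where
  "admits c \<sigma> b \<longleftrightarrow> admissible W c \<and> banks_fit b \<sigma> \<and> b\<^sub>0 \<le> b \<and> (\<forall>k. k \<notin> W \<longrightarrow> fits b\<^sub>0 (\<sigma> k)) \<and>
     (\<forall>e \<in> loop_bounds c. ev inp \<sigma> e \<le> U) \<and> bit_growth c * (b\<^sub>0 + 1) \<le> g \<and>
     b + max_stores U c * g \<le> B \<and> com_cost c \<le> K"

definition simulates :: "bcom \<Rightarrow> banks \<Rightarrow> nat \<Rightarrow> bool" where
  "simulates c \<sigma> b \<longleftrightarrow>
     exec (compile_com c) (flat inp \<sigma>) (return_pmf (flat inp (sem inp c \<sigma>))) (max_steps U c * tick) \<and>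
     banks_fit (b + max_stores U c * g) (sem inp c \<sigma>)"

lemma eval_cost_flat_le:
  assumes "banks_fit b \<sigma>" "b\<^sub>0 \<le> b" "b \<le> B"
  shows "eval_cost (flat inp \<sigma>) e \<le> expr_cost e * (B + 1)"
  by (rule eval_cost_le[OF flat_fits assms(3)]) (use assms input_fits fits_mono in auto)

lemma test_time_le:
  assumes "banks_fit b \<sigma>" "b\<^sub>0 \<le> b" "b \<le> B" "expr_cost e \<le> K"
  shows "1 + eval_cost (flat inp \<sigma>) e \<le> tick"
  using eval_cost_flat_le[OF assms(1-3), of e] mult_le_mono1[OF assms(4), of "B + 1"]
  unfolding tick_def by linarith

lemma exec_store_tick:
  assumes "banks_fit b \<sigma>" "b\<^sub>0 \<le> b" "b \<le> B" "store_cost k i e \<le> K"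
    and "k < num_banks" "banks_valid i" "banks_valid e"
  shows "exec (compile_store k i e) (flat inp \<sigma>)
    (return_pmf (flat inp (put k (ev inp \<sigma> i) (ev inp \<sigma> e) \<sigma>))) tick"
proof (rule exec_mono[OF exec_compile_store[OF assms(5-7)]])
  have "store_cost k i e * (B + 1) \<le> K * (B + 1)" using assms(4) by (rule mult_le_mono1)
  thus "1 + eval_cost (flat inp \<sigma>) (cell_addr k (compile_expr i)) + eval_cost (flat inp \<sigma>)
      (compile_expr e) \<le> tick"
    using eval_cost_flat_le[OF assms(1-3), of "cell_addr k (compile_expr i)"]
      eval_cost_flat_le[OF assms(1-3), of "compile_expr e"]
    unfolding tick_def store_cost_def add_mult_distrib by linarith
qed

lemma simulates_Store:
  assumes "admits (Store k i e) \<sigma> b"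
  shows "simulates (Store k i e) \<sigma> b"
proof -
  from assms have admissible: "k < num_banks" "banks_valid i" "banks_valid e" "bit_degree W e \<le> 1"
    "store_cost k i e \<le> K"
    and fit: "banks_fit b \<sigma>" "b\<^sub>0 \<le> b" "\<And>k. k \<notin> W \<Longrightarrow> fits b\<^sub>0 (\<sigma> k)"
    and growth: "b + g \<le> B" "bexpr_weight e * (b\<^sub>0 + 1) \<le> g"
    by (auto simp: admits_def)
  have "bit_degree W e * b \<le> b" using admissible(4) by (cases "bit_degree W e") auto
  hence "bit_degree W e * b + bexpr_weight e * (b\<^sub>0 + 1) \<le> b + g" using growth(2) by (rule add_mono)
  with ev_le[OF fits_mono[OF input_fits fit(2)] fit(1,3)] have "ev inp \<sigma> e \<le> 2 ^ (b + g)"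
    by (rule le_two_power_trans)
  with banks_fit_mono[OF fit(1)] have "banks_fit (b + g) (sem inp (Store k i e) \<sigma>)"
    by (auto intro: banks_fit_put)
  moreover have "b \<le> B" using growth(1) by simp
  ultimately show ?thesis
    using exec_store_tick[OF fit(1,2) _ admissible(5,1-3)] by (simp add: simulates_def)
qed

lemma simulates_Then:
  assumes "simulates c \<sigma> b" "simulates d (sem inp c \<sigma>) (b + max_stores U c * g)"
  shows "simulates (c ;; d) \<sigma> b"
proof -
  have "exec (compile_com (c ;; d)) (flat inp \<sigma>) (return_pmf (flat inp (sem inp (c ;; d) \<sigma>)))
      (1 + max_steps U c * tick + max_steps U d * tick)"
    using assms unfolding simulates_def compile_com.simps sem.simps by (blast intro: exec_Seq_return)
  moreover have "1 + max_steps U c * tick + max_steps U d * tick \<le> max_steps U (c ;; d) * tick"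
    by (simp add: tick_def algebra_simps)
  ultimately show ?thesis
    using assms(2) exec_mono by (auto simp: simulates_def algebra_simps)
qed

lemma simulates_Ite:
  assumes "admits (Ite e c d) \<sigma> b" "simulates c \<sigma> b" "simulates d \<sigma> b"
  shows "simulates (Ite e c d) \<sigma> b"
proof -
  from assms(1) have fit: "banks_fit b \<sigma>" "b\<^sub>0 \<le> b" "b \<le> B" and "banks_valid e"
    "expr_cost (compile_expr e) \<le> K"
    by (auto simp: admits_def)
  let ?time = "max_steps U c * tick + max_steps U d * tick"
  have "exec (if ev inp \<sigma> e \<noteq> 0 then compile_com c else compile_com d) (flat inp \<sigma>)
      (return_pmf (flat inp (sem inp (Ite e c d) \<sigma>))) ?time"
    using assms(2,3) exec_mono[OF _ le_add1] exec_mono[OF _ le_add2] by (auto simp: simulates_def)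
  with \<open>banks_valid e\<close> have "exec (compile_com (Ite e c d)) (flat inp \<sigma>)
      (return_pmf (flat inp (sem inp (Ite e c d) \<sigma>)))
      (1 + eval_cost (flat inp \<sigma>) (compile_expr e) + ?time)"
    unfolding compile_com.simps by (intro exec_Cond) (simp add: eval_compile_expr)
  moreover have "1 + eval_cost (flat inp \<sigma>) (compile_expr e) + ?time \<le> max_steps U (Ite e c d) * tick"
    using test_time_le[OF fit \<open>expr_cost (compile_expr e) \<le> K\<close>] by (simp add: algebra_simps)
  moreover have "banks_fit (b + max_stores U (Ite e c d) * g) (sem inp (Ite e c d) \<sigma>)"
    using assms(2,3) by (auto simp: simulates_def algebra_simps elim!: banks_fit_mono)
  ultimately show ?thesis using exec_mono unfolding simulates_def by blast
qed

lemma admits_Then_left: "admits (c ;; d) \<sigma> b \<Longrightarrow> admits c \<sigma> b"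
  by (auto simp: admits_def algebra_simps)

lemma admits_Then_right:
  assumes "admits (c ;; d) \<sigma> b" "simulates c \<sigma> b"
  shows "admits d (sem inp c \<sigma>) (b + max_stores U c * g)"
proof -
  have admissible: "admissible W c" "admissible W d" using assms(1) by (auto simp: admits_def)
  have "ev inp (sem inp c \<sigma>) e \<le> U" if "e \<in> loop_bounds d" for e
    using ev_loop_bound[OF admissible(2) that, of "sem inp c \<sigma>" \<sigma>] sem_read_only[OF admissible(1)]
      assms(1) that
    by (auto simp: admits_def)
  with assms show ?thesis
    using sem_read_only[OF admissible(1)] by (auto simp: admits_def simulates_def algebra_simps)
qed

lemma admits_Ite: "admits (Ite e c d) \<sigma> b \<Longrightarrow> admits c \<sigma> b \<and> admits d \<sigma> b"
  by (auto simp: admits_def algebra_simps)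

context
  fixes k :: nat and e :: bexpr and c :: bcom and \<sigma> :: banks and b :: nat
  assumes loop: "admits (For k e c) \<sigma> b" and body: "\<And>\<tau> b'. admits c \<tau> b' \<Longrightarrow> simulates c \<tau> b'"
begin

abbreviation "bits_after x \<equiv> b + x * (max_stores U c + 1) * g"
abbreviation "state_after x \<equiv> loop_state inp k c \<sigma> x"

lemma loop_admissible:
  "k \<in> W" "k < num_banks" "k \<notin> written c" "banks_valid e" "banks_read e \<inter> W = {}" "admissible W c"
  and loop_costs: "store_cost k (Num 0) (Num 0) \<le> K" "store_cost k (Num 0) (Var k \<oplus> Num 1) \<le> K"
    "expr_cost (compile_expr (Less (Var k) e)) \<le> K" "com_cost c \<le> K"
  and loop_growth: "1 \<le> g" "bit_growth c * (b\<^sub>0 + 1) \<le> g"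
  and loop_fit: "banks_fit b \<sigma>" "b\<^sub>0 \<le> b"
  and loop_limit: "ev inp \<sigma> e \<le> U"
  using loop by (auto simp: admits_def algebra_simps)

lemma bits_after_le: "x \<le> ev inp \<sigma> e \<Longrightarrow> bits_after x \<le> b + max_stores U (For k e c) * g"
  using loop_limit unfolding max_stores.simps by (intro add_left_mono mult_le_mono1) simp

lemma bits_after_le_budget: "x \<le> ev inp \<sigma> e \<Longrightarrow> bits_after x \<le> B"
  using bits_after_le[of x] loop unfolding admits_def by linarith

lemma state_after_read_only: "l \<notin> W \<Longrightarrow> state_after x l = \<sigma> l"
  using loop_admissible admissible_written by (intro loop_state_unwritten) auto

lemma ev_bound_state_after: "ev inp (state_after x) e = ev inp \<sigma> e"
  by (rule ev_cong) (use state_after_read_only loop_admissible(5) in auto)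

lemma simulates_loop_body:
  assumes "x < ev inp \<sigma> e" "banks_fit (bits_after x) (state_after x)"
  shows "simulates c (state_after x) (bits_after x)"
proof (rule body)
  have "bits_after x + max_stores U c * g \<le> bits_after (Suc x)" by (simp add: algebra_simps)
  also have "\<dots> \<le> B" using assms(1) by (intro bits_after_le_budget) simp
  finally have "bits_after x + max_stores U c * g \<le> B" .
  moreover have "ev inp (state_after x) e' \<le> U" if "e' \<in> loop_bounds c" for e'
    using ev_loop_bound[OF loop_admissible(6) that, of "state_after x" \<sigma>]
      state_after_read_only loop that
    by (auto simp: admits_def)
  ultimately show "admits c (state_after x) (bits_after x)"
    using assms(2) loop loop_growth(2) loop_costs(4) loop_admissible(6) state_after_read_only
    by (auto simp: admits_def)
qed

lemma state_after_fits: "x \<le> ev inp \<sigma> e \<Longrightarrow> banks_fit (bits_after x) (state_after x)"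
proof (induction x)
  case 0
  show ?case using loop_fit(1) by (simp add: banks_fit_put)
next
  case (Suc x)
  let ?\<tau> = "sem inp c (state_after x)" and ?b = "bits_after x + max_stores U c * g"
  have "banks_fit ?b ?\<tau>" using simulates_loop_body[of x] Suc by (simp add: simulates_def)
  moreover from banks_fitD[OF this order_refl, of k 0] have "Suc (?\<tau> k 0) \<le> 2 ^ (?b + 1)"
    using add_le_two_power[of "?\<tau> k 0" ?b 1 0 ?b] by simp
  ultimately have "banks_fit (?b + 1) (state_after (Suc x))"
    by (simp add: bump_def banks_fit_put banks_fit_mono[of ?b])
  thus ?case by (rule banks_fit_mono) (use loop_growth(1) in \<open>simp add: algebra_simps\<close>)
qed

lemma exec_loop_body:
  assumes "x < ev inp \<sigma> e"
  shows "exec (Seq (compile_com c) (compile_store k (Num 0) (Var k \<oplus> Num 1))) (flat inp (state_after x))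
    (return_pmf (flat inp (state_after (Suc x)))) (1 + max_steps U c * tick + tick)"
proof (rule exec_Seq_return)
  let ?\<tau> = "sem inp c (state_after x)" and ?b = "bits_after x + max_stores U c * g"
  have body: "simulates c (state_after x) (bits_after x)"
    using assms state_after_fits by (intro simulates_loop_body) auto
  thus "exec (compile_com c) (flat inp (state_after x)) (return_pmf (flat inp ?\<tau>))
      (max_steps U c * tick)"
    by (simp add: simulates_def)
  have "?b \<le> bits_after (Suc x)" by (simp add: algebra_simps)
  also have "\<dots> \<le> B" using assms by (intro bits_after_le_budget) simp
  finally have "?b \<le> B" .
  with body loop_fit(2) loop_costs(2) loop_admissible(2)
  have "exec (compile_store k (Num 0) (Var k \<oplus> Num 1)) (flat inp ?\<tau>)
      (return_pmf (flat inp (put k (ev inp ?\<tau> (Num 0)) (ev inp ?\<tau> (Var k \<oplus> Num 1)) ?\<tau>))) tick"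
    by (intro exec_store_tick[of ?b]) (auto simp: simulates_def)
  thus "exec (compile_store k (Num 0) (Var k \<oplus> Num 1)) (flat inp ?\<tau>)
      (return_pmf (flat inp (state_after (Suc x)))) tick"
    by (simp add: bump_def)
qed

lemma simulates_For: "simulates (For k e c) \<sigma> b"
proof -
  let ?n = "ev inp \<sigma> e" and ?test = "compile_expr (Less (Var k) e)"
  let ?loop = "While ?test (Seq (compile_com c) (compile_store k (Num 0) (Var k \<oplus> Num 1)))"
  let ?body_time = "1 + max_steps U c * tick + tick"
  have test: "eval (flat inp (state_after x)) ?test = ?n - x" for x
    using loop_admissible eval_compile_expr[of "Less (Var k) e" inp "state_after x"]
    by (simp add: ev_bound_state_after loop_state_counter del: compile_expr.simps)
  have "exec ?loop (flat inp (state_after 0)) (return_pmf (flat inp (state_after ?n)))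
      (?n * (?body_time + tick) + tick)"
  proof (rule exec_While_iterate[where M = "\<lambda>x. flat inp (state_after x)"])
    show "1 + eval_cost (flat inp (state_after x)) ?test \<le> tick" if "x \<le> ?n" for x
      by (rule test_time_le[OF state_after_fits[OF that] _ bits_after_le_budget[OF that] loop_costs(3)])
        (use loop_fit(2) in simp)
  qed (use test exec_loop_body in \<open>simp_all del: loop_state_simps compile_expr.simps\<close>)
  moreover have "b \<le> B" using bits_after_le_budget[of 0] by simp
  with loop_fit loop_costs(1) loop_admissible(2)
  have "exec (compile_store k (Num 0) (Num 0)) (flat inp \<sigma>)
      (return_pmf (flat inp (state_after 0))) tick"
    using exec_store_tick[of b \<sigma> k "Num 0" "Num 0"] by simp
  ultimately have "exec (compile_com (For k e c)) (flat inp \<sigma>)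
      (return_pmf (flat inp (sem inp (For k e c) \<sigma>)))
      (1 + tick + (?n * (?body_time + tick) + tick))"
    unfolding sem_For compile_com.simps by (intro exec_Seq_return)
  moreover have "1 + tick + (?n * (?body_time + tick) + tick) \<le> max_steps U (For k e c) * tick"
  proof -
    have "?body_time + tick \<le> (max_steps U c + 3) * tick" by (simp add: tick_def algebra_simps)
    hence "?n * (?body_time + tick) \<le> U * ((max_steps U c + 3) * tick)"
      using loop_limit by (intro mult_le_mono)
    moreover have "1 \<le> tick" by (simp add: tick_def)
    ultimately show ?thesis by (simp add: add_mult_distrib mult.assoc)
  qed
  moreover have "banks_fit (b + max_stores U (For k e c) * g) (sem inp (For k e c) \<sigma>)"
    unfolding sem_For
    by (rule banks_fit_mono[OF state_after_fits[OF order_refl] bits_after_le[OF order_refl]])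
  ultimately show ?thesis using exec_mono unfolding simulates_def by blast
qed

end

lemma admits_simulates: "admits c \<sigma> b \<Longrightarrow> simulates c \<sigma> b"
proof (induction c arbitrary: \<sigma> b)
  case Nop
  have "exec Skip (flat inp \<sigma>) (return_pmf (flat inp \<sigma>)) tick"
    by (rule exec_mono[OF exec_Skip]) (simp add: tick_def)
  with Nop show ?case by (simp add: simulates_def admits_def)
next
  case (Then c d)
  thus ?case using admits_Then_left admits_Then_right by (blast intro: simulates_Then)
next
  case (Ite e c d)
  thus ?case using admits_Ite by (blast intro: simulates_Ite)
next
  case (For k e c)
  thus ?case by (blast intro: simulates_For)
qed (rule simulates_Store)

end

definition phase_bits :: "bcom \<Rightarrow> nat \<Rightarrow> nat \<Rightarrow> nat" where
  "phase_bits c U b = b + max_stores U c * (bit_growth c * (b + 1))"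

definition phase_time :: "bcom \<Rightarrow> nat \<Rightarrow> nat \<Rightarrow> nat" where
  "phase_time c U b = max_steps U c * (1 + com_cost c * (phase_bits c U b + 1))"

lemma exec_phase:
  assumes "admissible W c" "fits b inp" "banks_fit b \<sigma>" "\<And>e. e \<in> loop_bounds c \<Longrightarrow> ev inp \<sigma> e \<le> U"
  shows "exec (compile_com c) (flat inp \<sigma>) (return_pmf (flat inp (sem inp c \<sigma>))) (phase_time c U b)"
    and "banks_fit (phase_bits c U b) (sem inp c \<sigma>)"
proof -
  interpret bit_budget inp W b "bit_growth c * (b + 1)" "phase_bits c U b" U "com_cost c"
    by unfold_locales (rule assms(2))
  have "admits c \<sigma> b"
    unfolding admits_def using assms by (simp add: phase_bits_def banks_fit_def)
  hence "simulates c \<sigma> b" by (rule admits_simulates)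
  thus "exec (compile_com c) (flat inp \<sigma>) (return_pmf (flat inp (sem inp c \<sigma>))) (phase_time c U b)"
    "banks_fit (phase_bits c U b) (sem inp c \<sigma>)"
    unfolding simulates_def tick_def phase_time_def by (auto simp: phase_bits_def)
qed

lemma le_phase_bits: "b \<le> phase_bits c U b"
  by (simp add: phase_bits_def)

primrec compile_list :: "bcom list \<Rightarrow> com" where
  "compile_list [] = Skip"
| "compile_list (c # cs) = Seq (compile_com c) (compile_list cs)"

primrec list_bits :: "bcom list \<Rightarrow> nat \<Rightarrow> nat \<Rightarrow> nat" where
  "list_bits [] U b = b"
| "list_bits (c # cs) U b = list_bits cs U (phase_bits c U b)"

primrec list_time :: "bcom list \<Rightarrow> nat \<Rightarrow> nat \<Rightarrow> nat" where
  "list_time [] U b = 1"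
| "list_time (c # cs) U b = 1 + phase_time c U b + list_time cs U (phase_bits c U b)"

definition loops_bounded_by :: "bexpr set \<Rightarrow> bcom \<Rightarrow> bool" where
  "loops_bounded_by E c \<longleftrightarrow> admissible (written c) c \<and> loop_bounds c \<subseteq> E \<and>
     (\<forall>e \<in> E. banks_read e \<inter> written c = {})"

lemma le_list_bits: "b \<le> list_bits cs U b"
  by (induction cs arbitrary: b) (auto intro: order_trans[OF le_phase_bits])

lemma exec_compile_list:
  assumes "\<And>c. c \<in> set cs \<Longrightarrow> loops_bounded_by E c" "fits b inp" "banks_fit b \<sigma>"
    and "\<And>e. e \<in> E \<Longrightarrow> ev inp \<sigma> e \<le> U"
  shows "exec (compile_list cs) (flat inp \<sigma>) (return_pmf (flat inp (sems inp cs \<sigma>)))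
      (list_time cs U b) \<and>
    banks_fit (list_bits cs U b) (sems inp cs \<sigma>)"
  using assms
proof (induction cs arbitrary: \<sigma> b)
  case Nil
  show ?case using exec_Skip[of "flat inp \<sigma>"] Nil.prems(3) by simp
next
  case (Cons c cs)
  let ?\<tau> = "sem inp c \<sigma>" and ?b = "phase_bits c U b"
  have c_bounded: "admissible (written c) c" "loop_bounds c \<subseteq> E"
    "\<And>e. e \<in> E \<Longrightarrow> banks_read e \<inter> written c = {}"
    using Cons.prems(1)[of c] by (auto simp: loops_bounded_by_def)
  have phase: "exec (compile_com c) (flat inp \<sigma>) (return_pmf (flat inp ?\<tau>)) (phase_time c U b)"
    "banks_fit ?b ?\<tau>"
    using exec_phase[OF c_bounded(1) Cons.prems(2,3)] Cons.prems(4) c_bounded(2) by blast+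
  have "ev inp ?\<tau> e \<le> U" if "e \<in> E" for e
    using ev_cong[of e ?\<tau> \<sigma> inp] c_bounded(3)[OF that] Cons.prems(4)[OF that]
    by (force simp: sem_unwritten)
  with Cons.prems(1,2) phase(2) have "exec (compile_list cs) (flat inp ?\<tau>)
      (return_pmf (flat inp (sems inp cs ?\<tau>)))
      (list_time cs U ?b) \<and> banks_fit (list_bits cs U ?b) (sems inp cs ?\<tau>)"
    by (intro Cons.IH) (auto intro: fits_mono le_phase_bits)
  with phase(1) show ?case unfolding compile_list.simps sems.simps list_time.simps list_bits.simps
    by (blast intro: exec_Seq_return)
qed

definition poly_bounded :: "(nat \<Rightarrow> nat) \<Rightarrow> bool" where
  "poly_bounded f \<longleftrightarrow> (\<exists>p :: nat poly. \<forall>x. f x \<le> poly p x)"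

lemma poly_bounded_const: "poly_bounded (\<lambda>_. c)"
  unfolding poly_bounded_def by (rule exI[of _ "[:c:]"]) simp

lemma poly_bounded_id: "poly_bounded (\<lambda>x. x)"
  unfolding poly_bounded_def by (rule exI[of _ "[:0, 1:]"]) simp

lemma poly_bounded_add:
  assumes "poly_bounded f" "poly_bounded g" shows "poly_bounded (\<lambda>x. f x + g x)"
proof -
  obtain p q :: "nat poly" where "\<And>x. f x \<le> poly p x" "\<And>x. g x \<le> poly q x"
    using assms unfolding poly_bounded_def by blast
  thus ?thesis unfolding poly_bounded_def by (intro exI[of _ "p + q"]) (simp add: add_mono)
qed

lemma poly_bounded_mult:
  assumes "poly_bounded f" "poly_bounded g" shows "poly_bounded (\<lambda>x. f x * g x)"
proof -
  obtain p q :: "nat poly" where "\<And>x. f x \<le> poly p x" "\<And>x. g x \<le> poly q x"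
    using assms unfolding poly_bounded_def by blast
  thus ?thesis unfolding poly_bounded_def by (intro exI[of _ "p * q"]) (simp add: mult_le_mono)
qed

lemmas poly_bounded_arith = poly_bounded_const poly_bounded_id poly_bounded_add poly_bounded_mult

lemma poly_bounded_max_stores: "poly_bounded u \<Longrightarrow> poly_bounded (\<lambda>x. max_stores (u x) c)"
  by (induction c) (auto intro!: poly_bounded_arith simp del: mult_Suc_right add_Suc_right)

lemma poly_bounded_max_steps: "poly_bounded u \<Longrightarrow> poly_bounded (\<lambda>x. max_steps (u x) c)"
proof (induction c)
  case (For k e c)
  show ?case unfolding max_steps.simps by (intro poly_bounded_arith For)
qed (auto simp only: max_steps.simps intro!: poly_bounded_arith)

lemma poly_bounded_phase_bits:
  "poly_bounded u \<Longrightarrow> poly_bounded f \<Longrightarrow> poly_bounded (\<lambda>x. phase_bits c (u x) (f x))"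
  unfolding phase_bits_def by (intro poly_bounded_arith poly_bounded_max_stores)

lemma poly_bounded_phase_time:
  "poly_bounded u \<Longrightarrow> poly_bounded f \<Longrightarrow> poly_bounded (\<lambda>x. phase_time c (u x) (f x))"
  unfolding phase_time_def
  by (intro poly_bounded_arith poly_bounded_max_steps poly_bounded_phase_bits)

lemma poly_bounded_list_bits:
  "poly_bounded u \<Longrightarrow> poly_bounded f \<Longrightarrow> poly_bounded (\<lambda>x. list_bits cs (u x) (f x))"
  by (induction cs arbitrary: f) (auto intro: poly_bounded_phase_bits)

lemma poly_bounded_list_time:
  "poly_bounded u \<Longrightarrow> poly_bounded f \<Longrightarrow> poly_bounded (\<lambda>x. list_time cs (u x) (f x))"
proof (induction cs arbitrary: f)
  case (Cons c cs)
  show ?case unfolding list_time.simps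
    by (intro poly_bounded_add poly_bounded_const poly_bounded_phase_time Cons poly_bounded_phase_bits)
qed (simp add: poly_bounded_const)


section \<open>The threshold inequality\<close>

lemma exp_one_ge: "2718 / 1000 \<le> exp (1::real)"
  using abs_le_D2[OF e_approx_32] by simp

lemma exp_19_11_bounds: "5572 / 1000 \<le> exp (19 / 11 :: real)" "exp (19 / 11 :: real) \<le> 5747 / 1000"
proof -
  have exp_pow: "exp (19 / 11 :: real) ^ 11 = exp 1 ^ 19"
    by (simp add: exp_of_nat_mult[symmetric])
  have "(5572 / 1000) ^ 11 \<le> (2718 / 1000 :: real) ^ 19" by (simp add: power_divide)
  also have "\<dots> \<le> exp (19 / 11) ^ 11" unfolding exp_pow using exp_one_ge by (intro power_mono) auto
  finally show "5572 / 1000 \<le> exp (19 / 11 :: real)" by (simp add: power_mono_iff)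
  have "exp (19 / 11 :: real) ^ 11 \<le> (272 / 100) ^ 19"
    unfolding exp_pow using e_less_272 by (intro power_mono) auto
  also have "\<dots> \<le> (5747 / 1000) ^ 11" by (simp add: power_divide)
  finally show "exp (19 / 11 :: real) \<le> 5747 / 1000" by (simp add: power_mono_iff)
qed

text \<open>The limit probability that none of \<open>N\<close> atoms is open if each is open with probability \<open>1/L\<close>.\<close>

definition miss_prob :: real where "miss_prob = exp (- (19 / 11))"

lemma miss_prob_bounds: "0 < miss_prob" "174 / 1000 \<le> miss_prob" "miss_prob \<le> 1795 / 10000"
  using exp_19_11_bounds by (simp_all add: miss_prob_def exp_minus field_simps)

lemma exp_minus_plus_mono:
  assumes "0 \<le> x" "x \<le> (y :: real)"
  shows "exp (- x) + x \<le> exp (- y) + y"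
proof -
  have "exp (- x) - exp (- y) = exp (- x) * (1 - exp (- (y - x)))"
    by (simp add: right_diff_distrib exp_add[symmetric])
  also have "\<dots> \<le> 1 * (y - x)"
  proof (rule mult_mono)
    show "1 - exp (- (y - x)) \<le> y - x" using exp_ge_add_one_self[of "- (y - x)"] by linarith
  qed (use assms in auto)
  finally show ?thesis by simp
qed

lemma exp_le_chord:
  assumes "0 \<le> x" "x \<le> 19 / 11"
  shows "exp (- x) \<le> 1 - x * (11 / 19) * (1 - miss_prob)"
proof -
  define u where "u = x * (11 / 19)"
  have u_range: "0 \<le> u" "u \<le> 1" using assms by (auto simp: u_def)
  have "exp ((1 - u) *\<^sub>R 0 + u *\<^sub>R (- (19 / 11))) \<le> (1 - u) * exp 0 + u * exp (- (19 / 11) :: real)"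
    by (rule convex_onD[OF exp_convex, of u]) (use u_range in auto)
  thus ?thesis by (simp add: u_def miss_prob_def algebra_simps)
qed

text \<open>
  This inequality determines the constant 19/11: at \<open>X = 1\<close> it reads
  \<open>1 + 1/e + 2 * exp (- 19/11) \<le> 19/11\<close>. For several demands the chord of the exponential suffices.
\<close>

lemma threshold_inequality_single:
  assumes "0 \<le> X" "X \<le> 19 / 11" "c \<le> 1" "1 \<le> X \<Longrightarrow> c \<le> 0"
  shows "exp (- X) - miss_prob + 3 * miss_prob * c \<le> 19 / 11 - X"
proof (cases "X < 1")
  case True
  have "exp (- X) + X \<le> exp (- 1) + 1" using exp_minus_plus_mono[of X 1] assms(1) True by simp
  moreover have "exp (- 1 :: real) \<le> 36792 / 100000"
    using exp_one_ge by (simp add: exp_minus field_simps)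
  moreover have "3 * miss_prob * c \<le> 3 * miss_prob * 1"
    using assms(3) miss_prob_bounds by (intro mult_left_mono) auto
  ultimately show ?thesis using miss_prob_bounds by linarith
next
  case False
  have "exp (- X) + X \<le> miss_prob + 19 / 11"
    using exp_minus_plus_mono[of X "19 / 11"] assms(1,2) by (simp add: miss_prob_def)
  moreover have "3 * miss_prob * c \<le> 0"
    using assms(4) miss_prob_bounds False by (intro mult_nonneg_nonpos) auto
  ultimately show ?thesis by linarith
qed

lemma threshold_inequality_many:
  assumes "2 \<le> real r" "0 \<le> X" "X \<le> 19 / 11 * real r"
    and "X < real r \<Longrightarrow> c \<le> real r - X + 1" "real r \<le> X \<Longrightarrow> c \<le> 0"
  shows "real r * (1 - miss_prob) - X * (11 / 19 * (1 - miss_prob)) + 3 * miss_prob * c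
      \<le> 19 / 11 * real r - X"
proof (cases "X < real r")
  case True
  have "miss_prob * c \<le> miss_prob * (real r - X + 1)"
    using assms(4)[OF True] miss_prob_bounds(1) by (intro mult_left_mono) auto
  hence "real r * (1 - miss_prob) - X * (11 / 19 * (1 - miss_prob)) + 3 * miss_prob * c
      \<le> real r * (1 - miss_prob) - X * (11 / 19 * (1 - miss_prob)) + 3 * (miss_prob * (real r - X + 1))"
    by simp
  also have "\<dots> = real r * (1 + 2 * miss_prob) - X * (11 / 19 + 46 / 19 * miss_prob) + 3 * miss_prob"
    by (simp add: field_simps)
  also have "\<dots> \<le> real r * (136 / 100) - X * 1 + 3 * (1795 / 10000)"
    using assms(1,2) miss_prob_bounds by (intro add_mono diff_mono mult_left_mono) auto
  also have "\<dots> \<le> 19 / 11 * real r - X" using assms(1) by simp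
  finally show ?thesis .
next
  case False
  have "miss_prob * c \<le> 0" using assms(5) miss_prob_bounds False by (simp add: mult_nonneg_nonpos)
  moreover have "real r * (1 - miss_prob) - X * (11 / 19 * (1 - miss_prob))
      = (19 / 11 * real r - X) * (11 / 19 * (1 - miss_prob))"
    by (simp add: field_simps)
  moreover have "\<dots> \<le> (19 / 11 * real r - X) * 1"
    using assms(3) miss_prob_bounds by (intro mult_left_mono) auto
  ultimately show ?thesis by simp
qed

lemma threshold_inequality:
  assumes "1 \<le> r" "\<And>k. k < r \<Longrightarrow> 0 \<le> x k \<and> x k \<le> 19 / 11" "X = (\<Sum>k<r. x k)"
    and "c \<le> real r" "X < real r \<Longrightarrow> c \<le> real r - X + 1" "real r \<le> X \<Longrightarrow> c \<le> 0"
  shows "(\<Sum>k<r. exp (- x k) - miss_prob) + 3 * miss_prob * c \<le> 19 / 11 * real r - X"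
proof (cases "r = 1")
  case True
  with assms show ?thesis using threshold_inequality_single[of X c] by auto
next
  case False
  have "(\<Sum>k<r. exp (- x k) - miss_prob) \<le> (\<Sum>k<r. (1 - miss_prob) - x k * (11 / 19 * (1 - miss_prob)))"
  proof (rule sum_mono)
    fix k assume "k \<in> {..<r}"
    thus "exp (- x k) - miss_prob \<le> (1 - miss_prob) - x k * (11 / 19 * (1 - miss_prob))"
      using exp_le_chord[of "x k"] assms(2)[of k] by (simp add: algebra_simps)
  qed
  also have "\<dots> = real r * (1 - miss_prob) - X * (11 / 19 * (1 - miss_prob))"
    by (simp add: sum_subtractf sum_distrib_right assms(3))
  finally have "(\<Sum>k<r. exp (- x k) - miss_prob) + 3 * miss_prob * c
      \<le> real r * (1 - miss_prob) - X * (11 / 19 * (1 - miss_prob)) + 3 * miss_prob * c"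
    by (rule add_right_mono)
  also have "\<dots> \<le> 19 / 11 * real r - X"
  proof (rule threshold_inequality_many[OF _ _ _ assms(5,6)])
    show "0 \<le> X" unfolding assms(3) using assms(2) by (intro sum_nonneg) auto
    show "X \<le> 19 / 11 * real r"
      unfolding assms(3) using sum_mono[of "{..<r}" x "\<lambda>_. 19 / 11"] assms(2) by simp
  qed (use assms(1) False in auto)
  finally show ?thesis .
qed


section \<open>Independent uniform draws\<close>

definition draws :: "nat \<Rightarrow> nat \<Rightarrow> (nat \<Rightarrow> nat) pmf" where
  "draws J L = Pi_pmf {..<J} 0 (\<lambda>_. pmf_of_set {0..L - 1})"

lemma set_draws: "set_pmf (draws J L) = PiE_dflt {..<J} 0 (\<lambda>_. {0..L - 1})"
  unfolding draws_def by (subst set_Pi_pmf) (auto simp: set_pmf_of_set)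

lemma finite_set_draws: "finite (set_pmf (draws J L))"
  unfolding set_draws by (intro finite_PiE_dflt) auto

lemma draws_less: "\<omega> \<in> set_pmf (draws J L) \<Longrightarrow> x < J \<Longrightarrow> 0 < L \<Longrightarrow> \<omega> x < L"
  unfolding set_draws PiE_dflt_def by (auto dest!: spec[of _ x])

lemma draws_outside: "\<omega> \<in> set_pmf (draws J L) \<Longrightarrow> \<not> x < J \<Longrightarrow> \<omega> x = 0"
  unfolding set_draws PiE_dflt_def by auto

lemma prob_uniform_compl:
  assumes "0 < L" "B \<subseteq> {..<L}"
  shows "measure_pmf.prob (pmf_of_set {0..L - 1}) (- B) = 1 - real (card B) / real L"
proof -
  have "{0..L - 1} \<inter> B = B" using assms by auto
  hence "measure_pmf.prob (pmf_of_set {0..L - 1}) B = real (card B) / real L"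
    by (subst measure_pmf_of_set) (use assms in auto)
  thus ?thesis using measure_pmf.prob_compl[of B "pmf_of_set {0..L - 1}"]
    by (simp add: Compl_eq_Diff_UNIV)
qed

lemma prob_draws_eq:
  assumes "0 < L" "x < J" "v < L"
  shows "measure_pmf.prob (draws J L) {\<omega>. \<omega> x = v} = 1 / real L"
proof -
  have "{\<omega>. \<omega> x = v} = Pi {..<J} (\<lambda>y. if y = x then {v} else (UNIV :: nat set))"
    using assms(2) by (auto simp: Pi_def)
  hence "measure_pmf.prob (draws J L) {\<omega>. \<omega> x = v}
      = (\<Prod>y<J. measure_pmf.prob (pmf_of_set {0..L - 1}) (if y = x then {v} else UNIV))"
    unfolding draws_def by (simp add: measure_Pi_pmf_Pi)
  also have "\<dots> = (\<Prod>y<J. if y = x then measure_pmf.prob (pmf_of_set {0..L - 1}) {v} else 1)"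
    by (intro prod.cong) auto
  also have "\<dots> = measure_pmf.prob (pmf_of_set {0..L - 1}) {v}" using assms(2) by simp
  also have "\<dots> = 1 / real L"
    using assms by (subst measure_pmf_of_set) auto
  finally show ?thesis .
qed

lemma prob_draws_miss:
  fixes slot val :: "'a \<Rightarrow> nat"
  assumes "0 < L" "finite A" "\<And>t. t \<in> A \<Longrightarrow> slot t < J \<and> val t < L"
    and "inj_on (\<lambda>t. (slot t, val t)) A"
  shows "measure_pmf.prob (draws J L) {\<omega>. \<forall>t\<in>A. \<omega> (slot t) \<noteq> val t} \<le> exp (- real (card A) / real L)"
proof -
  define B where "B x = val ` {t \<in> A. slot t = x}" for x
  have B_sub: "B x \<subseteq> {..<L}" for x unfolding B_def using assms(3) by auto
  have "{\<omega>. \<forall>t\<in>A. \<omega> (slot t) \<noteq> val t} = Pi {..<J} (\<lambda>x. - B x)"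
    unfolding B_def using assms(3) by (auto simp: Pi_def)
  hence "measure_pmf.prob (draws J L) {\<omega>. \<forall>t\<in>A. \<omega> (slot t) \<noteq> val t}
      = (\<Prod>x<J. 1 - real (card (B x)) / real L)"
    unfolding draws_def using prob_uniform_compl[OF assms(1) B_sub] by (simp add: measure_Pi_pmf_Pi)
  also have "\<dots> \<le> (\<Prod>x<J. exp (- real (card (B x)) / real L))"
  proof (rule prod_mono)
    fix x
    have "real (card (B x)) / real L \<le> 1"
      using card_mono[OF _ B_sub[of x]] assms(1) by simp
    thus "0 \<le> 1 - real (card (B x)) / real L \<and>
        1 - real (card (B x)) / real L \<le> exp (- real (card (B x)) / real L)"
      using exp_ge_add_one_self[of "- real (card (B x)) / real L"] by simp
  qed
  also have "\<dots> = exp (- (\<Sum>x<J. real (card (B x))) / real L)"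
    by (simp add: exp_sum[symmetric] sum_negf sum_divide_distrib)
  also have "(\<Sum>x<J. real (card (B x))) = real (card A)"
  proof -
    have "card (B x) = card {t \<in> A. slot t = x}" for x
      unfolding B_def by (rule card_image) (use assms(4) in \<open>auto simp: inj_on_def\<close>)
    moreover have "(\<Sum>x<J. \<Sum>t\<in>{t \<in> A. slot t = x}. 1) = (\<Sum>t\<in>A. (1::nat))"
      by (rule sum.group) (use assms in auto)
    ultimately show ?thesis by (simp flip: of_nat_sum)
  qed
  finally show ?thesis .
qed

lemma expectation_sum_finite:
  assumes "finite (set_pmf p)"
  shows "measure_pmf.expectation p (\<lambda>\<omega>. \<Sum>x\<in>A. f x \<omega>)
      = (\<Sum>x\<in>A. measure_pmf.expectation p (f x :: _ \<Rightarrow> real))"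
  by (rule Bochner_Integration.integral_sum) (rule integrable_measure_pmf_finite[OF assms])

lemma expectation_of_bool:
  "measure_pmf.expectation p (\<lambda>\<omega>. of_bool (Q \<omega>)) = measure_pmf.prob p {\<omega>. Q \<omega>}"
proof -
  have "(\<lambda>\<omega>. of_bool (Q \<omega>) :: real) = indicator {\<omega>. Q \<omega>}" by (auto simp: indicator_def)
  thus ?thesis by simp
qed

lemma expectation_mono_finite:
  assumes "finite (set_pmf p)" "\<And>\<omega>. \<omega> \<in> set_pmf p \<Longrightarrow> f \<omega> \<le> (g \<omega> :: real)"
  shows "measure_pmf.expectation p f \<le> measure_pmf.expectation p g"
  by (rule integral_mono_AE)
    (use assms in \<open>auto simp: integrable_measure_pmf_finite AE_measure_pmf_iff\<close>)


section \<open>Expected connection cost of one client\<close>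

lemma real_eq_sum_thresholds: "d \<le> H \<Longrightarrow> real d = (\<Sum>\<theta><H. of_bool (\<theta> < d))"
proof -
  assume "d \<le> H"
  hence "{..<H} \<inter> {\<theta>. \<theta> < d} = {..<d}" by auto
  thus ?thesis by (simp add: of_bool_def sum.If_cases)
qed

lemma enlarge_disjoint_family_member:
  fixes A :: "nat \<Rightarrow> 'a set"
  assumes "finite P" "\<And>k. k < r \<Longrightarrow> A k \<subseteq> P \<and> card (A k) \<le> N" "disjoint_family_on A {..<r}"
    and "r * N \<le> card P" "i < r"
  obtains B where "A i \<subseteq> B" "B \<subseteq> P" "card B = N" "disjoint_family_on (A(i := B)) {..<r}"
proof -
  let ?others = "\<Union>k\<in>{..<r} - {i}. A k"
  have finite_A: "finite (A k)" if "k < r" for k using assms(1,2) that finite_subset by blast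
  have "card ?others \<le> (\<Sum>k\<in>{..<r} - {i}. card (A k))" by (rule card_UN_le) simp
  also have "\<dots> \<le> (\<Sum>k\<in>{..<r} - {i}. N)" using assms(2) by (intro sum_mono) auto
  also have "\<dots> = (r - 1) * N" using assms(5) by simp
  finally have "card ?others + N \<le> r * N" using assms(5) by (cases r) auto
  hence "N \<le> card P - card ?others" using assms(4) by linarith
  also have "\<dots> \<le> card (P - ?others)" by (rule diff_card_le_card_Diff) (use finite_A in auto)
  finally have "N \<le> card (P - ?others)" .
  moreover have "A i \<subseteq> P - ?others"
    using assms(2,3,5) unfolding disjoint_family_on_def by fastforce
  ultimately obtain B where B_props: "A i \<subseteq> B" "B \<subseteq> P - ?others" "card B = N"
    using exists_subset_between[of "A i" N "P - ?others"] assms(1,2,5) by auto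
  have "disjoint_family_on (A(i := B)) {..<r}"
    using assms(3) B_props(2) by (fastforce simp: disjoint_family_on_def)
  with B_props show ?thesis by (intro that[of B]) auto
qed

lemma extend_disjoint_family:
  fixes A :: "nat \<Rightarrow> 'a set"
  assumes "finite P" "\<And>k. k < r \<Longrightarrow> A k \<subseteq> P \<and> card (A k) \<le> N" "disjoint_family_on A {..<r}"
    and "r * N \<le> card P"
  obtains S where "\<And>k. k < r \<Longrightarrow> A k \<subseteq> S k \<and> S k \<subseteq> P \<and> card (S k) = N" "disjoint_family_on S {..<r}"
proof -
  have "\<exists>S. (\<forall>k<r. A k \<subseteq> S k \<and> S k \<subseteq> P \<and> card (S k) \<le> N) \<and> (\<forall>k<i. card (S k) = N) \<and>
      disjoint_family_on S {..<r}" if "i \<le> r" for i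
    using that
  proof (induction i)
    case 0
    show ?case using assms by (intro exI[of _ A]) auto
  next
    case (Suc i)
    then obtain S where S_props: "\<forall>k<r. A k \<subseteq> S k \<and> S k \<subseteq> P \<and> card (S k) \<le> N" "\<forall>k<i. card (S k) = N"
      "disjoint_family_on S {..<r}" by auto
    obtain B where B_props: "S i \<subseteq> B" "B \<subseteq> P" "card B = N" "disjoint_family_on (S(i := B)) {..<r}"
      by (rule enlarge_disjoint_family_member[of P r S N i]) (use S_props assms(1,4) Suc.prems in auto)
    have "i < r" using Suc.prems by simp
    hence "A i \<subseteq> B" using S_props(1) B_props(1) by blast
    hence "\<forall>k<r. A k \<subseteq> (S(i := B)) k \<and> (S(i := B)) k \<subseteq> P \<and> card ((S(i := B)) k) \<le> N"
      using S_props(1) B_props by simp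
    moreover have "\<forall>k<Suc i. card ((S(i := B)) k) = N"
      using S_props(2) B_props(3) by (simp add: less_Suc_eq)
    ultimately show ?case using B_props(4) by blast
  qed
  from this[of r] obtain S where "\<forall>k<r. A k \<subseteq> S k \<and> S k \<subseteq> P" "\<forall>k<r. card (S k) = N"
    "disjoint_family_on S {..<r}" by blast
  thus ?thesis by (intro that[of S]) auto
qed

text \<open>
  Each demand \<open>k\<close> takes the nearest open atom of its own set \<open>S k\<close> unless that is farther than
  \<open>R k\<close>, in which case it takes the open atom of its cluster \<open>C k\<close>. Since \<open>S k\<close> contains
  all atoms of \<open>C k\<close> in the neighbourhood \<open>P\<close> of the client, the fallback atom lies outside
  \<open>P\<close>, so that the demands of one client never collide.
\<close>

lemma nearest_or_fallback:
  fixes \<delta> :: "'a \<Rightarrow> nat"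
  assumes "P \<inter> C \<subseteq> S" "finite S" "\<And>t. t \<in> C \<Longrightarrow> \<delta> t \<le> R" "C \<inter> Op \<noteq> {}"
  obtains a where "a \<in> Op" "a \<in> S \<or> a \<in> C - P" "\<delta> a \<le> R" "\<And>t. t \<in> S \<inter> Op \<Longrightarrow> \<delta> a \<le> \<delta> t"
proof (cases "\<exists>t \<in> S \<inter> Op. \<delta> t \<le> R")
  case True
  then obtain a where "a \<in> S \<inter> Op" "\<forall>t \<in> S \<inter> Op. \<delta> a \<le> \<delta> t"
    using ex_is_arg_min_if_finite[of "S \<inter> Op" \<delta>] assms(2) by (auto simp: is_arg_min_linorder)
  with True show ?thesis by (intro that[of a]) (auto intro: order_trans)
next
  case False
  obtain a where a_mem: "a \<in> C" "a \<in> Op" using assms(4) by auto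
  hence "\<delta> a \<le> R" using assms(3) by auto
  moreover from this have "a \<notin> P" using False assms(1) a_mem by auto
  moreover have "\<delta> a \<le> \<delta> t" if "t \<in> S \<inter> Op" for t
    using False \<open>\<delta> a \<le> R\<close> that by (meson nat_le_linear order_trans)
  ultimately show ?thesis using a_mem by (intro that[of a]) auto
qed

lemma demand_assignment:
  fixes S C :: "nat \<Rightarrow> 'a set" and \<delta> :: "'a \<Rightarrow> nat"
  assumes S_props: "\<And>k. k < r \<Longrightarrow> P \<inter> C k \<subseteq> S k \<and> S k \<subseteq> P \<and> finite (S k)"
    and disjoint: "disjoint_family_on S {..<r}" "disjoint_family_on C {..<r}"
    and C_near: "\<And>k t. k < r \<Longrightarrow> t \<in> C k \<Longrightarrow> \<delta> t \<le> R k" and hits: "\<And>k. k < r \<Longrightarrow> C k \<inter> Op \<noteq> {}"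
  obtains a where "inj_on a {..<r}" "\<And>k. k < r \<Longrightarrow> a k \<in> Op"
    "\<And>k \<theta>. k < r \<Longrightarrow> \<theta> < \<delta> (a k) \<Longrightarrow> \<theta> < R k \<and> (\<forall>t\<in>S k. \<delta> t \<le> \<theta> \<longrightarrow> t \<notin> Op)"
proof -
  have "\<exists>a. a \<in> Op \<and> (a \<in> S k \<or> a \<in> C k - P) \<and> \<delta> a \<le> R k \<and> (\<forall>t \<in> S k \<inter> Op. \<delta> a \<le> \<delta> t)" if "k < r" for k
    using nearest_or_fallback[of P "C k" "S k" \<delta> "R k" Op] S_props[OF that] C_near[OF that]
      hits[OF that] by metis
  then obtain a where a_mem: "\<And>k. k < r \<Longrightarrow> a k \<in> Op" "\<And>k. k < r \<Longrightarrow> a k \<in> S k \<or> a k \<in> C k - P"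
      "\<And>k. k < r \<Longrightarrow> \<delta> (a k) \<le> R k" "\<And>k t. k < r \<Longrightarrow> t \<in> S k \<inter> Op \<Longrightarrow> \<delta> (a k) \<le> \<delta> t" by metis
  have "inj_on a {..<r}"
  proof (rule inj_onI, rule ccontr)
    fix k l assume equal: "k \<in> {..<r}" "l \<in> {..<r}" "a k = a l" "k \<noteq> l"
    hence "S k \<inter> S l = {}" "C k \<inter> C l = {}" using disjoint by (auto simp: disjoint_family_on_def)
    moreover have "a k \<in> S k \<or> a k \<in> C k - P" "a k \<in> S l \<or> a k \<in> C l - P"
      using a_mem(2)[of k] a_mem(2)[of l] equal by auto
    ultimately show False using S_props[of k] S_props[of l] equal by blast
  qed
  moreover have "\<theta> < R k \<and> (\<forall>t\<in>S k. \<delta> t \<le> \<theta> \<longrightarrow> t \<notin> Op)" if "k < r" "\<theta> < \<delta> (a k)" for k \<theta>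
    using a_mem(3)[OF that(1)] a_mem(4)[OF that(1)] that(2) by fastforce
  ultimately show ?thesis using that a_mem(1) by blast
qed

locale client_demands =
  fixes M N L r J :: nat and P :: "'a set" and slot val \<delta> :: "'a \<Rightarrow> nat" and C :: "nat \<Rightarrow> 'a set"
    and reach :: "nat \<Rightarrow> nat"
  assumes sizes: "0 < M" "N = 19 * M" "L = 11 * M"
    and finite_pool: "finite P" and pool_large: "r * N \<le> card P"
    and slot_val_less: "\<And>t. t \<in> P \<Longrightarrow> slot t < J \<and> val t < L"
    and inj_slot_val: "inj_on (\<lambda>t. (slot t, val t)) P"
    and clusters: "\<And>k. k < r \<Longrightarrow> finite (C k) \<and> card (C k) = L"
    and clusters_disjoint: "disjoint_family_on C {..<r}"
    and cluster_open: "\<And>k \<omega>. k < r \<Longrightarrow> \<omega> \<in> set_pmf (draws J L) \<Longrightarrow> \<exists>t\<in>C k. \<omega> (slot t) = val t"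
    and cluster_near: "\<And>k t. k < r \<Longrightarrow> t \<in> C k \<Longrightarrow> \<delta> t \<le> 3 * reach k"
    and few_within_reach: "\<And>k. k < r \<Longrightarrow> card {t \<in> P. \<delta> t < reach k} < Suc k * L"
begin

lemma L_pos: "0 < L" and L_le_N: "L \<le> N" and N_over_L: "real N / real L = 19 / 11"
  using sizes by auto

end

locale split_demands = client_demands +
  fixes S :: "nat \<Rightarrow> 'a set"
  assumes S_props: "\<And>k. k < r \<Longrightarrow> P \<inter> C k \<subseteq> S k \<and> S k \<subseteq> P \<and> card (S k) = N"
    and S_disjoint: "disjoint_family_on S {..<r}"
begin

abbreviation "Q \<equiv> \<Union>k<r. S k"

definition near :: "nat \<Rightarrow> nat \<Rightarrow> real" where
  "near \<theta> k = real (card {t \<in> S k. \<delta> t \<le> \<theta>}) / real L"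

definition near_total :: "nat \<Rightarrow> real" where
  "near_total \<theta> = (\<Sum>k<r. near \<theta> k)"

lemma finite_S: "k < r \<Longrightarrow> finite (S k)"
  using S_props[of k] finite_subset[OF _ finite_pool] by simp

lemma finite_Q: "finite Q"
  using finite_S by auto

lemma Q_sub: "Q \<subseteq> P"
  using S_props by auto

lemma card_Q: "card Q = r * N"
  using card_UN_disjoint[of "{..<r}" S] finite_S S_props S_disjoint
  by (simp add: disjoint_family_on_def)

lemma near_bounds: "0 \<le> near \<theta> k" "k < r \<Longrightarrow> near \<theta> k \<le> 19 / 11"
proof -
  show "0 \<le> near \<theta> k" by (simp add: near_def)
  assume k_less: "k < r"
  hence "card {t \<in> S k. \<delta> t \<le> \<theta>} \<le> N"
    using S_props[OF k_less] card_mono[OF finite_S[OF k_less], of "{t \<in> S k. \<delta> t \<le> \<theta>}"] by auto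
  thus "near \<theta> k \<le> 19 / 11" unfolding near_def N_over_L[symmetric] by (intro divide_right_mono) auto
qed

lemma near_total_eq: "near_total \<theta> = real (card {t \<in> Q. \<delta> t \<le> \<theta>}) / real L"
proof -
  have "{t \<in> Q. \<delta> t \<le> \<theta>} = (\<Union>k<r. {t \<in> S k. \<delta> t \<le> \<theta>})" by auto
  also have "card \<dots> = (\<Sum>k<r. card {t \<in> S k. \<delta> t \<le> \<theta>})"
    by (rule card_UN_disjoint) (use finite_S S_disjoint in \<open>auto simp: disjoint_family_on_def\<close>)
  finally show ?thesis by (simp add: near_total_def near_def sum_divide_distrib)
qed

lemma near_total_less: "k < r \<Longrightarrow> \<theta> < reach k \<Longrightarrow> near_total \<theta> < real (Suc k)"
proof -
  assume k_near: "k < r" "\<theta> < reach k"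
  have "card {t \<in> Q. \<delta> t \<le> \<theta>} \<le> card {t \<in> P. \<delta> t < reach k}"
    using k_near Q_sub finite_pool by (intro card_mono) auto
  also have "\<dots> < Suc k * L" by (rule few_within_reach[OF k_near(1)])
  finally have "real (card {t \<in> Q. \<delta> t \<le> \<theta>}) < real (Suc k) * real L"
    by (metis of_nat_less_iff of_nat_mult)
  thus ?thesis unfolding near_total_eq using L_pos by (simp add: field_simps)
qed

lemma reach_count_le:
  fixes \<theta> :: nat
  defines "c \<equiv> (\<Sum>k<r. of_bool (\<theta> < reach k)) :: real"
  shows "c \<le> real r"
    and "near_total \<theta> < real r \<Longrightarrow> c \<le> real r - near_total \<theta> + 1"
    and "real r \<le> near_total \<theta> \<Longrightarrow> c \<le> 0"
proof -
  let ?K = "{k \<in> {..<r}. \<theta> < reach k}"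
  have c_card: "c = real (card ?K)" unfolding c_def by (simp add: of_bool_def sum.If_cases Int_def)
  have "card ?K \<le> card {..<r}" by (rule card_mono) auto
  thus "c \<le> real r" unfolding c_card by simp
  have above: "near_total \<theta> < real (Suc k)" if "k \<in> ?K" for k using near_total_less that by simp
  show "c \<le> real r - near_total \<theta> + 1" if "near_total \<theta> < real r"
  proof -
    define f where "f = nat \<lfloor>near_total \<theta>\<rfloor>"
    have "0 \<le> near_total \<theta>" unfolding near_total_eq by simp
    hence f_floor: "real f \<le> near_total \<theta>" "near_total \<theta> < real f + 1" unfolding f_def by linarith+
    have "?K \<subseteq> {f..<r}" using above f_floor by force
    hence "card ?K \<le> card {f..<r}" by (intro card_mono) auto
    moreover have "f < r" using f_floor that by linarith
    ultimately have "real (card ?K) \<le> real r - real f"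
      by (simp add: of_nat_diff[symmetric] del: of_nat_diff)
    thus ?thesis unfolding c_card using f_floor by linarith
  qed
  show "c \<le> 0" if "real r \<le> near_total \<theta>"
  proof -
    have "?K = {}" using above that by fastforce
    thus ?thesis unfolding c_card by simp
  qed
qed

lemma threshold_bound:
  "(\<Sum>k<r. exp (- near \<theta> k) - miss_prob) + 3 * miss_prob * (\<Sum>k<r. of_bool (\<theta> < reach k))
     \<le> 19 / 11 * real r - near_total \<theta>"
proof (cases "r = 0")
  case False
  show ?thesis
    by (rule threshold_inequality[OF _ _ near_total_def reach_count_le]) (use False near_bounds in auto)
next
  case True
  hence "near_total \<theta> = 0" unfolding near_total_def by simp
  thus ?thesis using True by simp
qed

lemma threshold_complement: "19 / 11 * real r - near_total \<theta> = (\<Sum>t\<in>Q. of_bool (\<theta> < \<delta> t)) / real L"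
proof -
  have "{t \<in> Q. \<theta> < \<delta> t} = Q - {t \<in> Q. \<delta> t \<le> \<theta>}" by auto
  moreover have "finite {t \<in> Q. \<delta> t \<le> \<theta>}" by (rule rev_finite_subset[OF finite_Q]) auto
  ultimately have "card {t \<in> Q. \<theta> < \<delta> t} = card Q - card {t \<in> Q. \<delta> t \<le> \<theta>}"
    by (metis (no_types, lifting) card_Diff_subset mem_Collect_eq subsetI)
  moreover have "card {t \<in> Q. \<delta> t \<le> \<theta>} \<le> card Q" using finite_Q by (intro card_mono) auto
  ultimately have "real (card {t \<in> Q. \<theta> < \<delta> t}) = real r * real N - real (card {t \<in> Q. \<delta> t \<le> \<theta>})"
    by (simp add: card_Q of_nat_diff)
  moreover have "(\<Sum>t\<in>Q. of_bool (\<theta> < \<delta> t) :: real) = real (card {t \<in> Q. \<theta> < \<delta> t})"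
    using finite_Q by (simp add: of_bool_def sum.If_cases Int_def)
  ultimately show ?thesis
    unfolding near_total_eq N_over_L[symmetric] by (simp add: diff_divide_distrib)
qed

lemma sum_thresholds_le:
  assumes "b \<le> H" "k < r"
  shows "(\<Sum>\<theta><b. exp (- near \<theta> k)) \<le> (\<Sum>\<theta><H. exp (- near \<theta> k) - miss_prob) + miss_prob * real b"
proof -
  have "(\<Sum>\<theta><b. exp (- near \<theta> k)) = (\<Sum>\<theta><b. exp (- near \<theta> k) - miss_prob) + miss_prob * real b"
    by (simp add: sum_subtractf)
  moreover have "(\<Sum>\<theta><b. exp (- near \<theta> k) - miss_prob) \<le> (\<Sum>\<theta><H. exp (- near \<theta> k) - miss_prob)"
    by (rule sum_mono2) (use assms near_bounds in \<open>auto simp: miss_prob_def\<close>)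
  ultimately show ?thesis by simp
qed

lemma exp_near_bound:
  "(\<Sum>k<r. \<Sum>\<theta><3 * reach k. exp (- near \<theta> k)) \<le> (\<Sum>t\<in>Q. real (\<delta> t)) / real L"
proof -
  define H where "H = (\<Sum>k<r. 3 * reach k) + (\<Sum>t\<in>Q. \<delta> t)"
  have reach_H: "3 * reach k \<le> H" if "k < r" for k
    unfolding H_def using member_le_sum[of k "{..<r}" "\<lambda>k. 3 * reach k"] that by simp
  have dist_H: "\<delta> t \<le> H" if "t \<in> Q" for t
    unfolding H_def using member_le_sum[of t Q \<delta>] that finite_Q by simp
  have "(\<Sum>k<r. \<Sum>\<theta><3 * reach k. exp (- near \<theta> k))
      \<le> (\<Sum>k<r. (\<Sum>\<theta><H. exp (- near \<theta> k) - miss_prob) + miss_prob * real (3 * reach k))"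
    by (intro sum_mono sum_thresholds_le reach_H) auto
  also have "\<dots> = (\<Sum>k<r. (\<Sum>\<theta><H. exp (- near \<theta> k) - miss_prob) + 3 * miss_prob *
      (\<Sum>\<theta><H. of_bool (\<theta> < reach k)))"
  proof (intro sum.cong refl)
    fix k assume "k \<in> {..<r}"
    hence "reach k \<le> H" using reach_H[of k] by simp
    from real_eq_sum_thresholds[OF this]
    show "(\<Sum>\<theta><H. exp (- near \<theta> k) - miss_prob) + miss_prob * real (3 * reach k)
      = (\<Sum>\<theta><H. exp (- near \<theta> k) - miss_prob) + 3 * miss_prob * (\<Sum>\<theta><H. of_bool (\<theta> < reach k))" by simp
  qed
  also have "\<dots> = (\<Sum>\<theta><H. (\<Sum>k<r. exp (- near \<theta> k) - miss_prob) + 3 * miss_prob *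
      (\<Sum>k<r. of_bool (\<theta> < reach k)))"
    unfolding sum.distrib sum_distrib_left by (subst (1 2) sum.swap) simp
  also have "\<dots> \<le> (\<Sum>\<theta><H. (\<Sum>t\<in>Q. of_bool (\<theta> < \<delta> t)) / real L)"
    unfolding threshold_complement[symmetric] by (rule sum_mono[OF threshold_bound])
  also have "\<dots> = (\<Sum>t\<in>Q. \<Sum>\<theta><H. of_bool (\<theta> < \<delta> t)) / real L"
    unfolding sum_divide_distrib[symmetric] by (subst sum.swap) simp
  also have "\<dots> = (\<Sum>t\<in>Q. real (\<delta> t)) / real L"
    by (intro arg_cong2[where f = "(/)"] sum.cong refl) (use real_eq_sum_thresholds[OF dist_H] in simp)
  finally show ?thesis .
qed

definition missed :: "nat \<Rightarrow> nat \<Rightarrow> (nat \<Rightarrow> nat) \<Rightarrow> bool" where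
  "missed k \<theta> \<omega> \<longleftrightarrow> (\<forall>t \<in> {t \<in> S k. \<delta> t \<le> \<theta>}. \<omega> (slot t) \<noteq> val t)"

lemma prob_missed_le: "k < r \<Longrightarrow> measure_pmf.prob (draws J L) {\<omega>. missed k \<theta> \<omega>} \<le> exp (- near \<theta> k)"
proof -
  assume k_less: "k < r"
  have "measure_pmf.prob (draws J L) {\<omega>. missed k \<theta> \<omega>}
      \<le> exp (- real (card {t \<in> S k. \<delta> t \<le> \<theta>}) / real L)"
    unfolding missed_def
  proof (rule prob_draws_miss[OF L_pos])
    show "finite {t \<in> S k. \<delta> t \<le> \<theta>}" using finite_S[OF k_less] by simp
    show "\<And>t. t \<in> {t \<in> S k. \<delta> t \<le> \<theta>} \<Longrightarrow> slot t < J \<and> val t < L"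
      using S_props[OF k_less] slot_val_less by blast
    show "inj_on (\<lambda>t. (slot t, val t)) {t \<in> S k. \<delta> t \<le> \<theta>}"
      by (rule inj_on_subset[OF inj_slot_val]) (use S_props[OF k_less] in auto)
  qed
  thus ?thesis by (simp add: near_def)
qed

lemma assignment_within_thresholds:
  assumes "\<omega> \<in> set_pmf (draws J L)"
  obtains a where "inj_on a {..<r}"
    "\<And>k. k < r \<Longrightarrow> \<omega> (slot (a k)) = val (a k) \<and> a k \<in> P \<union> (\<Union>k<r. C k)"
    "(\<Sum>k<r. real (\<delta> (a k))) \<le> (\<Sum>k<r. \<Sum>\<theta><3 * reach k. of_bool (missed k \<theta> \<omega>))"
proof -
  define Op where "Op = {t \<in> P \<union> (\<Union>k<r. C k). \<omega> (slot t) = val t}"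
  obtain a where a_inj: "inj_on a {..<r}" "\<And>k. k < r \<Longrightarrow> a k \<in> Op"
    "\<And>k \<theta>. k < r \<Longrightarrow> \<theta> < \<delta> (a k) \<Longrightarrow> \<theta> < 3 * reach k \<and> (\<forall>t\<in>S k. \<delta> t \<le> \<theta> \<longrightarrow> t \<notin> Op)"
  proof (rule demand_assignment[of r P C S \<delta> "\<lambda>k. 3 * reach k" Op])
    show "C k \<inter> Op \<noteq> {}" if "k < r" for k using cluster_open[OF that assms] that by (auto simp: Op_def)
  qed (use S_props finite_S S_disjoint clusters_disjoint cluster_near in auto)
  have "real (\<delta> (a k)) \<le> (\<Sum>\<theta><3 * reach k. of_bool (missed k \<theta> \<omega>))" if k_less: "k < r" for k
  proof -
    have "\<delta> (a k) \<le> 3 * reach k" using a_inj(3)[OF k_less, of "3 * reach k"]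
      by (meson not_le less_irrefl)
    hence "real (\<delta> (a k)) = (\<Sum>\<theta><3 * reach k. of_bool (\<theta> < \<delta> (a k)))" by (rule real_eq_sum_thresholds)
    also have "\<dots> \<le> (\<Sum>\<theta><3 * reach k. of_bool (missed k \<theta> \<omega>))"
    proof (rule sum_mono)
      fix \<theta>
      have "missed k \<theta> \<omega>" if "\<theta> < \<delta> (a k)"
        using a_inj(3)[OF k_less that] S_props[OF k_less] by (auto simp: missed_def Op_def)
      thus "of_bool (\<theta> < \<delta> (a k)) \<le> (of_bool (missed k \<theta> \<omega>) :: real)" by simp
    qed
    finally show ?thesis .
  qed
  hence "(\<Sum>k<r. real (\<delta> (a k))) \<le> (\<Sum>k<r. \<Sum>\<theta><3 * reach k. of_bool (missed k \<theta> \<omega>))"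
    by (intro sum_mono) simp
  with a_inj(1,2) show ?thesis by (intro that[of a]) (auto simp: Op_def)
qed

end

context client_demands
begin

lemma split_demands_exists: "\<exists>S. split_demands M N L r J P slot val \<delta> C reach S"
proof -
  have "P \<inter> C k \<subseteq> P \<and> card (P \<inter> C k) \<le> N" if "k < r" for k
    using card_mono[of "C k" "P \<inter> C k"] clusters[OF that] L_le_N by auto
  moreover have "disjoint_family_on (\<lambda>k. P \<inter> C k) {..<r}"
    using clusters_disjoint by (fastforce simp: disjoint_family_on_def)
  ultimately obtain S where "\<And>k. k < r \<Longrightarrow> P \<inter> C k \<subseteq> S k \<and> S k \<subseteq> P \<and> card (S k) = N"
    "disjoint_family_on S {..<r}"
    using extend_disjoint_family[of P r "\<lambda>k. P \<inter> C k" N] finite_pool pool_large by blast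
  hence "split_demands M N L r J P slot val \<delta> C reach S" by unfold_locales blast+
  thus ?thesis by blast
qed

lemma client_expected_cost:
  fixes conn :: "(nat \<Rightarrow> nat) \<Rightarrow> nat"
  assumes conn: "\<And>\<omega> a. \<omega> \<in> set_pmf (draws J L) \<Longrightarrow> inj_on a {..<r} \<Longrightarrow>
      (\<And>k. k < r \<Longrightarrow> \<omega> (slot (a k)) = val (a k) \<and> a k \<in> P \<union> (\<Union>k<r. C k)) \<Longrightarrow>
      conn \<omega> \<le> (\<Sum>k<r. \<delta> (a k))"
  shows "measure_pmf.expectation (draws J L) (\<lambda>\<omega>. real (conn \<omega>)) \<le> (\<Sum>t\<in>P. real (\<delta> t)) / real L"
proof -
  obtain S where "split_demands M N L r J P slot val \<delta> C reach S"
    using split_demands_exists by blast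
  then interpret split_demands M N L r J P slot val \<delta> C reach S .
  have "real (conn \<omega>) \<le> (\<Sum>k<r. \<Sum>\<theta><3 * reach k. of_bool (missed k \<theta> \<omega>))"
    if \<omega>_mem: "\<omega> \<in> set_pmf (draws J L)" for \<omega>
  proof -
    obtain a where a_assigns: "inj_on a {..<r}"
      "\<And>k. k < r \<Longrightarrow> \<omega> (slot (a k)) = val (a k) \<and> a k \<in> P \<union> (\<Union>k<r. C k)"
      "(\<Sum>k<r. real (\<delta> (a k))) \<le> (\<Sum>k<r. \<Sum>\<theta><3 * reach k. of_bool (missed k \<theta> \<omega>))"
      using assignment_within_thresholds[OF \<omega>_mem] by blast
    from conn[OF \<omega>_mem a_assigns(1,2)] have "real (conn \<omega>) \<le> (\<Sum>k<r. real (\<delta> (a k)))"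
      by (simp flip: of_nat_sum)
    with a_assigns(3) show ?thesis by linarith
  qed
  hence "measure_pmf.expectation (draws J L) (\<lambda>\<omega>. real (conn \<omega>))
      \<le> measure_pmf.expectation (draws J L) (\<lambda>\<omega>. \<Sum>k<r. \<Sum>\<theta><3 * reach k. of_bool (missed k \<theta> \<omega>))"
    by (rule expectation_mono_finite[OF finite_set_draws])
  also have "\<dots> = (\<Sum>k<r. \<Sum>\<theta><3 * reach k. measure_pmf.prob (draws J L) {\<omega>. missed k \<theta> \<omega>})"
    unfolding expectation_sum_finite[OF finite_set_draws] expectation_of_bool ..
  also have "\<dots> \<le> (\<Sum>k<r. \<Sum>\<theta><3 * reach k. exp (- near \<theta> k))"
    by (intro sum_mono prob_missed_le) simp
  also have "\<dots> \<le> (\<Sum>t\<in>Q. real (\<delta> t)) / real L" by (rule exp_near_bound)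
  also have "\<dots> \<le> (\<Sum>t\<in>P. real (\<delta> t)) / real L"
    using Q_sub finite_pool by (intro divide_right_mono sum_mono2) auto
  finally show ?thesis .
qed

end


section \<open>Multiplicative weights on stars\<close>

lemma exp_le_one_minus:
  assumes "0 \<le> x" "x \<le> 1 / (1000::real)"
  shows "exp (- (1002 / 1000 * x)) \<le> 1 - x"
proof -
  have "0 < 1 - x" using assms by simp
  have "x * x \<le> x * (1 / 1000)" using assms by (intro mult_left_mono)
  hence "1 \<le> (1 + 1002 / 1000 * x) * (1 - x)" using assms by (simp add: algebra_simps)
  hence "1 / (1 - x) \<le> 1 + 1002 / 1000 * x" using \<open>0 < 1 - x\<close> by (simp add: field_simps)
  also have "\<dots> \<le> exp (1002 / 1000 * x)" by (rule exp_ge_add_one_self)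
  finally show ?thesis using \<open>0 < 1 - x\<close> by (simp add: exp_minus field_simps)
qed

text \<open>
  The metric enters only through the four-point inequality between two sites and two clients.
\<close>

locale scaled_ftfp =
  fixes n m :: nat and F :: "nat \<Rightarrow> nat" and D :: "nat \<Rightarrow> nat \<Rightarrow> nat" and r :: "nat \<Rightarrow> nat"
  assumes r_pos: "j < n \<Longrightarrow> 0 < r j"
    and four_point: "i < m \<Longrightarrow> i' < m \<Longrightarrow> j < n \<Longrightarrow> j' < n \<Longrightarrow> D i j \<le> D i j' + D i' j' + D i' j"
    and sites_nonempty: "0 < n \<Longrightarrow> 0 < m"
begin

definition granularity :: nat where "granularity = 1000000 * (n + 1)"
definition atoms_per_unit :: nat where "atoms_per_unit = 19 * granularity"
definition cluster_size :: nat where "cluster_size = 11 * granularity"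
definition demand_prod :: nat where "demand_prod = (\<Prod>j<n. r j)"

lemma granularity_pos: "0 < granularity"
  and atoms_per_unit_pos: "0 < atoms_per_unit"
  and cluster_size_pos: "0 < cluster_size"
  by (simp_all add: granularity_def atoms_per_unit_def cluster_size_def)

lemma demand_prod_pos: "0 < demand_prod"
  unfolding demand_prod_def using r_pos by (intro prod_pos) auto

lemma demand_prod_div: "j < n \<Longrightarrow> demand_prod div r j * r j = demand_prod"
  unfolding demand_prod_def by (rule dvd_div_mult_self) (auto intro!: dvd_prodI)

lemma demand_prod_div_pos: "j < n \<Longrightarrow> 0 < demand_prod div r j"
  using demand_prod_div[of j] demand_prod_pos by (cases "demand_prod div r j") auto

lemma real_demand_prod_div: "j < n \<Longrightarrow> real (demand_prod div r j) = real demand_prod / real (r j)"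
  using demand_prod_div[of j] r_pos[of j] by (metis div_mult_self_is_m dvd_triv_right real_of_nat_div)

text \<open>\<open>H j\<close> is the amount bought so far in units of \<open>1 / atoms_per_unit\<close> for client \<open>j\<close>, \<open>W j\<close> its weight.\<close>

definition active :: "(nat \<Rightarrow> nat) \<Rightarrow> nat set" where
  "active H = {j. j < n \<and> H j < atoms_per_unit * r j}"

definition star :: "(nat \<Rightarrow> nat) \<Rightarrow> (nat \<Rightarrow> nat) \<Rightarrow> nat \<Rightarrow> nat \<Rightarrow> nat set" where
  "star W H i l = {j \<in> active H. D i j * W l \<le> D i l * W j}"

definition star_cost :: "nat \<Rightarrow> nat set \<Rightarrow> nat" where
  "star_cost i S = F i + (\<Sum>j\<in>S. D i j)"

definition star_ratio :: "(nat \<Rightarrow> nat) \<Rightarrow> (nat \<Rightarrow> nat) \<Rightarrow> nat \<times> nat \<Rightarrow> real" where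
  "star_ratio W H = (\<lambda>(i, l). real (star_cost i (star W H i l)) / real (sum W (star W H i l)))"

definition best_star :: "(nat \<Rightarrow> nat) \<Rightarrow> (nat \<Rightarrow> nat) \<Rightarrow> nat \<Rightarrow> nat \<Rightarrow> bool" where
  "best_star W H i l \<longleftrightarrow> is_arg_min (star_ratio W H) (\<lambda>s. s \<in> {..<m} \<times> active H) (i, l)"

definition dual_bound :: "real \<Rightarrow> bool" where
  "dual_bound Z \<longleftrightarrow> (\<forall>\<alpha>. (\<forall>j<n. 0 \<le> \<alpha> j) \<longrightarrow>
     (\<forall>i<m. (\<Sum>j<n. max 0 (\<alpha> j - real (D i j))) \<le> real (F i)) \<longrightarrow>
     (\<Sum>j<n. real (r j) * \<alpha> j) \<le> Z)"

lemma finite_active [simp]: "finite (active H)"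
  by (simp add: active_def)

lemma finite_star [simp]: "finite (star W H i l)"
  by (simp add: star_def)

lemma star_self: "l \<in> active H \<Longrightarrow> l \<in> star W H i l"
  by (simp add: star_def)

lemma star_subset: "star W H i l \<subseteq> active H" "star W H i l \<subseteq> {..<n}"
  by (auto simp: star_def active_def)

lemma active_cong: "(\<And>j. j < n \<Longrightarrow> H j = H' j) \<Longrightarrow> active H = active H'"
  by (auto simp: active_def)

lemma star_weight_pos: "(\<And>j. j < n \<Longrightarrow> 0 < W j) \<Longrightarrow> l \<in> active H \<Longrightarrow> 0 < sum W (star W H i l)"
  using sum_pos2[of "star W H i l" l W] star_self[of l H W i] by (auto simp: active_def)

lemma best_starD:
  assumes "best_star W H i l"
  shows "i < m" "l \<in> active H"
    and "i' < m \<Longrightarrow> l' \<in> active H \<Longrightarrow> star_ratio W H (i, l) \<le> star_ratio W H (i', l')"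
  using assms by (auto simp: best_star_def is_arg_min_linorder)

lemma mem_star_iff_ratio_le:
  assumes W_pos: "\<And>j. j < n \<Longrightarrow> 0 < W j" and "j \<in> active H" "l \<in> active H"
  shows "j \<in> star W H i l \<longleftrightarrow> real (D i j) / real (W j) \<le> real (D i l) / real (W l)"
proof -
  have "j \<in> star W H i l \<longleftrightarrow> real (D i j) * real (W l) \<le> real (D i l) * real (W j)"
    using assms(2) by (simp add: star_def flip: of_nat_mult)
  moreover have "0 < W j" "0 < W l" using assms by (auto simp: active_def)
  ultimately show ?thesis by (simp add: field_simps)
qed

lemma positive_slack_is_star:
  fixes lam :: real and i :: nat and H :: "nat \<Rightarrow> nat"
  assumes W_pos: "\<And>j. j < n \<Longrightarrow> 0 < W j"
  defines "T \<equiv> {j \<in> active H. real (D i j) < lam * real (W j)}"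
  assumes "T \<noteq> {}"
  obtains l where "l \<in> active H" "star W H i l = T"
proof -
  let ?ratio = "\<lambda>j. real (D i j) / real (W j)"
  have "finite T" by (simp add: T_def)
  then obtain l where l_max: "l \<in> T" "\<And>j. j \<in> T \<Longrightarrow> ?ratio j \<le> ?ratio l"
    using ex_is_arg_min_if_finite[of T "\<lambda>j. - ?ratio j"] \<open>T \<noteq> {}\<close> by (auto simp: is_arg_min_linorder)
  have l_active: "l \<in> active H" using l_max by (simp add: T_def)
  have pos: "0 < W j" if "j \<in> active H" for j using W_pos that by (simp add: active_def)
  have mem_T: "j \<in> T \<longleftrightarrow> ?ratio j < lam" if "j \<in> active H" for j
    using pos[OF that] that by (auto simp: T_def field_simps)
  have "j \<in> star W H i l \<longleftrightarrow> j \<in> T" for j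
  proof (cases "j \<in> active H")
    case True
    have "j \<in> star W H i l \<longleftrightarrow> ?ratio j \<le> ?ratio l"
      by (rule mem_star_iff_ratio_le[OF W_pos True l_active])
    also have "\<dots> \<longleftrightarrow> j \<in> T" using mem_T[OF True] mem_T[OF l_active] l_max by force
    finally show ?thesis .
  qed (auto simp: star_def T_def)
  thus ?thesis using that[OF l_active] by blast
qed

lemma slack_sum_le_open_cost:
  assumes W_pos: "\<And>j. j < n \<Longrightarrow> 0 < W j"
    and ratio: "\<And>l. l \<in> active H \<Longrightarrow> lam \<le> star_ratio W H (i, l)"
  shows "(\<Sum>j \<in> {j \<in> active H. real (D i j) < lam * real (W j)}. lam * real (W j) - real (D i j))
      \<le> real (F i)"
    (is "(\<Sum>j\<in>?T. _) \<le> _")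
proof (cases "?T = {}")
  case True
  show ?thesis unfolding True by simp
next
  case False
  obtain l where l_star: "l \<in> active H" "star W H i l = ?T"
    by (rule positive_slack_is_star[OF W_pos False])
  have "0 < sum W ?T" using star_weight_pos[of W l H i] W_pos l_star by simp
  with ratio[OF l_star(1)] have "lam * real (sum W ?T) \<le> real (star_cost i ?T)"
    by (simp add: star_ratio_def l_star(2) pos_le_divide_eq del: of_nat_sum)
  thus ?thesis by (simp add: star_cost_def sum_subtractf sum_distrib_left)
qed

lemma best_star_dual:
  assumes Z_dual: "dual_bound Z" and best: "best_star W H i l" and W_pos: "\<And>j. j < n \<Longrightarrow> 0 < W j"
  shows "real (star_cost i (star W H i l)) * (\<Sum>j\<in>active H. real (r j) * real (W j))
    \<le> Z * real (sum W (star W H i l))"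
proof -
  define lam where "lam = star_ratio W H (i, l)"
  define \<alpha> where "\<alpha> j = (if j \<in> active H then lam * real (W j) else 0)" for j
  have "0 \<le> lam" by (simp add: lam_def star_ratio_def del: of_nat_sum)
  have "(\<Sum>j<n. real (r j) * \<alpha> j) \<le> Z"
  proof (rule Z_dual[unfolded dual_bound_def, rule_format])
    show "0 \<le> \<alpha> j" for j using \<open>0 \<le> lam\<close> by (simp add: \<alpha>_def)
    fix i' assume "i' < m"
    have "(\<Sum>j<n. max 0 (\<alpha> j - real (D i' j)))
        = (\<Sum>j \<in> {j \<in> active H. real (D i' j) < lam * real (W j)}. lam * real (W j) - real (D i' j))"
      by (rule sum.mono_neutral_cong_right) (auto simp: \<alpha>_def active_def max_def)
    also have "\<dots> \<le> real (F i')"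
      by (rule slack_sum_le_open_cost[OF W_pos])
        (use best_starD(3)[OF best \<open>i' < m\<close>] in \<open>simp_all add: lam_def\<close>)
    finally show "(\<Sum>j<n. max 0 (\<alpha> j - real (D i' j))) \<le> real (F i')" .
  qed
  moreover have "(\<Sum>j<n. real (r j) * \<alpha> j) = (\<Sum>j\<in>active H. real (r j) * (lam * real (W j)))"
    by (rule sum.mono_neutral_cong_right) (auto simp: \<alpha>_def active_def)
  ultimately have "lam * (\<Sum>j\<in>active H. real (r j) * real (W j)) \<le> Z"
    by (simp add: sum_distrib_left ac_simps)
  moreover have "0 < sum W (star W H i l)" using star_weight_pos[OF W_pos best_starD(2)[OF best]] .
  ultimately show ?thesis by (simp add: lam_def star_ratio_def field_simps del: of_nat_sum)
qed

definition star_amount :: "nat set \<Rightarrow> nat" where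
  "star_amount S = Min (r ` S)"

definition upd_W :: "nat set \<Rightarrow> nat \<Rightarrow> (nat \<Rightarrow> nat) \<Rightarrow> nat \<Rightarrow> nat" where
  "upd_W S a W j = (if j \<in> S then W j * (1000 * demand_prod - demand_prod div r j * a)
     else W j * (1000 * demand_prod))"

definition upd_H :: "nat set \<Rightarrow> nat \<Rightarrow> (nat \<Rightarrow> nat) \<Rightarrow> nat \<Rightarrow> nat" where
  "upd_H S a H j = (if j \<in> S then H j + a else H j)"

text \<open>Integral weights keep growing; \<open>s\<close> is the scale that turns them into the weights of the analysis.\<close>

definition mass :: "real \<Rightarrow> (nat \<Rightarrow> nat) \<Rightarrow> nat \<Rightarrow> real" where
  "mass s W j = real (r j) * real (W j) / s"

definition potential :: "real \<Rightarrow> (nat \<Rightarrow> nat) \<Rightarrow> (nat \<Rightarrow> nat) \<Rightarrow> real" where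
  "potential s W H = (\<Sum>j\<in>active H. mass s W j)"

definition covers_mass :: "real \<Rightarrow> (nat \<Rightarrow> nat) \<Rightarrow> (nat \<Rightarrow> nat) \<Rightarrow> bool" where
  "covers_mass s W H \<longleftrightarrow> (\<forall>j<n. exp (- (1002 / 1000000 * real (H j) / real (r j))) \<le> mass s W j)"

definition cost_limit :: "real \<Rightarrow> real" where
  "cost_limit Z = Z * (1000 * real n + real atoms_per_unit * (1002 / 1000) + 1)"

definition progress :: "(nat \<Rightarrow> nat) \<Rightarrow> nat" where
  "progress H = (\<Sum>j<n. min atoms_per_unit (H j div r j))"

definition mwu_inv :: "real \<Rightarrow> nat \<Rightarrow> (nat \<Rightarrow> nat) \<Rightarrow> (nat \<Rightarrow> nat) \<Rightarrow> nat \<Rightarrow> bool" where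
  "mwu_inv Z k W H c \<longleftrightarrow>
     (\<exists>s > 0. covers_mass s W H \<and> (0 < Z \<longrightarrow> potential s W H \<le> exp (real n - real c / (1000 * Z)))) \<and>
     real c \<le> cost_limit Z \<and> (active H = {} \<or> k \<le> progress H)"

lemma mwu_inv_cong:
  assumes "\<And>j. j < n \<Longrightarrow> W j = W' j" "\<And>j. j < n \<Longrightarrow> H j = H' j"
  shows "mwu_inv Z k W H c \<longleftrightarrow> mwu_inv Z k W' H' c"
proof -
  have active: "active H = active H'" by (rule active_cong) (rule assms(2))
  have mass: "mass s W j = mass s W' j" if "j < n" for s j
    using assms(1)[OF that] by (simp add: mass_def)
  hence "covers_mass s W H \<longleftrightarrow> covers_mass s W' H'" for s
    using assms(2) by (simp add: covers_mass_def)
  moreover have "potential s W H = potential s W' H'" for s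
    unfolding potential_def active by (intro sum.cong refl mass) (simp add: active_def)
  moreover have "progress H = progress H'"
    unfolding progress_def by (intro sum.cong refl) (simp add: assms(2))
  ultimately show ?thesis unfolding mwu_inv_def active by simp
qed

lemma mwu_inv_init:
  assumes "0 \<le> Z" "\<And>j. j < n \<Longrightarrow> W j = demand_prod div r j" "\<And>j. j < n \<Longrightarrow> H j = 0"
  shows "mwu_inv Z 0 W H 0"
proof -
  let ?s = "real demand_prod"
  have mass: "mass ?s W j = 1" if "j < n" for j
    using assms(2)[OF that] real_demand_prod_div[OF that] r_pos[OF that] demand_prod_pos
    by (simp add: mass_def)
  have "potential ?s W H = real (card (active H))"
    unfolding potential_def using mass by (simp add: active_def)
  also have "card (active H) \<le> card {..<n}" by (rule card_mono) (auto simp: active_def)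
  also have "real (card {..<n}) \<le> exp (real n)"
    using exp_ge_add_one_self[of "real n"] unfolding card_lessThan by linarith
  finally have "potential ?s W H \<le> exp (real n)" by simp
  moreover have "covers_mass ?s W H" using mass assms(3) by (simp add: covers_mass_def)
  ultimately show ?thesis unfolding mwu_inv_def using assms(1) demand_prod_pos
    by (intro conjI exI[of _ ?s]) (auto simp: cost_limit_def)
qed

lemma mwu_inv_skip:
  "mwu_inv Z k W H c \<Longrightarrow> active H = {} \<Longrightarrow> mwu_inv Z (Suc k) W H c"
  unfolding mwu_inv_def by blast

lemma star_amount_le: "finite S \<Longrightarrow> j \<in> S \<Longrightarrow> star_amount S \<le> r j"
  by (simp add: star_amount_def)

lemma upd_W_pos:
  assumes "\<And>j. j < n \<Longrightarrow> 0 < W j" "\<And>j. j \<in> S \<Longrightarrow> a \<le> r j" "j < n"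
  shows "0 < upd_W S a W j"
proof -
  have "demand_prod div r j * a < 1000 * demand_prod" if "j \<in> S"
  proof -
    have "demand_prod div r j * a \<le> demand_prod div r j * r j" using assms(2)[OF that] by simp
    also have "\<dots> = demand_prod" by (rule demand_prod_div[OF assms(3)])
    finally show ?thesis using demand_prod_pos by linarith
  qed
  thus ?thesis using assms(1)[OF assms(3)] demand_prod_pos by (simp add: upd_W_def)
qed

context
  fixes Z s :: real and W H :: "nat \<Rightarrow> nat" and i l :: nat
  assumes Z_dual: "0 \<le> Z" "dual_bound Z" and best: "best_star W H i l"
    and W_pos: "\<And>j. j < n \<Longrightarrow> 0 < W j" and s_pos: "0 < s"
begin

abbreviation "chosen \<equiv> star W H i l"
abbreviation "amount \<equiv> star_amount chosen"

definition shrink :: "nat \<Rightarrow> real" where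
  "shrink j = (if j \<in> chosen then real amount / (1000 * real (r j)) else 0)"

lemma l_active: "l \<in> active H" and l_less: "l < n" and l_in_star: "l \<in> chosen"
  using best_starD[OF best] star_self by (auto simp: active_def)

lemma in_star_less: "j \<in> chosen \<Longrightarrow> j < n"
  using star_subset by blast

lemma shrink_bounds: "j < n \<Longrightarrow> 0 \<le> shrink j" "j < n \<Longrightarrow> shrink j \<le> 1 / 1000"
  using star_amount_le[OF finite_star, of j W H i l] r_pos[of j] by (auto simp: shrink_def field_simps)

lemma mass_pos: "j < n \<Longrightarrow> 0 < mass s W j"
  using W_pos r_pos s_pos by (simp add: mass_def)

lemma mass_upd: "j < n \<Longrightarrow> mass (s * (1000 * real demand_prod)) (upd_W chosen amount W) j
    = mass s W j * (1 - shrink j)"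
proof -
  assume j_less: "j < n"
  have "real (upd_W chosen amount W j) = real (W j) * (1000 * real demand_prod * (1 - shrink j))"
  proof (cases "j \<in> chosen")
    case True
    have "demand_prod div r j * amount \<le> demand_prod div r j * r j" using star_amount_le True by simp
    hence "demand_prod div r j * amount \<le> 1000 * demand_prod"
      using demand_prod_div[OF j_less] by linarith
    hence "real (1000 * demand_prod - demand_prod div r j * amount) = 1000 * real demand_prod *
        (1 - shrink j)"
      using real_demand_prod_div[OF j_less] True r_pos[OF j_less]
      by (simp add: of_nat_diff shrink_def field_simps)
    thus ?thesis using True by (simp only: upd_W_def if_True of_nat_mult)
  qed (simp add: upd_W_def shrink_def)
  thus ?thesis using demand_prod_pos s_pos by (simp add: mass_def)
qed

lemma covers_mass_step:
  assumes "covers_mass s W H"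
  shows "covers_mass (s * (1000 * real demand_prod)) (upd_W chosen amount W) (upd_H chosen amount H)"
  unfolding covers_mass_def
proof (intro allI impI)
  fix j assume j_less: "j < n"
  have "real (upd_H chosen amount H j) = real (H j) + 1000 * shrink j * real (r j)"
    using r_pos[OF j_less] by (simp add: upd_H_def shrink_def)
  hence "exp (- (1002 / 1000000 * real (upd_H chosen amount H j) / real (r j)))
      = exp (- (1002 / 1000000 * real (H j) / real (r j))) * exp (- (1002 / 1000 * shrink j))"
    using r_pos[OF j_less] by (simp add: exp_add[symmetric] field_simps)
  also have "\<dots> \<le> mass s W j * (1 - shrink j)"
    using assms j_less exp_le_one_minus[OF shrink_bounds[OF j_less]] mass_pos[OF j_less]
    by (intro mult_mono) (auto simp: covers_mass_def)
  finally show "exp (- (1002 / 1000000 * real (upd_H chosen amount H j) / real (r j)))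
      \<le> mass (s * (1000 * real demand_prod)) (upd_W chosen amount W) j"
    by (simp add: mass_upd[OF j_less])
qed

lemma potential_pos: "0 < potential s W H"
  unfolding potential_def using mass_pos l_active l_less
  by (intro sum_pos2[of _ l]) (auto simp: active_def less_imp_le)

lemma star_cost_potential_le: "real (star_cost i chosen) * potential s W H
    \<le> Z * (real (sum W chosen) / s)"
proof -
  have "real (star_cost i chosen) * (\<Sum>j\<in>active H. real (r j) * real (W j)) / s
      \<le> Z * real (sum W chosen) / s"
    using best_star_dual[OF Z_dual(2) best W_pos] s_pos by (intro divide_right_mono) auto
  thus ?thesis by (simp add: potential_def mass_def sum_divide_distrib[symmetric])
qed

lemma sum_mass_shrink: "(\<Sum>j\<in>active H. mass s W j * shrink j)
    = real amount * (real (sum W chosen) / s) / 1000"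
proof -
  have "(\<Sum>j\<in>active H. mass s W j * shrink j) = (\<Sum>j\<in>chosen. mass s W j * shrink j)"
    by (rule sum.mono_neutral_right) (use star_subset in \<open>auto simp: shrink_def\<close>)
  also have "\<dots> = (\<Sum>j\<in>chosen. real amount * (real (W j) / s) / 1000)"
    by (intro sum.cong refl) (use r_pos in_star_less in \<open>force simp: shrink_def mass_def\<close>)
  finally show ?thesis by (simp add: sum_distrib_left sum_divide_distrib)
qed

lemma amount_weight_le_potential: "real amount * (real (sum W chosen) / s) \<le> potential s W H"
proof -
  have "real amount * (real (sum W chosen) / s) = (\<Sum>j\<in>chosen. real amount * (real (W j) / s))"
    by (simp add: sum_distrib_left sum_divide_distrib)
  also have "\<dots> \<le> (\<Sum>j\<in>chosen. mass s W j)"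
    by (rule sum_mono) (use star_amount_le s_pos in \<open>auto simp: mass_def intro!: divide_right_mono
      mult_right_mono\<close>)
  also have "\<dots> \<le> potential s W H" unfolding potential_def
    by (rule sum_mono2) (use star_subset mass_pos in \<open>auto simp: active_def less_imp_le\<close>)
  finally show ?thesis .
qed

lemma round_cost_le: "real (star_cost i chosen) * real amount \<le> Z"
proof -
  have "real (star_cost i chosen) * real amount * potential s W H
      = real (star_cost i chosen) * potential s W H * real amount" by simp
  also have "\<dots> \<le> Z * (real (sum W chosen) / s) * real amount"
    using star_cost_potential_le by (rule mult_right_mono) simp
  also have "\<dots> = Z * (real amount * (real (sum W chosen) / s))" by simp
  also have "\<dots> \<le> Z * potential s W H"
    using amount_weight_le_potential Z_dual(1) by (rule mult_left_mono)
  finally show ?thesis using potential_pos by simp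
qed

lemma active_upd_H: "active (upd_H chosen amount H) \<subseteq> active H"
  by (auto simp: active_def upd_H_def split: if_splits)

lemma potential_step_le:
  assumes "0 < Z"
  shows "potential (s * (1000 * real demand_prod)) (upd_W chosen amount W) (upd_H chosen amount H)
    \<le> potential s W H * exp (- (real (star_cost i chosen) * real amount / (1000 * Z)))"
proof -
  let ?w = "real amount * (real (sum W chosen) / s)" and ?c = "real (star_cost i chosen) * real amount"
  have "potential (s * (1000 * real demand_prod)) (upd_W chosen amount W) (upd_H chosen amount H)
      = (\<Sum>j\<in>active (upd_H chosen amount H). mass s W j * (1 - shrink j))"
    unfolding potential_def by (intro sum.cong refl mass_upd) (simp add: active_def)
  also have "\<dots> \<le> (\<Sum>j\<in>active H. mass s W j * (1 - shrink j))"
  proof (rule sum_mono2[OF finite_active active_upd_H])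
    fix j assume "j \<in> active H - active (upd_H chosen amount H)"
    hence "j < n" by (simp add: active_def)
    from mass_pos[OF this] shrink_bounds[OF this] show "0 \<le> mass s W j * (1 - shrink j)" by simp
  qed
  also have "\<dots> = potential s W H - ?w / 1000"
    unfolding sum_mass_shrink[symmetric] potential_def by (simp add: right_diff_distrib sum_subtractf)
  also have "\<dots> \<le> potential s W H * (1 - ?c / (1000 * Z))"
    using mult_right_mono[OF star_cost_potential_le, of "real amount"] assms by (simp add: field_simps)
  also have "\<dots> \<le> potential s W H * exp (- (?c / (1000 * Z)))"
    using exp_ge_add_one_self[of "- (?c / (1000 * Z))"] potential_pos by (intro mult_left_mono) auto
  finally show ?thesis .
qed

lemma cost_limit_step:
  assumes covers: "covers_mass s W H"
    and potential_le: "0 < Z \<Longrightarrow> potential s W H \<le> exp (real n - real c / (1000 * Z))"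
      and c_le: "real c \<le> cost_limit Z"
  shows "real (c + star_cost i chosen * amount) \<le> cost_limit Z"
proof (cases "Z = 0")
  case True
  thus ?thesis using c_le round_cost_le by (simp add: cost_limit_def)
next
  case False
  hence "0 < Z" using Z_dual(1) by simp
  have "real (H l) \<le> real (atoms_per_unit * r l)"
    using l_active by (simp add: active_def del: of_nat_mult)
  hence "real (H l) / real (r l) \<le> real atoms_per_unit"
    using r_pos[OF l_less] by (simp add: field_simps)
  hence "exp (- (1002 / 1000000 * real atoms_per_unit))
      \<le> exp (- (1002 / 1000000 * real (H l) / real (r l)))"
    by simp
  also have "\<dots> \<le> mass s W l" using covers l_less by (simp add: covers_mass_def)
  also have "\<dots> \<le> potential s W H" unfolding potential_def
    by (rule member_le_sum) (use l_active mass_pos in \<open>auto simp: active_def less_imp_le\<close>)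
  also have "\<dots> \<le> exp (real n - real c / (1000 * Z))" by (rule potential_le[OF \<open>0 < Z\<close>])
  finally have "real c / (1000 * Z) \<le> real n + 1002 / 1000000 * real atoms_per_unit" by simp
  hence "real c \<le> (real n + 1002 / 1000000 * real atoms_per_unit) * (1000 * Z)"
    using \<open>0 < Z\<close> by (simp add: field_simps)
  thus ?thesis using round_cost_le by (simp add: cost_limit_def algebra_simps)
qed

lemma progress_step: "Suc (progress H) \<le> progress (upd_H chosen amount H)"
proof -
  have "amount \<in> r ` chosen" unfolding star_amount_def using l_in_star by (intro Min_in) auto
  then obtain j where j_chosen: "j \<in> chosen" "r j = amount" by auto
  have "j < n" using in_star_less j_chosen by simp
  have "j \<in> active H" using star_subset(1) j_chosen(1) by blast
  hence "H j < atoms_per_unit * r j" by (simp add: active_def)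
  hence "H j div r j < atoms_per_unit" using r_pos[OF \<open>j < n\<close>] by (simp add: less_mult_imp_div_less)
  moreover have "upd_H chosen amount H j div r j = Suc (H j div r j)"
    using j_chosen r_pos[OF \<open>j < n\<close>] by (simp add: upd_H_def)
  ultimately have "\<exists>j\<in>{..<n}. min atoms_per_unit (H j div r j) < min atoms_per_unit
      (upd_H chosen amount H j div r j)"
    using \<open>j < n\<close> by (intro bexI[of _ j]) auto
  moreover have "min atoms_per_unit (H j div r j) \<le> min atoms_per_unit
      (upd_H chosen amount H j div r j)" for j
    by (intro min.mono div_le_mono) (simp_all add: upd_H_def)
  ultimately have "progress H < progress (upd_H chosen amount H)"
    unfolding progress_def by (intro sum_strict_mono_ex1) auto
  thus ?thesis by simp
qed

end

lemma mwu_inv_step: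
  fixes W H :: "nat \<Rightarrow> nat" and i l :: nat
  defines "S \<equiv> star W H i l"
  assumes Z_dual: "0 \<le> Z" "dual_bound Z" and inv: "mwu_inv Z k W H c" and best: "best_star W H i l"
    and W_pos: "\<And>j. j < n \<Longrightarrow> 0 < W j"
  shows "mwu_inv Z (Suc k) (upd_W S (star_amount S) W) (upd_H S (star_amount S) H)
      (c + star_cost i S * star_amount S)"
proof -
  obtain s where s_pos: "0 < s" and covers: "covers_mass s W H"
    and potential_le: "0 < Z \<Longrightarrow> potential s W H \<le> exp (real n - real c / (1000 * Z))"
    using inv unfolding mwu_inv_def by blast
  have "active H \<noteq> {}" using best_starD(2)[OF best] by blast
  hence k_le: "k \<le> progress H" and c_le: "real c \<le> cost_limit Z" using inv by (auto simp: mwu_inv_def)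
  note step = Z_dual best W_pos s_pos
  let ?s = "s * (1000 * real demand_prod)"
  let ?W = "upd_W S (star_amount S) W" and ?H = "upd_H S (star_amount S) H"
  have "potential ?s ?W ?H \<le> exp (real n - real (c + star_cost i S * star_amount S) / (1000 * Z))"
    if "0 < Z"
  proof -
    have "potential ?s ?W ?H
        \<le> potential s W H * exp (- (real (star_cost i S) * real (star_amount S) / (1000 * Z)))"
      unfolding S_def by (rule potential_step_le[OF step that])
    also have "\<dots> \<le> exp (real n - real c / (1000 * Z)) * exp
        (- (real (star_cost i S) * real (star_amount S) / (1000 * Z)))"
      by (rule mult_right_mono[OF potential_le[OF that]]) simp
    finally show ?thesis by (simp add: exp_add[symmetric] add_divide_distrib diff_diff_add)
  qed
  moreover have "covers_mass ?s ?W ?H" unfolding S_def by (rule covers_mass_step[OF step covers])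
  moreover have "0 < ?s" using s_pos demand_prod_pos by simp
  moreover have "real (c + star_cost i S * star_amount S) \<le> cost_limit Z"
    unfolding S_def by (rule cost_limit_step[OF step covers potential_le c_le])
  moreover have "Suc k \<le> progress ?H" using progress_step[OF step] k_le unfolding S_def by linarith
  ultimately show ?thesis unfolding mwu_inv_def by blast
qed

lemma mwu_inv_end:
  assumes "mwu_inv Z (n * atoms_per_unit) W H c"
  shows "active H = {}" and "real c \<le> cost_limit Z"
proof -
  show "real c \<le> cost_limit Z" using assms by (simp add: mwu_inv_def)
  show "active H = {}"
  proof (rule ccontr)
    assume nonempty: "active H \<noteq> {}"
    then obtain l where l_active: "l < n" "H l < atoms_per_unit * r l" by (auto simp: active_def)
    have "H l div r l < atoms_per_unit"
      using l_active r_pos[OF l_active(1)] by (simp add: less_mult_imp_div_less)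
    hence "progress H < (\<Sum>j<n. atoms_per_unit)" unfolding progress_def
      using l_active by (intro sum_strict_mono_ex1) (auto intro!: bexI[of _ l])
    thus False using assms nonempty by (simp add: mwu_inv_def)
  qed
qed

end


section \<open>Clustering of the atoms\<close>

lemma exists_dominating_member:
  fixes \<delta> :: "'a \<Rightarrow> nat"
  assumes "finite A" "Q \<subseteq> A" "0 < L" "L \<le> card Q"
  obtains t where "t \<in> Q" "L \<le> card {v \<in> A. \<delta> v \<le> \<delta> t}"
proof -
  have "finite Q" "Q \<noteq> {}" using assms finite_subset by auto
  hence "Max (\<delta> ` Q) \<in> \<delta> ` Q" by (intro Max_in) auto
  then obtain t where "t \<in> Q" "\<delta> t = Max (\<delta> ` Q)" by auto
  with \<open>finite Q\<close> have t_max: "t \<in> Q" "\<And>v. v \<in> Q \<Longrightarrow> \<delta> v \<le> \<delta> t" by auto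
  hence "card Q \<le> card {v \<in> A. \<delta> v \<le> \<delta> t}" using assms by (intro card_mono) auto
  thus ?thesis using that[OF t_max(1)] assms by simp
qed

locale atom_instance = scaled_ftfp +
  fixes T :: nat and site :: "nat \<Rightarrow> nat" and pool0 :: "nat \<Rightarrow> nat set" and residual :: "nat \<Rightarrow> nat"
  assumes pool0_sub: "j < n \<Longrightarrow> pool0 j \<subseteq> {..<T}"
    and site_less: "j < n \<Longrightarrow> t \<in> pool0 j \<Longrightarrow> site t < m"
    and pool0_large: "j < n \<Longrightarrow> atoms_per_unit * residual j \<le> card (pool0 j)"
begin

definition \<delta> :: "nat \<Rightarrow> nat \<Rightarrow> nat" where "\<delta> j t = D (site t) j"

text \<open>Label 0 means that an atom belongs to no cluster.\<close>

definition cluster :: "(nat \<Rightarrow> nat) \<Rightarrow> nat \<Rightarrow> nat set" where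
  "cluster label q = {t. t < T \<and> label t = q}"

definition crowded :: "(nat \<Rightarrow> nat set) \<Rightarrow> nat \<Rightarrow> nat \<Rightarrow> bool" where
  "crowded pool j d \<longleftrightarrow> cluster_size \<le> card {v \<in> pool j. \<delta> j v \<le> d}"

lemma finite_pool0: "j < n \<Longrightarrow> finite (pool0 j)"
  using pool0_sub[of j] finite_subset[of "pool0 j" "{..<T}"] by simp

lemma finite_cluster [simp]: "finite (cluster label q)"
  by (simp add: cluster_def)

end

text \<open>
  After \<open>s\<close> rounds, the clusters assigned to the first \<open>assigned j\<close> demands of client \<open>j\<close> have left
  the pool of \<open>j\<close>. The clusters are formed in the order of increasing radius, so no radius exceeds
  that of a cluster which could still be formed.
\<close>

locale clustering = atom_instance +
  fixes s :: nat and pool :: "nat \<Rightarrow> nat set" and label position assigned center radius :: "nat \<Rightarrow> nat"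
    and link reach :: "nat \<Rightarrow> nat \<Rightarrow> nat"
  assumes assigned_le: "j < n \<Longrightarrow> assigned j \<le> residual j"
    and label_le: "t < T \<Longrightarrow> label t \<le> s"
    and position_bij: "0 < q \<Longrightarrow> cluster label q \<noteq> {} \<Longrightarrow>
        bij_betw position (cluster label q) {..<cluster_size}"
    and center_less: "0 < q \<Longrightarrow> cluster label q \<noteq> {} \<Longrightarrow> center q < n"
    and near_center: "0 < q \<Longrightarrow> t \<in> cluster label q \<Longrightarrow> site t < m \<and> \<delta> (center q) t \<le> radius q"
    and radius_le: "0 < q \<Longrightarrow> cluster label q \<noteq> {} \<Longrightarrow> j < n \<Longrightarrow> assigned j < residual j \<Longrightarrow> t \<in> pool j \<Longrightarrow>
      crowded pool j (\<delta> j t) \<Longrightarrow> radius q \<le> \<delta> j t"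
    and link_inj: "j < n \<Longrightarrow> inj_on (link j) {..<assigned j}"
    and pool_eq: "j < n \<Longrightarrow> pool j = pool0 j - (\<Union>k<assigned j. cluster label (link j k))"
    and link_pos: "j < n \<Longrightarrow> k < assigned j \<Longrightarrow> 0 < link j k"
    and link_nonempty: "j < n \<Longrightarrow> k < assigned j \<Longrightarrow> cluster label (link j k) \<noteq> {}"
    and link_near: "j < n \<Longrightarrow> k < assigned j \<Longrightarrow> t \<in> cluster label (link j k) \<Longrightarrow> \<delta> j t \<le> 3 * reach j k"
    and few_within_reach: "j < n \<Longrightarrow> k < assigned j \<Longrightarrow>
      card {t \<in> pool0 j. \<delta> j t < reach j k} < Suc k * cluster_size"

abbreviation (in atom_instance) "is_clustering \<equiv> clustering n m D r T site pool0 residual"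

context clustering
begin

lemma card_cluster: "0 < q \<Longrightarrow> cluster label q \<noteq> {} \<Longrightarrow> card (cluster label q) = cluster_size"
  using bij_betw_same_card[OF position_bij] by simp

lemma pool_sub: "j < n \<Longrightarrow> pool j \<subseteq> pool0 j"
  using pool_eq by blast

lemma finite_pool: "j < n \<Longrightarrow> finite (pool j)"
  using finite_subset[OF pool_sub finite_pool0] .

lemma card_pool0_le:
  assumes "j < n"
  shows "card {t \<in> pool0 j. Q t} \<le> card {t \<in> pool j. Q t} + assigned j * cluster_size"
proof -
  let ?linked = "\<Union>k<assigned j. cluster label (link j k)"
  have "card {t \<in> pool0 j. Q t} \<le> card ({t \<in> pool j. Q t} \<union> ?linked)"
    using pool_eq[OF assms] finite_pool[OF assms] by (intro card_mono) auto
  also have "\<dots> \<le> card {t \<in> pool j. Q t} + card ?linked" by (rule card_Un_le)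
  also have "card ?linked \<le> (\<Sum>k<assigned j. card (cluster label (link j k)))"
    by (rule card_UN_le) simp
  also have "\<dots> = assigned j * cluster_size"
    using card_cluster link_pos[OF assms] link_nonempty[OF assms] by simp
  finally show ?thesis by simp
qed

lemma exists_crowded:
  assumes "j < n" "assigned j < residual j"
  shows "\<exists>t\<in>pool j. crowded pool j (\<delta> j t)"
proof -
  have "atoms_per_unit * residual j \<le> card (pool j) + assigned j * cluster_size"
    using card_pool0_le[OF assms(1), of "\<lambda>_. True"] pool0_large[OF assms(1)] by simp
  moreover have "cluster_size * residual j \<le> atoms_per_unit * residual j"
    by (simp add: cluster_size_def atoms_per_unit_def)
  moreover have "cluster_size * Suc (assigned j) \<le> cluster_size * residual j"
    using assms(2) by (intro mult_le_mono2) simp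
  moreover have "cluster_size * Suc (assigned j) = cluster_size + assigned j * cluster_size" by simp
  ultimately have "cluster_size \<le> card (pool j)" by linarith
  then obtain t where "t \<in> pool j" "cluster_size \<le> card {v \<in> pool j. \<delta> j v \<le> \<delta> j t}"
    using exists_dominating_member[of "pool j" "pool j" cluster_size] finite_pool[OF assms(1)]
      cluster_size_pos
    by blast
  thus ?thesis by (auto simp: crowded_def)
qed

lemma few_closer:
  assumes "j < n" and d_min: "\<And>t. t \<in> pool j \<Longrightarrow> crowded pool j (\<delta> j t) \<Longrightarrow> d \<le> \<delta> j t"
  shows "card {t \<in> pool j. \<delta> j t < d} < cluster_size"
proof (rule ccontr)
  assume "\<not> card {t \<in> pool j. \<delta> j t < d} < cluster_size"
  hence "cluster_size \<le> card {t \<in> pool j. \<delta> j t < d}" by simp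
  then obtain t where "t \<in> {t \<in> pool j. \<delta> j t < d}" "cluster_size \<le> card {v \<in> pool j. \<delta> j v \<le> \<delta> j t}"
    using exists_dominating_member[of "pool j" "{t \<in> pool j. \<delta> j t < d}" cluster_size]
      finite_pool[OF assms(1)] cluster_size_pos by blast
  thus False using d_min[of t] by (auto simp: crowded_def)
qed

lemma radius_le_crowded:
  assumes "0 < q" "cluster label q \<noteq> {}" "j < n" "assigned j < residual j" "crowded pool j d"
  shows "radius q \<le> d"
proof -
  obtain t where t_near: "t \<in> {v \<in> pool j. \<delta> j v \<le> d}" "cluster_size \<le> card {v \<in> pool j. \<delta> j v \<le> \<delta> j t}"
    using exists_dominating_member[of "pool j" "{v \<in> pool j. \<delta> j v \<le> d}" cluster_size]
      finite_pool[OF assms(3)] cluster_size_pos assms(5) unfolding crowded_def by blast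
  hence "radius q \<le> \<delta> j t" using radius_le[OF assms(1-4)] by (simp add: crowded_def)
  with t_near show ?thesis by simp
qed

lemma clustering_Suc: "is_clustering (Suc s) pool label position assigned center radius link reach"
proof unfold_locales
  show "label t \<le> Suc s" if "t < T" for t using label_le[OF that] by simp
qed (fact assigned_le position_bij center_less near_center radius_le link_inj pool_eq link_pos
  link_nonempty
      link_near few_within_reach)+

end

text \<open>Joining: the next demand of client \<open>p\<close> is linked to a cluster that contains a near atom of its pool.\<close>

locale joining = clustering +
  fixes p d q a :: nat and pool' :: "nat \<Rightarrow> nat set"
  assumes p_unserved: "p < n" "assigned p < residual p"
    and few: "card {t \<in> pool p. \<delta> p t < d} < cluster_size"
    and a_near: "a \<in> pool p" "\<delta> p a \<le> d" "label a = q" and q_pos: "0 < q" "radius q \<le> d"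
    and pool': "\<And>j. j < n \<Longrightarrow> pool' j = (if j = p then pool p - cluster label q else pool j)"
begin

abbreviation "assigned' \<equiv> assigned(p := Suc (assigned p))"
abbreviation "link' \<equiv> link(p := (link p)(assigned p := q))"
abbreviation "reach' \<equiv> reach(p := (reach p)(assigned p := d))"

lemma a_in_cluster: "a \<in> cluster label q"
  using a_near pool_sub[OF p_unserved(1)] pool0_sub[OF p_unserved(1)] by (auto simp: cluster_def)

lemma q_fresh: "k < assigned p \<Longrightarrow> link p k \<noteq> q"
  using a_near(1) a_in_cluster pool_eq[OF p_unserved(1)] by auto

lemma pool'_sub: "j < n \<Longrightarrow> pool' j \<subseteq> pool j"
  using pool' by auto

lemma crowded_pool': "j < n \<Longrightarrow> crowded pool' j x \<Longrightarrow> crowded pool j x"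
  unfolding crowded_def
  by (erule order_trans, rule card_mono) (use finite_pool pool'_sub in auto)

text \<open>From \<open>p\<close> to \<open>a\<close>, on to the center of the cluster, and from there to \<open>t\<close>.\<close>

lemma q_near: "t \<in> cluster label q \<Longrightarrow> \<delta> p t \<le> 3 * d"
proof -
  assume t_mem: "t \<in> cluster label q"
  hence "center q < n" using center_less[OF q_pos(1)] by blast
  hence "\<delta> p t \<le> \<delta> (center q) t + \<delta> (center q) a + \<delta> p a"
    unfolding \<delta>_def using four_point[of "site t" "site a" p "center q"] near_center[OF q_pos(1) t_mem]
      near_center[OF q_pos(1) a_in_cluster] p_unserved(1) by simp
  with near_center[OF q_pos(1) t_mem] near_center[OF q_pos(1) a_in_cluster] a_near(2) q_pos(2) show
    ?thesis by linarith
qed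

lemma few_within_d: "card {t \<in> pool0 p. \<delta> p t < d} < Suc (assigned p) * cluster_size"
  using card_pool0_le[OF p_unserved(1), of "\<lambda>t. \<delta> p t < d"] few by simp

lemma link'_props:
  assumes "j < n" "k < assigned' j"
  shows "0 < link' j k" "cluster label (link' j k) \<noteq> {}"
    and "t \<in> cluster label (link' j k) \<Longrightarrow> \<delta> j t \<le> 3 * reach' j k"
    and "card {t \<in> pool0 j. \<delta> j t < reach' j k} < Suc k * cluster_size"
proof -
  consider (new) "j = p" "k = assigned p" | (old) "link' j k = link j k" "reach' j k = reach j k" "k < assigned j"
    using assms(2) by (cases "j = p"; cases "k = assigned p") auto
  hence "0 < link' j k \<and> cluster label (link' j k) \<noteq> {} \<and>
      (t \<in> cluster label (link' j k) \<longrightarrow> \<delta> j t \<le> 3 * reach' j k) \<and>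
      card {t \<in> pool0 j. \<delta> j t < reach' j k} < Suc k * cluster_size"
  proof cases
    case new
    thus ?thesis using q_pos(1) a_in_cluster q_near few_within_d by auto
  next
    case old
    show ?thesis
      unfolding old(1,2) using link_pos[OF assms(1) old(3)] link_nonempty[OF assms(1) old(3)]
        link_near[OF assms(1) old(3)] few_within_reach[OF assms(1) old(3)] by blast
  qed
  thus "0 < link' j k" "cluster label (link' j k) \<noteq> {}"
    "t \<in> cluster label (link' j k) \<Longrightarrow> \<delta> j t \<le> 3 * reach' j k"
    "card {t \<in> pool0 j. \<delta> j t < reach' j k} < Suc k * cluster_size" by blast+
qed

lemma link'_inj: "j < n \<Longrightarrow> inj_on (link' j) {..<assigned' j}"
proof (cases "j = p")
  case True
  have "inj_on (link' p) (insert (assigned p) {..<assigned p})"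
    using link_inj[OF p_unserved(1)] q_fresh by (auto simp: inj_on_def)
  thus ?thesis using True by (simp add: lessThan_Suc)
qed (use link_inj in simp)

lemma pool'_eq: "j < n \<Longrightarrow> pool' j = pool0 j - (\<Union>k<assigned' j. cluster label (link' j k))"
proof (cases "j = p")
  case True
  have "(\<Union>k<assigned' p. cluster label (link' p k)) = cluster label q \<union>
      (\<Union>k<assigned p. cluster label (link p k))"
    by (auto simp: lessThan_Suc)
  thus ?thesis using pool'[OF p_unserved(1)] pool_eq[OF p_unserved(1)] True by auto
qed (use pool' pool_eq in simp)

lemma is_clustering_joined: "is_clustering s pool' label position assigned' center radius link' reach'"
proof unfold_locales
  show "assigned' j \<le> residual j" if "j < n" for j using assigned_le[OF that] p_unserved by simp
  show "radius q' \<le> \<delta> j t" if "0 < q'" "cluster label q' \<noteq> {}" "j < n" "assigned' j < residual j"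
    "t \<in> pool' j" "crowded pool' j (\<delta> j t)" for q' j t
  proof (rule radius_le[OF that(1-3)])
    show "assigned j < residual j" using that(4) by (auto split: if_splits)
    show "t \<in> pool j" using pool'_sub[OF that(3)] that(5) by blast
    show "crowded pool j (\<delta> j t)" by (rule crowded_pool'[OF that(3,6)])
  qed
qed (fact label_le position_bij center_less near_center link'_inj pool'_eq link'_props)+

end

text \<open>Creating: atoms without a cluster around client \<open>p\<close> form the cluster \<open>Suc s\<close>.\<close>

locale creating = clustering +
  fixes p d :: nat and B :: "nat set" and position' :: "nat \<Rightarrow> nat"
  assumes p_less: "p < n"
    and d_min: "\<And>j t. j < n \<Longrightarrow> assigned j < residual j \<Longrightarrow> t \<in> pool j \<Longrightarrow> crowded pool j (\<delta> j t) \<Longrightarrow> d \<le> \<delta> j t"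
    and B_near: "B \<subseteq> pool p" "\<And>t. t \<in> B \<Longrightarrow> \<delta> p t \<le> d \<and> label t = 0"
      "bij_betw position' B {..<cluster_size}"
    and position': "\<And>t. t \<notin> B \<Longrightarrow> position' t = position t"
begin

abbreviation "label' \<equiv> \<lambda>t. if t \<in> B then Suc s else label t"

lemma B_sub: "B \<subseteq> pool0 p" "B \<subseteq> {..<T}"
  using B_near(1) pool_sub[OF p_less] pool0_sub[OF p_less] by auto

lemma cluster_new: "cluster label' (Suc s) = B"
  using B_sub(2) label_le by (force simp: cluster_def)

lemma cluster_old: "0 < q \<Longrightarrow> q \<noteq> Suc s \<Longrightarrow> cluster label' q = cluster label q"
  using B_near(2) by (auto simp: cluster_def)

lemma cluster_link:
  assumes "j < n" "k < assigned j"
  shows "cluster label' (link j k) = cluster label (link j k)"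
proof (rule cluster_old)
  have "cluster label (Suc s) = {}" using label_le by (force simp: cluster_def)
  thus "link j k \<noteq> Suc s" using link_nonempty[OF assms] by auto
qed (rule link_pos[OF assms])

lemma position'_bij:
  assumes "0 < q" "cluster label' q \<noteq> {}"
  shows "bij_betw position' (cluster label' q) {..<cluster_size}"
proof (cases "q = Suc s")
  case True
  thus ?thesis using B_near(3) cluster_new by simp
next
  case False
  have "position' t = position t" if "t \<in> cluster label q" for t
    using position' B_near(2)[of t] that assms(1) by (auto simp: cluster_def)
  hence "bij_betw position' (cluster label q) {..<cluster_size} \<longleftrightarrow>
      bij_betw position (cluster label q) {..<cluster_size}"
    by (rule bij_betw_cong)
  thus ?thesis using position_bij assms cluster_old[OF assms(1) False] by simp
qed

lemma is_clustering_created: "is_clustering (Suc s) pool label' position' assigned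
    (center(Suc s := p)) (radius(Suc s := d)) link reach"
proof unfold_locales
  show "label' t \<le> Suc s" if "t < T" for t using label_le[OF that] by simp
  show "(center(Suc s := p)) q < n" if "0 < q" "cluster label' q \<noteq> {}" for q
    using p_less center_less[OF that(1)] cluster_old[OF that(1)] that(2) by auto
  show "site t < m \<and> \<delta> ((center(Suc s := p)) q) t \<le> (radius(Suc s := d)) q"
    if "0 < q" "t \<in> cluster label' q" for q t
    using near_center[OF that(1), of t] cluster_old[OF that(1)] that(2) B_near(2) B_sub(1)
      site_less[OF p_less] cluster_new
    by (cases "q = Suc s") auto
  show "(radius(Suc s := d)) q \<le> \<delta> j t" if "0 < q" "cluster label' q \<noteq> {}" "j < n"
    "assigned j < residual j"
    "t \<in> pool j" "crowded pool j (\<delta> j t)" for q j t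
    using radius_le[OF that(1) _ that(3-6)] d_min[OF that(3-6)] cluster_old[OF that(1)] that(2) by auto
  show "pool j = pool0 j - (\<Union>k<assigned j. cluster label' (link j k))" if "j < n" for j
    using pool_eq[OF that] cluster_link[OF that] by simp
  show "cluster label' (link j k) \<noteq> {}" if "j < n" "k < assigned j" for j k
    using link_nonempty[OF that] cluster_link[OF that] by simp
  show "\<delta> j t \<le> 3 * reach j k" if "j < n" "k < assigned j" "t \<in> cluster label' (link j k)" for j k t
    using link_near[OF that(1,2)] that(3) cluster_link[OF that(1,2)] by simp
qed (fact assigned_le position'_bij link_inj link_pos few_within_reach)+

end

context atom_instance
begin

definition clustering_inv ::
  "nat \<Rightarrow> (nat \<Rightarrow> nat set) \<Rightarrow> (nat \<Rightarrow> nat) \<Rightarrow> (nat \<Rightarrow> nat) \<Rightarrow> (nat \<Rightarrow> nat) \<Rightarrow> bool" where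
  "clustering_inv s pool label position assigned \<longleftrightarrow>
     (\<exists>center radius link reach.
        is_clustering s pool label position assigned center radius link reach) \<and>
     ((\<forall>j<n. assigned j = residual j) \<or> (\<Sum>j<n. assigned j) = s)"

lemma clustering_invE:
  assumes "clustering_inv s pool label position assigned"
  obtains center radius link reach where
    "is_clustering s pool label position assigned center radius link reach"
  using assms unfolding clustering_inv_def by blast

lemma clustering_inv_init:
  assumes "\<And>j. j < n \<Longrightarrow> pool j = pool0 j" "\<And>t. t < T \<Longrightarrow> label t = 0" "\<And>j. j < n \<Longrightarrow> assigned j = 0"
  shows "clustering_inv 0 pool label position assigned"
proof -
  have "cluster label q = {}" if "0 < q" for q using assms(2) that by (auto simp: cluster_def)
  hence "is_clustering 0 pool label position assigned center radius link reach"
    for center radius link reach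
    by unfold_locales (use assms in auto)
  moreover have "(\<Sum>j<n. assigned j) = 0" using assms(3) by simp
  ultimately show ?thesis unfolding clustering_inv_def by blast
qed

lemma clustering_inv_pool_sub: "clustering_inv s pool label position assigned \<Longrightarrow> j < n \<Longrightarrow>
    pool j \<subseteq> pool0 j"
  by (erule clustering_invE) (rule clustering.pool_sub)

lemma clustering_inv_crowded:
  "clustering_inv s pool label position assigned \<Longrightarrow> j < n \<Longrightarrow> assigned j < residual j \<Longrightarrow>
   \<exists>t\<in>pool j. crowded pool j (\<delta> j t)"
  by (erule clustering_invE) (rule clustering.exists_crowded)

lemma clustering_inv_skip:
  assumes inv: "clustering_inv s pool label position assigned"
    and satisfied: "\<And>j. j < n \<Longrightarrow> \<not> assigned j < residual j"
  shows "clustering_inv (Suc s) pool label position assigned"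
proof -
  obtain center radius link reach where
    "is_clustering s pool label position assigned center radius link reach"
    using inv by (rule clustering_invE)
  then interpret clustering n m F D r T site pool0 residual s pool label position assigned center
    radius link reach .
  have "\<forall>j<n. assigned j = residual j" using satisfied assigned_le by (metis le_neq_implies_less)
  thus ?thesis unfolding clustering_inv_def using clustering_Suc by blast
qed

context
  fixes s :: nat and pool :: "nat \<Rightarrow> nat set" and label position assigned :: "nat \<Rightarrow> nat" and p d :: nat
  assumes inv: "clustering_inv s pool label position assigned" and client: "p < n"
    "assigned p < residual p"
    and crowded_p: "crowded pool p d"
    and nearest: "\<And>j t. j < n \<Longrightarrow> assigned j < residual j \<Longrightarrow> t \<in> pool j \<Longrightarrow>
        crowded pool j (\<delta> j t) \<Longrightarrow> d \<le> \<delta> j t"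
begin

lemma sum_assigned_Suc: "(\<Sum>j<n. (assigned(p := Suc (assigned p))) j) = Suc s"
proof -
  have "(\<Sum>j<n. assigned j) = s" using inv client unfolding clustering_inv_def by auto
  moreover have "(\<Sum>j<n. (assigned(p := Suc (assigned p))) j)
      = (\<Sum>j<n. assigned j + (if j = p then 1 else 0))"
    by (rule sum.cong) auto
  ultimately show ?thesis using client(1) by (simp add: sum.distrib)
qed

lemma clustering_inv_join:
  assumes a_near: "a \<in> pool p" "\<delta> p a \<le> d" "label a = q" "0 < q"
    and pool': "\<And>j. j < n \<Longrightarrow> pool' j = (if j = p then pool p - cluster label q else pool j)"
  shows "clustering_inv (Suc s) pool' label position (assigned(p := Suc (assigned p)))"
proof -
  obtain center radius link reach where
    "is_clustering s pool label position assigned center radius link reach"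
    using inv by (rule clustering_invE)
  then interpret clustering n m F D r T site pool0 residual s pool label position assigned center
    radius link reach .
  have "cluster label q \<noteq> {}" using a_near(1,3) pool_sub[OF client(1)] pool0_sub[OF client(1)]
    by (auto simp: cluster_def)
  then interpret joining n m F D r T site pool0 residual s pool label position assigned center
    radius link reach p d q a pool'
    using client a_near pool' few_closer[OF client(1) nearest[OF client]]
      radius_le_crowded[OF a_near(4) _ client crowded_p]
    by unfold_locales auto
  show ?thesis
    unfolding clustering_inv_def using clustering.clustering_Suc[OF is_clustering_joined] sum_assigned_Suc by blast
qed

lemma clustering_inv_create:
  assumes B_near: "B \<subseteq> pool p" "\<And>t. t \<in> B \<Longrightarrow> \<delta> p t \<le> d \<and> label t = 0"
    "bij_betw position' B {..<cluster_size}"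
    and label': "label' = (\<lambda>t. if t \<in> B then Suc s else label t)"
      and position': "\<And>t. t \<notin> B \<Longrightarrow> position' t = position t"
    and pool': "\<And>j. j < n \<Longrightarrow> pool' j = (if j = p then pool p - cluster label' (Suc s) else pool j)"
  shows "clustering_inv (Suc s) pool' label' position' (assigned(p := Suc (assigned p)))"
proof -
  obtain center radius link reach where
    "is_clustering s pool label position assigned center radius link reach"
    using inv by (rule clustering_invE)
  then interpret clustering n m F D r T site pool0 residual s pool label position assigned center
    radius link reach .
  interpret creating n m F D r T site pool0 residual s pool label position assigned center radius
    link reach p d B position'
    using client nearest B_near position' by unfold_locales auto
  interpret new: clustering n m F D r T site pool0 residual "Suc s" pool label' position' assigned
      "center(Suc s := p)" "radius(Suc s := d)" link reach
    unfolding label' by (rule is_clustering_created)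
  obtain a where a_mem: "a \<in> B" using B_near(3) cluster_size_pos by (auto simp: bij_betw_def)
  interpret joining n m F D r T site pool0 residual "Suc s" pool label' position' assigned
      "center(Suc s := p)" "radius(Suc s := d)" link reach p d "Suc s" a pool'
    using client a_mem B_near few_closer[OF client(1) nearest[OF client]] pool'
    by unfold_locales (auto simp: label')
  show ?thesis unfolding clustering_inv_def using is_clustering_joined sum_assigned_Suc by blast
qed

end

lemma clustering_inv_end:
  assumes inv: "clustering_inv s pool label position assigned" and "(\<Sum>j<n. residual j) \<le> s"
  obtains center radius link reach where
    "is_clustering s pool label position residual center radius link reach"
proof -
  obtain center radius link reach where
    "is_clustering s pool label position assigned center radius link reach"
    using inv by (rule clustering_invE)
  then interpret clustering n m F D r T site pool0 residual s pool label position assigned center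
    radius link reach .
  have all_assigned: "\<forall>j<n. assigned j = residual j"
  proof (rule ccontr)
    assume open_demand: "\<not> (\<forall>j<n. assigned j = residual j)"
    hence "(\<Sum>j<n. assigned j) = s" using inv by (auto simp: clustering_inv_def)
    moreover have "(\<Sum>j<n. assigned j) < (\<Sum>j<n. residual j)"
      using open_demand assigned_le by (intro sum_strict_mono_ex1) (auto simp: le_less)
    ultimately show False using assms(2) by simp
  qed
  have "is_clustering s pool label position residual center radius link reach"
    by unfold_locales (use all_assigned assigned_le label_le position_bij center_less near_center
      radius_le link_inj
      pool_eq link_pos link_nonempty link_near few_within_reach in auto)
  thus ?thesis by (rule that)
qed

end


section \<open>Greedy connection of one client\<close>

context scaled_ftfp
begin

definition greedy_inv :: "(nat \<Rightarrow> nat) \<Rightarrow> nat \<Rightarrow> nat \<Rightarrow> (nat \<Rightarrow> nat) \<Rightarrow> bool" where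
  "greedy_inv Y j k x \<longleftrightarrow> (\<forall>i<m. x i \<le> Y i) \<and> (\<Sum>i<m. x i) = min k (\<Sum>i<m. Y i) \<and>
     (\<exists>\<theta>. (\<forall>i<m. D i j < \<theta> \<longrightarrow> x i = Y i) \<and> (\<forall>i<m. 0 < x i \<longrightarrow> D i j \<le> \<theta>))"

lemma greedy_inv_init: "(\<And>i. i < m \<Longrightarrow> x i = 0) \<Longrightarrow> greedy_inv Y j 0 x"
  by (auto simp: greedy_inv_def intro!: exI[of _ 0])

lemma greedy_inv_optimal:
  assumes "greedy_inv Y j k x" "\<And>i. i < m \<Longrightarrow> x' i \<le> Y i" "(\<Sum>i<m. x' i) = k"
  shows "(\<Sum>i<m. D i j * x i) \<le> (\<Sum>i<m. D i j * x' i)"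
proof -
  obtain \<theta> where threshold: "\<And>i. i < m \<Longrightarrow> D i j < \<theta> \<Longrightarrow> x i = Y i" "\<And>i. i < m \<Longrightarrow> 0 < x i \<Longrightarrow> D i j \<le> \<theta>"
    using assms(1) by (auto simp: greedy_inv_def)
  have "(int (D i j) - int \<theta>) * (int (x i) - int (x' i)) \<le> 0" if i_less: "i < m" for i
  proof -
    consider (below) "D i j < \<theta>" | (used) "\<theta> \<le> D i j" "0 < x i" | (unused) "\<theta> \<le> D i j" "x i = 0" by linarith
    thus ?thesis
    proof cases
      case below
      thus ?thesis using threshold(1)[OF i_less] assms(2)[OF i_less] by (intro mult_nonpos_nonneg) auto
    next
      case used
      thus ?thesis using threshold(2)[OF i_less] by simp
    next
      case unused
      thus ?thesis by (intro mult_nonneg_nonpos) auto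
    qed
  qed
  hence "(\<Sum>i<m. (int (D i j) - int \<theta>) * (int (x i) - int (x' i))) \<le> 0" by (intro sum_nonpos) auto
  moreover have "(\<Sum>i<m. (int (D i j) - int \<theta>) * (int (x i) - int (x' i))) =
      (int (\<Sum>i<m. D i j * x i) - int (\<Sum>i<m. D i j * x' i)) - int \<theta> *
      (int (\<Sum>i<m. x i) - int (\<Sum>i<m. x' i))"
    by (simp add: algebra_simps sum.distrib sum_subtractf sum_distrib_left)
  moreover have "(\<Sum>i<m. x i) \<le> (\<Sum>i<m. x' i)" using assms(1,3) by (auto simp: greedy_inv_def)
  hence "int \<theta> * (int (\<Sum>i<m. x i) - int (\<Sum>i<m. x' i)) \<le> 0"
    by (intro mult_nonneg_nonpos) (auto simp del: of_nat_sum)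
  ultimately show ?thesis by linarith
qed

lemma greedy_inv_step:
  assumes greedy: "greedy_inv Y j k x" and i_free: "i < m" "x i < Y i"
    and i_nearest: "\<And>i'. i' < m \<Longrightarrow> x i' < Y i' \<Longrightarrow> D i j \<le> D i' j"
  shows "greedy_inv Y j (Suc k) (x(i := Suc (x i)))"
proof -
  obtain \<theta> where threshold: "\<And>i. i < m \<Longrightarrow> D i j < \<theta> \<Longrightarrow> x i = Y i" "\<And>i. i < m \<Longrightarrow> 0 < x i \<Longrightarrow> D i j \<le> \<theta>"
    using greedy by (auto simp: greedy_inv_def)
  have x_le: "x i' \<le> Y i'" if "i' < m" for i' using greedy that by (auto simp: greedy_inv_def)
  have "(\<Sum>i<m. x i) < (\<Sum>i<m. Y i)" using i_free x_le by (intro sum_strict_mono_ex1) auto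
  hence "(\<Sum>i<m. x i) = k" "k < (\<Sum>i<m. Y i)" using greedy by (auto simp: greedy_inv_def)
  moreover have "(\<Sum>i'<m. (x(i := Suc (x i))) i') = (\<Sum>i'<m. x i' + (if i' = i then 1 else 0))"
    by (rule sum.cong) auto
  ultimately have "(\<Sum>i'<m. (x(i := Suc (x i))) i') = min (Suc k) (\<Sum>i<m. Y i)"
    using i_free by (simp add: sum.distrib)
  moreover have "(x(i := Suc (x i))) i' = Y i'" if "i' < m" "D i' j < D i j" for i'
    using i_nearest[OF that(1)] that x_le[OF that(1)] by fastforce
  moreover have "\<theta> \<le> D i j" using threshold(1)[OF i_free(1)] i_free(2) by (cases "D i j < \<theta>") auto
  hence "D i' j \<le> D i j" if "i' < m" "0 < (x(i := Suc (x i))) i'" for i'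
    using that threshold(2)[OF that(1)] by (cases "i' = i") auto
  ultimately show ?thesis unfolding greedy_inv_def
    using x_le i_free by (intro conjI exI[of _ "D i j"]) auto
qed

lemma greedy_inv_stuck:
  assumes greedy: "greedy_inv Y j k x" and full: "\<And>i. i < m \<Longrightarrow> \<not> x i < Y i"
  shows "greedy_inv Y j (Suc k) x"
proof -
  have "x i = Y i" if "i < m" for i using greedy full[OF that] that by (auto simp: greedy_inv_def)
  hence "(\<Sum>i<m. x i) = (\<Sum>i<m. Y i)" by simp
  thus ?thesis using greedy by (auto simp: greedy_inv_def)
qed

end


section \<open>Rounding a combination of stars\<close>

lemma sum_blocks:
  fixes g :: "nat \<Rightarrow> 'a :: comm_semiring_1"
  assumes "0 < N" "\<And>k. k < K \<Longrightarrow> c k \<le> N"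
  shows "(\<Sum>t \<in> {t. t < K * N \<and> t mod N < c (t div N)}. g (t div N)) = (\<Sum>k<K. of_nat (c k) * g k)"
proof -
  let ?f = "\<lambda>t. if t mod N < c (t div N) then g (t div N) else 0"
  have "(\<Sum>t \<in> {t. t < K * N \<and> t mod N < c (t div N)}. g (t div N)) = (\<Sum>t<K * N. ?f t)"
    by (rule sum.mono_neutral_cong_left) auto
  also have "\<dots> = (\<Sum>k<K. sum ?f {k * N..<k * N + N})" by (rule sum.nat_group[symmetric])
  also have "\<dots> = (\<Sum>k<K. of_nat (c k) * g k)"
  proof (rule sum.cong[OF refl])
    fix k assume k_less: "k \<in> {..<K}"
    have "sum ?f {k * N..<k * N + N} = (\<Sum>u\<in>{0..<N}. ?f (u + k * N))"
      using sum.shift_bounds_nat_ivl[of ?f 0 "k * N" N] by (simp add: add.commute)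
    also have "\<dots> = (\<Sum>u\<in>{0..<N}. if u < c k then g k else 0)"
      by (rule sum.cong) (use assms(1) in auto)
    also have "\<dots> = (\<Sum>u\<in>{..<c k}. g k)"
      by (rule sum.mono_neutral_cong_right) (use assms(2)[of k] k_less in auto)
    finally show "sum ?f {k * N..<k * N + N} = of_nat (c k) * g k" by simp
  qed
  finally show ?thesis .
qed

lemma sum_select:
  fixes g :: "nat \<Rightarrow> nat \<Rightarrow> 'a :: comm_monoid_add"
  assumes "\<And>k. k < K \<Longrightarrow> s k < m \<or> g (s k) k = 0"
  shows "(\<Sum>i<m. \<Sum>k<K. if s k = i then g i k else 0) = (\<Sum>k<K. g (s k) k)"
proof -
  have "(\<Sum>i<m. if s k = i then g i k else 0) = g (s k) k" if "k < K" for k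
  proof -
    have "(\<Sum>i<m. if s k = i then g i k else 0) = (\<Sum>i<m. if s k = i then g (s k) k else 0)"
      by (intro sum.cong) auto
    thus ?thesis using assms[OF that] by (auto simp: sum.delta')
  qed
  thus ?thesis by (subst sum.swap) simp
qed

lemma counted_assignment:
  fixes a :: "nat \<Rightarrow> 'a" and site :: "'a \<Rightarrow> nat"
  assumes "inj_on a {..<r}" "\<And>k. k < r \<Longrightarrow> a k \<in> A" "finite A" "\<And>t. t \<in> A \<Longrightarrow> site t < m"
  defines "x \<equiv> (\<lambda>i. card {k. k < r \<and> site (a k) = i})"
  shows "x i \<le> card {t \<in> A. site t = i}"
    and "(\<Sum>i<m. d i * x i) = (\<Sum>k<r. (d (site (a k)) :: nat))"
proof -
  have "x i = card (a ` {k. k < r \<and> site (a k) = i})"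
    unfolding x_def by (rule card_image[symmetric]) (use assms(1) in \<open>auto simp: inj_on_def\<close>)
  also have "\<dots> \<le> card {t \<in> A. site t = i}" using assms(2,3) by (intro card_mono) auto
  finally show "x i \<le> card {t \<in> A. site t = i}" .
  have "(\<Sum>i<m. d i * x i) = (\<Sum>i<m. \<Sum>k \<in> {k \<in> {..<r}. site (a k) = i}. d (site (a k)))"
    by (intro sum.cong refl) (simp add: x_def mult.commute)
  also have "\<dots> = (\<Sum>k<r. d (site (a k)))" by (rule sum.group) (use assms(2,4) in auto)
  finally show "(\<Sum>i<m. d i * x i) = (\<Sum>k<r. d (site (a k)))" .
qed

text \<open>\<open>amount k / atoms_per_unit\<close> is the multiplicity of star \<open>k\<close>.\<close>

locale star_solution = scaled_ftfp +
  fixes K :: nat and amount star_site :: "nat \<Rightarrow> nat" and star_members :: "nat \<Rightarrow> nat set"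
  assumes star_site_less: "amount k = 0 \<or> star_site k < m"
    and star_members_sub: "star_members k \<subseteq> {..<n}"
    and covered: "j < n \<Longrightarrow> atoms_per_unit * r j \<le> (\<Sum>k<K. if j \<in> star_members k then amount k else 0)"
begin

definition whole :: "nat \<Rightarrow> nat" where "whole k = amount k div atoms_per_unit"
definition rest :: "nat \<Rightarrow> nat" where "rest k = amount k mod atoms_per_unit"

definition fixed_open :: "nat \<Rightarrow> nat" where
  "fixed_open i = (\<Sum>k<K. if star_site k = i then whole k else 0)"

definition fixed_conn :: "nat \<Rightarrow> nat \<Rightarrow> nat" where
  "fixed_conn i j = (\<Sum>k<K. if star_site k = i then (if j \<in> star_members k then whole k else 0) else 0)"

definition fixed_cover :: "nat \<Rightarrow> nat" where
  "fixed_cover j = (\<Sum>k<K. if j \<in> star_members k then whole k else 0)"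

definition residual :: "nat \<Rightarrow> nat" where
  "residual j = r j - fixed_cover j"

definition num_atoms :: nat where "num_atoms = K * atoms_per_unit"

definition valid :: "nat \<Rightarrow> bool" where
  "valid t \<longleftrightarrow> t mod atoms_per_unit < rest (t div atoms_per_unit)"

definition atoms :: "nat set" where
  "atoms = {t. t < num_atoms \<and> valid t}"

definition atom_site :: "nat \<Rightarrow> nat" where
  "atom_site t = (if valid t then star_site (t div atoms_per_unit) else m)"

definition pool0 :: "nat \<Rightarrow> nat set" where
  "pool0 j = {t \<in> atoms. j \<in> star_members (t div atoms_per_unit)}"

lemma amount_eq: "amount k = atoms_per_unit * whole k + rest k"
  by (simp add: whole_def rest_def)

lemma star_site_less_or_whole_zero: "star_site k < m \<or> whole k = 0"
  using star_site_less[of k] by (auto simp: whole_def)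

lemma atom_site_less_iff: "atom_site t < m \<longleftrightarrow> valid t"
proof -
  have "amount (t div atoms_per_unit) \<noteq> 0" if "valid t"
    using that by (intro notI) (simp add: valid_def rest_def)
  thus ?thesis using star_site_less[of "t div atoms_per_unit"] by (auto simp: atom_site_def)
qed

lemma atom_site_less: "t \<in> atoms \<Longrightarrow> atom_site t < m"
  by (simp add: atoms_def atom_site_less_iff)

lemma finite_atoms [simp]: "finite atoms"
  by (simp add: atoms_def)

lemma pool0_sub_atoms: "pool0 j \<subseteq> atoms"
  by (auto simp: pool0_def)

lemma sum_atoms:
  fixes g :: "nat \<Rightarrow> 'a :: comm_semiring_1"
  shows "(\<Sum>t\<in>atoms. g (t div atoms_per_unit)) = (\<Sum>k<K. of_nat (rest k) * g k)"
  unfolding atoms_def num_atoms_def valid_def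
  by (rule sum_blocks) (simp_all add: atoms_per_unit_pos rest_def less_imp_le)

lemma card_pool0: "card (pool0 j) = (\<Sum>k<K. if j \<in> star_members k then rest k else 0)"
proof -
  have "card (pool0 j) = (\<Sum>t\<in>atoms. if j \<in> star_members (t div atoms_per_unit) then 1 else 0)"
    unfolding pool0_def card_eq_sum by (rule sum.inter_filter) simp
  also have "\<dots> = (\<Sum>k<K. of_nat (rest k) * (if j \<in> star_members k then 1 else 0))" by (rule sum_atoms)
  finally show ?thesis by (simp add: if_distrib cong: if_cong)
qed

lemma pool0_residual_le:
  assumes "j < n"
  shows "atoms_per_unit * residual j \<le> card (pool0 j)"
proof -
  have "(\<Sum>k<K. if j \<in> star_members k then amount k else 0)
      = atoms_per_unit * fixed_cover j + card (pool0 j)"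
    unfolding card_pool0 fixed_cover_def sum_distrib_left sum.distrib[symmetric]
    by (rule sum.cong) (auto simp: amount_eq)
  with covered[OF assms] show ?thesis by (simp add: residual_def diff_mult_distrib2)
qed

sublocale atom_instance n m F D r num_atoms atom_site pool0 residual
  using pool0_residual_le pool0_sub_atoms atom_site_less by unfold_locales (auto simp: atoms_def)

lemma residual_le: "j < n \<Longrightarrow> residual j \<le> K"
proof -
  assume j_less: "j < n"
  have "card (pool0 j) \<le> card {..<num_atoms}" by (rule card_mono) (use pool0_sub[OF j_less] in auto)
  with pool0_residual_le[OF j_less] have "atoms_per_unit * residual j \<le> num_atoms" by simp
  also have "\<dots> = atoms_per_unit * K" by (simp add: num_atoms_def mult.commute)
  finally have "atoms_per_unit * residual j \<le> atoms_per_unit * K" .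
  thus ?thesis using atoms_per_unit_pos by simp
qed

lemma sum_residual_le: "(\<Sum>j<n. residual j) \<le> n * K"
  using sum_bounded_above[of "{..<n}" residual K] residual_le by simp

lemma fixed_conn_le: "fixed_conn i j \<le> fixed_open i"
  unfolding fixed_conn_def fixed_open_def by (rule sum_mono) simp

lemma sum_fixed_conn: "(\<Sum>i<m. fixed_conn i j) = fixed_cover j"
  unfolding fixed_conn_def fixed_cover_def by (rule sum_select) (use star_site_less_or_whole_zero in auto)

lemma sum_open_fixed: "(\<Sum>i<m. F i * fixed_open i) = (\<Sum>k<K. F (star_site k) * whole k)"
proof -
  have "(\<Sum>i<m. F i * fixed_open i) = (\<Sum>i<m. \<Sum>k<K. if star_site k = i then F i * whole k else 0)"
    unfolding fixed_open_def sum_distrib_left by (intro sum.cong refl) auto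
  also have "\<dots> = (\<Sum>k<K. F (star_site k) * whole k)"
    by (rule sum_select) (metis star_site_less_or_whole_zero mult_0_right)
  finally show ?thesis .
qed

lemma sum_conn_fixed:
  "(\<Sum>i<m. D i j * fixed_conn i j) =
      (\<Sum>k<K. if j \<in> star_members k then D (star_site k) j * whole k else 0)"
proof -
  have "(\<Sum>i<m. D i j * fixed_conn i j)
      = (\<Sum>i<m. \<Sum>k<K. if star_site k = i then (if j \<in> star_members k then D i j * whole k else 0)
      else 0)"
    unfolding fixed_conn_def sum_distrib_left by (intro sum.cong refl) auto
  also have "\<dots> = (\<Sum>k<K. if j \<in> star_members k then D (star_site k) j * whole k else 0)"
    by (rule sum_select) (metis star_site_less_or_whole_zero mult_0_right)
  finally show ?thesis .
qed

lemma star_cost_members: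
  "star_cost i (star_members k) = F i + (\<Sum>j<n. if j \<in> star_members k then D i j else 0)"
  using star_members_sub[of k] by (simp add: star_cost_def sum.If_cases Int_absorb1)

lemma fixed_cost:
  "(\<Sum>i<m. F i * fixed_open i) + (\<Sum>j<n. \<Sum>i<m. D i j * fixed_conn i j)
     = (\<Sum>k<K. whole k * star_cost (star_site k) (star_members k))"
proof -
  have "(\<Sum>j<n. \<Sum>i<m. D i j * fixed_conn i j)
      = (\<Sum>k<K. \<Sum>j<n. if j \<in> star_members k then D (star_site k) j * whole k else 0)"
    unfolding sum_conn_fixed by (rule sum.swap)
  thus ?thesis
    unfolding sum_open_fixed star_cost_members
    by (simp add: sum.distrib distrib_left sum_distrib_left if_distrib mult.commute cong: if_cong)
qed

lemma residual_cost:
  "(\<Sum>t\<in>atoms. F (atom_site t)) + (\<Sum>j<n. \<Sum>t\<in>pool0 j. \<delta> j t)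
     = (\<Sum>k<K. rest k * star_cost (star_site k) (star_members k))"
proof -
  let ?k = "\<lambda>t. t div atoms_per_unit"
  have site: "atom_site t = star_site (?k t)" if "t \<in> atoms" for t
    using that by (simp add: atoms_def atom_site_def)
  have "(\<Sum>t\<in>pool0 j. \<delta> j t) = (\<Sum>t\<in>atoms. if j \<in> star_members (?k t) then D (atom_site t) j else 0)"
    for j
    unfolding pool0_def \<delta>_def by (rule sum.inter_filter) simp
  hence "(\<Sum>j<n. \<Sum>t\<in>pool0 j. \<delta> j t)
      = (\<Sum>t\<in>atoms. \<Sum>j<n. if j \<in> star_members (?k t) then D (atom_site t) j else 0)"
    by (simp add: sum.swap[of _ atoms])
  hence "(\<Sum>t\<in>atoms. F (atom_site t)) + (\<Sum>j<n. \<Sum>t\<in>pool0 j. \<delta> j t)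
      = (\<Sum>t\<in>atoms. star_cost (star_site (?k t)) (star_members (?k t)))"
    unfolding star_cost_members by (auto simp: sum.distrib[symmetric] site intro!: sum.cong)
  also have "\<dots> = (\<Sum>k<K. rest k * star_cost (star_site k) (star_members k))"
    using sum_atoms[of "\<lambda>k. star_cost (star_site k) (star_members k)"] by simp
  finally show ?thesis .
qed

end

locale clustered_solution = star_solution +
  fixes s :: nat and pool :: "nat \<Rightarrow> nat set" and label position center radius :: "nat \<Rightarrow> nat"
    and link reach :: "nat \<Rightarrow> nat \<Rightarrow> nat"
  assumes clustered: "is_clustering s pool label position residual center radius link reach"
begin

sublocale clustering n m F D r num_atoms atom_site pool0 residual s pool label position residual
  center radius link reach
  by (rule clustered)

text \<open>
  An atom outside all clusters has a random number of its own and is open if that number is 0. A cluster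
  has one random number, which is the position of its only open atom.
\<close>

definition num_draws :: nat where "num_draws = num_atoms + s"

definition slot :: "nat \<Rightarrow> nat" where
  "slot t = (if label t = 0 then t else num_atoms + (label t - 1))"

definition val :: "nat \<Rightarrow> nat" where
  "val t = (if label t = 0 then 0 else position t)"

definition opened :: "(nat \<Rightarrow> nat) \<Rightarrow> nat set" where
  "opened \<omega> = {t \<in> atoms. \<omega> (slot t) = val t}"

definition random_open :: "(nat \<Rightarrow> nat) \<Rightarrow> nat \<Rightarrow> nat" where
  "random_open \<omega> i = card {t \<in> opened \<omega>. atom_site t = i}"

lemma in_own_cluster: "t < num_atoms \<Longrightarrow> t \<in> cluster label (label t)"
  by (simp add: cluster_def)

lemma own_position_bij:
  "t < num_atoms \<Longrightarrow> label t \<noteq> 0 \<Longrightarrow> bij_betw position (cluster label (label t)) {..<cluster_size}"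
  using in_own_cluster by (intro position_bij) auto

lemma slot_val_less:
  assumes "t < num_atoms"
  shows "slot t < num_draws \<and> val t < cluster_size"
proof (cases "label t = 0")
  case True
  thus ?thesis using assms cluster_size_pos by (simp add: slot_def val_def num_draws_def)
next
  case False
  have "position t < cluster_size"
    using own_position_bij[OF assms False] in_own_cluster[OF assms] by (auto simp: bij_betw_def)
  thus ?thesis using False label_le[OF assms] by (simp add: slot_def val_def num_draws_def)
qed

lemma inj_slot_val: "inj_on (\<lambda>t. (slot t, val t)) {..<num_atoms}"
proof (rule inj_onI)
  fix t u assume equal: "t \<in> {..<num_atoms}" "u \<in> {..<num_atoms}" "(slot t, val t) = (slot u, val u)"
  show "t = u"
  proof (cases "label t = 0 \<or> label u = 0")
    case True
    thus ?thesis using equal by (auto simp: slot_def split: if_splits)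
  next
    case False
    hence same: "label t = label u" "position t = position u"
      using equal by (auto simp: slot_def val_def)
    have "t \<in> cluster label (label u)" "u \<in> cluster label (label u)"
      using equal(1,2) in_own_cluster same(1) by fastforce+
    thus ?thesis using own_position_bij[of u] False equal(2) same(2)
      by (auto simp: bij_betw_def inj_on_def)
  qed
qed

lemma cluster_has_open_atom:
  assumes q_nonempty: "0 < q" "cluster label q \<noteq> {}"
    and \<omega>_mem: "\<omega> \<in> set_pmf (draws num_draws cluster_size)"
  shows "\<exists>t \<in> cluster label q. t \<in> opened \<omega>"
proof -
  obtain u where "u < num_atoms" "label u = q" using q_nonempty(2) by (auto simp: cluster_def)
  hence "num_atoms + (q - 1) < num_draws"
    using label_le[of u] q_nonempty(1) by (simp add: num_draws_def)
  hence "\<omega> (num_atoms + (q - 1)) < cluster_size" by (rule draws_less[OF \<omega>_mem _ cluster_size_pos])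
  then obtain t where t_drawn: "t \<in> cluster label q" "position t = \<omega> (num_atoms + (q - 1))"
    using position_bij[OF q_nonempty] unfolding bij_betw_def by (metis imageE lessThan_iff)
  hence "t \<in> opened \<omega>"
    using q_nonempty(1) near_center[OF q_nonempty(1) t_drawn(1)]
    by (auto simp: opened_def atoms_def atom_site_less_iff cluster_def slot_def val_def)
  with t_drawn(1) show ?thesis by blast
qed

lemma client_demands:
  assumes j_less: "j < n"
  shows "client_demands granularity atoms_per_unit cluster_size (residual j) num_draws
      (pool0 j) slot val (\<delta> j)
    (\<lambda>k. cluster label (link j k)) (reach j)"
proof
  show "0 < granularity" "atoms_per_unit = 19 * granularity" "cluster_size = 11 * granularity"
    by (simp_all add: granularity_pos atoms_per_unit_def cluster_size_def)
  show "finite (pool0 j)" by (rule finite_pool0[OF j_less])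
  show "residual j * atoms_per_unit \<le> card (pool0 j)"
    using pool0_large[OF j_less] by (simp add: mult.commute)
  show "slot t < num_draws \<and> val t < cluster_size" if "t \<in> pool0 j" for t
    using pool0_sub[OF j_less] that by (intro slot_val_less) auto
  show "inj_on (\<lambda>t. (slot t, val t)) (pool0 j)"
    by (rule inj_on_subset[OF inj_slot_val pool0_sub[OF j_less]])
  show "finite (cluster label (link j k)) \<and> card (cluster label (link j k)) = cluster_size"
    if "k < residual j" for k
    using card_cluster link_pos[OF j_less that] link_nonempty[OF j_less that] by simp
  show "disjoint_family_on (\<lambda>k. cluster label (link j k)) {..<residual j}"
    using link_inj[OF j_less] by (auto simp: disjoint_family_on_def cluster_def inj_on_def)
  show "\<exists>t\<in>cluster label (link j k). \<omega> (slot t) = val t"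
    if "k < residual j" "\<omega> \<in> set_pmf (draws num_draws cluster_size)" for k \<omega>
    using cluster_has_open_atom[OF link_pos[OF j_less that(1)] link_nonempty[OF j_less that(1)] that(2)]
    by (auto simp: opened_def)
qed (use link_near few_within_reach j_less in auto)

lemma expected_open_cost:
  "measure_pmf.expectation (draws num_draws cluster_size) (\<lambda>\<omega>. real (\<Sum>i<m. F i * random_open \<omega> i))
     = real (\<Sum>t\<in>atoms. F (atom_site t)) / real cluster_size"
proof -
  have pointwise: "real (\<Sum>i<m. F i * random_open \<omega> i)
      = (\<Sum>t\<in>atoms. real (F (atom_site t)) * of_bool (\<omega> (slot t) = val t))" for \<omega>
  proof -
    have "(\<Sum>i<m. F i * random_open \<omega> i) = (\<Sum>i<m. \<Sum>t \<in> {t \<in> opened \<omega>. atom_site t = i}. F (atom_site t))"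
      by (intro sum.cong refl) (simp add: random_open_def)
    also have "\<dots> = (\<Sum>t\<in>opened \<omega>. F (atom_site t))"
      by (rule sum.group) (auto simp: opened_def atom_site_less)
    also have "\<dots> = (\<Sum>t\<in>atoms. F (atom_site t) * of_bool (\<omega> (slot t) = val t))"
      unfolding opened_def by (rule sum.mono_neutral_cong_left) auto
    finally show ?thesis by simp
  qed
  have "measure_pmf.expectation (draws num_draws cluster_size) (\<lambda>\<omega>. real (\<Sum>i<m. F i * random_open \<omega> i))
      = (\<Sum>t\<in>atoms. real (F (atom_site t)) *
      measure_pmf.prob (draws num_draws cluster_size) {\<omega>. \<omega> (slot t) = val t})"
    unfolding pointwise expectation_sum_finite[OF finite_set_draws] by (simp add: expectation_of_bool)
  also have "\<dots> = (\<Sum>t\<in>atoms. real (F (atom_site t)) * (1 / real cluster_size))"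
    by (intro sum.cong refl)
      (use slot_val_less prob_draws_eq[OF cluster_size_pos] in \<open>simp add: atoms_def\<close>)
  finally show ?thesis by (simp add: sum_divide_distrib)
qed

end

locale rounded_solution = clustered_solution +
  fixes conn :: "(nat \<Rightarrow> nat) \<Rightarrow> nat \<Rightarrow> nat \<Rightarrow> nat"
  assumes greedy: "\<omega> \<in> set_pmf (draws num_draws cluster_size) \<Longrightarrow> j < n \<Longrightarrow>
    greedy_inv (random_open \<omega>) j (residual j) (\<lambda>i. conn \<omega> i j)"
begin

abbreviation "\<Omega> \<equiv> draws num_draws cluster_size"

definition total_open :: "(nat \<Rightarrow> nat) \<Rightarrow> nat \<Rightarrow> nat" where
  "total_open \<omega> i = fixed_open i + random_open \<omega> i"

definition total_conn :: "(nat \<Rightarrow> nat) \<Rightarrow> nat \<Rightarrow> nat \<Rightarrow> nat" where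
  "total_conn \<omega> i j = fixed_conn i j + conn \<omega> i j"

lemma conn_le_assignment:
  assumes "\<omega> \<in> set_pmf \<Omega>" "j < n" and a_assigns: "inj_on a {..<residual j}"
    "\<And>k. k < residual j \<Longrightarrow> a k \<in> opened \<omega>"
  shows "(\<Sum>i<m. conn \<omega> i j) = residual j" "(\<Sum>i<m. D i j * conn \<omega> i j) \<le> (\<Sum>k<residual j. \<delta> j (a k))"
proof -
  let ?x = "\<lambda>i. card {k. k < residual j \<and> atom_site (a k) = i}"
  have "finite (opened \<omega>)" "\<And>t. t \<in> opened \<omega> \<Longrightarrow> atom_site t < m"
    by (auto simp: opened_def atom_site_less)
  note counted = counted_assignment[where a = a and A = "opened \<omega>" and site = atom_site
    and m = m, OF a_assigns this]
  have x_le: "?x i \<le> random_open \<omega> i" for i using counted(1) by (simp add: random_open_def)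
  have x_sum: "(\<Sum>i<m. ?x i) = residual j" using counted(2)[of "\<lambda>_. 1"] by simp
  hence "residual j \<le> (\<Sum>i<m. random_open \<omega> i)" using sum_mono[of "{..<m}" ?x, OF x_le] by simp
  thus "(\<Sum>i<m. conn \<omega> i j) = residual j" using greedy[OF assms(1,2)] by (simp add: greedy_inv_def)
  have "(\<Sum>i<m. D i j * conn \<omega> i j) \<le> (\<Sum>i<m. D i j * ?x i)"
    by (rule greedy_inv_optimal[OF greedy[OF assms(1,2)] x_le x_sum])
  thus "(\<Sum>i<m. D i j * conn \<omega> i j) \<le> (\<Sum>k<residual j. \<delta> j (a k))"
    using counted(2)[of "\<lambda>i. D i j"] by (simp add: \<delta>_def)
qed

lemma residual_connected:
  assumes \<omega>_mem: "\<omega> \<in> set_pmf \<Omega>" and j_less: "j < n"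
  shows "(\<Sum>i<m. conn \<omega> i j) = residual j"
proof -
  have "\<exists>t. t \<in> cluster label (link j k) \<and> t \<in> opened \<omega>" if "k < residual j" for k
    using cluster_has_open_atom[OF link_pos[OF j_less that] link_nonempty[OF j_less that] \<omega>_mem]
    by blast
  then obtain a where a_opened: "\<And>k. k < residual j \<Longrightarrow> a k \<in> cluster label (link j k)"
    "\<And>k. k < residual j \<Longrightarrow> a k \<in> opened \<omega>" by metis
  have "inj_on a {..<residual j}"
  proof (rule inj_onI)
    fix k l assume equal: "k \<in> {..<residual j}" "l \<in> {..<residual j}" "a k = a l"
    hence "link j k = link j l" using a_opened(1)[of k] a_opened(1)[of l] by (simp add: cluster_def)
    thus "k = l" using link_inj[OF j_less] equal by (auto simp: inj_on_def)
  qed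
  thus ?thesis by (rule conn_le_assignment(1)[OF \<omega>_mem j_less _ a_opened(2)])
qed

lemma total_conn_le: "\<omega> \<in> set_pmf \<Omega> \<Longrightarrow> i < m \<Longrightarrow> j < n \<Longrightarrow> total_conn \<omega> i j \<le> total_open \<omega> i"
  unfolding total_conn_def total_open_def using greedy[of \<omega> j] fixed_conn_le[of i j]
  by (auto simp: greedy_inv_def intro: add_mono)

lemma demand_met: "\<omega> \<in> set_pmf \<Omega> \<Longrightarrow> j < n \<Longrightarrow> r j \<le> (\<Sum>i<m. total_conn \<omega> i j)"
  by (simp add: total_conn_def sum.distrib sum_fixed_conn residual_connected residual_def)

lemma expected_conn_cost:
  assumes j_less: "j < n"
  shows "measure_pmf.expectation \<Omega> (\<lambda>\<omega>. real (\<Sum>i<m. D i j * conn \<omega> i j))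
    \<le> real (\<Sum>t\<in>pool0 j. \<delta> j t) / real cluster_size"
proof -
  have "measure_pmf.expectation \<Omega> (\<lambda>\<omega>. real (\<Sum>i<m. D i j * conn \<omega> i j))
      \<le> (\<Sum>t\<in>pool0 j. real (\<delta> j t)) / real cluster_size"
  proof (rule client_demands.client_expected_cost[OF client_demands[OF j_less]])
    fix \<omega> and a :: "nat \<Rightarrow> nat"
    assume \<omega>_mem: "\<omega> \<in> set_pmf \<Omega>" and a_inj: "inj_on a {..<residual j}"
      and a_opened: "\<And>k. k < residual j \<Longrightarrow> \<omega> (slot (a k)) = val (a k) \<and>
        a k \<in> pool0 j \<union> (\<Union>k<residual j. cluster label (link j k))"
    have "a k \<in> opened \<omega>" if "k < residual j" for k
    proof -
      from a_opened[OF that] consider (pool) "a k \<in> pool0 j" | (cluster) l where "l < residual j"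
        "a k \<in> cluster label (link j l)" by auto
      hence "a k \<in> atoms"
      proof cases
        case pool
        thus ?thesis using pool0_sub_atoms by blast
      next
        case cluster
        thus ?thesis using near_center[OF link_pos[OF j_less cluster(1)] cluster(2)]
          by (simp add: atoms_def cluster_def atom_site_less_iff)
      qed
      with a_opened[OF that] show ?thesis by (simp add: opened_def)
    qed
    thus "(\<Sum>i<m. D i j * conn \<omega> i j) \<le> (\<Sum>k<residual j. \<delta> j (a k))"
      by (rule conn_le_assignment(2)[OF \<omega>_mem j_less a_inj])
  qed
  thus ?thesis by simp
qed

definition solution_cost :: "(nat \<Rightarrow> nat) \<Rightarrow> nat" where
  "solution_cost \<omega> = (\<Sum>i<m. F i * total_open \<omega> i) + (\<Sum>i<m. \<Sum>j<n. D i j * total_conn \<omega> i j)"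

abbreviation "cost_of k \<equiv> star_cost (star_site k) (star_members k)"

lemma solution_cost_eq:
  "solution_cost \<omega> = (\<Sum>k<K. whole k * cost_of k) +
     ((\<Sum>i<m. F i * random_open \<omega> i) + (\<Sum>j<n. \<Sum>i<m. D i j * conn \<omega> i j))"
proof -
  have "(\<Sum>i<m. \<Sum>j<n. D i j * total_conn \<omega> i j) = (\<Sum>j<n. \<Sum>i<m. D i j * total_conn \<omega> i j)"
    by (rule sum.swap)
  thus ?thesis
    unfolding solution_cost_def fixed_cost[symmetric] total_open_def total_conn_def
    by (simp add: distrib_left sum.distrib)
qed

lemma expected_solution_cost_le_stars:
  "measure_pmf.expectation \<Omega> (\<lambda>\<omega>. real (solution_cost \<omega>))
     \<le> real (\<Sum>k<K. whole k * cost_of k) + real (\<Sum>k<K. rest k * cost_of k) / real cluster_size"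
proof -
  have integrable: "integrable (measure_pmf \<Omega>) (f :: (nat \<Rightarrow> nat) \<Rightarrow> real)" for f
    by (rule integrable_measure_pmf_finite[OF finite_set_draws])
  have "measure_pmf.expectation \<Omega> (\<lambda>\<omega>. real (solution_cost \<omega>)) = real (\<Sum>k<K. whole k * cost_of k) +
      (measure_pmf.expectation \<Omega> (\<lambda>\<omega>. real (\<Sum>i<m. F i * random_open \<omega> i)) +
       (\<Sum>j<n. measure_pmf.expectation \<Omega> (\<lambda>\<omega>. real (\<Sum>i<m. D i j * conn \<omega> i j))))"
    unfolding solution_cost_eq of_nat_add of_nat_sum[of "\<lambda>j. \<Sum>i<m. D i j * conn _ i j"]
    by (simp only: Bochner_Integration.integral_add[OF integrable integrable]
      expectation_sum_finite[OF finite_set_draws]) simp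
  also have "\<dots> \<le> real (\<Sum>k<K. whole k * cost_of k) +
      (real (\<Sum>t\<in>atoms. F (atom_site t)) / real cluster_size +
      (\<Sum>j<n. real (\<Sum>t\<in>pool0 j. \<delta> j t) / real cluster_size))"
    unfolding expected_open_cost by (intro add_left_mono sum_mono expected_conn_cost) simp
  also have "\<dots> = real (\<Sum>k<K. whole k * cost_of k) + real (\<Sum>k<K. rest k * cost_of k) / real cluster_size"
    unfolding residual_cost[symmetric] by (simp add: add_divide_distrib sum_divide_distrib)
  finally show ?thesis .
qed

lemma expected_solution_cost:
  "measure_pmf.expectation \<Omega> (\<lambda>\<omega>. real (solution_cost \<omega>))
      \<le> real (\<Sum>k<K. cost_of k * amount k) / real cluster_size"
proof -
  define A B where "A = (\<Sum>k<K. whole k * cost_of k)" and "B = (\<Sum>k<K. rest k * cost_of k)"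
  have "cost_of k * amount k = atoms_per_unit * (whole k * cost_of k) + rest k * cost_of k" for k
    by (subst amount_eq) (simp add: distrib_left)
  hence "(\<Sum>k<K. cost_of k * amount k) = A * atoms_per_unit + B"
    by (simp add: A_def B_def sum.distrib sum_distrib_left mult.commute)
  moreover have "A * cluster_size \<le> A * atoms_per_unit"
    by (rule mult_le_mono2) (simp add: cluster_size_def atoms_per_unit_def)
  ultimately have "A * cluster_size + B \<le> (\<Sum>k<K. cost_of k * amount k)" by linarith
  hence "real A * real cluster_size + real B \<le> real (\<Sum>k<K. cost_of k * amount k)"
    unfolding of_nat_mult[symmetric] of_nat_add[symmetric] of_nat_le_iff .
  hence "real A + real B / real cluster_size \<le> real (\<Sum>k<K. cost_of k * amount k) / real cluster_size"
    using cluster_size_pos by (simp add: le_divide_eq distrib_right del: of_nat_sum)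
  thus ?thesis using expected_solution_cost_le_stars
    unfolding A_def B_def by (rule order_trans[rotated])
qed

end

lemma (in scaled_ftfp) cost_limit_le:
  assumes "0 \<le> Z"
  shows "cost_limit Z / real cluster_size \<le> (1 + 2 / exp 1) * Z"
proof -
  have "(1000 * real n + real atoms_per_unit * (1002 / 1000) + 1) / real cluster_size
      \<le> 19 / 11 * (1 + 1 / 500 + 1 / 10000)"
    by (simp add: atoms_per_unit_def cluster_size_def granularity_def field_simps)
  also have "\<dots> \<le> 1 + 2 / exp 1" using e_less_272 by (simp add: field_simps)
  finally have "Z * ((1000 * real n + real atoms_per_unit * (1002 / 1000) + 1) / real cluster_size)
      \<le> Z * (1 + 2 / exp 1)"
    by (rule mult_left_mono[OF _ assms])
  thus ?thesis by (simp only: cost_limit_def times_divide_eq_right mult.commute[of _ Z])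
qed


section \<open>The program\<close>

text \<open>
  Matrices are stored row by row, with one row of length \<open>n\<close> per site, star or atom. \<open>ClusterOf\<close> is 0
  for atoms outside all clusters, and \<open>Found\<close> tells whether a search has met a candidate.
\<close>

abbreviation (input) "NumSites \<equiv> 2 :: nat"
abbreviation (input) "NumClients \<equiv> 3 :: nat"
abbreviation (input) "NumPairs \<equiv> 4 :: nat"
abbreviation (input) "AtomsPerUnit \<equiv> 5 :: nat"
abbreviation (input) "ClusterSize \<equiv> 6 :: nat"
abbreviation (input) "NumStars \<equiv> 7 :: nat"
abbreviation (input) "NumAtoms \<equiv> 8 :: nat"
abbreviation (input) "NumRounds \<equiv> 9 :: nat"
abbreviation (input) "NumDraws \<equiv> 10 :: nat"
abbreviation (input) "OpenNum \<equiv> 11 :: nat"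
abbreviation (input) "OpenDen \<equiv> 12 :: nat"
abbreviation (input) "DistNum \<equiv> 13 :: nat"
abbreviation (input) "DistDen \<equiv> 14 :: nat"
abbreviation (input) "Demand \<equiv> 15 :: nat"
abbreviation (input) "DenProd \<equiv> 16 :: nat"
abbreviation (input) "DemandProd \<equiv> 17 :: nat"
abbreviation (input) "OpenCost \<equiv> 18 :: nat"
abbreviation (input) "Distance \<equiv> 19 :: nat"
abbreviation (input) "DemandQuot \<equiv> 20 :: nat"
abbreviation (input) "Weight \<equiv> 21 :: nat"
abbreviation (input) "Coverage \<equiv> 22 :: nat"
abbreviation (input) "LoopI \<equiv> 23 :: nat"
abbreviation (input) "LoopJ \<equiv> 24 :: nat"
abbreviation (input) "LoopK \<equiv> 25 :: nat"
abbreviation (input) "Found \<equiv> 26 :: nat"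
abbreviation (input) "BestCost \<equiv> 27 :: nat"
abbreviation (input) "BestWeight \<equiv> 28 :: nat"
abbreviation (input) "BestStar \<equiv> 29 :: nat"
abbreviation (input) "StarCost \<equiv> 30 :: nat"
abbreviation (input) "StarWeight \<equiv> 31 :: nat"
abbreviation (input) "StarMember \<equiv> 32 :: nat"
abbreviation (input) "StarSite \<equiv> 33 :: nat"
abbreviation (input) "StarAmount \<equiv> 34 :: nat"
abbreviation (input) "MinDemand \<equiv> 35 :: nat"
abbreviation (input) "FixedOpen \<equiv> 36 :: nat"
abbreviation (input) "FixedConn \<equiv> 37 :: nat"
abbreviation (input) "FixedCover \<equiv> 38 :: nat"
abbreviation (input) "InPool \<equiv> 39 :: nat"
abbreviation (input) "AtomSite \<equiv> 40 :: nat"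
abbreviation (input) "AtomValid \<equiv> 41 :: nat"
abbreviation (input) "ResidualDemand \<equiv> 42 :: nat"
abbreviation (input) "NumAssigned \<equiv> 43 :: nat"
abbreviation (input) "ClusterOf \<equiv> 44 :: nat"
abbreviation (input) "PositionOf \<equiv> 45 :: nat"
abbreviation (input) "Count \<equiv> 46 :: nat"
abbreviation (input) "BestDist \<equiv> 47 :: nat"
abbreviation (input) "BestClient \<equiv> 48 :: nat"
abbreviation (input) "CurCluster \<equiv> 49 :: nat"
abbreviation (input) "LoopV \<equiv> 50 :: nat"
abbreviation (input) "WholePart \<equiv> 51 :: nat"
abbreviation (input) "RandomDraw \<equiv> 52 :: nat"
abbreviation (input) "RandomOpen \<equiv> 53 :: nat"
abbreviation (input) "RandomConn \<equiv> 54 :: nat"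
abbreviation (input) "BestSite \<equiv> 55 :: nat"
abbreviation (input) "Output \<equiv> 56 :: nat"
abbreviation (input) "LoopU \<equiv> 57 :: nat"
abbreviation (input) "LoopP \<equiv> 58 :: nat"

abbreviation Cell2 :: "nat \<Rightarrow> bexpr \<Rightarrow> bexpr \<Rightarrow> bexpr" where
  "Cell2 k i j \<equiv> Cell k (i \<otimes> Var NumClients \<oplus> j)"

abbreviation Store2 :: "nat \<Rightarrow> bexpr \<Rightarrow> bexpr \<Rightarrow> bexpr \<Rightarrow> bcom" where
  "Store2 k i j e \<equiv> Store k (i \<otimes> Var NumClients \<oplus> j) e"

abbreviation Incr2 :: "nat \<Rightarrow> bexpr \<Rightarrow> bexpr \<Rightarrow> bexpr \<Rightarrow> bcom" where
  "Incr2 k i j e \<equiv> Incr k (i \<otimes> Var NumClients \<oplus> j) e"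

abbreviation Row :: "bexpr \<Rightarrow> bexpr" where "Row t \<equiv> t \<oslash> Var NumClients"
abbreviation Col :: "bexpr \<Rightarrow> bexpr" where "Col t \<equiv> t \<ominus> Row t \<otimes> Var NumClients"

definition load_dims :: bcom where
  "load_dims = SetV NumSites (Inp (Num 0)) ;; SetV NumClients (Inp (Num 1))"

abbreviation "Granularity \<equiv> Num 1000000 \<otimes> (Var NumClients \<oplus> Num 1)"

definition load_sizes :: bcom where
  "load_sizes =
     SetV NumPairs (Var NumSites \<otimes> Var NumClients) ;;
     SetV AtomsPerUnit (Num 19 \<otimes> Granularity) ;;
     SetV ClusterSize (Num 11 \<otimes> Granularity)"

definition load_counts :: bcom where
  "load_counts =
     SetV NumStars (Var NumClients \<otimes> Var AtomsPerUnit) ;;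
     SetV NumAtoms (Var NumClients \<otimes> Var AtomsPerUnit \<otimes> Var AtomsPerUnit) ;;
     SetV NumRounds (Var NumClients \<otimes> (Var NumClients \<otimes> Var AtomsPerUnit)) ;;
     SetV NumDraws (Var NumAtoms \<oplus> Var NumRounds)"

definition load_open_costs :: bcom where
  "load_open_costs =
     For LoopI (Var NumSites)
       (Store OpenNum (Var LoopI) (Inp (Num 2 \<oplus> Num 2 \<otimes> Var LoopI)) ;;
        Store OpenDen (Var LoopI) (Inp (Num 3 \<oplus> Num 2 \<otimes> Var LoopI)))"

definition load_distances :: bcom where
  "load_distances =
     For LoopI (Var NumPairs)
       (Store DistNum (Var LoopI) (Inp (Num 2 \<oplus> Num 2 \<otimes> Var NumSites \<oplus> Num 2 \<otimes> Var LoopI)) ;;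
        Store DistDen (Var LoopI) (Inp (Num 3 \<oplus> Num 2 \<otimes> Var NumSites \<oplus> Num 2 \<otimes> Var LoopI)))"

definition load_demands :: bcom where
  "load_demands =
     For LoopJ (Var NumClients)
       (Store Demand (Var LoopJ) (Inp (Num 2 \<oplus> Num 2 \<otimes> Var NumSites \<oplus> Num 2 \<otimes> Var NumPairs \<oplus>
       Var LoopJ)))"

definition multiply_open_dens :: bcom where
  "multiply_open_dens =
     SetV DenProd (Num 1) ;;
     For LoopI (Var NumSites) (SetV DenProd (Var DenProd \<otimes> Cell OpenDen (Var LoopI)))"

definition multiply_dist_dens :: bcom where
  "multiply_dist_dens = For LoopI (Var NumPairs)
      (SetV DenProd (Var DenProd \<otimes> Cell DistDen (Var LoopI)))"

definition multiply_demands :: bcom where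
  "multiply_demands =
     SetV DemandProd (Num 1) ;;
     For LoopJ (Var NumClients) (SetV DemandProd (Var DemandProd \<otimes> Cell Demand (Var LoopJ)))"

definition scale_open_costs :: bcom where
  "scale_open_costs =
     For LoopI (Var NumSites)
       (Store OpenCost (Var LoopI) (Cell OpenNum (Var LoopI) \<otimes>
       (Var DenProd \<oslash> Cell OpenDen (Var LoopI))))"

definition scale_distances :: bcom where
  "scale_distances =
     For LoopI (Var NumPairs)
       (Store Distance (Var LoopI) (Cell DistNum (Var LoopI) \<otimes>
       (Var DenProd \<oslash> Cell DistDen (Var LoopI))))"

definition init_weights :: bcom where
  "init_weights =
     For LoopJ (Var NumClients)
       (Store DemandQuot (Var LoopJ) (Var DemandProd \<oslash> Cell Demand (Var LoopJ)) ;;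
        Store Weight (Var LoopJ) (Var DemandProd \<oslash> Cell Demand (Var LoopJ)))"

abbreviation Active :: "bexpr \<Rightarrow> bexpr" where
  "Active j \<equiv> Less (Cell Coverage j) (Var AtomsPerUnit \<otimes> Cell Demand j)"

abbreviation InStar :: "bexpr \<Rightarrow> bexpr \<Rightarrow> bexpr" where
  "InStar t j \<equiv> Active j \<otimes> Leq (Cell2 Distance (Row t) j \<otimes> Cell Weight (Col t))
      (Cell Distance t \<otimes> Cell Weight j)"

definition add_member :: bcom where
  "add_member =
     Incr StarCost (Num 0) (Cell2 Distance (Row (Var LoopI)) (Var LoopJ)) ;;
     Incr StarWeight (Num 0) (Cell Weight (Var LoopJ))"

definition add_members :: bcom where
  "add_members = For LoopJ (Var NumClients) (When (InStar (Var LoopI) (Var LoopJ)) add_member)"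

definition evaluate_star :: bcom where
  "evaluate_star = SetV StarCost (Cell OpenCost (Row (Var LoopI))) ;; SetV StarWeight
      (Num 0) ;; add_members"

definition keep_if_better :: bcom where
  "keep_if_better =
     When (Neg (Var Found) \<oplus> Less (Var StarCost \<otimes> Var BestWeight) (Var BestCost \<otimes> Var StarWeight))
       (SetV Found (Num 1) ;; SetV BestCost (Var StarCost) ;; SetV BestWeight (Var StarWeight) ;;
        SetV BestStar (Var LoopI))"

definition find_best_star :: bcom where
  "find_best_star =
     For LoopI (Var NumPairs) (When (Active (Col (Var LoopI))) (evaluate_star ;; keep_if_better))"

definition record_member :: bcom where
  "record_member =
     Store2 StarMember (Var LoopK) (Var LoopJ) (Num 1) ;;
     When (Neg (Var MinDemand) \<oplus> Less (Cell Demand (Var LoopJ)) (Var MinDemand))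
       (SetV MinDemand (Cell Demand (Var LoopJ)))"

definition record_members :: bcom where
  "record_members = For LoopJ (Var NumClients) (When (InStar (Var BestStar) (Var LoopJ)) record_member)"

definition record_star :: bcom where
  "record_star =
     SetV MinDemand (Num 0) ;;
     record_members ;;
     Store StarSite (Var LoopK) (Row (Var BestStar)) ;;
     Store StarAmount (Var LoopK) (Var MinDemand)"

definition update_weights :: bcom where
  "update_weights =
     For LoopJ (Var NumClients) (Ite (Cell2 StarMember (Var LoopK) (Var LoopJ))
       (Store Weight (Var LoopJ) (Cell Weight (Var LoopJ) \<otimes>
          (Num 1000 \<otimes> Var DemandProd \<ominus> Cell DemandQuot (Var LoopJ) \<otimes> Var MinDemand)) ;;
        Incr Coverage (Var LoopJ) (Var MinDemand))
       (Store Weight (Var LoopJ) (Cell Weight (Var LoopJ) \<otimes> (Num 1000 \<otimes> Var DemandProd))))"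

definition select_stars :: bcom where
  "select_stars =
     For LoopK (Var NumStars)
       (SetV Found (Num 0) ;; find_best_star ;; When (Var Found) (record_star ;; update_weights))"

definition fix_connections :: bcom where
  "fix_connections =
     For LoopJ (Var NumClients) (When (Cell2 StarMember (Var LoopK) (Var LoopJ))
       (Incr2 FixedConn (Cell StarSite (Var LoopK)) (Var LoopJ) (Var WholePart) ;;
        Incr FixedCover (Var LoopJ) (Var WholePart)))"

definition fix_star :: bcom where
  "fix_star =
     SetV WholePart (Cell StarAmount (Var LoopK) \<oslash> Var AtomsPerUnit) ;;
     Incr FixedOpen (Cell StarSite (Var LoopK)) (Var WholePart) ;;
     fix_connections"

definition split_amounts :: bcom where
  "split_amounts = For LoopK (Var NumStars) fix_star"

abbreviation StarOf :: "bexpr \<Rightarrow> bexpr" where "StarOf t \<equiv> t \<oslash> Var AtomsPerUnit"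
abbreviation ModUnit :: "bexpr \<Rightarrow> bexpr" where "ModUnit t \<equiv> t \<ominus> t \<oslash> Var AtomsPerUnit \<otimes> Var AtomsPerUnit"

definition create_atoms :: bcom where
  "create_atoms =
     For LoopI (Var NumAtoms)
       (When (Less (ModUnit (Var LoopI)) (ModUnit (Cell StarAmount (StarOf (Var LoopI)))))
         (Store AtomValid (Var LoopI) (Num 1) ;;
         Store AtomSite (Var LoopI) (Cell StarSite (StarOf (Var LoopI)))))"

definition fill_pools :: bcom where
  "fill_pools =
     For LoopI (Var NumAtoms \<otimes> Var NumClients)
       (When (Cell AtomValid (Row (Var LoopI)))
         (Store InPool (Var LoopI) (Cell2 StarMember (StarOf (Row (Var LoopI))) (Col (Var LoopI)))))"

definition set_residuals :: bcom where
  "set_residuals =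
     For LoopJ (Var NumClients)
       (Store ResidualDemand (Var LoopJ) (Cell Demand (Var LoopJ) \<ominus> Cell FixedCover (Var LoopJ)))"

abbreviation AtomDist :: "bexpr \<Rightarrow> bexpr \<Rightarrow> bexpr" where
  "AtomDist t j \<equiv> Cell2 Distance (Cell AtomSite t) j"

definition count_closer :: bcom where
  "count_closer =
     SetV Count (Num 0) ;;
     For LoopV (Var NumAtoms) (When (Cell2 InPool (Var LoopV) (Var LoopP) \<otimes>
         Leq (AtomDist (Var LoopV) (Var LoopP)) (AtomDist (Var LoopI) (Var LoopP)))
       (Incr Count (Num 0) (Num 1)))"

definition consider_atom :: bcom where
  "consider_atom =
     count_closer ;;
     When (Leq (Var ClusterSize) (Var Count) \<otimes>
         (Neg (Var Found) \<oplus> Less (AtomDist (Var LoopI) (Var LoopP)) (Var BestDist)))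
       (SetV Found (Num 1) ;;
        SetV BestDist (AtomDist (Var LoopI) (Var LoopP)) ;;
        SetV BestClient (Var LoopP))"

definition search_pool :: bcom where
  "search_pool = For LoopI (Var NumAtoms) (When (Cell2 InPool (Var LoopI) (Var LoopP)) consider_atom)"

definition find_center :: bcom where
  "find_center =
     For LoopP (Var NumClients)
     (When (Less (Cell NumAssigned (Var LoopP)) (Cell ResidualDemand (Var LoopP))) search_pool)"

abbreviation Near :: "bexpr \<Rightarrow> bexpr" where
  "Near t \<equiv> Cell2 InPool t (Var BestClient) \<otimes> Leq (AtomDist t (Var BestClient)) (Var BestDist)"

definition find_old_cluster :: bcom where
  "find_old_cluster =
     SetV CurCluster (Num 0) ;;
     For LoopI (Var NumAtoms)
       (When (Near (Var LoopI) \<otimes> Cell ClusterOf (Var LoopI))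
       (SetV CurCluster (Cell ClusterOf (Var LoopI))))"

definition fill_cluster :: bcom where
  "fill_cluster =
     For LoopI (Var NumAtoms) (When (Near (Var LoopI) \<otimes> Less (Var Count) (Var ClusterSize))
       (Store ClusterOf (Var LoopI) (Var LoopK \<oplus> Num 1) ;;
        Store PositionOf (Var LoopI) (Var Count) ;;
        Incr Count (Num 0) (Num 1)))"

definition new_cluster :: bcom where
  "new_cluster = SetV Count (Num 0) ;; fill_cluster ;; SetV CurCluster (Var LoopK \<oplus> Num 1)"

definition remove_cluster :: bcom where
  "remove_cluster =
     For LoopI (Var NumAtoms) (When (Equ (Cell ClusterOf (Var LoopI)) (Var CurCluster))
       (Store2 InPool (Var LoopI) (Var BestClient) (Num 0)))"

definition serve_center :: bcom where
  "serve_center =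
     find_old_cluster ;;
     When (Neg (Var CurCluster)) new_cluster ;;
     remove_cluster ;;
     Incr NumAssigned (Var BestClient) (Num 1)"

definition form_clusters :: bcom where
  "form_clusters =
     For LoopK (Var NumRounds) (SetV Found (Num 0) ;; find_center ;; When (Var Found) serve_center)"

definition open_atoms :: bcom where
  "open_atoms =
     For LoopI (Var NumAtoms)
       (When (Cell AtomValid (Var LoopI) \<otimes>
           (Neg (Cell ClusterOf (Var LoopI)) \<otimes> Neg (Cell RandomDraw (Var LoopI)) \<oplus>
            Cell ClusterOf (Var LoopI) \<otimes>
              Equ (Cell RandomDraw (Var NumAtoms \<oplus> (Cell ClusterOf (Var LoopI) \<ominus> Num 1)))
              (Cell PositionOf (Var LoopI))))
         (Incr RandomOpen (Cell AtomSite (Var LoopI)) (Num 1)))"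

definition find_free_site :: bcom where
  "find_free_site =
     SetV Found (Num 0) ;;
     For LoopI (Var NumSites)
       (When (Less (Cell2 RandomConn (Var LoopI) (Var LoopJ)) (Cell RandomOpen (Var LoopI)) \<otimes>
           (Neg (Var Found) \<oplus> Less (Cell2 Distance (Var LoopI) (Var LoopJ)) (Var BestDist)))
         (SetV Found (Num 1) ;; SetV BestDist (Cell2 Distance (Var LoopI) (Var LoopJ)) ;;
         SetV BestSite (Var LoopI)))"

definition connect_once :: bcom where
  "connect_once = find_free_site ;; When (Var Found)
      (Incr2 RandomConn (Var BestSite) (Var LoopJ) (Num 1))"

definition connect_client :: bcom where
  "connect_client =
     For LoopK (Var NumStars) (When (Less (Var LoopK) (Cell ResidualDemand (Var LoopJ))) connect_once)"

definition connect_clients :: bcom where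
  "connect_clients = For LoopJ (Var NumClients) connect_client"

definition write_open :: bcom where
  "write_open =
     For LoopI (Var NumSites) (Store Output (Var LoopI) (Cell FixedOpen (Var LoopI) \<oplus>
     Cell RandomOpen (Var LoopI)))"

definition write_conn :: bcom where
  "write_conn =
     For LoopI (Var NumPairs)
       (Store Output (Var NumSites \<oplus> Var LoopI) (Cell FixedConn (Var LoopI) \<oplus>
       Cell RandomConn (Var LoopI)))"

lemmas program_defs =
  load_dims_def load_sizes_def load_counts_def load_open_costs_def load_distances_def load_demands_def
  multiply_open_dens_def multiply_dist_dens_def multiply_demands_def scale_open_costs_def
  scale_distances_def init_weights_def add_member_def add_members_def evaluate_star_def
  keep_if_better_def find_best_star_def record_member_def record_members_def record_star_def
  update_weights_def select_stars_def fix_connections_def fix_star_def split_amounts_def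
  create_atoms_def fill_pools_def set_residuals_def count_closer_def consider_atom_def
  search_pool_def find_center_def find_old_cluster_def fill_cluster_def new_cluster_def
  remove_cluster_def serve_center_def form_clusters_def open_atoms_def find_free_site_def
  connect_once_def connect_client_def connect_clients_def write_open_def write_conn_def

definition set_sizes :: "bcom list" where
  "set_sizes = [load_dims, load_sizes, load_counts]"

definition preprocess :: "bcom list" where
  "preprocess = [load_open_costs, load_distances, load_demands, multiply_open_dens, multiply_dist_dens,
     multiply_demands, scale_open_costs, scale_distances, init_weights]"

definition solve_and_cluster :: "bcom list" where
  "solve_and_cluster = [select_stars, split_amounts, create_atoms, fill_pools, set_residuals,
      form_clusters]"

definition connect_and_write :: "bcom list" where
  "connect_and_write = [open_atoms, connect_clients, write_open, write_conn]"

definition size_bounds :: "bexpr set" where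
  "size_bounds = {Var NumSites, Var NumClients, Var NumPairs, Var NumStars, Var NumAtoms, Var NumRounds,
     Var NumAtoms \<otimes> Var NumClients}"

lemma loops_bounded_program:
  "c \<in> set (preprocess @ solve_and_cluster @ connect_and_write) \<Longrightarrow> loops_bounded_by size_bounds c"
  unfolding preprocess_def solve_and_cluster_def connect_and_write_def
  by (auto simp: loops_bounded_by_def size_bounds_def num_banks_def program_defs)

lemma loops_bounded_set_sizes: "c \<in> set set_sizes \<Longrightarrow> loops_bounded_by {} c"
  unfolding set_sizes_def by (auto simp: loops_bounded_by_def num_banks_def program_defs)

lemma written_program [simp]:
  "written load_dims = {NumSites, NumClients}"
  "written load_sizes = {NumPairs, AtomsPerUnit, ClusterSize}"
  "written load_counts = {NumStars, NumAtoms, NumRounds, NumDraws}"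
  "written load_open_costs = {LoopI, OpenNum, OpenDen}"
  "written load_distances = {LoopI, DistNum, DistDen}"
  "written load_demands = {LoopJ, Demand}"
  "written multiply_open_dens = {DenProd, LoopI}"
  "written multiply_dist_dens = {DenProd, LoopI}"
  "written multiply_demands = {DemandProd, LoopJ}"
  "written scale_open_costs = {LoopI, OpenCost}"
  "written scale_distances = {LoopI, Distance}"
  "written init_weights = {LoopJ, DemandQuot, Weight}"
  "written add_member = {StarCost, StarWeight}"
  "written add_members = {LoopJ, StarCost, StarWeight}"
  "written evaluate_star = {LoopJ, StarCost, StarWeight}"
  "written keep_if_better = {Found, BestCost, BestWeight, BestStar}"
  "written find_best_star = {LoopI, LoopJ, StarCost, StarWeight, Found, BestCost, BestWeight, BestStar}"
  "written record_member = {StarMember, MinDemand}"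
  "written record_members = {LoopJ, StarMember, MinDemand}"
  "written record_star = {LoopJ, StarMember, MinDemand, StarSite, StarAmount}"
  "written update_weights = {LoopJ, Weight, Coverage}"
  "written select_stars = {LoopK, LoopI, LoopJ, StarCost, StarWeight, Found, BestCost,
      BestWeight, BestStar,
     StarMember, MinDemand, StarSite, StarAmount, Weight, Coverage}"
  "written fix_connections = {LoopJ, FixedConn, FixedCover}"
  "written fix_star = {LoopJ, WholePart, FixedOpen, FixedConn, FixedCover}"
  "written split_amounts = {LoopK, LoopJ, WholePart, FixedOpen, FixedConn, FixedCover}"
  "written create_atoms = {LoopI, AtomValid, AtomSite}"
  "written fill_pools = {LoopI, InPool}"
  "written set_residuals = {LoopJ, ResidualDemand}"
  "written count_closer = {LoopV, Count}"
  "written consider_atom = {LoopV, Count, Found, BestDist, BestClient}"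
  "written search_pool = {LoopI, LoopV, Count, Found, BestDist, BestClient}"
  "written find_center = {LoopP, LoopI, LoopV, Count, Found, BestDist, BestClient}"
  "written find_old_cluster = {LoopI, CurCluster}"
  "written fill_cluster = {LoopI, ClusterOf, PositionOf, Count}"
  "written new_cluster = {LoopI, ClusterOf, PositionOf, Count, CurCluster}"
  "written remove_cluster = {LoopI, InPool}"
  "written serve_center = {LoopI, ClusterOf, PositionOf, Count, CurCluster, InPool, NumAssigned}"
  "written form_clusters = {LoopK, LoopP, LoopI, LoopV, Count, Found, BestDist, BestClient,
     ClusterOf, PositionOf, CurCluster, InPool, NumAssigned}"
  "written open_atoms = {LoopI, RandomOpen}"
  "written find_free_site = {LoopI, Found, BestDist, BestSite}"
  "written connect_once = {LoopI, Found, BestDist, BestSite, RandomConn}"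
  "written connect_client = {LoopK, LoopI, Found, BestDist, BestSite, RandomConn}"
  "written connect_clients = {LoopJ, LoopK, LoopI, Found, BestDist, BestSite, RandomConn}"
  "written write_open = {LoopI, Output}"
  "written write_conn = {LoopI, Output}"
  by (auto simp: program_defs)


section \<open>Semantics of the preprocessing\<close>

lemma sem_load_open_costs:
  assumes "2 + 2 * \<sigma> NumSites 0 \<le> base inp" "i < \<sigma> NumSites 0"
  shows "sem inp load_open_costs \<sigma> OpenNum i = inp (2 + 2 * i)"
    "sem inp load_open_costs \<sigma> OpenDen i = inp (3 + 2 * i)"
proof -
  have input: "2 + 2 * x < base inp" "3 + 2 * x < base inp" if "x < \<sigma> NumSites 0" for x
    using that assms(1) by simp_all
  have "sem inp load_open_costs \<sigma> OpenNum i = (if i < \<sigma> NumSites 0 then inp (2 + 2 * i)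
      else \<sigma> OpenNum i)"
    unfolding load_open_costs_def by (rule sem_For_fill_array) (use input in auto)
  moreover have "sem inp load_open_costs \<sigma> OpenDen i = (if i < \<sigma> NumSites 0 then inp (3 + 2 * i)
      else \<sigma> OpenDen i)"
    unfolding load_open_costs_def by (rule sem_For_fill_array) (use input in auto)
  ultimately show "sem inp load_open_costs \<sigma> OpenNum i = inp (2 + 2 * i)"
    "sem inp load_open_costs \<sigma> OpenDen i = inp (3 + 2 * i)" using assms(2) by simp_all
qed

lemma sem_load_distances:
  assumes "2 + 2 * \<sigma> NumSites 0 + 2 * \<sigma> NumPairs 0 \<le> base inp" "t < \<sigma> NumPairs 0"
  shows "sem inp load_distances \<sigma> DistNum t = inp (2 + 2 * \<sigma> NumSites 0 + 2 * t)"
    "sem inp load_distances \<sigma> DistDen t = inp (3 + 2 * \<sigma> NumSites 0 + 2 * t)"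
proof -
  have input: "2 + 2 * \<sigma> NumSites 0 + 2 * x < base inp" "3 + 2 * \<sigma> NumSites 0 + 2 * x < base inp"
    if "x < \<sigma> NumPairs 0" for x
    using that assms(1) by simp_all
  have "sem inp load_distances \<sigma> DistNum t
      = (if t < \<sigma> NumPairs 0 then inp (2 + 2 * \<sigma> NumSites 0 + 2 * t) else \<sigma> DistNum t)"
    unfolding load_distances_def by (rule sem_For_fill_array) (use input in auto)
  moreover have "sem inp load_distances \<sigma> DistDen t
      = (if t < \<sigma> NumPairs 0 then inp (3 + 2 * \<sigma> NumSites 0 + 2 * t) else \<sigma> DistDen t)"
    unfolding load_distances_def by (rule sem_For_fill_array) (use input in auto)
  ultimately show "sem inp load_distances \<sigma> DistNum t = inp (2 + 2 * \<sigma> NumSites 0 + 2 * t)"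
    "sem inp load_distances \<sigma> DistDen t = inp (3 + 2 * \<sigma> NumSites 0 + 2 * t)" using assms(2) by simp_all
qed

lemma sem_load_demands:
  assumes "2 + 2 * \<sigma> NumSites 0 + 2 * \<sigma> NumPairs 0 + \<sigma> NumClients 0 \<le> base inp" "j < \<sigma> NumClients 0"
  shows "sem inp load_demands \<sigma> Demand j = inp (2 + 2 * \<sigma> NumSites 0 + 2 * \<sigma> NumPairs 0 + j)"
proof -
  have "sem inp load_demands \<sigma> Demand j
      = (if j < \<sigma> NumClients 0 then inp (2 + 2 * \<sigma> NumSites 0 + 2 * \<sigma> NumPairs 0 + j) else \<sigma> Demand j)"
    unfolding load_demands_def by (rule sem_For_fill_array) (use assms(1) in auto)
  thus ?thesis using assms(2) by simp
qed

lemma sem_multiply_open_dens: "sem inp multiply_open_dens \<sigma> DenProd 0 = (\<Prod>i<\<sigma> NumSites 0. \<sigma> OpenDen i)"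
proof -
  let ?\<tau> = "sem inp (SetV DenProd (Num 1)) \<sigma>"
  have "sem inp multiply_open_dens \<sigma> DenProd 0 = ?\<tau> DenProd 0 * (\<Prod>i<\<sigma> NumSites 0. \<sigma> OpenDen i)"
    unfolding multiply_open_dens_def sem.simps(3) by (rule sem_For_prod) auto
  thus ?thesis by simp
qed

lemma sem_multiply_dist_dens:
  "sem inp multiply_dist_dens \<sigma> DenProd 0 = \<sigma> DenProd 0 * (\<Prod>t<\<sigma> NumPairs 0. \<sigma> DistDen t)"
  unfolding multiply_dist_dens_def by (rule sem_For_prod) auto

lemma sem_multiply_demands: "sem inp multiply_demands \<sigma> DemandProd 0 = (\<Prod>j<\<sigma> NumClients 0. \<sigma> Demand j)"
proof -
  let ?\<tau> = "sem inp (SetV DemandProd (Num 1)) \<sigma>"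
  have "sem inp multiply_demands \<sigma> DemandProd 0 = ?\<tau> DemandProd 0 * (\<Prod>j<\<sigma> NumClients 0. \<sigma> Demand j)"
    unfolding multiply_demands_def sem.simps(3) by (rule sem_For_prod) auto
  thus ?thesis by simp
qed

lemma sem_scale_open_costs:
  "sem inp scale_open_costs \<sigma> OpenCost i =
     (if i < \<sigma> NumSites 0 then \<sigma> OpenNum i * (\<sigma> DenProd 0 div \<sigma> OpenDen i) else \<sigma> OpenCost i)"
  unfolding scale_open_costs_def by (rule sem_For_fill_array) auto

lemma sem_scale_distances:
  "sem inp scale_distances \<sigma> Distance t =
     (if t < \<sigma> NumPairs 0 then \<sigma> DistNum t * (\<sigma> DenProd 0 div \<sigma> DistDen t) else \<sigma> Distance t)"
  unfolding scale_distances_def by (rule sem_For_fill_array) auto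

lemma sem_init_weights:
  "sem inp init_weights \<sigma> DemandQuot j = (if j < \<sigma> NumClients 0 then \<sigma> DemandProd 0 div \<sigma> Demand j
      else \<sigma> DemandQuot j)"
  "sem inp init_weights \<sigma> Weight j = (if j < \<sigma> NumClients 0 then \<sigma> DemandProd 0 div \<sigma> Demand j
      else \<sigma> Weight j)"
  unfolding init_weights_def by (rule sem_For_fill_array; auto)+

definition sized :: "memory \<Rightarrow> banks" where
  "sized inp = sems inp set_sizes (\<lambda>_ _. 0)"

definition prepared :: "memory \<Rightarrow> banks" where
  "prepared inp = sems inp preprocess (sized inp)"

definition common_den :: "memory \<Rightarrow> nat" where
  "common_den inp = (\<Prod>i<inp 0. inp (3 + 2 * i)) * (\<Prod>t<inp 0 * inp 1. inp (3 + 2 * inp 0 + 2 * t))"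

lemma sized_values:
  fixes inp :: memory
  defines "u \<equiv> 19 * (1000000 * (inp 1 + 1))"
  shows "sized inp NumSites 0 = inp 0" "sized inp NumClients 0 = inp 1"
    "sized inp NumPairs 0 = inp 0 * inp 1"
    and "sized inp AtomsPerUnit 0 = u" "sized inp ClusterSize 0 = 11 * (1000000 * (inp 1 + 1))"
    and "sized inp NumStars 0 = inp 1 * u" "sized inp NumAtoms 0 = inp 1 * u * u"
      "sized inp NumRounds 0 = inp 1 * (inp 1 * u)"
    and "sized inp NumDraws 0 = inp 1 * u * u + inp 1 * (inp 1 * u)"
  using base_ge_two[of inp]
  by (simp_all add: sized_def set_sizes_def load_dims_def load_sizes_def load_counts_def u_def)

lemma sized_zero: "k \<notin> {NumSites..NumDraws} \<Longrightarrow> sized inp k = (\<lambda>_. 0)"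
  unfolding sized_def by (subst sems_unwritten) (auto simp: set_sizes_def)

lemma prepared_unwritten: "k \<notin> {OpenNum..Weight} \<union> {LoopI, LoopJ} \<Longrightarrow> prepared inp k = sized inp k"
  unfolding prepared_def by (rule sems_unwritten) (auto simp: preprocess_def)

lemma prepared_values:
  fixes inp :: memory
  defines "m \<equiv> inp 0" and "n \<equiv> inp 1"
  defines "req \<equiv> (\<lambda>j. inp (2 + 2 * m + 2 * (m * n) + j))"
  shows "i < m \<Longrightarrow> prepared inp OpenCost i = inp (2 + 2 * i) * (common_den inp div inp (3 + 2 * i))"
    and "t < m * n \<Longrightarrow> prepared inp Distance t = inp (2 + 2 * m + 2 * t) *
        (common_den inp div inp (3 + 2 * m + 2 * t))"
    and "j < n \<Longrightarrow> prepared inp Demand j = req j"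
    and "prepared inp DemandProd 0 = (\<Prod>j<n. req j)"
    and "j < n \<Longrightarrow> prepared inp DemandQuot j = (\<Prod>j<n. req j) div req j"
    and "j < n \<Longrightarrow> prepared inp Weight j = (\<Prod>j<n. req j) div req j"
proof -
  have base: "base inp = 2 + 2 * m + 2 * (m * n) + n" by (simp add: base_def m_def n_def)
  note rules = sized_values[of inp, folded m_def n_def] base sem_unwritten
    sem_load_open_costs sem_load_distances sem_load_demands sem_multiply_open_dens
      sem_multiply_dist_dens
    sem_multiply_demands sem_scale_open_costs sem_scale_distances sem_init_weights
  have "common_den inp = (\<Prod>i<m. inp (3 + 2 * i)) * (\<Prod>t<m * n. inp (3 + 2 * m + 2 * t))"
    by (simp add: common_den_def m_def n_def)
  note defs = this prepared_def preprocess_def req_def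
  show "i < m \<Longrightarrow> prepared inp OpenCost i = inp (2 + 2 * i) * (common_den inp div inp (3 + 2 * i))"
    "t < m * n \<Longrightarrow> prepared inp Distance t = inp (2 + 2 * m + 2 * t) *
        (common_den inp div inp (3 + 2 * m + 2 * t))"
    "j < n \<Longrightarrow> prepared inp Demand j = req j"
    "prepared inp DemandProd 0 = (\<Prod>j<n. req j)"
    "j < n \<Longrightarrow> prepared inp DemandQuot j = (\<Prod>j<n. req j) div req j"
    "j < n \<Longrightarrow> prepared inp Weight j = (\<Prod>j<n. req j) div req j"
    by (simp_all add: defs rules)
qed


section \<open>Semantics of the star selection\<close>

lemma row_major_less:
  assumes "i < m" "j < (n::nat)" shows "i * n + j < m * n"
proof -
  have "i * n + j < Suc i * n" using assms(2) by simp
  also have "\<dots> \<le> m * n" using assms(1) by (intro mult_le_mono1) simp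
  finally show ?thesis .
qed

lemma row_major_eq_iff:
  assumes "j < (n::nat)" "j' < n" shows "i * n + j = i' * n + j' \<longleftrightarrow> i = i' \<and> j = j'"
proof
  assume "i * n + j = i' * n + j'"
  hence "(i * n + j) div n = (i' * n + j') div n" "(i * n + j) mod n = (i' * n + j') mod n" by simp_all
  thus "i = i' \<and> j = j'" using assms by simp
qed simp

lemma sum_if_mem:
  fixes N :: nat
  assumes "S \<subseteq> {..<N}" shows "(\<Sum>x<N. if x \<in> S then f x else 0) = sum f S"
  by (rule sum.mono_neutral_cong_right) (use assms in auto)

text \<open>The state of a search for a candidate with the least key: \<open>found = 0\<close> until a candidate turns up.\<close>

definition tracks_min :: "('a \<Rightarrow> 'b :: linorder) \<Rightarrow> 'a set \<Rightarrow> nat \<Rightarrow> 'a \<Rightarrow> bool" where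
  "tracks_min key C found best \<longleftrightarrow> (if found = 0 then C = {} else is_arg_min key (\<lambda>c. c \<in> C) best)"

lemma tracks_min_init: "tracks_min key {} 0 best"
  by (simp add: tracks_min_def)

lemma tracks_min_better:
  "tracks_min key C found best \<Longrightarrow> found = 0 \<or> key c < key best \<Longrightarrow> 0 < found' \<Longrightarrow>
      tracks_min key (insert c C) found' c"
  by (auto simp: tracks_min_def is_arg_min_linorder split: if_splits intro: order_trans less_imp_le)

lemma tracks_min_worse:
  "tracks_min key C found best \<Longrightarrow> \<not> (found = 0 \<or> key c < key best) \<Longrightarrow>
      tracks_min key (insert c C) found best"
  by (auto simp: tracks_min_def is_arg_min_linorder)

lemma tracks_minD:
  assumes "tracks_min key C found best" "found \<noteq> 0"
  shows "best \<in> C" "c \<in> C \<Longrightarrow> key best \<le> key c"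
  using assms by (auto simp: tracks_min_def is_arg_min_linorder)

lemma frac_less_iff: "0 < w \<Longrightarrow> 0 < w' \<Longrightarrow> real c / real w < real c' / real w' \<longleftrightarrow> c * w' < c' * w"
  by (simp add: divide_less_eq less_divide_eq mult.commute flip: of_nat_mult)

context scaled_ftfp
begin

definition data_loaded :: "banks \<Rightarrow> bool" where
  "data_loaded \<sigma> \<longleftrightarrow> \<sigma> NumSites 0 = m \<and> \<sigma> NumClients 0 = n \<and> \<sigma> NumPairs 0 = m * n \<and>
     \<sigma> AtomsPerUnit 0 = atoms_per_unit \<and> \<sigma> ClusterSize 0 = cluster_size \<and>
     \<sigma> NumStars 0 = n * atoms_per_unit \<and> \<sigma> NumAtoms 0 = n * atoms_per_unit * atoms_per_unit \<and>
     \<sigma> NumRounds 0 = n * (n * atoms_per_unit) \<and>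
     (\<forall>j<n. \<sigma> Demand j = r j) \<and> \<sigma> DemandProd 0 = demand_prod \<and> (\<forall>i<m. \<sigma> OpenCost i = F i) \<and>
     (\<forall>i<m. \<forall>j<n. \<sigma> Distance (i * n + j) = D i j) \<and> (\<forall>j<n. \<sigma> DemandQuot j = demand_prod div r j)"

lemma data_loadedD:
  assumes "data_loaded \<sigma>"
  shows "\<sigma> NumSites 0 = m" "\<sigma> NumClients 0 = n" "\<sigma> NumPairs 0 = m * n"
    "\<sigma> AtomsPerUnit 0 = atoms_per_unit"
    "\<sigma> ClusterSize 0 = cluster_size" "\<sigma> NumStars 0 = n * atoms_per_unit"
    "\<sigma> NumAtoms 0 = n * atoms_per_unit * atoms_per_unit" "\<sigma> NumRounds 0 = n * (n * atoms_per_unit)"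
    "\<And>j. j < n \<Longrightarrow> \<sigma> Demand j = r j" "\<sigma> DemandProd 0 = demand_prod" "\<And>i. i < m \<Longrightarrow> \<sigma> OpenCost i = F i"
    "\<And>i j. i < m \<Longrightarrow> j < n \<Longrightarrow> \<sigma> Distance (i * n + j) = D i j"
      "\<And>j. j < n \<Longrightarrow> \<sigma> DemandQuot j = demand_prod div r j"
  using assms unfolding data_loaded_def by blast+

abbreviation "data_banks \<equiv> {NumSites..DemandQuot}"

lemma data_loaded_cong:
  assumes "data_loaded \<sigma>" "\<And>l. l \<in> data_banks \<Longrightarrow> \<tau> l = \<sigma> l"
  shows "data_loaded \<tau>"
  using assms(1) unfolding data_loaded_def by (simp add: assms(2))

lemma sem_When_InStar:
  assumes "data_loaded \<sigma>" "i < m" "l < n" "\<sigma> v 0 = i * n + l" "j < n" "\<tau> w 0 = j"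
    and "\<And>k. k \<in> data_banks \<union> {Weight, Coverage, v} \<Longrightarrow> \<tau> k = \<sigma> k"
  shows "sem inp (When (InStar (Var v) (Var w)) c) \<tau>
    = (if j \<in> star (\<sigma> Weight) (\<sigma> Coverage) i l then sem inp c \<tau> else \<tau>)"
  by (rule sem_When) (use assms in \<open>auto simp: data_loadedD star_def active_def\<close>)

lemma sem_add_members:
  assumes loaded: "data_loaded \<sigma>" and index: "i < m" "l < n" "\<sigma> LoopI 0 = i * n + l"
  defines "S \<equiv> star (\<sigma> Weight) (\<sigma> Coverage) i l"
  shows "sem inp add_members \<sigma> StarCost 0 = \<sigma> StarCost 0 + (\<Sum>j\<in>S. D i j)"
    and "sem inp add_members \<sigma> StarWeight 0 = \<sigma> StarWeight 0 + sum (\<sigma> Weight) S"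
proof -
  have round: "sem inp (When (InStar (Var LoopI) (Var LoopJ)) add_member) \<tau> StarCost 0
      = \<tau> StarCost 0 + (if j \<in> S then D i j else 0)"
    "sem inp (When (InStar (Var LoopI) (Var LoopJ)) add_member) \<tau> StarWeight 0 = \<tau> StarWeight 0 +
        (if j \<in> S then \<sigma> Weight j else 0)"
    if "j < n" "\<tau> LoopJ 0 = j" "\<And>k. k \<notin> {LoopJ, StarCost, StarWeight} \<Longrightarrow> \<tau> k = \<sigma> k" for j \<tau>
  proof -
    have member: "sem inp (When (InStar (Var LoopI) (Var LoopJ)) add_member) \<tau>
        = (if j \<in> S then sem inp add_member \<tau> else \<tau>)"
      unfolding S_def by (rule sem_When_InStar[OF loaded index]) (use that in auto)
    show "sem inp (When (InStar (Var LoopI) (Var LoopJ)) add_member) \<tau> StarCost 0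
        = \<tau> StarCost 0 + (if j \<in> S then D i j else 0)"
      "sem inp (When (InStar (Var LoopI) (Var LoopJ)) add_member) \<tau> StarWeight 0 = \<tau> StarWeight 0 +
          (if j \<in> S then \<sigma> Weight j else 0)"
      unfolding member using that index loaded by (simp_all add: add_member_def data_loadedD)
  qed
  have "S \<subseteq> {..<n}" unfolding S_def by (rule star_subset(2))
  have "sem inp add_members \<sigma> StarCost 0 = \<sigma> StarCost 0 + (\<Sum>j<n. if j \<in> S then D i j else 0)"
    unfolding add_members_def
    by (rule sem_For_sum) (use round(1) loaded in \<open>auto simp: data_loadedD simp del: sem.simps\<close>)
  thus "sem inp add_members \<sigma> StarCost 0 = \<sigma> StarCost 0 + (\<Sum>j\<in>S. D i j)"
    unfolding sum_if_mem[OF \<open>S \<subseteq> {..<n}\<close>] .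
  have "sem inp add_members \<sigma> StarWeight 0 = \<sigma> StarWeight 0 + (\<Sum>j<n. if j \<in> S then \<sigma> Weight j else 0)"
    unfolding add_members_def
    by (rule sem_For_sum) (use round(2) loaded in \<open>auto simp: data_loadedD simp del: sem.simps\<close>)
  thus "sem inp add_members \<sigma> StarWeight 0 = \<sigma> StarWeight 0 + sum (\<sigma> Weight) S"
    unfolding sum_if_mem[OF \<open>S \<subseteq> {..<n}\<close>] .
qed

lemma sem_evaluate_star:
  assumes loaded: "data_loaded \<sigma>" and index: "i < m" "l < n" "\<sigma> LoopI 0 = i * n + l"
  defines "S \<equiv> star (\<sigma> Weight) (\<sigma> Coverage) i l"
  shows "sem inp evaluate_star \<sigma> StarCost 0 = star_cost i S"
    "sem inp evaluate_star \<sigma> StarWeight 0 = sum (\<sigma> Weight) S"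
proof -
  let ?\<tau> = "sem inp (SetV StarWeight (Num 0))
      (sem inp (SetV StarCost (Cell OpenCost (Row (Var LoopI)))) \<sigma>)"
  have "data_loaded ?\<tau>" by (rule data_loaded_cong[OF loaded]) auto
  note sums = sem_add_members[OF this index(1,2), of inp]
  show "sem inp evaluate_star \<sigma> StarCost 0 = star_cost i S"
    "sem inp evaluate_star \<sigma> StarWeight 0 = sum (\<sigma> Weight) S"
    using sums index loaded by (simp_all add: evaluate_star_def data_loadedD star_cost_def S_def)
qed

definition site_client :: "nat \<Rightarrow> nat \<times> nat" where
  "site_client t = (t div n, t mod n)"

definition tracks_best_star :: "(nat \<Rightarrow> nat) \<Rightarrow> (nat \<Rightarrow> nat) \<Rightarrow> nat \<Rightarrow> banks \<Rightarrow> bool" where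
  "tracks_best_star W H x \<tau> \<longleftrightarrow> (let (i, l) = site_client (\<tau> BestStar 0) in
     tracks_min (star_ratio W H) (site_client ` {t. t < x \<and> t mod n \<in> active H}) (\<tau> Found 0) (i, l) \<and>
     (\<tau> Found 0 \<noteq> 0 \<longrightarrow> \<tau> BestCost 0 = star_cost i (star W H i l) \<and>
     \<tau> BestWeight 0 = sum W (star W H i l)))"

lemma tracks_best_star_cong:
  "tracks_best_star W H x \<tau> \<Longrightarrow> (\<And>k. k \<in> {Found, BestCost, BestWeight, BestStar} \<Longrightarrow> \<tau>' k = \<tau> k) \<Longrightarrow>
   tracks_best_star W H x \<tau>'"
  by (simp add: tracks_best_star_def)

lemma tracks_best_star_step:
  assumes W_pos: "\<And>j. j < n \<Longrightarrow> 0 < W j" and inv: "tracks_best_star W H x \<tau>" and x_index: "\<tau> LoopI 0 = x"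
    and l_active: "x mod n \<in> active H"
    and star: "\<tau> StarCost 0 = star_cost (x div n) (star W H (x div n) (x mod n))"
      "\<tau> StarWeight 0 = sum W (star W H (x div n) (x mod n))"
  shows "tracks_best_star W H (Suc x) (sem inp keep_if_better \<tau>)"
proof -
  define i' l' where "i' = \<tau> BestStar 0 div n" and "l' = \<tau> BestStar 0 mod n"
  let ?C = "\<lambda>x. site_client ` {t. t < x \<and> t mod n \<in> active H}"
  have C_Suc: "?C (Suc x) = insert (x div n, x mod n) (?C x)"
    using l_active by (auto simp: less_Suc_eq site_client_def)
  have inv': "tracks_min (star_ratio W H) (?C x) (\<tau> Found 0) (i', l')"
    and best: "\<tau> Found 0 \<noteq> 0 \<Longrightarrow> \<tau> BestCost 0 = star_cost i' (star W H i' l') \<and>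
        \<tau> BestWeight 0 = sum W (star W H i' l')"
    using inv by (auto simp: tracks_best_star_def site_client_def i'_def l'_def)
  have better:
    "ev inp \<tau> (Neg (Var Found) \<oplus> Less (Var StarCost \<otimes> Var BestWeight) (Var BestCost \<otimes>
      Var StarWeight)) \<noteq> 0 \<longleftrightarrow>
      \<tau> Found 0 = 0 \<or> star_ratio W H (x div n, x mod n) < star_ratio W H (i', l')"
  proof (cases "\<tau> Found 0 = 0")
    case False
    have "l' \<in> active H" using tracks_minD(1)[OF inv' False] by (auto simp: site_client_def)
    hence "0 < sum W (star W H i' l')" "0 < sum W (star W H (x div n) (x mod n))"
      using star_weight_pos W_pos l_active by blast+
    thus ?thesis using False best star by (auto simp: star_ratio_def frac_less_iff simp del: of_nat_sum)
  qed simp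
  show ?thesis
  proof (cases "\<tau> Found 0 = 0 \<or> star_ratio W H (x div n, x mod n) < star_ratio W H (i', l')")
    case True
    from tracks_min_better[OF inv' this] show ?thesis
      using True x_index star unfolding keep_if_better_def sem_When[OF better]
      by (simp add: tracks_best_star_def site_client_def C_Suc[unfolded site_client_def])
  next
    case False
    from tracks_min_worse[OF inv' this] show ?thesis
      using False inv unfolding keep_if_better_def sem_When[OF better]
      by (simp add: tracks_best_star_def C_Suc i'_def l'_def site_client_def[of "\<tau> BestStar 0"])
  qed
qed

lemma sem_find_best_star:
  assumes loaded: "data_loaded \<sigma>" and W_pos: "\<And>j. j < n \<Longrightarrow> 0 < \<sigma> Weight j" and unset: "\<sigma> Found 0 = 0"
  shows "tracks_best_star (\<sigma> Weight) (\<sigma> Coverage) (m * n) (sem inp find_best_star \<sigma>)"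
  unfolding find_best_star_def
proof (induct rule: sem_For_invariant[where P = "tracks_best_star (\<sigma> Weight) (\<sigma> Coverage)"])
  case (step x \<tau>)
  have same: "\<tau> k = \<sigma> k" if "k \<notin> {LoopI, LoopJ, StarCost, StarWeight, Found, BestCost, BestWeight,
      BestStar}" for k
    by (rule step(3)) (use that in simp)
  have loaded': "data_loaded \<tau>" by (rule data_loaded_cong[OF loaded]) (simp add: same)
  define i l where "i = x div n" and "l = x mod n"
  have x_split: "x = i * n + l" by (simp add: i_def l_def)
  have "0 < n" using step(1) by (cases n) auto
  hence il_less: "i < m" "l < n" using step(1) by (simp_all add: i_def l_def less_mult_imp_div_less)
  have active: "ev inp \<tau> (Active (Col (Var LoopI))) \<noteq> 0 \<longleftrightarrow> l \<in> active (\<sigma> Coverage)"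
    using step(2) il_less loaded by (simp add: data_loadedD x_split same active_def not_le)
  show ?case
  proof (cases "l \<in> active (\<sigma> Coverage)")
    case True
    let ?\<tau> = "sem inp evaluate_star \<tau>"
    have "tracks_best_star (\<sigma> Weight) (\<sigma> Coverage) x ?\<tau>"
      by (rule tracks_best_star_cong[OF step(4)]) (auto simp: sem_unwritten)
    moreover have "?\<tau> StarCost 0 = star_cost i (star (\<sigma> Weight) (\<sigma> Coverage) i l)"
      "?\<tau> StarWeight 0 = sum (\<sigma> Weight) (star (\<sigma> Weight) (\<sigma> Coverage) i l)"
      using sem_evaluate_star[OF loaded' il_less, of inp] step(2) x_split same[of Weight]
        same[of Coverage] by simp_all
    ultimately have "tracks_best_star (\<sigma> Weight) (\<sigma> Coverage) (Suc x) (sem inp keep_if_better ?\<tau>)"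
      using True step(2) W_pos by (intro tracks_best_star_step)
        (simp_all add: sem_unwritten i_def l_def)
    thus ?thesis using True unfolding sem_When[OF active] by (auto elim!: tracks_best_star_cong)
  next
    case False
    hence "{t. t < Suc x \<and> t mod n \<in> active (\<sigma> Coverage)} = {t. t < x \<and> t mod n \<in> active (\<sigma> Coverage)}"
      by (auto simp: less_Suc_eq l_def)
    hence "tracks_best_star (\<sigma> Weight) (\<sigma> Coverage) (Suc x) \<tau>"
      using step(4) by (simp add: tracks_best_star_def)
    thus ?thesis using False unfolding sem_When[OF active] by (auto elim!: tracks_best_star_cong)
  qed
qed (use loaded unset in \<open>auto simp: data_loadedD tracks_best_star_def tracks_min_def site_client_def\<close>)

lemma tracks_best_star_end:
  assumes "tracks_best_star W H (m * n) \<tau>"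
  shows "\<tau> Found 0 = 0 \<Longrightarrow> active H = {}"
    and "\<tau> Found 0 \<noteq> 0 \<Longrightarrow> best_star W H (\<tau> BestStar 0 div n) (\<tau> BestStar 0 mod n)"
proof -
  have pairs: "site_client ` {t. t < m * n \<and> t mod n \<in> active H} = {..<m} \<times> active H"
  proof (intro equalityI subsetI)
    fix p assume "p \<in> {..<m} \<times> active H"
    then obtain i l where "p = (i, l)" "i < m" "l \<in> active H" by auto
    moreover from this have "l < n" by (simp add: active_def)
    ultimately show "p \<in> site_client ` {t. t < m * n \<and> t mod n \<in> active H}"
      by (intro image_eqI[of _ _ "i * n + l"]) (auto simp: site_client_def row_major_less)
  qed (auto simp: site_client_def less_mult_imp_div_less)
  show "active H = {}" if "\<tau> Found 0 = 0"
  proof -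
    have "active H = {} \<or> m = 0" using assms that
      by (auto simp: tracks_best_star_def tracks_min_def pairs)
    thus ?thesis using sites_nonempty by (auto simp: active_def)
  qed
  show "best_star W H (\<tau> BestStar 0 div n) (\<tau> BestStar 0 mod n)" if "\<tau> Found 0 \<noteq> 0"
    using assms that by (simp add: tracks_best_star_def tracks_min_def pairs best_star_def
      site_client_def[of "\<tau> BestStar 0"])
qed

context
  fixes inp :: memory and \<sigma> :: banks and i l k :: nat
  assumes loaded: "data_loaded \<sigma>" and best: "i < m" "l < n" "\<sigma> BestStar 0 = i * n + l"
    and k_index: "\<sigma> LoopK 0 = k"
begin

abbreviation "best_members \<equiv> star (\<sigma> Weight) (\<sigma> Coverage) i l"

lemma sem_When_record_member:
  assumes "j < n" "\<tau> LoopJ 0 = j" "\<And>l. l \<notin> {LoopJ, StarMember, MinDemand} \<Longrightarrow> \<tau> l = \<sigma> l"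
  shows "sem inp (When (InStar (Var BestStar) (Var LoopJ)) record_member) \<tau>
    = (if j \<in> best_members then sem inp record_member \<tau> else \<tau>)"
  by (rule sem_When_InStar[OF loaded best]) (use assms in auto)

lemma record_members_star_amount:
  assumes unset: "\<sigma> MinDemand 0 = 0" and nonempty: "best_members \<noteq> {}"
  shows "sem inp record_members \<sigma> MinDemand 0 = star_amount best_members"
proof -
  let ?P = "\<lambda>x \<tau>. tracks_min id (r ` (best_members \<inter> {..<x})) (\<tau> MinDemand 0) (\<tau> MinDemand 0)"
  have "?P n (sem inp record_members \<sigma>)"
    unfolding record_members_def
  proof (induct rule: sem_For_invariant[where P = ?P])
    case (step x \<tau>)
    have same: "\<tau> l = \<sigma> l" if "l \<notin> {LoopJ, StarMember, MinDemand}" for l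
      by (rule step(3)) (use that in simp)
    have round: "sem inp (When (InStar (Var BestStar) (Var LoopJ)) record_member) \<tau>
        = (if x \<in> best_members then sem inp record_member \<tau> else \<tau>)"
      by (rule sem_When_record_member) (use step(1,2) same in simp_all)
    show ?case
    proof (cases "x \<in> best_members")
      case True
      hence "r ` (best_members \<inter> {..<Suc x}) = insert (r x) (r ` (best_members \<inter> {..<x}))"
        by (auto simp: less_Suc_eq)
      thus ?thesis
        using tracks_min_better[OF step(4), of "r x" "r x"] tracks_min_worse[OF step(4), of "r x"]
          r_pos[OF step(1)]
          True step(1,2) loaded same unfolding round by (auto simp: record_member_def data_loadedD)
    next
      case False
      hence "best_members \<inter> {..<Suc x} = best_members \<inter> {..<x}" by (auto simp: less_Suc_eq)
      thus ?thesis using False step(4) unfolding round by simp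
    qed
  qed (use loaded unset tracks_min_init in \<open>simp_all add: data_loadedD\<close>)
  moreover have "best_members \<inter> {..<n} = best_members" using star_subset(2) by blast
  ultimately show ?thesis
    unfolding star_amount_def using nonempty
    by (intro Min_eqI[symmetric]) (auto simp: tracks_min_def is_arg_min_linorder split: if_splits)
qed

lemma record_members_StarMember:
  "sem inp record_members \<sigma> StarMember y = (if \<exists>j\<in>best_members. y = k * n + j then 1
      else \<sigma> StarMember y)"
proof -
  let ?g = "\<lambda>y. if \<exists>j\<in>best_members. y = k * n + j then 1 else \<sigma> StarMember y"
  have "sem inp record_members \<sigma> StarMember y =
      (if y \<in> (\<lambda>j. k * n + j) ` {..<n} then ?g y else \<sigma> StarMember y)"
    unfolding record_members_def
  proof (rule sem_For_fill, goal_cases bound fresh other inj step)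
    case (step x \<tau>)
    hence same: "\<tau> l = \<sigma> l" if "l \<notin> {LoopJ, StarMember, MinDemand}" for l using that by simp
    have round: "sem inp (When (InStar (Var BestStar) (Var LoopJ)) record_member) \<tau>
        = (if x \<in> best_members then sem inp record_member \<tau> else \<tau>)"
      by (rule sem_When_record_member) (use step(1,2) same in simp_all)
    show ?case
      using step(2,4) loaded k_index same unfolding round
      by (auto simp: record_member_def data_loadedD fun_upd_idem)
  qed (use loaded in \<open>simp_all add: data_loadedD\<close>)
  moreover have "best_members \<subseteq> {..<n}" by (rule star_subset(2))
  ultimately show ?thesis by auto
qed

end

lemma sem_record_star:
  fixes inp :: memory and \<sigma> :: banks and i l :: nat
  assumes loaded: "data_loaded \<sigma>" and best: "\<sigma> BestStar 0 = i * n + l" "i < m"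
    "l \<in> active (\<sigma> Coverage)" and k_index: "\<sigma> LoopK 0 = k"
  defines "S \<equiv> star (\<sigma> Weight) (\<sigma> Coverage) i l" and "\<tau> \<equiv> sem inp record_star \<sigma>"
  shows "\<tau> MinDemand 0 = star_amount S" "\<tau> StarSite = (\<sigma> StarSite)(k := i)"
    "\<tau> StarAmount = (\<sigma> StarAmount)(k := star_amount S)"
    and "\<tau> StarMember y = (if \<exists>j\<in>S. y = k * n + j then 1 else \<sigma> StarMember y)"
proof -
  let ?\<sigma> = "sem inp (SetV MinDemand (Num 0)) \<sigma>"
  have "l < n" "S \<noteq> {}" using best(3) star_self[of l "\<sigma> Coverage"] by (auto simp: active_def S_def)
  have loaded': "data_loaded ?\<sigma>" by (rule data_loaded_cong[OF loaded]) auto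
  note members = record_members_star_amount[OF loaded' best(2) \<open>l < n\<close>, where inp = inp and k = k]
    record_members_StarMember[OF loaded' best(2) \<open>l < n\<close>, where inp = inp and k = k]
  show "\<tau> MinDemand 0 = star_amount S" "\<tau> StarSite = (\<sigma> StarSite)(k := i)"
    "\<tau> StarAmount = (\<sigma> StarAmount)(k := star_amount S)"
    "\<tau> StarMember y = (if \<exists>j\<in>S. y = k * n + j then 1 else \<sigma> StarMember y)"
    using members best k_index \<open>S \<noteq> {}\<close> \<open>l < n\<close> loaded
    by (auto simp: \<tau>_def record_star_def S_def sem_unwritten data_loadedD)
qed

lemma sem_update_weights:
  assumes loaded: "data_loaded \<sigma>" and k_index: "\<sigma> LoopK 0 = k"
    and S_members: "\<And>j. j < n \<Longrightarrow> \<sigma> StarMember (k * n + j) \<noteq> 0 \<longleftrightarrow> j \<in> S" and j_less: "j < n"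
  shows "sem inp update_weights \<sigma> Weight j = upd_W S (\<sigma> MinDemand 0) (\<sigma> Weight) j"
    and "sem inp update_weights \<sigma> Coverage j = upd_H S (\<sigma> MinDemand 0) (\<sigma> Coverage) j"
proof -
  have "sem inp update_weights \<sigma> Weight j = (if j < n then upd_W S (\<sigma> MinDemand 0) (\<sigma> Weight) j
      else \<sigma> Weight j)"
    unfolding update_weights_def
    by (rule sem_For_fill_array) (use loaded k_index S_members in \<open>auto simp: data_loadedD upd_W_def\<close>)
  thus "sem inp update_weights \<sigma> Weight j = upd_W S (\<sigma> MinDemand 0) (\<sigma> Weight) j" using j_less by simp
  have "sem inp update_weights \<sigma> Coverage j = (if j < n then upd_H S (\<sigma> MinDemand 0) (\<sigma> Coverage) j
      else \<sigma> Coverage j)"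
    unfolding update_weights_def
    by (rule sem_For_fill_array)
      (use loaded k_index S_members in \<open>auto simp: data_loadedD upd_H_def fun_upd_idem\<close>)
  thus "sem inp update_weights \<sigma> Coverage j = upd_H S (\<sigma> MinDemand 0) (\<sigma> Coverage) j"
    using j_less by simp
qed

definition members_of :: "banks \<Rightarrow> nat \<Rightarrow> nat set" where
  "members_of \<tau> k = {j. j < n \<and> \<tau> StarMember (k * n + j) \<noteq> 0}"

definition stars_cost :: "banks \<Rightarrow> nat \<Rightarrow> nat" where
  "stars_cost \<tau> k = (\<Sum>k'<k. star_cost (\<tau> StarSite k') (members_of \<tau> k') * \<tau> StarAmount k')"

definition star_history :: "nat \<Rightarrow> banks \<Rightarrow> bool" where
  "star_history k \<tau> \<longleftrightarrow>
     (\<forall>Z\<ge>0. dual_bound Z \<longrightarrow> mwu_inv Z k (\<tau> Weight) (\<tau> Coverage) (stars_cost \<tau> k)) \<and>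
     (\<forall>j<n. 0 < \<tau> Weight j) \<and>
     (\<forall>j<n. \<tau> Coverage j = (\<Sum>k'<k. if j \<in> members_of \<tau> k' then \<tau> StarAmount k' else 0)) \<and>
     (\<forall>k'. \<tau> StarAmount k' = 0 \<or> \<tau> StarSite k' < m) \<and>
     (\<forall>k'\<ge>k. \<tau> StarAmount k' = 0) \<and> (\<forall>y\<ge>k * n. \<tau> StarMember y = 0)"

lemma star_historyD:
  assumes "star_history k \<tau>"
  shows "0 \<le> Z \<Longrightarrow> dual_bound Z \<Longrightarrow> mwu_inv Z k (\<tau> Weight) (\<tau> Coverage) (stars_cost \<tau> k)"
    and "j < n \<Longrightarrow> 0 < \<tau> Weight j"
    and "j < n \<Longrightarrow> \<tau> Coverage j = (\<Sum>k'<k. if j \<in> members_of \<tau> k' then \<tau> StarAmount k' else 0)"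
    and "\<tau> StarAmount k' = 0 \<or> \<tau> StarSite k' < m"
    and "k \<le> k' \<Longrightarrow> \<tau> StarAmount k' = 0" and "k * n \<le> y \<Longrightarrow> \<tau> StarMember y = 0"
  using assms unfolding star_history_def by blast+

lemma star_history_cong:
  assumes "star_history k \<tau>" "\<And>l. l \<in> {Weight, Coverage, StarSite, StarAmount, StarMember} \<Longrightarrow> \<tau>' l = \<tau> l"
  shows "star_history k \<tau>'"
proof -
  have "\<tau>' Weight = \<tau> Weight" "\<tau>' Coverage = \<tau> Coverage" "\<tau>' StarSite = \<tau> StarSite"
    "\<tau>' StarAmount = \<tau> StarAmount"
    "\<tau>' StarMember = \<tau> StarMember"
    using assms(2) by auto
  with assms(1) show ?thesis unfolding star_history_def stars_cost_def members_of_def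
    by (simp cong: if_cong)
qed

lemma star_history_init:
  assumes "\<And>j. j < n \<Longrightarrow> \<tau> Weight j = demand_prod div r j"
    and "\<tau> Coverage = (\<lambda>_. 0)" "\<tau> StarAmount = (\<lambda>_. 0)" "\<tau> StarMember = (\<lambda>_. 0)"
  shows "star_history 0 \<tau>"
  using assms mwu_inv_init[of _ "\<tau> Weight" "\<tau> Coverage"] demand_prod_div_pos
  by (simp add: star_history_def stars_cost_def)

lemma star_history_skip:
  assumes "star_history k \<tau>" "active (\<tau> Coverage) = {}"
  shows "star_history (Suc k) \<tau>"
  using assms mwu_inv_skip unfolding star_history_def by (simp add: stars_cost_def)

lemma star_history_step:
  assumes hist: "star_history k \<tau>" and best: "best_star (\<tau> Weight) (\<tau> Coverage) i l"
  defines "S \<equiv> star (\<tau> Weight) (\<tau> Coverage) i l"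
  assumes site: "\<tau>' StarSite = (\<tau> StarSite)(k := i)"
    and amount: "\<tau>' StarAmount = (\<tau> StarAmount)(k := star_amount S)"
    and member: "\<And>y. \<tau>' StarMember y = (if \<exists>j\<in>S. y = k * n + j then 1 else \<tau> StarMember y)"
    and weight: "\<And>j. j < n \<Longrightarrow> \<tau>' Weight j = upd_W S (star_amount S) (\<tau> Weight) j"
    and coverage: "\<And>j. j < n \<Longrightarrow> \<tau>' Coverage j = upd_H S (star_amount S) (\<tau> Coverage) j"
  shows "star_history (Suc k) \<tau>'"
proof -
  note hist = star_historyD[OF hist]
  have S_sub: "S \<subseteq> {..<n}" unfolding S_def by (rule star_subset(2))
  have members_new: "members_of \<tau>' k = S" using S_sub hist(6) by (auto simp: members_of_def member)
  have "\<tau>' StarMember (k' * n + j) = \<tau> StarMember (k' * n + j)" if "k' < k" "j < n" for k' j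
    using row_major_less[OF that] by (auto simp: member)
  hence members_old: "members_of \<tau>' k' = members_of \<tau> k'" if "k' < k" for k'
    using that by (auto simp: members_of_def)
  have cost: "stars_cost \<tau>' (Suc k) = stars_cost \<tau> k + star_cost i S * star_amount S"
    by (simp add: stars_cost_def members_new members_old site amount)
  show ?thesis
    unfolding star_history_def
  proof (intro conjI allI impI)
    fix Z :: real assume Z_dual: "0 \<le> Z" "dual_bound Z"
    show "mwu_inv Z (Suc k) (\<tau>' Weight) (\<tau>' Coverage) (stars_cost \<tau>' (Suc k))"
      using mwu_inv_step[OF Z_dual hist(1)[OF Z_dual] best hist(2)] weight coverage unfolding cost S_def
      by (simp cong: mwu_inv_cong)
  next
    fix j assume "j < n"
    thus "0 < \<tau>' Weight j" using weight hist(2) star_amount_le[of S] by (simp add: upd_W_pos S_def)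
    show "\<tau>' Coverage j = (\<Sum>k'<Suc k. if j \<in> members_of \<tau>' k' then \<tau>' StarAmount k' else 0)"
      using coverage[OF \<open>j < n\<close>] hist(3)[OF \<open>j < n\<close>]
      by (simp add: members_new members_old amount upd_H_def cong: if_cong)
  next
    fix k' show "\<tau>' StarAmount k' = 0 \<or> \<tau>' StarSite k' < m"
      using hist(4)[of k'] best_starD(1)[OF best] by (simp add: site amount)
    show "\<tau>' StarAmount k' = 0" if "Suc k \<le> k'" using hist(5) that by (simp add: amount)
  next
    fix y assume "Suc k * n \<le> y"
    thus "\<tau>' StarMember y = 0" using hist(6)[of y] S_sub by (auto simp: member)
  qed
qed

lemma star_history_record_star:
  assumes loaded: "data_loaded \<sigma>" and hist: "star_history k \<sigma>" and index: "\<sigma> LoopK 0 = k"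
    "\<sigma> BestStar 0 = i * n + l"
    and best: "best_star (\<sigma> Weight) (\<sigma> Coverage) i l"
  shows "star_history (Suc k) (sem inp (record_star ;; update_weights) \<sigma>)"
proof -
  define S where "S = star (\<sigma> Weight) (\<sigma> Coverage) i l"
  define \<tau> where "\<tau> = sem inp record_star \<sigma>"
  have loaded': "data_loaded \<tau>" by (rule data_loaded_cong[OF loaded]) (simp add: \<tau>_def sem_unwritten)
  have same: "\<tau> Weight = \<sigma> Weight" "\<tau> Coverage = \<sigma> Coverage" "\<tau> LoopK 0 = k"
    using index by (simp_all add: \<tau>_def sem_unwritten)
  note recorded = sem_record_star[OF loaded index(2) best_starD(1,2)[OF best] index(1), of inp,
    folded \<tau>_def S_def]
  have "\<tau> StarMember (k * n + j) \<noteq> 0 \<longleftrightarrow> j \<in> S" if "j < n" for j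
    using star_historyD(6)[OF hist] by (auto simp: recorded(4))
  note update = sem_update_weights[OF loaded' same(3) this, of _ inp, unfolded recorded(1) same(1,2)]
  have "star_history (Suc k) (sem inp update_weights \<tau>)"
    by (rule star_history_step[OF hist best])
      (auto simp: sem_unwritten recorded(2-4) update S_def[symmetric])
  thus ?thesis by (simp add: \<tau>_def)
qed

lemma sem_select_stars:
  assumes loaded: "data_loaded \<sigma>" and weight: "\<And>j. j < n \<Longrightarrow> \<sigma> Weight j = demand_prod div r j"
    and zero: "\<sigma> Coverage = (\<lambda>_. 0)" "\<sigma> StarAmount = (\<lambda>_. 0)" "\<sigma> StarMember = (\<lambda>_. 0)"
  shows "star_history (n * atoms_per_unit) (sem inp select_stars \<sigma>)"
  unfolding select_stars_def
proof (induct rule: sem_For_invariant[where P = star_history])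
  case init
  show ?case by (rule star_history_init) (use weight zero in auto)
next
  case (step k \<tau>)
  let ?\<tau> = "sem inp (SetV Found (Num 0)) \<tau>"
  define \<tau>' where "\<tau>' = sem inp find_best_star ?\<tau>"
  have same: "\<tau>' l = \<tau> l" if "l \<notin> {LoopI, LoopJ, StarCost, StarWeight, Found, BestCost, BestWeight,
      BestStar}" for l
    using that by (simp add: \<tau>'_def sem_unwritten)
  have loaded_\<tau>: "data_loaded \<tau>" by (rule data_loaded_cong[OF loaded], rule step(3)) auto
  have "data_loaded ?\<tau>" by (rule data_loaded_cong[OF loaded_\<tau>]) auto
  from sem_find_best_star[OF this, of inp] star_historyD(2)[OF step(4)]
  have "tracks_best_star (\<tau> Weight) (\<tau> Coverage) (m * n) \<tau>'" by (simp add: \<tau>'_def)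
  note found = tracks_best_star_end[OF this]
  have hist: "star_history k \<tau>'" by (rule star_history_cong[OF step(4)]) (auto simp: same)
  have body: "sem inp (SetV Found (Num 0) ;; find_best_star ;;
      When (Var Found) (record_star ;; update_weights)) \<tau>
      = (if \<tau>' Found 0 = 0 then \<tau>' else sem inp (record_star ;; update_weights) \<tau>')"
    by (simp add: \<tau>'_def)
  have "star_history (Suc k) (if \<tau>' Found 0 = 0 then \<tau>' else sem inp
      (record_star ;; update_weights) \<tau>')"
  proof (cases "\<tau>' Found 0 = 0")
    case True
    with star_history_skip[OF hist] found(1) show ?thesis by (simp add: same)
  next
    case False
    have "data_loaded \<tau>'" by (rule data_loaded_cong[OF loaded_\<tau>]) (simp add: same)
    from star_history_record_star[OF this hist, of "\<tau>' BestStar 0 div n" "\<tau>' BestStar 0 mod n" inp]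
      found(2)[OF False] step(2)
    show ?thesis using False by (simp add: same del: sem.simps)
  qed
  thus ?case unfolding body by (rule star_history_cong) auto
qed (use loaded in \<open>simp_all add: data_loadedD\<close>)

lemma star_history_end:
  assumes hist: "star_history (n * atoms_per_unit) \<tau>" and Z_dual: "0 \<le> Z" "dual_bound Z"
  shows "star_solution n m D r (n * atoms_per_unit) (\<tau> StarAmount) (\<tau> StarSite) (members_of \<tau>)"
    and "real (stars_cost \<tau> (n * atoms_per_unit)) \<le> cost_limit Z"
proof -
  note mwu = mwu_inv_end[OF star_historyD(1)[OF hist Z_dual]]
  show "real (stars_cost \<tau> (n * atoms_per_unit)) \<le> cost_limit Z" by (rule mwu(2))
  show "star_solution n m D r (n * atoms_per_unit) (\<tau> StarAmount) (\<tau> StarSite) (members_of \<tau>)"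
  proof unfold_locales
    fix j assume "j < n"
    moreover from this have "atoms_per_unit * r j \<le> \<tau> Coverage j"
      using mwu(1) by (auto simp: active_def)
    ultimately show "atoms_per_unit * r j
        \<le> (\<Sum>k<n * atoms_per_unit. if j \<in> members_of \<tau> k then \<tau> StarAmount k else 0)"
      by (simp add: star_historyD(3)[OF hist])
  qed (use star_historyD(4)[OF hist] in \<open>auto simp: members_of_def\<close>)
qed

lemma data_loaded_prepared:
  assumes dims: "inp 0 = m" "inp 1 = n"
    and "\<And>i. i < m \<Longrightarrow> F i = inp (2 + 2 * i) * (common_den inp div inp (3 + 2 * i))"
    and "\<And>i j. i < m \<Longrightarrow> j < n \<Longrightarrow>
      D i j = inp (2 + 2 * m + 2 * (i * n + j)) *
      (common_den inp div inp (3 + 2 * m + 2 * (i * n + j)))"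
    and demands: "\<And>j. j < n \<Longrightarrow> r j = inp (2 + 2 * m + 2 * (m * n) + j)"
  shows "data_loaded (prepared inp)" "j < n \<Longrightarrow> prepared inp Weight j = demand_prod div r j"
proof -
  have "(\<Prod>j<n. inp (2 + 2 * m + 2 * (m * n) + j)) = demand_prod" by (simp add: demand_prod_def demands)
  thus "data_loaded (prepared inp)" "j < n \<Longrightarrow> prepared inp Weight j = demand_prod div r j"
    using assms prepared_values[where inp = inp, unfolded dims] sized_values[where inp = inp,
      unfolded dims]
    by (simp_all add: data_loaded_def prepared_unwritten row_major_less atoms_per_unit_def
      cluster_size_def granularity_def)
qed

end


section \<open>Semantics of the rounding\<close>

context star_solution
begin

definition stars_loaded :: "banks \<Rightarrow> bool" where
  "stars_loaded \<sigma> \<longleftrightarrow> data_loaded \<sigma> \<and> K = n * atoms_per_unit \<and> \<sigma> StarAmount = amount \<and>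
      \<sigma> StarSite = star_site \<and>
     (\<forall>k. \<forall>j<n. \<sigma> StarMember (k * n + j) = 0 \<longleftrightarrow> j \<notin> star_members k)"

lemma stars_loadedD:
  assumes "stars_loaded \<sigma>"
  shows "data_loaded \<sigma>" "\<sigma> NumStars 0 = K" "\<sigma> NumAtoms 0 = num_atoms" "\<sigma> StarAmount k = amount k"
    "\<sigma> StarSite k = star_site k"
    "\<And>k j. j < n \<Longrightarrow> \<sigma> StarMember (k * n + j) = 0 \<longleftrightarrow> j \<notin> star_members k"
  using assms unfolding stars_loaded_def num_atoms_def by (simp_all add: data_loadedD)

lemma stars_loaded_cong:
  assumes "stars_loaded \<sigma>" "\<And>l. l \<in> data_banks \<union> {StarMember, StarSite, StarAmount} \<Longrightarrow> \<tau> l = \<sigma> l"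
  shows "stars_loaded \<tau>"
  using assms data_loaded_cong[of \<sigma> \<tau>] unfolding stars_loaded_def by simp

lemma sem_fix_connections:
  assumes loaded: "stars_loaded \<sigma>" and k_index: "\<sigma> LoopK 0 = k" and j_less: "j < n"
  defines "q \<equiv> \<sigma> WholePart 0"
  shows "sem inp fix_connections \<sigma> FixedConn (i * n + j) =
      \<sigma> FixedConn (i * n + j) + (if star_site k = i \<and> j \<in> star_members k then q else 0)"
    and "sem inp fix_connections \<sigma> FixedCover j = \<sigma> FixedCover j +
        (if j \<in> star_members k then q else 0)"
proof -
  note data = stars_loadedD[OF loaded] data_loadedD[OF stars_loadedD(1)[OF loaded]]
  have "sem inp fix_connections \<sigma> FixedConn (i * n + j) =
      \<sigma> FixedConn (i * n + j) + (\<Sum>j'<n. if j' = j then (if star_site k = i \<and>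
      j \<in> star_members k then q else 0) else 0)"
    unfolding fix_connections_def
    by (rule sem_For_sum) (use k_index j_less data in \<open>auto simp: q_def row_major_eq_iff\<close>)
  thus "sem inp fix_connections \<sigma> FixedConn (i * n + j) =
      \<sigma> FixedConn (i * n + j) + (if star_site k = i \<and> j \<in> star_members k then q else 0)"
    using j_less by simp
  have "sem inp fix_connections \<sigma> FixedCover j =
      \<sigma> FixedCover j + (\<Sum>j'<n. if j' = j then (if j \<in> star_members k then q else 0) else 0)"
    unfolding fix_connections_def
    by (rule sem_For_sum) (use k_index j_less data in \<open>auto simp: q_def\<close>)
  thus "sem inp fix_connections \<sigma> FixedCover j = \<sigma> FixedCover j + (if j \<in> star_members k then q else 0)"
    using j_less by simp
qed

lemma sem_fix_star:
  assumes loaded: "stars_loaded \<sigma>" and k_index: "\<sigma> LoopK 0 = k"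
  shows "sem inp fix_star \<sigma> FixedOpen i = \<sigma> FixedOpen i + (if star_site k = i then whole k else 0)"
    and "j < n \<Longrightarrow> sem inp fix_star \<sigma> FixedConn (i * n + j) = \<sigma> FixedConn (i * n + j) +
      (if star_site k = i then (if j \<in> star_members k then whole k else 0) else 0)"
    and "j < n \<Longrightarrow> sem inp fix_star \<sigma> FixedCover j =
      \<sigma> FixedCover j + (if j \<in> star_members k then whole k else 0)"
proof -
  let ?\<sigma> = "sem inp (SetV WholePart (Cell StarAmount (Var LoopK) \<oslash> Var AtomsPerUnit) ;;
     Incr FixedOpen (Cell StarSite (Var LoopK)) (Var WholePart)) \<sigma>"
  note data = stars_loadedD[OF loaded] data_loadedD[OF stars_loadedD(1)[OF loaded]]
  have fix_star: "sem inp fix_star \<sigma> = sem inp fix_connections ?\<sigma>" by (simp add: fix_star_def)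
  have loaded': "stars_loaded ?\<sigma>" by (rule stars_loaded_cong[OF loaded]) auto
  show "sem inp fix_star \<sigma> FixedOpen i = \<sigma> FixedOpen i + (if star_site k = i then whole k else 0)"
    unfolding fix_star using data k_index by (simp add: sem_unwritten whole_def)
  show "sem inp fix_star \<sigma> FixedConn (i * n + j) = \<sigma> FixedConn (i * n + j) +
      (if star_site k = i then (if j \<in> star_members k then whole k else 0) else 0)"
    "sem inp fix_star \<sigma> FixedCover j = \<sigma> FixedCover j + (if j \<in> star_members k then whole k else 0)"
    if "j < n"
    unfolding fix_star using sem_fix_connections[OF loaded' _ that, of k inp] data k_index
    by (simp_all add: whole_def)
qed

lemma sem_split_amounts:
  assumes loaded: "stars_loaded \<sigma>"
    and zero: "\<sigma> FixedOpen = (\<lambda>_. 0)" "\<sigma> FixedConn = (\<lambda>_. 0)" "\<sigma> FixedCover = (\<lambda>_. 0)"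
  shows "sem inp split_amounts \<sigma> FixedOpen i = fixed_open i"
    and "j < n \<Longrightarrow> sem inp split_amounts \<sigma> FixedConn (i * n + j) = fixed_conn i j"
    and "j < n \<Longrightarrow> sem inp split_amounts \<sigma> FixedCover j = fixed_cover j"
proof -
  have bound: "ev inp \<sigma> (Var NumStars) = K" using stars_loadedD(2)[OF loaded] by simp
  have loaded': "stars_loaded \<tau>" if "\<And>l. l \<notin> insert LoopK (written fix_star) \<Longrightarrow> \<tau> l = \<sigma> l" for \<tau>
    by (rule stars_loaded_cong[OF loaded]) (use that in auto)
  have "sem inp split_amounts \<sigma> FixedOpen i = \<sigma> FixedOpen i + fixed_open i"
    unfolding split_amounts_def fixed_open_def
    by (rule sem_For_sum[OF bound], simp, simp, rule sem_fix_star(1)[OF loaded']) blast+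
  thus "sem inp split_amounts \<sigma> FixedOpen i = fixed_open i" by (simp add: zero)
  have "sem inp split_amounts \<sigma> FixedConn (i * n + j) = \<sigma> FixedConn (i * n + j) + fixed_conn i j" if "j < n"
    unfolding split_amounts_def fixed_conn_def
    by (rule sem_For_sum[OF bound], simp, simp, rule sem_fix_star(2)[OF loaded']) (use that in blast)+
  thus "j < n \<Longrightarrow> sem inp split_amounts \<sigma> FixedConn (i * n + j) = fixed_conn i j" by (simp add: zero)
  have "sem inp split_amounts \<sigma> FixedCover j = \<sigma> FixedCover j + fixed_cover j" if "j < n"
    unfolding split_amounts_def fixed_cover_def
    by (rule sem_For_sum[OF bound], simp, simp, rule sem_fix_star(3)[OF loaded']) (use that in blast)+
  thus "j < n \<Longrightarrow> sem inp split_amounts \<sigma> FixedCover j = fixed_cover j" by (simp add: zero)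
qed

lemma sem_create_atoms:
  assumes loaded: "stars_loaded \<sigma>" and zero: "\<sigma> AtomValid = (\<lambda>_. 0)"
  shows "t < num_atoms \<Longrightarrow> sem inp create_atoms \<sigma> AtomValid t = of_bool (valid t)"
    and "t \<in> atoms \<Longrightarrow> sem inp create_atoms \<sigma> AtomSite t = atom_site t"
proof -
  note data = stars_loadedD[OF loaded] data_loadedD[OF stars_loadedD(1)[OF loaded]]
  let ?test = "Less (ModUnit (Var LoopI)) (ModUnit (Cell StarAmount (StarOf (Var LoopI))))"
  have test: "ev inp \<tau> ?test \<noteq> 0 \<longleftrightarrow> valid t"
    if "\<tau> LoopI 0 = t" "\<And>l. l \<notin> {LoopI, AtomValid, AtomSite} \<Longrightarrow> \<tau> l = \<sigma> l" for \<tau> t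
    using that data by (simp add: valid_def rest_def minus_div_mult_eq_mod not_le)
  have "sem inp create_atoms \<sigma> AtomValid t = (if t < num_atoms then of_bool (valid t)
      else \<sigma> AtomValid t)"
    unfolding create_atoms_def
  proof (rule sem_For_fill_array, goal_cases bound fresh other step)
    case (step t \<tau>)
    have "sem inp (When ?test c) \<tau> = (if valid t then sem inp c \<tau> else \<tau>)" for c
      by (rule sem_When, rule test) (use step in auto)
    thus ?case using step zero by (auto simp del: sem.simps(4))
  qed (use data in simp_all)
  thus "t < num_atoms \<Longrightarrow> sem inp create_atoms \<sigma> AtomValid t = of_bool (valid t)" by simp
  have "sem inp create_atoms \<sigma> AtomSite t
      = (if t < num_atoms then (if valid t then atom_site t else \<sigma> AtomSite t) else \<sigma> AtomSite t)"
    unfolding create_atoms_def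
  proof (rule sem_For_fill_array, goal_cases bound fresh other step)
    case (step t \<tau>)
    have "sem inp (When ?test c) \<tau> = (if valid t then sem inp c \<tau> else \<tau>)" for c
      by (rule sem_When, rule test) (use step in auto)
    thus ?case using step data by (auto simp: atom_site_def fun_upd_idem simp del: sem.simps(4))
  qed (use data in simp_all)
  thus "t \<in> atoms \<Longrightarrow> sem inp create_atoms \<sigma> AtomSite t = atom_site t" by (simp add: atoms_def)
qed

lemma sem_fill_pools:
  assumes loaded: "stars_loaded \<sigma>" and valid: "\<And>t. t < num_atoms \<Longrightarrow> \<sigma> AtomValid t = of_bool (valid t)"
    and zero: "\<sigma> InPool = (\<lambda>_. 0)" and tj_less: "t < num_atoms" "j < n"
  shows "sem inp fill_pools \<sigma> InPool (t * n + j) \<noteq> 0 \<longleftrightarrow> t \<in> pool0 j"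
proof -
  note data = stars_loadedD[OF loaded] data_loadedD[OF stars_loadedD(1)[OF loaded]]
  let ?g = "\<lambda>x. if valid (x div n) then \<sigma> StarMember (x div n div atoms_per_unit * n + x mod n) else 0"
  have "sem inp fill_pools \<sigma> InPool (t * n + j) = (if t * n + j < num_atoms * n then ?g (t * n + j)
      else \<sigma> InPool (t * n + j))"
    unfolding fill_pools_def
  proof (rule sem_For_fill_array, goal_cases bound fresh other step)
    case (step x \<tau>)
    have "x div n < num_atoms" using step(1) by (simp add: less_mult_imp_div_less)
    thus ?case using step data valid zero by (auto simp: minus_div_mult_eq_mod)
  qed (use data in simp_all)
  thus ?thesis
    using tj_less row_major_less[OF tj_less] data(6)[of j "t div atoms_per_unit"]
    by (auto simp: pool0_def atoms_def)
qed

lemma sem_set_residuals: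
  assumes "stars_loaded \<sigma>" "\<And>j. j < n \<Longrightarrow> \<sigma> FixedCover j = fixed_cover j" "j < n"
  shows "sem inp set_residuals \<sigma> ResidualDemand j = residual j"
proof -
  note data = data_loadedD[OF stars_loadedD(1)[OF assms(1)]]
  have "sem inp set_residuals \<sigma> ResidualDemand j = (if j < n then residual j else \<sigma> ResidualDemand j)"
    unfolding set_residuals_def by (rule sem_For_fill_array)
      (use assms(2) data in \<open>auto simp: residual_def\<close>)
  thus ?thesis using assms(3) by simp
qed

end

lemma bij_betw_rank:
  fixes A :: "nat set"
  assumes "finite A"
  shows "bij_betw (\<lambda>t. card (A \<inter> {..<t})) A {..<card A}"
proof -
  have mono: "card (A \<inter> {..<t}) < card (A \<inter> {..<u})" if "t \<in> A" "t < u" for t u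
    using that assms by (intro psubset_card_mono) auto
  have inj: "inj_on (\<lambda>t. card (A \<inter> {..<t})) A"
  proof (rule linorder_inj_onI)
    show "card (A \<inter> {..<t}) \<noteq> card (A \<inter> {..<u})" if "t < u" "t \<in> A" for t u using mono that by force
  qed auto
  have "card (A \<inter> {..<t}) < card A" if "t \<in> A" for t
    using that assms by (intro psubset_card_mono) auto
  hence "(\<lambda>t. card (A \<inter> {..<t})) ` A = {..<card A}"
    using assms by (intro card_subset_eq) (auto simp: card_image[OF inj])
  with inj show ?thesis by (simp add: bij_betw_def)
qed

context atom_instance
begin

definition bank_pool :: "banks \<Rightarrow> nat \<Rightarrow> nat set" where
  "bank_pool \<sigma> j = {t. t < T \<and> \<sigma> InPool (t * n + j) \<noteq> 0}"

definition atoms_loaded :: "banks \<Rightarrow> bool" where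
  "atoms_loaded \<sigma> \<longleftrightarrow> data_loaded \<sigma> \<and> T = n * atoms_per_unit * atoms_per_unit \<and>
     (\<forall>j<n. \<forall>t\<in>pool0 j. \<sigma> AtomSite t = site t) \<and> (\<forall>j<n. \<sigma> ResidualDemand j = residual j)"

lemma atoms_loadedD:
  assumes "atoms_loaded \<sigma>"
  shows "data_loaded \<sigma>" "\<sigma> NumAtoms 0 = T" "\<And>j. j < n \<Longrightarrow> \<sigma> ResidualDemand j = residual j"
    and "\<And>t j. j < n \<Longrightarrow> t \<in> pool0 j \<Longrightarrow> \<sigma> Distance (\<sigma> AtomSite t * n + j) = \<delta> j t"
  using assms site_less by (auto simp: atoms_loaded_def data_loadedD \<delta>_def)

lemma atoms_loaded_cong:
  assumes "atoms_loaded \<sigma>" "\<And>l. l \<in> data_banks \<union> {AtomSite, ResidualDemand} \<Longrightarrow> \<tau> l = \<sigma> l"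
  shows "atoms_loaded \<tau>"
  using assms data_loaded_cong[of \<sigma> \<tau>] unfolding atoms_loaded_def by simp

lemma finite_bank_pool [simp]: "finite (bank_pool \<sigma> j)"
  by (simp add: bank_pool_def)

lemma bank_pool_cong: "\<tau> InPool = \<sigma> InPool \<Longrightarrow> bank_pool \<tau> = bank_pool \<sigma>"
  by (simp add: bank_pool_def fun_eq_iff)

lemma mem_bank_pool: "t < T \<Longrightarrow> \<sigma> InPool (t * n + j) = 0 \<longleftrightarrow> t \<notin> bank_pool \<sigma> j"
  by (simp add: bank_pool_def)

lemma sem_count_closer:
  assumes loaded: "atoms_loaded \<sigma>" and pool_sub: "bank_pool \<sigma> p \<subseteq> pool0 p"
    and p_index: "\<sigma> LoopP 0 = p" "p < n"
    and t_index: "\<sigma> LoopI 0 = t" "t \<in> bank_pool \<sigma> p"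
  shows "sem inp count_closer \<sigma> Count 0 = card {v \<in> bank_pool \<sigma> p. \<delta> p v \<le> \<delta> p t}"
proof -
  let ?S = "{v \<in> bank_pool \<sigma> p. \<delta> p v \<le> \<delta> p t}" and ?\<sigma> = "sem inp (SetV Count (Num 0)) \<sigma>"
  note data = atoms_loadedD[OF loaded] data_loadedD[OF atoms_loadedD(1)[OF loaded]]
  have dist: "\<sigma> Distance (\<sigma> AtomSite v * n + p) = \<delta> p v" if "v \<in> bank_pool \<sigma> p" for v
    using data(4)[OF p_index(2)] pool_sub that by blast
  have "sem inp count_closer \<sigma> Count 0 = ?\<sigma> Count 0 + (\<Sum>v<T. if v \<in> ?S then 1 else 0)"
    unfolding count_closer_def sem.simps(3)
  proof (rule sem_For_sum, goal_cases bound fresh other step)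
    case (step v \<tau>)
    thus ?case using data p_index t_index dist mem_bank_pool[OF step(1), of \<sigma> p] dist[of v]
      by (cases "v \<in> bank_pool \<sigma> p") auto
  qed (use data in simp_all)
  also have "(\<Sum>v<T. if v \<in> ?S then 1 else 0) = card ?S"
    by (subst sum_if_mem) (auto simp: bank_pool_def)
  finally show ?thesis by simp
qed

definition tracks_center :: "(nat \<times> nat) set \<Rightarrow> banks \<Rightarrow> bool" where
  "tracks_center C \<tau> \<longleftrightarrow> tracks_min snd C (\<tau> Found 0) (\<tau> BestClient 0, \<tau> BestDist 0)"

lemma tracks_center_cong:
  "tracks_center C \<tau> \<Longrightarrow> (\<And>l. l \<in> {Found, BestClient, BestDist} \<Longrightarrow> \<tau>' l = \<tau> l) \<Longrightarrow> tracks_center C \<tau>'"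
  by (simp add: tracks_center_def)

definition centers :: "(nat \<Rightarrow> nat set) \<Rightarrow> nat \<Rightarrow> nat \<Rightarrow> (nat \<times> nat) set" where
  "centers pool p x = (\<lambda>t. (p, \<delta> p t)) ` {t \<in> pool p. t < x \<and> crowded pool p (\<delta> p t)}"

lemma centers_Suc:
  "centers pool p (Suc x) = (if x \<in> pool p \<and> crowded pool p (\<delta> p x) then insert (p, \<delta> p x)
      else id) (centers pool p x)"
  by (auto simp: centers_def less_Suc_eq)

lemma sem_consider_atom:
  assumes loaded: "atoms_loaded \<sigma>" and pool_sub: "bank_pool \<sigma> p \<subseteq> pool0 p"
    and index: "\<sigma> LoopP 0 = p" "p < n" "\<sigma> LoopI 0 = t" "t \<in> bank_pool \<sigma> p"
    and tracks: "tracks_center C \<sigma>"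
  shows "tracks_center (if crowded (bank_pool \<sigma>) p (\<delta> p t) then insert (p, \<delta> p t) C else C)
    (sem inp consider_atom \<sigma>)"
proof -
  note data = data_loadedD[OF atoms_loadedD(1)[OF loaded]]
  define \<tau> where "\<tau> = sem inp count_closer \<sigma>"
  have same: "\<tau> l = \<sigma> l" if "l \<notin> {LoopV, Count}" for l using that by (simp add: \<tau>_def sem_unwritten)
  have count: "\<tau> Count 0 = card {v \<in> bank_pool \<sigma> p. \<delta> p v \<le> \<delta> p t}"
    unfolding \<tau>_def by (rule sem_count_closer[OF loaded pool_sub index])
  have dist: "\<sigma> Distance (\<sigma> AtomSite t * n + p) = \<delta> p t"
    using atoms_loadedD(4)[OF loaded index(2)] pool_sub index(4) by blast
  let ?better = "Leq (Var ClusterSize) (Var Count) \<otimes>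
      (Neg (Var Found) \<oplus> Less (AtomDist (Var LoopI) (Var LoopP)) (Var BestDist))"
  have better: "ev inp \<tau> ?better \<noteq> 0 \<longleftrightarrow>
      crowded (bank_pool \<sigma>) p (\<delta> p t) \<and> (\<sigma> Found 0 = 0 \<or> \<delta> p t < \<sigma> BestDist 0)"
    using count data index dist by (auto simp: same crowded_def)
  have min: "tracks_min snd C (\<sigma> Found 0) (\<sigma> BestClient 0, \<sigma> BestDist 0)"
    using tracks by (simp add: tracks_center_def)
  have "sem inp consider_atom \<sigma> = sem inp (When ?better (SetV Found (Num 1) ;;
      SetV BestDist (AtomDist (Var LoopI) (Var LoopP)) ;; SetV BestClient (Var LoopP))) \<tau>"
    by (simp add: consider_atom_def \<tau>_def)
  thus ?thesis
    using tracks_min_better[OF min, of "(p, \<delta> p t)" 1] tracks_min_worse[OF min, of "(p, \<delta> p t)"]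
      data index dist tracks
    unfolding sem_When[OF better] by (auto simp: tracks_center_def same)
qed

lemma sem_search_pool:
  assumes loaded: "atoms_loaded \<sigma>" and pool_sub: "bank_pool \<sigma> p \<subseteq> pool0 p"
    and p_index: "\<sigma> LoopP 0 = p" "p < n"
    and tracks: "tracks_center C \<sigma>"
  shows "tracks_center (C \<union> centers (bank_pool \<sigma>) p T) (sem inp search_pool \<sigma>)"
  unfolding search_pool_def
proof (induct rule: sem_For_invariant[where P = "\<lambda>x. tracks_center (C \<union> centers (bank_pool \<sigma>) p x)"])
  case init
  show ?case using tracks by (simp add: tracks_center_def centers_def)
next
  case (step x \<tau>)
  have same: "\<tau> l = \<sigma> l" if "l \<notin> {LoopI, LoopV, Count, Found, BestDist, BestClient}" for l
    by (rule step(3)) (use that in simp)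
  note data = data_loadedD[OF atoms_loadedD(1)[OF loaded]]
  have pool: "bank_pool \<tau> = bank_pool \<sigma>" by (rule bank_pool_cong) (simp add: same)
  have in_pool: "ev inp \<tau> (Cell2 InPool (Var LoopI) (Var LoopP)) \<noteq> 0 \<longleftrightarrow> x \<in> bank_pool \<sigma> p"
    using step(1,2) data p_index by (simp add: same mem_bank_pool[of x \<sigma> p] del: neq0_conv)
  have loaded': "atoms_loaded \<tau>" by (rule atoms_loaded_cong[OF loaded]) (auto simp: same)
  have "tracks_center (C \<union> centers (bank_pool \<sigma>) p (Suc x))
      (if x \<in> bank_pool \<sigma> p then sem inp consider_atom \<tau> else \<tau>)"
    using sem_consider_atom[OF loaded' _ _ p_index(2) step(2) _ step(4), of inp] step(4) pool_sub p_index(1)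
    by (auto simp: centers_Suc pool same)
  thus ?case unfolding sem_When[OF in_pool] by (rule tracks_center_cong) auto
qed (use atoms_loadedD[OF loaded] in simp_all)

definition open_centers :: "banks \<Rightarrow> nat \<Rightarrow> (nat \<times> nat) set" where
  "open_centers \<sigma> x = (\<Union>j \<in> {j. j < x \<and> \<sigma> NumAssigned j < residual j}. centers (bank_pool \<sigma>) j T)"

lemma open_centers_Suc:
  "open_centers \<sigma> (Suc x) =
     open_centers \<sigma> x \<union> (if \<sigma> NumAssigned x < residual x then centers (bank_pool \<sigma>) x T else {})"
  by (auto simp: open_centers_def less_Suc_eq)

lemma mem_open_centers:
  "(j, d) \<in> open_centers \<sigma> n \<longleftrightarrow> j < n \<and> \<sigma> NumAssigned j < residual j \<and>
     (\<exists>t \<in> bank_pool \<sigma> j. crowded (bank_pool \<sigma>) j (\<delta> j t) \<and> d = \<delta> j t)"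
  by (auto simp: open_centers_def centers_def bank_pool_def)

lemma sem_find_center:
  assumes loaded: "atoms_loaded \<sigma>" and pool_sub: "\<And>j. j < n \<Longrightarrow> bank_pool \<sigma> j \<subseteq> pool0 j"
    and unset: "\<sigma> Found 0 = 0"
  shows "tracks_center (open_centers \<sigma> n) (sem inp find_center \<sigma>)"
  unfolding find_center_def
proof (induct rule: sem_For_invariant[where P = "\<lambda>x. tracks_center (open_centers \<sigma> x)"])
  case (step x \<tau>)
  have same: "\<tau> l = \<sigma> l" if "l \<notin> {LoopP, LoopI, LoopV, Count, Found, BestDist, BestClient}" for l
    by (rule step(3)) (use that in simp)
  have pool: "bank_pool \<tau> = bank_pool \<sigma>" by (rule bank_pool_cong) (simp add: same)
  have loaded': "atoms_loaded \<tau>" by (rule atoms_loaded_cong[OF loaded]) (auto simp: same)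
  have unserved: "ev inp \<tau> (Less (Cell NumAssigned (Var LoopP)) (Cell ResidualDemand (Var LoopP))) \<noteq> 0
      \<longleftrightarrow> \<sigma> NumAssigned x < residual x"
    using step(1,2) atoms_loadedD(3)[OF loaded] by (simp add: same not_le)
  show ?case
  proof (cases "\<sigma> NumAssigned x < residual x")
    case True
    have "tracks_center (open_centers \<sigma> x \<union> centers (bank_pool \<tau>) x T) (sem inp search_pool \<tau>)"
      by (rule sem_search_pool[OF loaded' _ step(2) step(1) step(4)])
        (use pool_sub[OF step(1)] pool in simp)
    thus ?thesis using True unfolding sem_When[OF unserved]
      by (auto simp: open_centers_Suc pool elim!: tracks_center_cong)
  next
    case False
    thus ?thesis using step(4) unfolding sem_When[OF unserved]
      by (auto simp: open_centers_Suc elim!: tracks_center_cong)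
  qed
qed (use unset data_loadedD[OF atoms_loadedD(1)[OF loaded]] in
  \<open>simp_all add: tracks_center_def tracks_min_init open_centers_def\<close>)

definition near :: "banks \<Rightarrow> nat set" where
  "near \<sigma> = {t \<in> bank_pool \<sigma> (\<sigma> BestClient 0). \<delta> (\<sigma> BestClient 0) t \<le> \<sigma> BestDist 0}"

definition center_loaded :: "banks \<Rightarrow> bool" where
  "center_loaded \<sigma> \<longleftrightarrow> atoms_loaded \<sigma> \<and> \<sigma> BestClient 0 < n \<and> (\<forall>j<n. bank_pool \<sigma> j \<subseteq> pool0 j)"

lemma near_cong: "(\<And>l. l \<in> {InPool, BestClient, BestDist} \<Longrightarrow> \<tau> l = \<sigma> l) \<Longrightarrow> near \<tau> = near \<sigma>"
  using bank_pool_cong[of \<tau> \<sigma>] by (simp add: near_def)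

lemma near_less: "t \<in> near \<sigma> \<Longrightarrow> t < T"
  by (simp add: near_def bank_pool_def)

lemma finite_near [simp]: "finite (near \<sigma>)"
  by (simp add: near_def)

lemma center_loaded_cong:
  assumes "center_loaded \<sigma>" "\<And>l. l \<in> data_banks \<union> {AtomSite, ResidualDemand, InPool, BestClient} \<Longrightarrow>
      \<tau> l = \<sigma> l"
  shows "center_loaded \<tau>"
  using assms atoms_loaded_cong[of \<sigma> \<tau>] bank_pool_cong[of \<tau> \<sigma>] by (auto simp: center_loaded_def)

lemma sem_When_Near:
  assumes "center_loaded \<sigma>" "\<tau> LoopI 0 = t" "t < T" "ev inp \<tau> e \<noteq> 0 \<longleftrightarrow> Q"
    and "\<And>l. l \<in> data_banks \<union> {AtomSite, ResidualDemand, InPool, BestClient, BestDist} \<Longrightarrow> \<tau> l = \<sigma> l"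
  shows "sem inp (When (Near (Var LoopI) \<otimes> e) c) \<tau> = (if t \<in> near \<sigma> \<and> Q then sem inp c \<tau> else \<tau>)"
proof (rule sem_When)
  let ?p = "\<sigma> BestClient 0"
  have loaded: "atoms_loaded \<sigma>" and p_less: "?p < n" and pool_sub: "bank_pool \<sigma> ?p \<subseteq> pool0 ?p"
    using assms(1) by (simp_all add: center_loaded_def)
  have "\<sigma> Distance (\<sigma> AtomSite t * n + ?p) = \<delta> ?p t" if "t \<in> bank_pool \<sigma> ?p"
    using atoms_loadedD(4)[OF loaded p_less] pool_sub that by blast
  hence "ev inp \<tau> (Near (Var LoopI)) \<noteq> 0 \<longleftrightarrow> t \<in> near \<sigma>"
    using assms(2,5) mem_bank_pool[OF assms(3), of \<sigma> ?p] data_loadedD(2)[OF atoms_loadedD(1)[OF loaded]]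
    by (cases "t \<in> bank_pool \<sigma> ?p") (auto simp: near_def)
  thus "ev inp \<tau> (Near (Var LoopI) \<otimes> e) \<noteq> 0 \<longleftrightarrow> t \<in> near \<sigma> \<and> Q"
    unfolding ev_Times_nonzero using assms(4) by blast
qed

lemma sem_find_old_cluster:
  fixes inp :: memory and \<sigma> :: banks
  assumes loaded: "center_loaded \<sigma>"
  defines "q \<equiv> sem inp find_old_cluster \<sigma> CurCluster 0"
  shows "q = 0 \<Longrightarrow> t \<in> near \<sigma> \<Longrightarrow> \<sigma> ClusterOf t = 0" and "q \<noteq> 0 \<Longrightarrow> \<exists>t\<in>near \<sigma>. \<sigma> ClusterOf t = q"
proof -
  let ?P = "\<lambda>x \<tau>. if \<tau> CurCluster 0 = 0 then \<forall>t\<in>near \<sigma>. t < x \<longrightarrow> \<sigma> ClusterOf t = 0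
    else \<exists>t\<in>near \<sigma>. \<sigma> ClusterOf t = \<tau> CurCluster 0"
  have "?P T (sem inp find_old_cluster \<sigma>)"
    unfolding find_old_cluster_def sem.simps(3)
  proof (induct rule: sem_For_invariant[where P = ?P])
    case (step x \<tau>)
    have same: "\<tau> l = \<sigma> l" if "l \<notin> {LoopI, CurCluster}" for l using that by (simp add: step(3))
    have "sem inp (When (Near (Var LoopI) \<otimes> Cell ClusterOf (Var LoopI)) c) \<tau>
        = (if x \<in> near \<sigma> \<and> \<sigma> ClusterOf x \<noteq> 0 then sem inp c \<tau> else \<tau>)" for c
      by (rule sem_When_Near[OF loaded]) (use step(1,2) in \<open>auto simp: same\<close>)
    thus ?case using step(2,4) by (auto simp: same less_Suc_eq simp del: sem.simps(4))
  qed (use loaded in \<open>simp_all add: center_loaded_def atoms_loadedD\<close>)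
  thus "q = 0 \<Longrightarrow> t \<in> near \<sigma> \<Longrightarrow> \<sigma> ClusterOf t = 0" "q \<noteq> 0 \<Longrightarrow> \<exists>t\<in>near \<sigma>. \<sigma> ClusterOf t = q"
    using near_less by (auto simp: q_def split: if_splits)
qed

definition cluster_members :: "banks \<Rightarrow> nat set" where
  "cluster_members \<sigma> = {t \<in> near \<sigma>. card (near \<sigma> \<inter> {..<t}) < cluster_size}"

lemma bij_betw_cluster_members:
  assumes "cluster_size \<le> card (near \<sigma>)"
  shows "bij_betw (\<lambda>t. card (near \<sigma> \<inter> {..<t})) (cluster_members \<sigma>) {..<cluster_size}"
proof (rule bij_betw_subset[OF bij_betw_rank[OF finite_near]])
  show "cluster_members \<sigma> \<subseteq> near \<sigma>" by (auto simp: cluster_members_def)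
  have "x \<in> (\<lambda>t. card (near \<sigma> \<inter> {..<t})) ` near \<sigma>" if "x < cluster_size" for x
    using bij_betw_imp_surj_on[OF bij_betw_rank[OF finite_near, of \<sigma>]] assms that by auto
  thus "(\<lambda>t. card (near \<sigma> \<inter> {..<t})) ` cluster_members \<sigma> = {..<cluster_size}"
    by (auto simp: cluster_members_def)
qed

lemma sem_fill_cluster:
  assumes loaded: "center_loaded \<sigma>" and unset: "\<sigma> Count 0 = 0" and s_index: "\<sigma> LoopK 0 = s"
  shows "sem inp fill_cluster \<sigma> ClusterOf t = (if t \<in> cluster_members \<sigma> then Suc s else \<sigma> ClusterOf t)"
    and "sem inp fill_cluster \<sigma> PositionOf t =
      (if t \<in> cluster_members \<sigma> then card (near \<sigma> \<inter> {..<t}) else \<sigma> PositionOf t)"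
proof -
  let ?B = "\<lambda>x. cluster_members \<sigma> \<inter> {..<x}" and ?rank = "\<lambda>t. card (near \<sigma> \<inter> {..<t})"
  let ?P = "\<lambda>x \<tau>. \<tau> Count 0 = min cluster_size (?rank x) \<and>
    (\<forall>t. \<tau> ClusterOf t = (if t \<in> ?B x then Suc s else \<sigma> ClusterOf t)) \<and>
    (\<forall>t. \<tau> PositionOf t = (if t \<in> ?B x then ?rank t else \<sigma> PositionOf t))"
  have "?P T (sem inp fill_cluster \<sigma>)"
    unfolding fill_cluster_def
  proof (induct rule: sem_For_invariant[where P = ?P])
    case (step x \<tau>)
    have same: "\<tau> l = \<sigma> l" if "l \<notin> {LoopI, ClusterOf, PositionOf, Count}" for l
      using that by (simp add: step(3))
    have "\<sigma> ClusterSize 0 = cluster_size"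
      using loaded by (simp add: center_loaded_def atoms_loadedD data_loadedD)
    hence round: "sem inp (When (Near (Var LoopI) \<otimes> Less (Var Count) (Var ClusterSize)) c) \<tau>
        = (if x \<in> near \<sigma> \<and> \<tau> Count 0 < cluster_size then sem inp c \<tau> else \<tau>)" for c
      using step(1,2) by (intro sem_When_Near[OF loaded]) (auto simp: same)
    have rank_Suc: "?rank (Suc x) = (if x \<in> near \<sigma> then Suc (?rank x) else ?rank x)"
      by (simp add: lessThan_Suc Int_insert_right)
    have "x \<in> cluster_members \<sigma> \<longleftrightarrow> x \<in> near \<sigma> \<and> \<tau> Count 0 < cluster_size"
      using step(4) by (auto simp: cluster_members_def)
    thus ?case using step(2,4) s_index unfolding round rank_Suc by (auto simp: same lessThan_Suc)
  qed (use loaded unset in \<open>simp_all add: center_loaded_def atoms_loadedD\<close>)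
  moreover have "?B T = cluster_members \<sigma>" using near_less by (auto simp: cluster_members_def)
  ultimately show "sem inp fill_cluster \<sigma> ClusterOf t = (if t \<in> cluster_members \<sigma> then Suc s
      else \<sigma> ClusterOf t)"
    "sem inp fill_cluster \<sigma> PositionOf t = (if t \<in> cluster_members \<sigma> then card (near \<sigma> \<inter> {..<t})
        else \<sigma> PositionOf t)"
    by simp_all
qed

lemma sem_remove_cluster:
  assumes loaded: "center_loaded \<sigma>" and j_less: "j < n"
  defines "p \<equiv> \<sigma> BestClient 0"
  shows "bank_pool (sem inp remove_cluster \<sigma>) j =
    (if j = p then bank_pool \<sigma> p - cluster (\<sigma> ClusterOf) (\<sigma> CurCluster 0) else bank_pool \<sigma> j)"
proof -
  have p_less: "p < n" and data: "\<sigma> NumClients 0 = n" "\<sigma> NumAtoms 0 = T"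
    using loaded by (simp_all add: center_loaded_def atoms_loadedD data_loadedD p_def)
  let ?g = "\<lambda>y. if \<sigma> ClusterOf (y div n) = \<sigma> CurCluster 0 then 0 else \<sigma> InPool y"
  have "sem inp remove_cluster \<sigma> InPool y = (if y \<in> (\<lambda>t. t * n + p) ` {..<T} then ?g y
      else \<sigma> InPool y)" for y
    unfolding remove_cluster_def
    by (rule sem_For_fill) (use p_less data in \<open>auto simp: inj_def p_def fun_upd_idem\<close>)
  thus ?thesis using j_less p_less by (auto simp: bank_pool_def cluster_def row_major_eq_iff image_iff)
qed

lemma sem_new_cluster:
  assumes loaded: "center_loaded \<sigma>" and s_index: "\<sigma> LoopK 0 = s"
  shows "sem inp new_cluster \<sigma> ClusterOf = (\<lambda>t. if t \<in> cluster_members \<sigma> then Suc s else \<sigma> ClusterOf t)"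
    and "sem inp new_cluster \<sigma> PositionOf
        = (\<lambda>t. if t \<in> cluster_members \<sigma> then card (near \<sigma> \<inter> {..<t}) else \<sigma> PositionOf t)"
    and "sem inp new_cluster \<sigma> CurCluster 0 = Suc s"
proof -
  let ?\<sigma> = "sem inp (SetV Count (Num 0)) \<sigma>"
  have "near ?\<sigma> = near \<sigma>" by (rule near_cong) auto
  moreover from this have "cluster_members ?\<sigma> = cluster_members \<sigma>" by (simp add: cluster_members_def)
  moreover have "center_loaded ?\<sigma>" by (rule center_loaded_cong[OF loaded]) auto
  note sem_fill_cluster[OF this, of s inp]
  ultimately show "sem inp new_cluster \<sigma> ClusterOf
      = (\<lambda>t. if t \<in> cluster_members \<sigma> then Suc s else \<sigma> ClusterOf t)"
    "sem inp new_cluster \<sigma> PositionOf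
        = (\<lambda>t. if t \<in> cluster_members \<sigma> then card (near \<sigma> \<inter> {..<t}) else \<sigma> PositionOf t)"
    "sem inp new_cluster \<sigma> CurCluster 0 = Suc s"
    using s_index by (simp_all add: new_cluster_def sem_unwritten fun_eq_iff)
qed

lemma new_cluster_position_bij:
  assumes "center_loaded \<sigma>" "cluster_size \<le> card (near \<sigma>)"
  shows "bij_betw (sem inp new_cluster \<sigma> PositionOf) (cluster_members \<sigma>) {..<cluster_size}"
  using bij_betw_cluster_members[OF assms(2)]
  by (rule bij_betw_cong[THEN iffD1, rotated]) (simp add: sem_new_cluster(2)[OF assms(1) refl])

lemma sem_remove_and_count:
  fixes inp :: memory and \<sigma> :: banks
  assumes loaded: "center_loaded \<sigma>"
  defines "p \<equiv> \<sigma> BestClient 0"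
    and "\<tau> \<equiv> sem inp (Incr NumAssigned (Var BestClient) (Num 1)) (sem inp remove_cluster \<sigma>)"
  shows "j < n \<Longrightarrow> bank_pool \<tau> j =
      (if j = p then bank_pool \<sigma> p - cluster (\<sigma> ClusterOf) (\<sigma> CurCluster 0) else bank_pool \<sigma> j)"
    and "\<tau> ClusterOf = \<sigma> ClusterOf" "\<tau> PositionOf = \<sigma> PositionOf"
    and "\<tau> NumAssigned = (\<sigma> NumAssigned)(p := Suc (\<sigma> NumAssigned p))"
proof -
  have "bank_pool \<tau> = bank_pool (sem inp remove_cluster \<sigma>)"
    unfolding \<tau>_def by (rule bank_pool_cong) simp
  thus "j < n \<Longrightarrow> bank_pool \<tau> j =
      (if j = p then bank_pool \<sigma> p - cluster (\<sigma> ClusterOf) (\<sigma> CurCluster 0) else bank_pool \<sigma> j)"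
    using sem_remove_cluster[OF loaded] by (simp add: p_def)
qed (auto simp: \<tau>_def p_def sem_unwritten)

abbreviation bank_clustering_inv :: "nat \<Rightarrow> banks \<Rightarrow> bool" where
  "bank_clustering_inv s \<sigma> \<equiv>
     clustering_inv s (bank_pool \<sigma>) (\<sigma> ClusterOf) (\<sigma> PositionOf) (\<sigma> NumAssigned)"

lemma sem_serve_center_banks:
  fixes inp :: memory and \<sigma> :: banks
  assumes center: "center_loaded \<sigma>"
  defines "p \<equiv> \<sigma> BestClient 0" and "\<tau> \<equiv> sem inp serve_center \<sigma>"
    and "\<rho> \<equiv> sem inp (find_old_cluster ;; When (Neg (Var CurCluster)) new_cluster) \<sigma>"
  shows "j < n \<Longrightarrow> bank_pool \<tau> j =
      (if j = p then bank_pool \<sigma> p - cluster (\<rho> ClusterOf) (\<rho> CurCluster 0) else bank_pool \<sigma> j)"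
    and "\<tau> ClusterOf = \<rho> ClusterOf" "\<tau> PositionOf = \<rho> PositionOf"
    and "\<tau> NumAssigned = (\<sigma> NumAssigned)(p := Suc (\<sigma> NumAssigned p))"
proof -
  have same: "\<rho> l = \<sigma> l" if "l \<notin> {LoopI, CurCluster, ClusterOf, PositionOf, Count}" for l
    unfolding \<rho>_def by (rule sem_unwritten) (use that in simp)
  have loaded: "center_loaded \<rho>" by (rule center_loaded_cong[OF center]) (auto simp: same)
  have "bank_pool \<rho> = bank_pool \<sigma>" by (rule bank_pool_cong) (simp add: same)
  moreover have "\<tau> = sem inp (Incr NumAssigned (Var BestClient) (Num 1)) (sem inp remove_cluster \<rho>)"
    by (simp add: \<tau>_def serve_center_def \<rho>_def)
  ultimately show "j < n \<Longrightarrow> bank_pool \<tau> j =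
      (if j = p then bank_pool \<sigma> p - cluster (\<rho> ClusterOf) (\<rho> CurCluster 0) else bank_pool \<sigma> j)"
    "\<tau> ClusterOf = \<rho> ClusterOf" "\<tau> PositionOf = \<rho> PositionOf"
    "\<tau> NumAssigned = (\<sigma> NumAssigned)(p := Suc (\<sigma> NumAssigned p))"
    using sem_remove_and_count[OF loaded, where inp = inp] by (simp_all add: same p_def)
qed

lemma sem_serve_center:
  fixes inp :: memory and \<sigma> :: banks
  defines "p \<equiv> \<sigma> BestClient 0" and "d \<equiv> \<sigma> BestDist 0" and "\<tau> \<equiv> sem inp serve_center \<sigma>"
  assumes loaded: "atoms_loaded \<sigma>" and s_index: "\<sigma> LoopK 0 = s"
    and inv: "bank_clustering_inv s \<sigma>"
    and client: "p < n" "\<sigma> NumAssigned p < residual p" "crowded (bank_pool \<sigma>) p d"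
    and nearest: "\<And>j t. j < n \<Longrightarrow> \<sigma> NumAssigned j < residual j \<Longrightarrow> t \<in> bank_pool \<sigma> j \<Longrightarrow>
      crowded (bank_pool \<sigma>) j (\<delta> j t) \<Longrightarrow> d \<le> \<delta> j t"
  shows "bank_clustering_inv (Suc s) \<tau>"
proof -
  define \<tau>\<^sub>1 where "\<tau>\<^sub>1 = sem inp find_old_cluster \<sigma>"
  define q where "q = \<tau>\<^sub>1 CurCluster 0"
  define \<tau>\<^sub>2 where "\<tau>\<^sub>2 = (if q = 0 then sem inp new_cluster \<tau>\<^sub>1 else \<tau>\<^sub>1)"
  have same: "\<tau>\<^sub>1 l = \<sigma> l" if "l \<notin> {LoopI, CurCluster}" for l
    using that by (simp add: \<tau>\<^sub>1_def sem_unwritten)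
  have center: "center_loaded \<sigma>"
    using loaded client(1) clustering_inv_pool_sub[OF inv] by (simp add: center_loaded_def p_def)
  have center\<^sub>1: "center_loaded \<tau>\<^sub>1" by (rule center_loaded_cong[OF center]) (auto simp: same)
  have near: "near \<tau>\<^sub>1 = near \<sigma>" "near \<sigma> = {t \<in> bank_pool \<sigma> p. \<delta> p t \<le> d}"
    by (rule near_cong) (auto simp: same near_def p_def d_def)
  have "\<tau>\<^sub>2 = sem inp (find_old_cluster ;; When (Neg (Var CurCluster)) new_cluster) \<sigma>"
    by (simp add: \<tau>\<^sub>1_def \<tau>\<^sub>2_def q_def)
  note served = sem_serve_center_banks(1)[OF center, where inp = inp, folded this, folded p_def \<tau>_def]
    and banks = sem_serve_center_banks(2-4)[OF center, where inp = inp, folded this, folded p_def \<tau>_def]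
  note old = sem_find_old_cluster[OF center, of inp, folded \<tau>\<^sub>1_def, folded q_def]
  show ?thesis
  proof (cases "q = 0")
    case True
    let ?B = "cluster_members \<tau>\<^sub>1"
    note new = sem_new_cluster[OF center\<^sub>1, of s inp, unfolded same[of LoopK, simplified], OF s_index]
    have "cluster_size \<le> card (near \<tau>\<^sub>1)" using client(3) by (simp add: near crowded_def)
    from new_cluster_position_bij[OF center\<^sub>1 this] have "bij_betw (\<tau>\<^sub>2 PositionOf) ?B {..<cluster_size}"
      using True by (simp add: \<tau>\<^sub>2_def)
    moreover have "?B \<subseteq> near \<sigma>" by (auto simp: cluster_members_def near(1))
    ultimately show ?thesis unfolding banks
      by (intro clustering_inv_create[OF inv client nearest, of ?B])
        (use old(1)[OF True] served True in \<open>auto simp: \<tau>\<^sub>2_def new same near(2)\<close>)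
  next
    case False
    then obtain a where "a \<in> near \<sigma>" "\<sigma> ClusterOf a = q" using old(2) by blast
    with False show ?thesis unfolding banks
      using clustering_inv_join[OF inv client nearest, of a q "bank_pool \<tau>"] served
      by (simp add: \<tau>\<^sub>2_def same near(2) q_def)
  qed
qed

lemma sem_reset_find_center:
  fixes inp :: memory and \<sigma> :: banks
  assumes loaded: "atoms_loaded \<sigma>" and pool_sub: "\<And>j. j < n \<Longrightarrow> bank_pool \<sigma> j \<subseteq> pool0 j"
  defines "\<tau> \<equiv> sem inp find_center (sem inp (SetV Found (Num 0)) \<sigma>)"
  shows "tracks_min snd (open_centers \<sigma> n) (\<tau> Found 0) (\<tau> BestClient 0, \<tau> BestDist 0)"
proof -
  let ?\<sigma> = "sem inp (SetV Found (Num 0)) \<sigma>"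
  have pools: "bank_pool ?\<sigma> = bank_pool \<sigma>" by (rule bank_pool_cong) simp
  have "atoms_loaded ?\<sigma>" by (rule atoms_loaded_cong[OF loaded]) auto
  hence "tracks_center (open_centers ?\<sigma> n) \<tau>"
    unfolding \<tau>_def by (rule sem_find_center) (use pool_sub pools in auto)
  moreover have "open_centers ?\<sigma> n = open_centers \<sigma> n" unfolding open_centers_def pools by simp
  ultimately show ?thesis by (simp add: tracks_center_def)
qed

lemma sem_center_round:
  assumes loaded: "atoms_loaded \<sigma>" and s_index: "\<sigma> LoopK 0 = s" and inv: "bank_clustering_inv s \<sigma>"
  shows "bank_clustering_inv (Suc s)
    (sem inp (SetV Found (Num 0) ;; find_center ;; When (Var Found) serve_center) \<sigma>)"
proof -
  define \<tau> where "\<tau> = sem inp find_center (sem inp (SetV Found (Num 0)) \<sigma>)"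
  have same: "\<tau> l = \<sigma> l" if "l \<notin> {LoopP, LoopI, LoopV, Count, Found, BestDist, BestClient}" for l
    using that by (simp add: \<tau>_def sem_unwritten)
  have pools: "bank_pool \<tau> = bank_pool \<sigma>" by (rule bank_pool_cong) (simp add: same)
  note tracks = sem_reset_find_center[OF loaded clustering_inv_pool_sub[OF inv], of inp, folded \<tau>_def]
  have body: "sem inp (SetV Found (Num 0) ;; find_center ;; When (Var Found) serve_center) \<sigma>
      = (if \<tau> Found 0 = 0 then \<tau> else sem inp serve_center \<tau>)"
    by (simp add: \<tau>_def)
  show ?thesis
  proof (cases "\<tau> Found 0 = 0")
    case True
    hence "open_centers \<sigma> n = {}" using tracks by (simp add: tracks_min_def)
    hence "\<not> \<sigma> NumAssigned j < residual j" if "j < n" for j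
      using clustering_inv_crowded[OF inv that] mem_open_centers[of j _ \<sigma>] that by auto
    from clustering_inv_skip[OF inv this] show ?thesis unfolding body using True by (simp add: same pools)
  next
    case False
    note center = tracks_minD[OF tracks False]
    have "atoms_loaded \<tau>" by (rule atoms_loaded_cong[OF loaded]) (auto simp: same)
    moreover have "\<tau> BestDist 0 \<le> \<delta> j t" if "j < n" "\<sigma> NumAssigned j < residual j"
      "t \<in> bank_pool \<sigma> j" "crowded (bank_pool \<sigma>) j (\<delta> j t)" for j t
      using center(2)[of "(j, \<delta> j t)"] that by (auto simp: mem_open_centers)
    ultimately have "bank_clustering_inv (Suc s) (sem inp serve_center \<tau>)"
      using center(1) s_index inv by (intro sem_serve_center) (auto simp: mem_open_centers same pools)
    thus ?thesis unfolding body using False by simp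
  qed
qed

lemma sem_form_clusters:
  assumes loaded: "atoms_loaded \<sigma>" and pool: "\<And>j. j < n \<Longrightarrow> bank_pool \<sigma> j = pool0 j"
    and zero: "\<sigma> NumAssigned = (\<lambda>_. 0)" "\<sigma> ClusterOf = (\<lambda>_. 0)"
  shows "bank_clustering_inv (n * (n * atoms_per_unit)) (sem inp form_clusters \<sigma>)"
  unfolding form_clusters_def
proof (induct rule: sem_For_invariant[where P = bank_clustering_inv])
  case init
  have "bank_pool (put LoopK 0 0 \<sigma>) = bank_pool \<sigma>" by (rule bank_pool_cong) simp
  thus ?case using zero pool by (intro clustering_inv_init) auto
next
  case (step s \<tau>)
  have "atoms_loaded \<tau>" by (rule atoms_loaded_cong[OF loaded], rule step(3)) auto
  from sem_center_round[OF this step(2,4), of inp] show ?case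
    by (simp add: bank_pool_cong[of "bump LoopK _"] del: sem.simps)
qed (use data_loadedD[OF atoms_loadedD(1)[OF loaded]] in simp_all)

end


section \<open>Semantics of opening and connecting\<close>

lemma (in clustered_solution) sem_open_atoms:
  assumes "data_loaded \<sigma>" "num_atoms = n * atoms_per_unit * atoms_per_unit"
    and atom: "\<And>t. t < num_atoms \<Longrightarrow> \<sigma> AtomValid t = of_bool (valid t)"
      "\<And>t. t \<in> atoms \<Longrightarrow> \<sigma> AtomSite t = atom_site t"
    and cluster: "\<sigma> ClusterOf = label" "\<sigma> PositionOf = position" and zero: "\<sigma> RandomOpen = (\<lambda>_. 0)"
  shows "sem inp open_atoms \<sigma> RandomOpen i = random_open (\<sigma> RandomDraw) i"
proof -
  let ?S = "{t \<in> opened (\<sigma> RandomDraw). atom_site t = i}"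
  have num_atoms: "\<sigma> NumAtoms 0 = num_atoms" using assms(1,2) by (simp add: data_loadedD)
  have "sem inp open_atoms \<sigma> RandomOpen i = \<sigma> RandomOpen i + (\<Sum>t<num_atoms. if t \<in> ?S then 1 else 0)"
    unfolding open_atoms_def
  proof (rule sem_For_sum, goal_cases bound fresh other step)
    case (step t \<tau>)
    show ?case
    proof (cases "valid t")
      case True
      hence "t \<in> atoms" using step(1) by (simp add: atoms_def)
      thus ?thesis using step atom cluster num_atoms True by (auto simp: opened_def slot_def val_def)
    next
      case False
      thus ?thesis using step atom by (auto simp: opened_def atoms_def)
    qed
  qed (use num_atoms in simp_all)
  also have "(\<Sum>t<num_atoms. if t \<in> ?S then 1 else 0) = card ?S"
    by (subst sum_if_mem) (auto simp: opened_def atoms_def)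
  finally show ?thesis by (simp add: zero random_open_def)
qed

context scaled_ftfp
begin

definition free_sites :: "banks \<Rightarrow> nat \<Rightarrow> nat \<Rightarrow> (nat \<times> nat) set" where
  "free_sites \<sigma> j x = (\<lambda>i. (i, D i j)) ` {i. i < x \<and> \<sigma> RandomConn (i * n + j) < \<sigma> RandomOpen i}"

lemma free_sites_Suc:
  "free_sites \<sigma> j (Suc x) =
     (if \<sigma> RandomConn (x * n + j) < \<sigma> RandomOpen x then insert (x, D x j) else id) (free_sites \<sigma> j x)"
  by (auto simp: free_sites_def less_Suc_eq)

lemma sem_find_free_site:
  fixes inp :: memory and \<sigma> :: banks
  assumes loaded: "data_loaded \<sigma>" and j_index: "\<sigma> LoopJ 0 = j" "j < n"
  defines "\<tau> \<equiv> sem inp find_free_site \<sigma>"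
  shows "tracks_min snd (free_sites \<sigma> j m) (\<tau> Found 0) (\<tau> BestSite 0, \<tau> BestDist 0)"
  unfolding \<tau>_def find_free_site_def sem.simps(3)
proof (induct rule: sem_For_invariant[where
    P = "\<lambda>x \<tau>. tracks_min snd (free_sites \<sigma> j x) (\<tau> Found 0) (\<tau> BestSite 0, \<tau> BestDist 0)"])
  case (step x \<tau>)
  have same: "\<tau> l = \<sigma> l" if "l \<notin> {LoopI, Found, BestDist, BestSite}" for l
    using that by (simp add: step(3))
  let ?better = "Less (Cell2 RandomConn (Var LoopI) (Var LoopJ)) (Cell RandomOpen (Var LoopI)) \<otimes>
    (Neg (Var Found) \<oplus> Less (Cell2 Distance (Var LoopI) (Var LoopJ)) (Var BestDist))"
  have better: "ev inp \<tau> ?better \<noteq> 0 \<longleftrightarrow>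
      \<sigma> RandomConn (x * n + j) < \<sigma> RandomOpen x \<and> (\<tau> Found 0 = 0 \<or> D x j < \<tau> BestDist 0)"
    using step(1,2) j_index data_loadedD[OF loaded] by (auto simp: same)
  from tracks_min_better[OF step(4), of "(x, D x j)" 1]
    tracks_min_worse[OF step(4), of "(x, D x j)"] show ?case
    using step(1,2,4) j_index data_loadedD[OF loaded]
      unfolding sem_When[OF better] by (auto simp: free_sites_Suc same)
qed (use data_loadedD[OF loaded] in \<open>simp_all add: free_sites_def tracks_min_init\<close>)

lemma sem_connect_once:
  assumes loaded: "data_loaded \<sigma>" and j_index: "\<sigma> LoopJ 0 = j" "j < n"
    and greedy: "greedy_inv (\<sigma> RandomOpen) j k (\<lambda>i. \<sigma> RandomConn (i * n + j))"
  shows "greedy_inv (\<sigma> RandomOpen) j (Suc k) (\<lambda>i. sem inp connect_once \<sigma> RandomConn (i * n + j))"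
    and "j' < n \<Longrightarrow> j' \<noteq> j \<Longrightarrow> sem inp connect_once \<sigma> RandomConn (i * n + j') = \<sigma> RandomConn (i * n + j')"
proof -
  define \<tau> where "\<tau> = sem inp find_free_site \<sigma>"
  define i\<^sub>0 where "i\<^sub>0 = \<tau> BestSite 0"
  have same: "\<tau> l = \<sigma> l" if "l \<notin> {LoopI, Found, BestDist, BestSite}" for l
    using that by (simp add: \<tau>_def sem_unwritten)
  have conn: "sem inp connect_once \<sigma> RandomConn =
      (if \<tau> Found 0 = 0 then \<sigma> RandomConn else
      (\<sigma> RandomConn)(i\<^sub>0 * n + j := Suc (\<sigma> RandomConn (i\<^sub>0 * n + j))))"
    using j_index data_loadedD[OF loaded] by (auto simp: connect_once_def \<tau>_def[symmetric] same i\<^sub>0_def)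
  show "sem inp connect_once \<sigma> RandomConn (i * n + j') = \<sigma> RandomConn (i * n + j')" if "j' < n" "j' \<noteq> j"
    using that j_index by (simp add: conn row_major_eq_iff)
  have tracks: "tracks_min snd (free_sites \<sigma> j m) (\<tau> Found 0) (i\<^sub>0, \<tau> BestDist 0)"
    unfolding \<tau>_def i\<^sub>0_def by (rule sem_find_free_site[OF loaded j_index])
  show "greedy_inv (\<sigma> RandomOpen) j (Suc k) (\<lambda>i. sem inp connect_once \<sigma> RandomConn (i * n + j))"
  proof (cases "\<tau> Found 0 = 0")
    case True
    hence "\<not> \<sigma> RandomConn (i * n + j) < \<sigma> RandomOpen i" if "i < m" for i
      using tracks that by (auto simp: tracks_min_def free_sites_def)
    from greedy_inv_stuck[OF greedy this] True show ?thesis by (simp add: conn)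
  next
    case False
    note best = tracks_minD[OF tracks False]
    have "D i\<^sub>0 j \<le> D i j" if "i < m" "\<sigma> RandomConn (i * n + j) < \<sigma> RandomOpen i" for i
      using best(1) best(2)[of "(i, D i j)"] that by (auto simp: free_sites_def)
    hence "greedy_inv (\<sigma> RandomOpen) j (Suc k)
        ((\<lambda>i. \<sigma> RandomConn (i * n + j))(i\<^sub>0 := Suc (\<sigma> RandomConn (i\<^sub>0 * n + j))))"
      using best(1) by (intro greedy_inv_step[OF greedy]) (auto simp: free_sites_def)
    moreover have "(\<lambda>i. sem inp connect_once \<sigma> RandomConn (i * n + j)) =
        (\<lambda>i. \<sigma> RandomConn (i * n + j))(i\<^sub>0 := Suc (\<sigma> RandomConn (i\<^sub>0 * n + j)))"
      using False j_index by (auto simp: conn fun_eq_iff)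
    ultimately show ?thesis by simp
  qed
qed

lemma sem_connect_client:
  assumes loaded: "data_loaded \<sigma>" and j_index: "\<sigma> LoopJ 0 = j" "j < n"
    and demand: "\<sigma> ResidualDemand j \<le> n * atoms_per_unit"
    and unset: "\<And>i. \<sigma> RandomConn (i * n + j) = 0"
  shows "greedy_inv (\<sigma> RandomOpen) j (\<sigma> ResidualDemand j)
      (\<lambda>i. sem inp connect_client \<sigma> RandomConn (i * n + j))"
    and "j' < n \<Longrightarrow> j' \<noteq> j \<Longrightarrow> sem inp connect_client \<sigma> RandomConn (i * n + j') = \<sigma> RandomConn (i * n + j')"
proof -
  let ?d = "\<sigma> ResidualDemand j"
  let ?P = "\<lambda>x \<tau>. greedy_inv (\<sigma> RandomOpen) j (min x ?d) (\<lambda>i. \<tau> RandomConn (i * n + j)) \<and>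
    (\<forall>i. \<forall>j'<n. j' \<noteq> j \<longrightarrow> \<tau> RandomConn (i * n + j') = \<sigma> RandomConn (i * n + j'))"
  have "?P (n * atoms_per_unit) (sem inp connect_client \<sigma>)"
    unfolding connect_client_def
  proof (induct rule: sem_For_invariant[where P = ?P])
    case init
    show ?case using unset by (simp add: greedy_inv_init)
  next
    case (step x \<tau>)
    have same: "\<tau> l = \<sigma> l" if "l \<notin> {LoopK, LoopI, Found, BestDist, BestSite, RandomConn}" for l
      using that by (simp add: step(3))
    have loaded': "data_loaded \<tau>" by (rule data_loaded_cong[OF loaded]) (simp add: same)
    have pending: "ev inp \<tau> (Less (Var LoopK) (Cell ResidualDemand (Var LoopJ))) \<noteq> 0 \<longleftrightarrow> x < ?d"
      using step(2) j_index(1) by (simp add: same not_le)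
    show ?case
    proof (cases "x < ?d")
      case True
      have "greedy_inv (\<tau> RandomOpen) j x (\<lambda>i. \<tau> RandomConn (i * n + j))"
        using step(4) True by (simp add: same)
      note round = sem_connect_once[OF loaded' _ j_index(2) this, where inp = inp]
      show ?thesis unfolding sem_When[OF pending] using True round step(4) j_index(1)
        by (simp add: same del: sem.simps)
    next
      case False
      thus ?thesis unfolding sem_When[OF pending] using step(4) by simp
    qed
  qed (use data_loadedD[OF loaded] in simp_all)
  thus "greedy_inv (\<sigma> RandomOpen) j ?d (\<lambda>i. sem inp connect_client \<sigma> RandomConn (i * n + j))"
    "j' < n \<Longrightarrow> j' \<noteq> j \<Longrightarrow> sem inp connect_client \<sigma> RandomConn (i * n + j') = \<sigma> RandomConn (i * n + j')"
    using demand by (simp_all add: min_absorb2)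
qed

lemma sem_connect_clients:
  assumes loaded: "data_loaded \<sigma>" and demand: "\<And>j. j < n \<Longrightarrow> \<sigma> ResidualDemand j \<le> n * atoms_per_unit"
    and zero: "\<sigma> RandomConn = (\<lambda>_. 0)" and j_less: "j < n"
  shows "greedy_inv (\<sigma> RandomOpen) j (\<sigma> ResidualDemand j)
      (\<lambda>i. sem inp connect_clients \<sigma> RandomConn (i * n + j))"
proof -
  let ?P = "\<lambda>x \<tau>. \<forall>j<n. if j
      < x then greedy_inv (\<sigma> RandomOpen) j (\<sigma> ResidualDemand j) (\<lambda>i. \<tau> RandomConn (i * n + j))
    else (\<forall>i. \<tau> RandomConn (i * n + j) = 0)"
  have "?P n (sem inp connect_clients \<sigma>)"
    unfolding connect_clients_def
  proof (induct rule: sem_For_invariant[where P = ?P])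
    case (step x \<tau>)
    have same: "\<tau> l = \<sigma> l" if "l \<notin> {LoopJ, LoopK, LoopI, Found, BestDist, BestSite, RandomConn}" for l
      using that by (simp add: step(3))
    have loaded': "data_loaded \<tau>" by (rule data_loaded_cong[OF loaded]) (simp add: same)
    have fresh: "\<tau> ResidualDemand x \<le> n * atoms_per_unit" "\<And>i. \<tau> RandomConn (i * n + x) = 0"
      using demand step(1,4) by (auto simp: same)
    note client = sem_connect_client[OF loaded' step(2,1) fresh,
      where inp = inp, unfolded same[of RandomOpen, simplified] same[of ResidualDemand, simplified]]
    show ?case
    proof (intro allI impI)
      fix j assume "j < n"
      thus "if j < Suc x then greedy_inv (\<sigma> RandomOpen) j (\<sigma> ResidualDemand j)
            (\<lambda>i. bump LoopJ (sem inp connect_client \<tau>) RandomConn (i * n + j))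
          else (\<forall>i. bump LoopJ (sem inp connect_client \<tau>) RandomConn (i * n + j) = 0)"
        using client step(4) by (cases "j = x") (auto simp: less_Suc_eq split: if_splits)
    qed
  qed (use zero data_loadedD[OF loaded] in simp_all)
  thus ?thesis using j_less by simp
qed

lemma sem_write_open:
  assumes "data_loaded \<sigma>" "i < m"
  shows "sem inp write_open \<sigma> Output i = \<sigma> FixedOpen i + \<sigma> RandomOpen i"
proof -
  have "sem inp write_open \<sigma> Output i = (if i < m then \<sigma> FixedOpen i + \<sigma> RandomOpen i else \<sigma> Output i)"
    unfolding write_open_def by (rule sem_For_fill_array) (use data_loadedD[OF assms(1)] in auto)
  thus ?thesis using assms(2) by simp
qed

lemma sem_write_conn:
  assumes "data_loaded \<sigma>"
  shows "i < m \<Longrightarrow> sem inp write_conn \<sigma> Output i = \<sigma> Output i"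
    and "t < m * n \<Longrightarrow> sem inp write_conn \<sigma> Output (m + t) = \<sigma> FixedConn t + \<sigma> RandomConn t"
proof -
  have "sem inp write_conn \<sigma> Output y =
      (if y \<in> (\<lambda>t. m + t) ` {..<m * n} then \<sigma> FixedConn (y - m) + \<sigma> RandomConn (y - m)
      else \<sigma> Output y)" for y
    unfolding write_conn_def
    by (rule sem_For_fill) (use data_loadedD[OF assms] in \<open>auto simp: inj_def\<close>)
  thus "i < m \<Longrightarrow> sem inp write_conn \<sigma> Output i = \<sigma> Output i"
    "t < m * n \<Longrightarrow> sem inp write_conn \<sigma> Output (m + t) = \<sigma> FixedConn t + \<sigma> RandomConn t"
    by auto
qed

end


section \<open>Random draws and output on the machine\<close>

definition step_time :: "nat \<Rightarrow> nat \<Rightarrow> nat" where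
  "step_time C b = 1 + C * (b + 1)"

lemma test_time_le_step_time:
  assumes "fits b m" "expr_cost e \<le> C"
  shows "1 + eval_cost m e \<le> step_time C b"
  using eval_cost_le[OF assms(1) order_refl, of e] mult_le_mono1[OF assms(2), of "b + 1"]
  unfolding step_time_def by linarith

lemma two_expr_time_le_step:
  assumes "fits b m" "expr_cost a + expr_cost e \<le> C"
  shows "1 + eval_cost m a + eval_cost m e \<le> step_time C b"
  using eval_cost_le[OF assms(1) order_refl, of a] eval_cost_le[OF assms(1) order_refl, of e]
    mult_le_mono1[OF assms(2), of "b + 1"]
  unfolding step_time_def add_mult_distrib by linarith

lemma exec_Assign_step:
  assumes "fits b m" "expr_cost a + expr_cost e \<le> C"
  shows "exec (Assign a e) m (return_pmf (m(eval m a := eval m e))) (step_time C b)"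
  by (rule exec_mono[OF exec_Assign two_expr_time_le_step[OF assms]])

lemma exec_Draw_step:
  assumes "fits b m" "expr_cost a + expr_cost e \<le> C"
  shows "exec (Draw a e) m (map_pmf (\<lambda>v. m(eval m a := v)) (pmf_of_set {0..eval m e})) (step_time C b)"
  by (rule exec_mono[OF exec_Draw two_expr_time_le_step[OF assms]])

abbreviation "index_addr \<equiv> cell_addr LoopU (Const 0)"
abbreviation "next_index \<equiv> Add (Mem index_addr) (Const 1)"

definition draw_test :: expr where "draw_test = Sub (compile_expr (Var NumDraws)) (Mem index_addr)"
definition draw_addr :: expr where "draw_addr = cell_addr RandomDraw (Mem index_addr)"
definition draw_range :: expr where "draw_range = Sub (compile_expr (Var ClusterSize)) (Const 1)"

definition draw_loop :: com where
  "draw_loop = While draw_test (Seq (Draw draw_addr draw_range) (Assign index_addr next_index))"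

definition draw_com :: com where
  "draw_com = Seq (Assign index_addr (Const 0)) draw_loop"

definition draw_cost :: nat where
  "draw_cost = expr_cost draw_test + expr_cost draw_addr + expr_cost draw_range + expr_cost index_addr +
     expr_cost next_index + expr_cost (Const 0)"

definition set_draws_from :: "nat \<Rightarrow> nat \<Rightarrow> (nat \<Rightarrow> nat) \<Rightarrow> banks \<Rightarrow> banks" where
  "set_draws_from x J \<omega> \<tau> = put LoopU 0 J
      (\<tau>(RandomDraw := (\<lambda>t. if t \<in> {x..<J} then \<omega> t else \<tau> RandomDraw t)))"

lemma draw_banks_less: "LoopU < num_banks" "RandomDraw < num_banks" "NumDraws < num_banks"
  "ClusterSize < num_banks"
  "NumSites < num_banks" "NumPairs < num_banks" "Output < num_banks"
  by (simp_all add: num_banks_def)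

lemma eval_index: "eval (flat inp \<tau>) index_addr = base inp + (num_banks * 0 + LoopU)"
  "eval (flat inp \<tau>) (Mem index_addr) = \<tau> LoopU 0"
  using flat_cell[OF draw_banks_less(1), of inp \<tau> 0] by (simp_all add: eval_cell_addr)

lemma eval_next_index: "eval (flat inp \<tau>) next_index = Suc (\<tau> LoopU 0)"
  using eval_index(2)[of inp \<tau>] by simp

lemma eval_draw: "eval (flat inp \<tau>) draw_test = \<tau> NumDraws 0 - \<tau> LoopU 0"
  "eval (flat inp \<tau>) draw_addr = base inp + (num_banks * \<tau> LoopU 0 + RandomDraw)"
  "eval (flat inp \<tau>) draw_range = \<tau> ClusterSize 0 - 1"
  using eval_compile_expr[of "Var NumDraws" inp \<tau>] eval_compile_expr[of "Var ClusterSize" inp \<tau>]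
    draw_banks_less eval_index(2)[of inp \<tau>]
  by (simp_all add: draw_test_def draw_addr_def draw_range_def eval_cell_addr del: compile_expr.simps)

definition draw_time :: "nat \<Rightarrow> nat \<Rightarrow> nat" where
  "draw_time J b = 1 + step_time draw_cost b +
      (J * (2 + 3 * step_time draw_cost b) + step_time draw_cost b)"

context
  fixes inp :: memory and b J L :: nat
  assumes input: "fits b inp" and L_pos: "0 < L" and sizes: "J \<le> 2 ^ b" "L \<le> 2 ^ b"
begin

abbreviation "uniform \<equiv> pmf_of_set {0..L - 1}"
abbreviation "tick \<equiv> step_time draw_cost b"

lemma exec_draw_one:
  assumes fit: "banks_fit b \<tau>" and x_index: "\<tau> LoopU 0 = x" "x < J" and range: "\<tau> ClusterSize 0 = L"
  shows "exec (Seq (Draw draw_addr draw_range) (Assign index_addr next_index)) (flat inp \<tau>)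
    (map_pmf (\<lambda>v. flat inp (put LoopU 0 (Suc x) (put RandomDraw x v \<tau>))) uniform) (1 + tick + tick)"
proof -
  let ?\<tau> = "\<lambda>v. put RandomDraw x v \<tau>"
  have draw: "exec (Draw draw_addr draw_range) (flat inp \<tau>)
      (map_pmf (\<lambda>v. flat inp (?\<tau> v)) uniform) tick"
    using exec_Draw_step[OF flat_fits[OF input fit], of draw_addr draw_range draw_cost] x_index range
    by (simp add: eval_draw flat_put[OF draw_banks_less(2)] draw_cost_def)
  have "exec (Assign index_addr next_index) (flat inp (?\<tau> v))
      (return_pmf (flat inp (put LoopU 0 (Suc x) (?\<tau> v)))) tick"
    if "v \<in> set_pmf uniform" for v
  proof -
    have "banks_fit b (?\<tau> v)" using that sizes(2)
      by (intro banks_fit_put[OF fit]) (auto simp: set_pmf_of_set)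
    from exec_Assign_step[OF flat_fits[OF input this], of index_addr next_index draw_cost]
    show ?thesis unfolding eval_index eval_next_index flat_put[OF draw_banks_less(1)]
      using x_index(1) by (simp add: draw_cost_def)
  qed
  from exec_Seq[OF draw this] show ?thesis by (simp add: map_pmf_def)
qed

lemma bind_set_draws_from:
  assumes "x < J"
  shows "bind_pmf uniform
      (\<lambda>v. map_pmf (\<lambda>\<omega>. flat inp (set_draws_from (Suc x) J \<omega>
      (put LoopU 0 (Suc x) (put RandomDraw x v \<tau>))))
      (Pi_pmf {Suc x..<J} 0 (\<lambda>_. uniform)))
    = map_pmf (\<lambda>\<omega>. flat inp (set_draws_from x J \<omega> \<tau>)) (Pi_pmf {x..<J} 0 (\<lambda>_. uniform))"
proof -
  have split: "{x..<J} = insert x {Suc x..<J}" using assms by auto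
  have "set_draws_from (Suc x) J \<omega> (put LoopU 0 (Suc x) (put RandomDraw x v \<tau>)) = set_draws_from x J
      ((\<omega>)(x := v)) \<tau>" for \<omega> v
    using assms by (auto simp: set_draws_from_def put_def fun_eq_iff)
  thus ?thesis
    unfolding split by (subst Pi_pmf_insert)
      (simp_all add: pair_pmf_def map_pmf_def bind_assoc_pmf bind_return_pmf)
qed

lemma exec_draw_loop:
  assumes "banks_fit b \<tau>" "\<tau> LoopU 0 + y = J" "\<tau> NumDraws 0 = J" "\<tau> ClusterSize 0 = L"
  shows "exec draw_loop (flat inp \<tau>)
    (map_pmf (\<lambda>\<omega>. flat inp (set_draws_from (J - y) J \<omega> \<tau>)) (Pi_pmf {J - y..<J} 0 (\<lambda>_. uniform)))
    (y * (2 + 3 * tick) + tick)"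
  using assms
proof (induction y arbitrary: \<tau>)
  case 0
  have "set_draws_from J J \<omega> \<tau> = \<tau>" for \<omega>
    using 0(2) by (auto simp: set_draws_from_def put_def fun_eq_iff)
  moreover have "1 + eval_cost (flat inp \<tau>) draw_test \<le> tick"
    by (rule test_time_le_step_time[OF flat_fits[OF input 0(1)]]) (simp add: draw_cost_def)
  moreover have "eval (flat inp \<tau>) draw_test = 0" using 0 by (simp add: eval_draw)
  note exec_While_False[OF this, of "Seq (Draw draw_addr draw_range) (Assign index_addr next_index)"]
  ultimately show ?case using exec_mono by (simp add: draw_loop_def map_pmf_const)
next
  case (Suc y)
  define x where "x = J - Suc y"
  have x_index: "\<tau> LoopU 0 = x" "x < J" "J - y = Suc x" using Suc.prems(2) by (auto simp: x_def)
  let ?S = "Pi_pmf {Suc x..<J} 0 (\<lambda>_. uniform)"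
  define \<tau>' where "\<tau>' v = put LoopU 0 (Suc x) (put RandomDraw x v \<tau>)" for v
  have test: "eval (flat inp \<tau>) draw_test \<noteq> 0" using Suc.prems(3) x_index by (simp add: eval_draw)
  have rest: "exec draw_loop (flat inp (\<tau>' v))
      (map_pmf (\<lambda>\<omega>. flat inp (set_draws_from (Suc x) J \<omega> (\<tau>' v))) ?S) (y * (2 + 3 * tick) + tick)"
    if "v \<in> set_pmf uniform" for v
  proof -
    have "banks_fit b (\<tau>' v)"
      unfolding \<tau>'_def using Suc.prems(1) that sizes x_index(2)
      by (intro banks_fit_put) (auto simp: set_pmf_of_set)
    from Suc.IH[OF this] show ?thesis using Suc.prems x_index unfolding x_index(3) by (simp add: \<tau>'_def)
  qed
  have looped: "exec draw_loop (flat inp \<tau>)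
      (bind_pmf uniform (\<lambda>v. map_pmf (\<lambda>\<omega>. flat inp (set_draws_from (Suc x) J \<omega> (\<tau>' v))) ?S))
      (1 + eval_cost (flat inp \<tau>) draw_test + (1 + tick + tick) + (y * (2 + 3 * tick) + tick))"
    using exec_While_True[OF test exec_draw_one[OF Suc.prems(1) x_index(1,2) Suc.prems(4)]
      rest[unfolded draw_loop_def \<tau>'_def]]
    unfolding draw_loop_def \<tau>'_def .
  have time: "1 + eval_cost (flat inp \<tau>) draw_test + (1 + tick + tick) + (y * (2 + 3 * tick) + tick)
      \<le> Suc y * (2 + 3 * tick) + tick"
    using test_time_le_step_time[OF flat_fits[OF input Suc.prems(1)], of draw_test draw_cost]
    by (simp add: draw_cost_def)
  show ?case
    unfolding x_def[symmetric] bind_set_draws_from[OF x_index(2), symmetric]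
    by (rule exec_mono[OF looped[unfolded \<tau>'_def] time])
qed

lemma exec_draw_com:
  assumes fit: "banks_fit b \<sigma>" and count: "\<sigma> NumDraws 0 = J" and range: "\<sigma> ClusterSize 0 = L"
    and zero: "\<sigma> RandomDraw = (\<lambda>_. 0)"
  shows "exec draw_com (flat inp \<sigma>)
      (map_pmf (\<lambda>\<omega>. flat inp (put LoopU 0 J (\<sigma>(RandomDraw := \<omega>)))) (draws J L))
    (draw_time J b)"
  unfolding draw_com_def draw_time_def
proof (rule exec_Seq_return)
  let ?\<tau> = "put LoopU 0 0 \<sigma>"
  show "exec (Assign index_addr (Const 0)) (flat inp \<sigma>) (return_pmf (flat inp ?\<tau>)) tick"
    using exec_Assign_step[OF flat_fits[OF input fit], of index_addr "Const 0" draw_cost]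
    unfolding eval_index by (simp add: flat_put[OF draw_banks_less(1)] draw_cost_def del: mult_0_right)
  have "set_draws_from 0 J \<omega> ?\<tau> = put LoopU 0 J (\<sigma>(RandomDraw := \<omega>))" if "\<omega> \<in> set_pmf (draws J L)" for \<omega>
    using draws_outside[OF that] zero by (auto simp: set_draws_from_def put_def fun_eq_iff)
  hence "map_pmf (\<lambda>\<omega>. flat inp (put LoopU 0 J (\<sigma>(RandomDraw := \<omega>)))) (draws J L)
      = map_pmf (\<lambda>\<omega>. flat inp (set_draws_from 0 J \<omega> ?\<tau>)) (draws J L)"
    by (intro map_pmf_cong) simp_all
  moreover have "banks_fit b ?\<tau>" by (rule banks_fit_put[OF fit]) simp
  note exec_draw_loop[OF this, of J]
  ultimately show "exec draw_loop (flat inp ?\<tau>)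
      (map_pmf (\<lambda>\<omega>. flat inp (put LoopU 0 J (\<sigma>(RandomDraw := \<omega>)))) (draws J L))
      (J * (2 + 3 * tick) + tick)"
    using count range by (simp add: draws_def lessThan_atLeast0)
qed

end

definition copy_test :: expr where "copy_test = Sub (compile_expr (Var NumSites \<oplus> Var NumPairs))
    (Mem index_addr)"
definition copy_value :: expr where "copy_value = compile_expr (Cell Output (Var LoopU))"

definition copy_loop :: com where
  "copy_loop = While copy_test
      (Seq (Assign (Mem index_addr) copy_value) (Assign index_addr next_index))"

abbreviation "first_output \<equiv> Mem (Add (mem_at 1) (Const Output))"
abbreviation "second_output \<equiv> Mem (Add (mem_at 1) (Const (num_banks + Output)))"

text \<open>
  The dimensions in cells 0 and 1 locate all banks, so these two cells are overwritten last;
  cell 1 temporarily holds the base address.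
\<close>

definition out_com :: com where
  "out_com = Seq (Assign index_addr (Const 2)) (Seq copy_loop
     (Seq (Assign (Const 1) base_expr)
     (Seq (Assign (Const 0) first_output) (Assign (Const 1) second_output))))"

definition out_cost :: nat where
  "out_cost = expr_cost copy_test + expr_cost (Mem index_addr) + expr_cost copy_value +
      expr_cost index_addr +
     expr_cost next_index + expr_cost (Const 2) + expr_cost (Const 1) + expr_cost base_expr +
     expr_cost (Const 0) +
     expr_cost first_output + expr_cost second_output"

definition copied :: "nat \<Rightarrow> banks \<Rightarrow> memory \<Rightarrow> memory" where
  "copied x \<sigma> inp = flat (\<lambda>a. if a \<in> {2..<2 + x} then \<sigma> Output a else inp a) (put LoopU 0 (2 + x) \<sigma>)"

definition output_memory :: "banks \<Rightarrow> memory \<Rightarrow> memory" where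
  "output_memory \<sigma> inp = (copied (\<sigma> NumSites 0 + \<sigma> NumPairs 0 - 2) \<sigma> inp)(1 := base inp, 0 :=
      \<sigma> Output 0, 1 := \<sigma> Output 1)"

lemma output_memory_cell:
  assumes "a < \<sigma> NumSites 0 + \<sigma> NumPairs 0" "\<sigma> NumSites 0 + \<sigma> NumPairs 0 \<le> base inp"
  shows "output_memory \<sigma> inp a = \<sigma> Output a"
proof -
  have "base (\<lambda>a. if a \<in> {2..<2 + x} then \<sigma> Output a else inp a) = base inp" for x
    by (simp add: base_def)
  thus ?thesis using assms by (cases "a = 0"; cases "a = 1") (auto simp: output_memory_def copied_def)
qed

definition out_time :: "nat \<Rightarrow> nat \<Rightarrow> nat" where
  "out_time M b = M * (1 + step_time out_cost b + step_time out_cost b + step_time out_cost b) + 5 *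
      (1 + step_time out_cost b)"

context
  fixes inp :: memory and \<sigma> :: banks and b M :: nat
  assumes input: "fits b inp" and fit: "banks_fit b \<sigma>" and size: "\<sigma> NumSites 0 + \<sigma> NumPairs 0 = M"
    "M \<le> base inp"
    and base_fits: "base inp \<le> 2 ^ b"
begin

abbreviation "out_tick \<equiv> step_time out_cost b"

lemma base_copied: "base (\<lambda>a. if a \<in> {2..<2 + x} then \<sigma> Output a else inp a) = base inp"
  by (simp add: base_def)

lemma copied_fits: "x \<le> M - 2 \<Longrightarrow> fits b (copied x \<sigma> inp)"
  unfolding copied_def
  by (rule flat_fits, use input fit in \<open>force simp: fits_def banks_fit_def\<close>, rule banks_fit_put[OF fit])
    (use size(2) base_fits base_ge_two[of inp] in linarith)

lemma exec_copy_one: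
  assumes "x < M - 2"
  shows "exec (Seq (Assign (Mem index_addr) copy_value) (Assign index_addr next_index)) (copied x \<sigma> inp)
    (return_pmf (copied (Suc x) \<sigma> inp)) (1 + out_tick + out_tick)"
proof (rule exec_Seq_return)
  let ?inp = "\<lambda>x a. if a \<in> {2..<2 + x} then \<sigma> Output a else inp a" and ?\<tau> = "put LoopU 0 (2 + x) \<sigma>"
  let ?m = "flat (?inp (Suc x)) ?\<tau>"
  have copied_value: "eval (copied x \<sigma> inp) copy_value = \<sigma> Output (2 + x)"
    using eval_compile_expr[of "Cell Output (Var LoopU)" "?inp x" ?\<tau>] draw_banks_less
    by (simp add: copied_def copy_value_def del: compile_expr.simps)
  have stored: "(copied x \<sigma> inp)(2 + x := \<sigma> Output (2 + x)) = ?m"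
    using assms size(2) base_copied[of x] base_copied[of "Suc x"]
    by (auto simp: copied_def flat_def fun_eq_iff)
  have "exec (Assign (Mem index_addr) copy_value) (copied x \<sigma> inp) (return_pmf ((copied x \<sigma> inp)
      (eval (copied x \<sigma> inp) (Mem index_addr) := eval (copied x \<sigma> inp) copy_value))) out_tick"
    by (rule exec_Assign_step[OF copied_fits]) (use assms in \<open>simp_all add: out_cost_def\<close>)
  moreover have "eval (copied x \<sigma> inp) (Mem index_addr) = 2 + x"
    unfolding copied_def eval_index(2) by simp
  ultimately show "exec (Assign (Mem index_addr) copy_value) (copied x \<sigma> inp) (return_pmf ?m) out_tick"
    by (simp only: copied_value stored)
  have "fits b ?m" unfolding stored[symmetric] using assms fit
    by (intro fits_upd copied_fits) (auto simp: banks_fit_def fits_def)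
  from exec_Assign_step[OF this, of index_addr next_index out_cost]
  show "exec (Assign index_addr next_index) ?m (return_pmf (copied (Suc x) \<sigma> inp)) out_tick"
    unfolding eval_index eval_next_index flat_put[OF draw_banks_less(1), symmetric]
    by (simp add: copied_def out_cost_def put_def)
qed

lemma exec_copy_loop:
  "exec copy_loop (copied 0 \<sigma> inp) (return_pmf (copied (M - 2) \<sigma> inp))
      ((M - 2) * (1 + out_tick + out_tick + out_tick) + out_tick)"
  unfolding copy_loop_def
proof (rule exec_While_iterate[where M = "\<lambda>x. copied x \<sigma> inp"])
  have test: "eval (copied x \<sigma> inp) copy_test = M - (2 + x)" for x
    using eval_compile_expr[of "Var NumSites \<oplus> Var NumPairs"
        "\<lambda>a. if a \<in> {2..<2 + x} then \<sigma> Output a else inp a"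
          "put LoopU 0 (2 + x) \<sigma>"] draw_banks_less size(1)
    unfolding copied_def copy_test_def eval.simps(4) eval_index(2) by (simp del: compile_expr.simps)
  show "eval (copied x \<sigma> inp) copy_test \<noteq> 0" if "x < M - 2" for x unfolding test using that by simp
  show "eval (copied (M - 2) \<sigma> inp) copy_test = 0" unfolding test by simp
  show "1 + eval_cost (copied x \<sigma> inp) copy_test \<le> out_tick" if "x \<le> M - 2" for x
    by (rule test_time_le_step_time[OF copied_fits[OF that]]) (simp add: out_cost_def)
qed (rule exec_copy_one)

lemma exec_write_dims:
  "exec (Seq (Assign (Const 1) base_expr)
      (Seq (Assign (Const 0) first_output) (Assign (Const 1) second_output)))
    (copied (M - 2) \<sigma> inp) (return_pmf (output_memory \<sigma> inp))
    (1 + out_tick + (1 + out_tick + out_tick))"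
proof (intro exec_Seq_return)
  let ?m\<^sub>0 = "copied (M - 2) \<sigma> inp"
  let ?m\<^sub>1 = "?m\<^sub>0(1 := base inp)"
  let ?m\<^sub>2 = "?m\<^sub>1(0 := \<sigma> Output 0)"
  have cell: "?m\<^sub>0 (base inp + (num_banks * i + Output)) = \<sigma> Output i" for i
    unfolding copied_def base_copied[of "M - 2", symmetric] flat_cell[OF draw_banks_less(7)] by simp
  have fits: "fits b ?m\<^sub>0" "fits b ?m\<^sub>1" "fits b ?m\<^sub>2"
    using copied_fits[OF order_refl] base_fits fit
    by (auto intro!: fits_upd simp: banks_fit_def fits_def)
  have "eval ?m\<^sub>0 base_expr = base inp" unfolding copied_def eval_base_expr base_copied ..
  thus "exec (Assign (Const 1) base_expr) ?m\<^sub>0 (return_pmf ?m\<^sub>1) out_tick"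
    using exec_Assign_step[OF fits(1), of "Const 1" base_expr out_cost] by (simp add: out_cost_def)
  show "exec (Assign (Const 0) first_output) ?m\<^sub>1 (return_pmf ?m\<^sub>2) out_tick"
    using exec_Assign_step[OF fits(2), of "Const 0" first_output out_cost] cell[of 0]
      base_ge_two[of inp]
    by (simp add: out_cost_def)
  show "exec (Assign (Const 1) second_output) ?m\<^sub>2 (return_pmf (output_memory \<sigma> inp)) out_tick"
    using exec_Assign_step[OF fits(3), of "Const 1" second_output out_cost] cell[of 1]
      base_ge_two[of inp]
    by (simp add: out_cost_def output_memory_def size(1))
qed

lemma exec_out_com:
  "exec out_com (flat inp \<sigma>) (return_pmf (output_memory \<sigma> inp)) (out_time M b)"
  unfolding out_com_def
proof (rule exec_mono[OF exec_Seq_return[OF _ exec_Seq_return[OF exec_copy_loop exec_write_dims]]])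
  show "exec (Assign index_addr (Const 2)) (flat inp \<sigma>) (return_pmf (copied 0 \<sigma> inp)) out_tick"
    using exec_Assign_step[OF flat_fits[OF input fit], of index_addr "Const 2" out_cost]
    unfolding eval_index flat_put[OF draw_banks_less(1), symmetric]
    by (simp add: copied_def out_cost_def)
  have "x \<le> y \<Longrightarrow> 1 + t + (1 + (x + t) + (1 + t + (1 + t + t))) \<le> y + 5 * (1 + t)" for x y t :: nat
    by simp
  thus "1 + out_tick + (1 + ((M - 2) * (1 + out_tick + out_tick + out_tick) + out_tick) +
      (1 + out_tick + (1 + out_tick + out_tick))) \<le> out_time M b"
    unfolding out_time_def by this (intro mult_le_mono1, simp)
qed

end


section \<open>Correctness of clustering and rounding on the machine\<close>

context star_solution
begin

definition split_loaded :: "banks \<Rightarrow> bool" where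
  "split_loaded \<sigma> \<longleftrightarrow> data_loaded \<sigma> \<and> K = n * atoms_per_unit \<and>
     (\<forall>i. \<sigma> FixedOpen i = fixed_open i) \<and> (\<forall>i. \<forall>j<n. \<sigma> FixedConn (i * n + j) = fixed_conn i j) \<and>
     (\<forall>t<num_atoms. \<sigma> AtomValid t = of_bool (valid t)) \<and> (\<forall>t\<in>atoms. \<sigma> AtomSite t = atom_site t) \<and>
     (\<forall>j<n. \<sigma> ResidualDemand j = residual j)"

lemma split_loadedD:
  assumes "split_loaded \<sigma>"
  shows "data_loaded \<sigma>" "num_atoms = n * atoms_per_unit * atoms_per_unit" "\<sigma> FixedOpen i = fixed_open i"
    and "j < n \<Longrightarrow> \<sigma> FixedConn (i * n + j) = fixed_conn i j"
    and "t < num_atoms \<Longrightarrow> \<sigma> AtomValid t = of_bool (valid t)" "t \<in> atoms \<Longrightarrow> \<sigma> AtomSite t = atom_site t"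
    and "j < n \<Longrightarrow> \<sigma> ResidualDemand j = residual j" "j < n \<Longrightarrow> \<sigma> ResidualDemand j \<le> n * atoms_per_unit"
  using assms residual_le[of j] unfolding split_loaded_def num_atoms_def by metis+

lemma split_loaded_cong:
  assumes "split_loaded \<sigma>"
    and "\<And>l. l \<in> data_banks \<union> {FixedOpen, FixedConn, AtomValid, AtomSite, ResidualDemand} \<Longrightarrow> \<tau> l = \<sigma> l"
  shows "split_loaded \<tau>"
  using assms data_loaded_cong[of \<sigma> \<tau>] unfolding split_loaded_def by simp

lemma sem_split_stars:
  fixes inp :: memory and \<sigma> :: banks
  assumes loaded: "stars_loaded \<sigma>"
    and zero: "\<And>l. l \<in> {FixedOpen, FixedConn, FixedCover, AtomValid, InPool} \<Longrightarrow> \<sigma> l = (\<lambda>_. 0)"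
  defines "\<tau> \<equiv> sems inp [split_amounts, create_atoms, fill_pools, set_residuals] \<sigma>"
  shows "split_loaded \<tau>" and "j < n \<Longrightarrow> bank_pool \<tau> j = pool0 j"
proof -
  define \<sigma>\<^sub>1 where "\<sigma>\<^sub>1 = sem inp split_amounts \<sigma>"
  define \<sigma>\<^sub>2 where "\<sigma>\<^sub>2 = sem inp create_atoms \<sigma>\<^sub>1"
  define \<sigma>\<^sub>3 where "\<sigma>\<^sub>3 = sem inp fill_pools \<sigma>\<^sub>2"
  have \<tau>_eq: "\<tau> = sem inp set_residuals \<sigma>\<^sub>3" by (simp add: \<tau>_def \<sigma>\<^sub>1_def \<sigma>\<^sub>2_def \<sigma>\<^sub>3_def)
  note defs = \<sigma>\<^sub>1_def \<sigma>\<^sub>2_def \<sigma>\<^sub>3_def \<tau>_eq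
  have loaded1: "stars_loaded \<sigma>\<^sub>1"
    by (rule stars_loaded_cong[OF loaded]) (auto simp: defs sem_unwritten)
  have loaded2: "stars_loaded \<sigma>\<^sub>2"
    by (rule stars_loaded_cong[OF loaded1]) (auto simp: defs sem_unwritten)
  have loaded3: "stars_loaded \<sigma>\<^sub>3"
    by (rule stars_loaded_cong[OF loaded2]) (auto simp: defs sem_unwritten)
  have loaded4: "stars_loaded \<tau>"
    by (rule stars_loaded_cong[OF loaded3]) (auto simp: defs sem_unwritten)
  have fixed: "\<sigma>\<^sub>1 FixedOpen i = fixed_open i" "j < n \<Longrightarrow> \<sigma>\<^sub>1 FixedConn (i * n + j) = fixed_conn i j"
    "j < n \<Longrightarrow> \<sigma>\<^sub>1 FixedCover j = fixed_cover j" for i j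
    unfolding \<sigma>\<^sub>1_def by (rule sem_split_amounts[OF loaded]; use zero in simp)+
  have atom: "t < num_atoms \<Longrightarrow> \<sigma>\<^sub>2 AtomValid t = of_bool (valid t)"
    "t \<in> atoms \<Longrightarrow> \<sigma>\<^sub>2 AtomSite t = atom_site t" for t
    unfolding \<sigma>\<^sub>2_def by (rule sem_create_atoms[OF loaded1]; use zero in \<open>simp add: defs sem_unwritten\<close>)+
  have in_pool: "\<sigma>\<^sub>3 InPool (t * n + j) \<noteq> 0 \<longleftrightarrow> t \<in> pool0 j" if "t < num_atoms" "j < n" for t j
    unfolding \<sigma>\<^sub>3_def
    by (rule sem_fill_pools[OF loaded2 atom(1)]) (use zero that in \<open>simp_all add: defs sem_unwritten\<close>)
  have residual: "\<tau> ResidualDemand j = residual j" if "j < n" for j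
    unfolding \<tau>_eq
    by (rule sem_set_residuals[OF loaded3]) (use fixed that in \<open>simp_all add: defs sem_unwritten\<close>)
  show "split_loaded \<tau>"
    unfolding split_loaded_def
    using loaded4 fixed atom residual by (auto simp: stars_loaded_def defs sem_unwritten)
  show "bank_pool \<tau> j = pool0 j" if "j < n"
    using in_pool[OF _ that] pool0_sub[OF that] by (auto simp: bank_pool_def \<tau>_eq sem_unwritten)
qed

lemma sem_cluster_stars:
  fixes inp :: memory and \<sigma> :: banks
  assumes loaded: "stars_loaded \<sigma>"
    and zero: "\<And>l. l \<in> {FixedOpen, FixedConn, FixedCover, AtomValid, InPool, NumAssigned, ClusterOf} \<Longrightarrow>
      \<sigma> l = (\<lambda>_. 0)"
  defines "\<tau> \<equiv> sems inp [split_amounts, create_atoms, fill_pools, set_residuals, form_clusters] \<sigma>"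
  shows "split_loaded \<tau>" and "bank_clustering_inv (n * (n * atoms_per_unit)) \<tau>"
proof -
  define \<rho> where "\<rho> = sems inp [split_amounts, create_atoms, fill_pools, set_residuals] \<sigma>"
  have split_loaded: "split_loaded \<rho>"
    unfolding \<rho>_def by (rule sem_split_stars(1)[OF loaded]) (use zero in blast)
  have pools: "bank_pool \<rho> j = pool0 j" if "j < n" for j
    unfolding \<rho>_def by (rule sem_split_stars(2)[OF loaded]) (use zero that in blast)+
  have \<tau>_eq: "\<tau> = sem inp form_clusters \<rho>" by (simp add: \<tau>_def \<rho>_def)
  show "split_loaded \<tau>" unfolding \<tau>_eq by (rule split_loaded_cong[OF split_loaded]) (auto simp: sem_unwritten)
  have "atoms_loaded \<rho>"
    using split_loadedD(1,2,6,7)[OF split_loaded] pool0_sub_atoms unfolding atoms_loaded_def by blast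
  moreover have "\<rho> NumAssigned = (\<lambda>_. 0)" "\<rho> ClusterOf = (\<lambda>_. 0)"
    using zero by (simp_all add: \<rho>_def sem_unwritten)
  ultimately show "bank_clustering_inv (n * (n * atoms_per_unit)) \<tau>"
    unfolding \<tau>_eq using pools by (intro sem_form_clusters)
qed

end

lemma (in clustered_solution) sem_connect_and_write:
  fixes inp :: memory and \<sigma> :: banks
  assumes loaded: "split_loaded \<sigma>" and cluster: "\<sigma> ClusterOf = label" "\<sigma> PositionOf = position"
    and zero: "\<sigma> RandomOpen = (\<lambda>_. 0)" "\<sigma> RandomConn = (\<lambda>_. 0)"
  defines "\<tau> \<equiv> sems inp connect_and_write \<sigma>"
  shows "j < n \<Longrightarrow> greedy_inv (random_open (\<sigma> RandomDraw)) j (residual j) (\<lambda>i. \<tau> RandomConn (i * n + j))"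
    and "i < m \<Longrightarrow> \<tau> Output i = fixed_open i + random_open (\<sigma> RandomDraw) i"
    and "i < m \<Longrightarrow> j < n \<Longrightarrow> \<tau> Output (m + (i * n + j)) = fixed_conn i j + \<tau> RandomConn (i * n + j)"
proof -
  define \<sigma>\<^sub>1 where "\<sigma>\<^sub>1 = sem inp open_atoms \<sigma>"
  define \<sigma>\<^sub>2 where "\<sigma>\<^sub>2 = sem inp connect_clients \<sigma>\<^sub>1"
  define \<sigma>\<^sub>3 where "\<sigma>\<^sub>3 = sem inp write_open \<sigma>\<^sub>2"
  have \<tau>_eq: "\<tau> = sem inp write_conn \<sigma>\<^sub>3" by (simp add: \<tau>_def connect_and_write_def \<sigma>\<^sub>1_def \<sigma>\<^sub>2_def \<sigma>\<^sub>3_def)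
  note defs = \<sigma>\<^sub>1_def \<sigma>\<^sub>2_def \<sigma>\<^sub>3_def
  have loaded1: "split_loaded \<sigma>\<^sub>1" by (rule split_loaded_cong[OF loaded]) (auto simp: defs sem_unwritten)
  have loaded2: "split_loaded \<sigma>\<^sub>2" by (rule split_loaded_cong[OF loaded1])
    (auto simp: defs sem_unwritten)
  have loaded3: "split_loaded \<sigma>\<^sub>3" by (rule split_loaded_cong[OF loaded2])
    (auto simp: defs sem_unwritten)
  have opened: "\<sigma>\<^sub>1 RandomOpen = random_open (\<sigma> RandomDraw)"
    unfolding \<sigma>\<^sub>1_def fun_eq_iff
    using sem_open_atoms[OF split_loadedD(1,2,5,6)[OF loaded] cluster zero(1)] by simp
  have connected: "greedy_inv (\<sigma>\<^sub>1 RandomOpen) j (\<sigma>\<^sub>1 ResidualDemand j)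
      (\<lambda>i. \<sigma>\<^sub>2 RandomConn (i * n + j))" if "j < n" for j
    unfolding \<sigma>\<^sub>2_def
    by (rule sem_connect_clients[OF split_loadedD(1,8)[OF loaded1]])
      (use that zero(2) in \<open>simp_all add: \<sigma>\<^sub>1_def sem_unwritten\<close>)
  have conn: "\<tau> RandomConn = \<sigma>\<^sub>2 RandomConn" by (simp add: \<tau>_eq \<sigma>\<^sub>3_def sem_unwritten)
  show "j < n \<Longrightarrow> greedy_inv (random_open (\<sigma> RandomDraw)) j (residual j) (\<lambda>i. \<tau> RandomConn (i * n + j))"
    using connected split_loadedD(7)[OF loaded1] by (simp add: conn opened)
  show "\<tau> Output i = fixed_open i + random_open (\<sigma> RandomDraw) i" if "i < m"
    unfolding \<tau>_eq sem_write_conn(1)[OF split_loadedD(1)[OF loaded3] that]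
    unfolding \<sigma>\<^sub>3_def sem_write_open[OF split_loadedD(1)[OF loaded2] that]
      split_loadedD(3)[OF loaded2] opened[symmetric]
    by (simp add: \<sigma>\<^sub>2_def sem_unwritten)
  show "\<tau> Output (m + (i * n + j)) = fixed_conn i j + \<tau> RandomConn (i * n + j)" if "i < m" "j < n"
    unfolding conn
      unfolding \<tau>_eq sem_write_conn(2)[OF split_loadedD(1)[OF loaded3] row_major_less[OF that]]
      split_loadedD(4)[OF loaded3 that(2)]
    by (simp add: \<sigma>\<^sub>3_def sem_unwritten)
qed


section \<open>Reading encoded instances\<close>

lemma concat_concat_upt:
  "concat (map (\<lambda>i. concat (map (g i) [0..<w])) [0..<k])
      = concat (map (\<lambda>t. g (t div w) (t mod w)) [0..<k * w])"
proof (induction k)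
  case (Suc k)
  have "map (\<lambda>t. g (t div w) (t mod w)) [k * w..<k * w + w] = map (g k) [0..<w]"
    by (rule nth_equalityI) auto
  moreover have "[0..<Suc k * w] = [0..<k * w] @ [k * w..<k * w + w]"
    using upt_add_eq_append[of 0 "k * w" w] by (simp add: add.commute)
  ultimately show ?case using Suc by simp
qed simp

definition rat_part :: "rat \<Rightarrow> nat \<Rightarrow> nat" where
  "rat_part q b = (if b = 0 then nat (fst (quotient_of q)) else nat (snd (quotient_of q)))"

lemma concat_map_encode_rat: "concat (map (\<lambda>t. encode_rat (q t)) [0..<k])
    = map (\<lambda>t. rat_part (q (t div 2)) (t mod 2)) [0..<k * 2]"
proof -
  have "encode_rat x = map (rat_part x) [0..<2]" for x
    by (simp add: encode_rat_def rat_part_def upt_rec)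
  thus ?thesis using concat_concat_upt[of "\<lambda>t b. [rat_part (q t) b]" 2 k]
    by (simp only: concat_map_singleton)
qed

lemma encode_eq:
  "encode I = [num_sites I, num_clients I] @
     map (\<lambda>t. rat_part (open_cost I (t div 2)) (t mod 2)) [0..<num_sites I * 2] @
     map (\<lambda>t. rat_part (conn_cost I (t div 2 div num_clients I) (t div 2 mod num_clients I)) (t mod 2))
       [0..<num_sites I * num_clients I * 2] @
     map (demand I) [0..<num_clients I]"
  by (simp only: encode_def concat_concat_upt) (simp only: concat_map_encode_rat)

lemma length_encode:
  "length (encode I) = 2 + 2 * num_sites I + 2 * (num_sites I * num_clients I) + num_clients I"
  by (simp add: encode_eq)

definition input_of :: "ftfp \<Rightarrow> memory" where
  "input_of I a = (if a < length (encode I) then encode I ! a else 0)"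

lemma input_of_dims: "input_of I 0 = num_sites I" "input_of I 1 = num_clients I"
  by (simp_all add: input_of_def encode_eq)

lemma input_of_open_cost:
  assumes "i < num_sites I" "b < 2"
  shows "input_of I (2 + 2 * i + b) = rat_part (open_cost I i) b"
  using assms by (simp add: input_of_def length_encode) (simp add: encode_eq nth_append)

lemma input_of_conn_cost:
  assumes "i < num_sites I" "j < num_clients I" "b < 2"
  shows "input_of I (2 + 2 * num_sites I + 2 * (i * num_clients I + j) + b)
      = rat_part (conn_cost I i j) b"
proof -
  let ?t = "i * num_clients I + j"
  have "t < k \<Longrightarrow> 2 * t + b < k * 2" for t k using assms(3) by simp
  hence "2 * ?t + b < num_sites I * num_clients I * 2" using row_major_less[OF assms(1,2)] .
  moreover have "(2 * t + b) div 2 = t" "(2 * t + b) mod 2 = b" for t using assms(3) by auto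
  moreover have "?t div num_clients I = i" "?t mod num_clients I = j" using assms(2) by auto
  moreover have "2 + 2 * num_sites I + 2 * ?t + b = 2 + (2 * num_sites I + (2 * ?t + b))" by simp
  ultimately show ?thesis
    unfolding input_of_def length_encode by (simp add: encode_eq nth_append)
qed

lemma input_of_demand:
  assumes "j < num_clients I"
  shows "input_of I (2 + 2 * num_sites I + 2 * (num_sites I * num_clients I) + j) = demand I j"
  using assms by (simp add: input_of_def length_encode) (simp add: encode_eq nth_append)

lemma rat_part_pos: "b \<noteq> 0 \<Longrightarrow> 0 < rat_part q b"
  using quotient_of_denom_pos'[of q] by (simp add: rat_part_def)

lemma real_of_rat_parts:
  assumes "0 \<le> q"
  shows "real_of_rat q = real (rat_part q 0) / real (rat_part q 1)"
proof -
  obtain a d where quotient: "quotient_of q = (a, d)" by (cases "quotient_of q")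
  have d_pos: "0 < d" using quotient_of_denom_pos[OF quotient] .
  have q_eq: "q = of_int a / of_int d" by (rule quotient_of_div[OF quotient])
  have "0 \<le> a" using assms d_pos unfolding q_eq by (simp add: zero_le_divide_iff)
  moreover have "real_of_rat q = of_int a / of_int d" by (simp add: q_eq of_rat_divide)
  ultimately show ?thesis using d_pos by (simp add: rat_part_def quotient)
qed

lemma real_mult_div_of_dvd: "d dvd q \<Longrightarrow> real (a * (q div d)) = real q * (real a / real d)"
  by (simp add: real_of_nat_div)


section \<open>Instances with a common denominator\<close>

locale encoded_ftfp =
  fixes I :: ftfp
  assumes inst: "ftfp_instance I"
begin

abbreviation "m \<equiv> num_sites I"
abbreviation "n \<equiv> num_clients I"
abbreviation "inp \<equiv> input_of I"
abbreviation "Q \<equiv> common_den inp"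

definition scaled_open_cost :: "nat \<Rightarrow> nat" where
  "scaled_open_cost i = inp (2 + 2 * i) * (Q div inp (3 + 2 * i))"

definition scaled_distance :: "nat \<Rightarrow> nat \<Rightarrow> nat" where
  "scaled_distance i j = inp (2 + 2 * m + 2 * (i * n + j)) * (Q div inp (3 + 2 * m + 2 * (i * n + j)))"

lemma open_cost_parts:
  assumes "i < m"
  shows "inp (2 + 2 * i) = rat_part (open_cost I i) 0" "inp (3 + 2 * i) = rat_part (open_cost I i) 1"
  using input_of_open_cost[OF assms, of 0] input_of_open_cost[OF assms, of 1]
  by (simp_all add: numeral_3_eq_3)

lemma conn_cost_parts:
  assumes "i < m" "j < n"
  shows "inp (2 + 2 * m + 2 * (i * n + j)) = rat_part (conn_cost I i j) 0"
    and "inp (3 + 2 * m + 2 * (i * n + j)) = rat_part (conn_cost I i j) 1"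
  using input_of_conn_cost[OF assms, of 0] input_of_conn_cost[OF assms, of 1]
  by (simp_all add: numeral_3_eq_3)

lemma Q_eq: "Q = (\<Prod>i<m. inp (3 + 2 * i)) * (\<Prod>t<m * n. inp (3 + 2 * m + 2 * t))"
  by (simp only: common_den_def input_of_dims)

lemma Q_pos: "0 < Q"
proof -
  have "0 < inp (3 + 2 * m + 2 * t)" if t_less: "t < m * n" for t
  proof -
    have "0 < n" using t_less by (cases n) auto
    hence "inp (3 + 2 * m + 2 * (t div n * n + t mod n)) = rat_part (conn_cost I (t div n) (t mod n)) 1"
      using t_less by (intro conn_cost_parts(2)) (auto simp: less_mult_imp_div_less)
    thus ?thesis using rat_part_pos by simp
  qed
  thus ?thesis unfolding Q_eq by (auto simp: open_cost_parts(2) rat_part_pos intro!: prod_pos)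
qed

lemma real_scaled_open_cost:
  assumes i_less: "i < m"
  shows "real (scaled_open_cost i) = real Q * real_of_rat (open_cost I i)"
proof -
  have "inp (3 + 2 * i) dvd Q" unfolding Q_eq using i_less by (intro dvd_mult2 dvd_prodI) auto
  moreover have "0 \<le> open_cost I i" using inst i_less by (simp add: ftfp_instance_def)
  ultimately show ?thesis
    unfolding scaled_open_cost_def by
      (simp only: real_mult_div_of_dvd open_cost_parts[OF i_less] real_of_rat_parts)
qed

lemma metric: "is_metric_on (points I) (distance I)"
  using inst by (simp add: ftfp_instance_def)

lemma points_memI: "i < m \<Longrightarrow> Inl i \<in> points I" "j < n \<Longrightarrow> Inr j \<in> points I"
  by (auto simp: points_def)

lemma conn_cost_nonneg:
  assumes "i < m" "j < n"
  shows "0 \<le> conn_cost I i j"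
  using metric points_memI(1)[OF assms(1)] points_memI(2)[OF assms(2)]
    unfolding is_metric_on_def by blast

lemma conn_cost_four_point:
  assumes "i < m" "i' < m" "j < n" "j' < n"
  shows "conn_cost I i j \<le> conn_cost I i j' + conn_cost I i' j' + conn_cost I i' j"
proof -
  note p = points_memI(1)[OF assms(1)] points_memI(1)[OF assms(2)] points_memI(2)[OF assms(3)]
    points_memI(2)[OF assms(4)]
  have "conn_cost I i j \<le> conn_cost I i j' + distance I (Inr j') (Inr j)"
    "distance I (Inr j') (Inr j) \<le> distance I (Inr j') (Inl i') + conn_cost I i' j"
    "distance I (Inr j') (Inl i') = conn_cost I i' j'"
    using metric p unfolding is_metric_on_def by blast+
  thus ?thesis by linarith
qed

lemma real_scaled_distance:
  assumes ij_less: "i < m" "j < n"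
  shows "real (scaled_distance i j) = real Q * real_of_rat (conn_cost I i j)"
proof -
  have "inp (3 + 2 * m + 2 * (i * n + j)) dvd Q"
    unfolding Q_eq using row_major_less[OF ij_less] by (intro dvd_mult dvd_prodI) auto
  thus ?thesis
    unfolding scaled_distance_def
    by
      (simp only: real_mult_div_of_dvd conn_cost_parts[OF ij_less] real_of_rat_parts[OF conn_cost_nonneg[OF ij_less]])
qed

sublocale scaled_ftfp n m scaled_open_cost scaled_distance "demand I"
proof
  show "0 < demand I j" if "j < n" for j using inst that by (simp add: ftfp_instance_def)
  show "0 < m" if "0 < n" using inst that by (simp add: ftfp_instance_def)
  fix i i' j j' assume ij_less: "i < m" "i' < m" "j < n" "j' < n"
  hence "real_of_rat (conn_cost I i j)
      \<le> real_of_rat (conn_cost I i j' + conn_cost I i' j' + conn_cost I i' j)"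
    by (simp only: of_rat_less_eq conn_cost_four_point)
  from mult_left_mono[OF this, of "real Q"]
  have "real (scaled_distance i j) \<le> real
      (scaled_distance i j' + scaled_distance i' j' + scaled_distance i' j)"
    using ij_less by (simp add: real_scaled_distance of_rat_add distrib_left)
  thus "scaled_distance i j \<le> scaled_distance i j' + scaled_distance i' j' + scaled_distance i' j"
    by (simp only: of_nat_le_iff)
qed

lemma scaled_cost:
  "real Q * cost I y x = (\<Sum>i<m. real (scaled_open_cost i) * y i) +
      (\<Sum>i<m. \<Sum>j<n. real (scaled_distance i j) * x i j)"
  unfolding cost_def distrib_left sum_distrib_left
  by (simp add: real_scaled_open_cost real_scaled_distance mult.assoc)

lemma feasibleD:
  assumes "feasible I y x"
  shows "i < m \<Longrightarrow> 0 \<le> y i" "i < m \<Longrightarrow> j < n \<Longrightarrow> 0 \<le> x i j" "i < m \<Longrightarrow> j < n \<Longrightarrow> x i j \<le> y i"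
    and "j < n \<Longrightarrow> of_nat (demand I j) \<le> (\<Sum>i<m. x i j)"
  using assms by (simp_all add: feasible_def)

lemma feasible_scaled_cost_nonneg: "feasible I y x \<Longrightarrow> 0 \<le> real Q * cost I y x"
  unfolding scaled_cost by (auto intro!: add_nonneg_nonneg sum_nonneg dest: feasibleD)

lemma feasible_dual_bound:
  assumes "feasible I y (x :: nat \<Rightarrow> nat \<Rightarrow> real)"
  shows "dual_bound (real Q * cost I y x)"
  unfolding dual_bound_def
proof (intro allI impI)
  fix \<alpha> :: "nat \<Rightarrow> real"
  let ?D = "\<lambda>i j. real (scaled_distance i j)"
  let ?gain = "\<lambda>i j. max 0 (\<alpha> j - ?D i j)"
  assume \<alpha>_nonneg: "\<forall>j<n. 0 \<le> \<alpha> j" and dual: "\<forall>i<m. (\<Sum>j<n. ?gain i j) \<le> real (scaled_open_cost i)"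
  note feas = feasibleD[OF assms]
  have split: "x i j * \<alpha> j \<le> ?D i j * x i j + ?gain i j * y i" if "i < m" "j < n" for i j
  proof -
    have "x i j * \<alpha> j \<le> x i j * (?D i j + ?gain i j)"
      using feas(2)[OF that] by (intro mult_left_mono) auto
    also have "\<dots> \<le> ?D i j * x i j + ?gain i j * y i"
      using mult_left_mono[OF feas(3)[OF that], of "?gain i j"] by (simp add: algebra_simps)
    finally show ?thesis .
  qed
  have "(\<Sum>j<n. real (demand I j) * \<alpha> j) \<le> (\<Sum>j<n. (\<Sum>i<m. x i j) * \<alpha> j)"
    using \<alpha>_nonneg feas(4) by (intro sum_mono mult_right_mono) auto
  also have "\<dots> = (\<Sum>i<m. \<Sum>j<n. x i j * \<alpha> j)" unfolding sum_distrib_right by (rule sum.swap)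
  also have "\<dots> \<le> (\<Sum>i<m. \<Sum>j<n. ?D i j * x i j + ?gain i j * y i)" using split by (intro sum_mono) simp
  also have "\<dots> = (\<Sum>i<m. (\<Sum>j<n. ?gain i j) * y i) + (\<Sum>i<m. \<Sum>j<n. ?D i j * x i j)"
    by (simp add: sum.distrib sum_distrib_right)
  also have "\<dots> \<le> real Q * cost I y x"
    unfolding scaled_cost using dual feas(1) by (intro add_right_mono sum_mono mult_right_mono) auto
  finally show "(\<Sum>j<n. real (demand I j) * \<alpha> j) \<le> real Q * cost I y x" .
qed

lemma int_feasible_ex:
  obtains y :: "nat \<Rightarrow> nat" and x where "feasible I y x"
proof
  show "feasible I (\<lambda>_. \<Sum>j<n. demand I j) (\<lambda>i j. if i = 0 then demand I j else 0)"
    using sites_nonempty by (auto simp: feasible_def intro: member_le_sum)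
qed

lemma feasible_real_of_nat:
  "feasible I (y :: nat \<Rightarrow> nat) x \<Longrightarrow> feasible I (\<lambda>i. real (y i)) (\<lambda>i j. real (x i j))"
  unfolding feasible_def by (auto simp flip: of_nat_sum)

lemma LP_opt_le_OPT: "LP_opt I \<le> OPT I"
  unfolding LP_opt_def OPT_def
proof (rule cInf_superset_mono)
  show "{int_cost I y x |y x. feasible I y x} \<noteq> {}" by (rule int_feasible_ex) blast
  show "bdd_below {cost I y x |y x. feasible I y x}"
  proof (rule bdd_belowI)
    fix c assume "c \<in> {cost I y x |y x. feasible I y x}"
    then obtain y x where "c = cost I y x" "feasible I y x" by blast
    thus "0 \<le> c" using feasible_scaled_cost_nonneg[of y x] Q_pos by (simp add: zero_le_mult_iff)
  qed
  show "{int_cost I y x |y x. feasible I y x} \<subseteq> {cost I y x |y x. feasible I y x}"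
    unfolding int_cost_def using feasible_real_of_nat by blast
qed

lemma LP_opt_greatest:
  assumes "\<And>y x. feasible I y x \<Longrightarrow> c \<le> cost I y x"
  shows "c \<le> LP_opt I"
proof -
  obtain y :: "nat \<Rightarrow> nat" and x where "feasible I y x" by (rule int_feasible_ex)
  from feasible_real_of_nat[OF this] show ?thesis
    unfolding LP_opt_def by (intro cInf_greatest) (use assms in blast)+
qed

end


section \<open>The complete program\<close>

definition ftfp_program :: com where
  "ftfp_program = Seq (compile_list set_sizes) (Seq (compile_list (preprocess @ solve_and_cluster))
     (Seq draw_com (Seq (compile_list connect_and_write) out_com)))"

definition loop_limit :: "nat \<Rightarrow> nat" where
  "loop_limit s = (s + 1) * (s + 1) * (19 * (1000000 * (s + 1)) * (19 * (1000000 * (s + 1))))"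

definition sized_bits :: "nat \<Rightarrow> nat" where
  "sized_bits s = list_bits set_sizes 0 s"

definition clustered_bits :: "nat \<Rightarrow> nat" where
  "clustered_bits s = list_bits (preprocess @ solve_and_cluster) (loop_limit s) (sized_bits s)"

definition written_bits :: "nat \<Rightarrow> nat" where
  "written_bits s = list_bits connect_and_write (loop_limit s) (clustered_bits s)"

definition program_time :: "nat \<Rightarrow> nat" where
  "program_time s = 1 + list_time set_sizes 0 s +
     (1 + list_time (preprocess @ solve_and_cluster) (loop_limit s) (sized_bits s) +
      (1 + draw_time (loop_limit s) (clustered_bits s) +
       (1 + list_time connect_and_write (loop_limit s) (clustered_bits s) +
       out_time s (written_bits s))))"

lemma poly_bounded_program_time: "poly_bounded program_time"
proof -
  have limit: "poly_bounded loop_limit" unfolding loop_limit_def by (intro poly_bounded_arith)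
  have sized: "poly_bounded sized_bits"
    unfolding sized_bits_def by (intro poly_bounded_list_bits poly_bounded_arith)
  have clustered: "poly_bounded clustered_bits"
    unfolding clustered_bits_def by (intro poly_bounded_list_bits limit sized)
  have written: "poly_bounded written_bits"
    unfolding written_bits_def by (intro poly_bounded_list_bits limit clustered)
  show ?thesis
    unfolding program_time_def draw_time_def out_time_def step_time_def
    by (intro poly_bounded_arith poly_bounded_list_time limit sized clustered written)
qed

lemma draw_time_mono: "J \<le> J' \<Longrightarrow> draw_time J b \<le> draw_time J' b"
  unfolding draw_time_def by (intro add_mono mult_le_mono1 order_refl)

lemma out_time_mono: "M \<le> M' \<Longrightarrow> out_time M b \<le> out_time M' b"
  unfolding out_time_def by (intro add_mono mult_le_mono1 order_refl)

lemma le_loop_limit: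
  assumes "a \<le> (s + 1) * (s + 1)" "n \<le> s" "v \<le> 19 * (1000000 * (n + 1)) * (19 * (1000000 * (n + 1)))"
  shows "a * v \<le> loop_limit s"
proof -
  have "v \<le> 19 * (1000000 * (s + 1)) * (19 * (1000000 * (s + 1)))"
    by (rule order_trans[OF assms(3)]) (use assms(2) in \<open>intro mult_le_mono; simp\<close>)
  thus ?thesis unfolding loop_limit_def by (rule mult_le_mono[OF assms(1)])
qed

lemma sizes_le_loop_limit:
  fixes n :: nat
  defines "u \<equiv> 19 * (1000000 * (n + 1))"
  assumes n_le: "n \<le> s"
  shows "a \<le> s \<Longrightarrow> a \<le> loop_limit s" "n * u \<le> loop_limit s" "n * u * u * n \<le> loop_limit s"
    and "n * u * u + n * (n * u) \<le> loop_limit s"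
proof -
  have u_le: "1 \<le> u * u" "u \<le> u * u" by (auto simp: u_def)
  note limit = le_loop_limit[OF _ n_le, folded u_def]
  have square: "n + n * n \<le> (s + 1) * (s + 1)"
    using mult_le_mono[of n "s + 1" "n + 1" "s + 1"] n_le by simp
  show "a \<le> loop_limit s" if "a \<le> s" using limit[of a 1] u_le(1) that by simp
  show "n * u \<le> loop_limit s" using limit[of n u] u_le(2) n_le by simp
  show "n * u * u * n \<le> loop_limit s" using limit[of "n * n" "u * u"] square by (simp add: ac_simps)
  have "n * u * u + n * (n * u) \<le> (n + n * n) * (u * u)"
    using mult_le_mono2[OF u_le(2), of "n * n"] by (simp add: algebra_simps)
  also have "\<dots> \<le> loop_limit s" by (rule limit[OF square]) simp
  finally show "n * u * u + n * (n * u) \<le> loop_limit s" .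
qed

lemma le_two_power_input_size:
  assumes "x \<in> set xs"
  shows "x \<le> 2 ^ input_size xs"
proof -
  have "nat_size x \<le> input_size xs" unfolding input_size_def
    using assms by (intro member_le_sum_list) auto
  moreover have "x \<le> 2 ^ nat_size x"
    using floorlog_bounds[of x 2] by (cases "x = 0") (auto simp: nat_size_def)
  ultimately show ?thesis by (rule le_two_power_trans[rotated])
qed

lemma length_le_input_size: "length xs \<le> input_size xs"
  unfolding input_size_def by (induction xs) (auto simp: nat_size_def)

context encoded_ftfp
begin

abbreviation "size_I \<equiv> input_size (encode I)"
abbreviation "draw_count \<equiv> n * atoms_per_unit * atoms_per_unit + n * (n * atoms_per_unit)"
abbreviation "\<Omega> \<equiv> draws draw_count cluster_size"

definition clustered_banks :: banks where
  "clustered_banks = sems inp solve_and_cluster (prepared inp)"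

definition drawn_banks :: "(nat \<Rightarrow> nat) \<Rightarrow> banks" where
  "drawn_banks \<omega> = put LoopU 0 draw_count (clustered_banks(RandomDraw := \<omega>))"

definition final_banks :: "(nat \<Rightarrow> nat) \<Rightarrow> banks" where
  "final_banks \<omega> = sems inp connect_and_write (drawn_banks \<omega>)"

lemma base_inp: "base inp = length (encode I)"
  unfolding base_def input_of_dims length_encode by simp

lemma dims_le: "base inp \<le> size_I" "m \<le> size_I" "n \<le> size_I" "m * n \<le> size_I" "m + m * n \<le> base inp"
  using length_le_input_size[of "encode I"] unfolding base_inp length_encode by simp_all

lemma fits_inp: "size_I \<le> b \<Longrightarrow> fits b inp"
  by (rule fits_mono) (auto simp: fits_def input_of_def intro: le_two_power_input_size)

lemma exec_loops_bounded:
  assumes "set cs \<subseteq> set (preprocess @ solve_and_cluster @ connect_and_write)" "size_I \<le> b"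
    "banks_fit b \<sigma>"
    and sizes: "\<And>k. k \<in> {NumSites..NumRounds} \<Longrightarrow> \<sigma> k = sized inp k"
  shows "exec (compile_list cs) (flat inp \<sigma>) (return_pmf (flat inp (sems inp cs \<sigma>)))
      (list_time cs (loop_limit size_I) b)"
    and "banks_fit (list_bits cs (loop_limit size_I) b) (sems inp cs \<sigma>)"
proof -
  have "loops_bounded_by size_bounds c" if "c \<in> set cs" for c
    using assms(1) that by (intro loops_bounded_program) blast
  moreover have "ev inp \<sigma> e \<le> loop_limit size_I" if "e \<in> size_bounds" for e
    using that sizes sized_values[of inp, unfolded input_of_dims]
      sizes_le_loop_limit[OF dims_le(3)] dims_le
    by (auto simp: size_bounds_def)
  ultimately show "exec (compile_list cs) (flat inp \<sigma>) (return_pmf (flat inp (sems inp cs \<sigma>)))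
      (list_time cs (loop_limit size_I) b)"
    "banks_fit (list_bits cs (loop_limit size_I) b) (sems inp cs \<sigma>)"
    using exec_compile_list[OF _ fits_inp[OF assms(2)] assms(3)] by blast+
qed

lemma clustered_unwritten: "k \<in> {NumSites..NumDraws} \<union> {RandomDraw, RandomOpen, RandomConn} \<Longrightarrow>
    clustered_banks k = sized inp k"
  unfolding clustered_banks_def
  by (subst sems_unwritten) (auto simp: solve_and_cluster_def prepared_unwritten)

lemma clustered_values:
  "clustered_banks NumDraws 0 = draw_count" "clustered_banks ClusterSize 0 = cluster_size"
  "clustered_banks NumSites 0 = m" "clustered_banks NumPairs 0 = m * n"
    "clustered_banks RandomDraw = (\<lambda>_. 0)"
  using sized_values[of inp, unfolded input_of_dims] sized_zero[of RandomDraw]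
  by (simp_all add: clustered_unwritten atoms_per_unit_def cluster_size_def granularity_def)

lemma exec_set_sizes:
  "exec (compile_list set_sizes) (flat inp (\<lambda>_ _. 0)) (return_pmf (flat inp (sized inp)))
      (list_time set_sizes 0 size_I)"
  "banks_fit (sized_bits size_I) (sized inp)"
  using exec_compile_list[OF loops_bounded_set_sizes, where \<sigma> = "\<lambda>_ _. 0"
    and U = 0, OF _ fits_inp[OF order_refl]]
  by (simp_all add: sized_def sized_bits_def banks_fit_def fits_def)

lemma size_le_bits: "size_I \<le> sized_bits size_I" "size_I \<le> clustered_bits size_I"
  "size_I \<le> written_bits size_I"
  unfolding written_bits_def clustered_bits_def sized_bits_def by (meson le_list_bits order_trans)+

lemma exec_solve_and_cluster:
  "exec (compile_list (preprocess @ solve_and_cluster)) (flat inp (sized inp))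
      (return_pmf (flat inp clustered_banks))
     (list_time (preprocess @ solve_and_cluster) (loop_limit size_I) (sized_bits size_I))"
  "banks_fit (clustered_bits size_I) clustered_banks"
  using exec_loops_bounded[OF _ size_le_bits(1) exec_set_sizes(2), of "preprocess @ solve_and_cluster"]
  by (simp_all add: clustered_bits_def clustered_banks_def prepared_def sems_append Un_assoc[symmetric])

lemma draws_fit:
  assumes "\<omega> \<in> set_pmf \<Omega>"
  shows "banks_fit (clustered_bits size_I) (drawn_banks \<omega>)"
proof -
  note fit = banks_fitD[OF exec_solve_and_cluster(2) order_refl]
  have "\<omega> x \<le> 2 ^ clustered_bits size_I" for x
    using draws_less[OF assms _ cluster_size_pos, of x] draws_outside[OF assms, of x]
      fit[of ClusterSize 0]
    by (cases "x < draw_count") (simp_all add: clustered_values)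
  thus ?thesis using fit fit[of NumDraws 0]
    by (simp add: drawn_banks_def banks_fit_def fits_def put_def clustered_values)
qed

lemma final_sizes: "final_banks \<omega> NumSites 0 + final_banks \<omega> NumPairs 0 = m + m * n"
  unfolding final_banks_def
  by (subst (1 2) sems_unwritten) (auto simp: connect_and_write_def drawn_banks_def clustered_values)

lemma exec_connect_and_write:
  assumes "\<omega> \<in> set_pmf \<Omega>"
  shows "exec (Seq (compile_list connect_and_write) out_com) (flat inp (drawn_banks \<omega>))
    (return_pmf (output_memory (final_banks \<omega>) inp))
    (1 + list_time connect_and_write (loop_limit size_I) (clustered_bits size_I) +
    out_time size_I (written_bits size_I))"
proof (rule exec_Seq_return)
  have "drawn_banks \<omega> k = sized inp k" if "k \<in> {NumSites..NumRounds}" for k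
    using that by (simp add: drawn_banks_def clustered_unwritten)
  note compiled = exec_loops_bounded[OF _ size_le_bits(2)
    draws_fit[OF assms] this, of connect_and_write]
  show "exec (compile_list connect_and_write) (flat inp (drawn_banks \<omega>))
      (return_pmf (flat inp (final_banks \<omega>)))
      (list_time connect_and_write (loop_limit size_I) (clustered_bits size_I))"
    unfolding final_banks_def by (rule compiled(1)) auto
  have "banks_fit (written_bits size_I) (final_banks \<omega>)"
    unfolding final_banks_def written_bits_def by (rule compiled(2)) auto
  moreover have "base inp \<le> 2 ^ written_bits size_I"
    using le_two_power_trans[OF le_two_power_self] dims_le(1) size_le_bits(3) by (meson order_trans)
  ultimately have "exec out_com (flat inp (final_banks \<omega>))
      (return_pmf (output_memory (final_banks \<omega>) inp))
      (out_time (m + m * n) (written_bits size_I))"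
    by (intro exec_out_com[OF fits_inp[OF size_le_bits(3)]] final_sizes dims_le(5))
  thus "exec out_com (flat inp (final_banks \<omega>)) (return_pmf (output_memory (final_banks \<omega>) inp))
      (out_time size_I (written_bits size_I))"
    by (rule exec_mono) (use dims_le in \<open>intro out_time_mono, simp\<close>)
qed

lemma exec_program:
  "exec ftfp_program (flat inp (\<lambda>_ _. 0)) (map_pmf (\<lambda>\<omega>. output_memory (final_banks \<omega>) inp) \<Omega>)
      (program_time size_I)"
proof -
  note fit = banks_fitD[OF exec_solve_and_cluster(2) order_refl]
  have "draw_count \<le> loop_limit size_I"
    using sizes_le_loop_limit(4)[OF dims_le(3)] by (simp add: atoms_per_unit_def granularity_def)
  hence "exec draw_com (flat inp clustered_banks) (map_pmf (\<lambda>\<omega>. flat inp (drawn_banks \<omega>)) \<Omega>)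
      (draw_time (loop_limit size_I) (clustered_bits size_I))"
    unfolding drawn_banks_def
    using exec_draw_com[OF fits_inp[OF size_le_bits(2)] cluster_size_pos _ _
      exec_solve_and_cluster(2) clustered_values(1,2,5)]
      fit[of NumDraws 0] fit[of ClusterSize 0]
    by (auto simp: clustered_values intro: exec_mono draw_time_mono)
  note drawn = exec_Seq[OF this exec_connect_and_write]
  show ?thesis
    unfolding ftfp_program_def program_time_def map_pmf_def
    by (rule exec_Seq_return[OF exec_set_sizes(1) exec_Seq_return[OF exec_solve_and_cluster(1) drawn]])
qed

lemma init_program: "init_config ftfp_program (encode I) = ([ftfp_program], flat inp (\<lambda>_ _. 0), 0)"
  unfolding init_config_def flat_def base_inp by (auto simp: input_of_def fun_eq_iff)

lemmas program_halts_within = exec_halts_within[OF exec_program init_program]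
lemmas program_outcome = exec_outcome[OF exec_program init_program]

definition output_open :: "(nat \<Rightarrow> nat) \<Rightarrow> nat \<Rightarrow> nat" where
  "output_open \<omega> i = final_banks \<omega> Output i"

definition output_conn :: "(nat \<Rightarrow> nat) \<Rightarrow> nat \<Rightarrow> nat \<Rightarrow> nat" where
  "output_conn \<omega> i j = final_banks \<omega> Output (m + (i * n + j))"

definition output_cost :: "(nat \<Rightarrow> nat) \<Rightarrow> nat" where
  "output_cost \<omega> = (\<Sum>i<m. scaled_open_cost i * output_open \<omega> i) +
      (\<Sum>i<m. \<Sum>j<n. scaled_distance i j * output_conn \<omega> i j)"

lemma out_output_memory:
  shows "i < m \<Longrightarrow> out_y I (output_memory (final_banks \<omega>) inp) i = output_open \<omega> i"
    and "i < m \<Longrightarrow> j < n \<Longrightarrow> out_x I (output_memory (final_banks \<omega>) inp) i j = output_conn \<omega> i j"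
proof -
  have "output_memory (final_banks \<omega>) inp a = final_banks \<omega> Output a" if "a < m + m * n" for a
    by (rule output_memory_cell) (use that final_sizes dims_le(5) in auto)
  thus "i < m \<Longrightarrow> out_y I (output_memory (final_banks \<omega>) inp) i = output_open \<omega> i"
    "i < m \<Longrightarrow> j < n \<Longrightarrow> out_x I (output_memory (final_banks \<omega>) inp) i j = output_conn \<omega> i j"
    using row_major_less[of i m j n]
    by (simp_all add: out_y_def out_x_def output_open_def output_conn_def add.assoc)
qed

lemma real_output_cost:
  "real (output_cost \<omega>) = real Q * int_cost I (out_y I (output_memory (final_banks \<omega>) inp))
      (out_x I (output_memory (final_banks \<omega>) inp))"
  unfolding int_cost_def scaled_cost output_cost_def by (simp add: out_output_memory)

definition starred_banks :: banks where
  "starred_banks = sem inp select_stars (prepared inp)"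

lemma data_loaded_prepared_input:
  "data_loaded (prepared inp)" "j < n \<Longrightarrow> prepared inp Weight j = demand_prod div demand I j"
  by (rule data_loaded_prepared;
      simp add: input_of_dims scaled_open_cost_def scaled_distance_def input_of_demand[symmetric]
        del: One_nat_def)+

lemma prepared_zero: "k \<notin> {NumSites..Weight} \<union> {LoopI, LoopJ} \<Longrightarrow> prepared inp k = (\<lambda>_. 0)"
  using prepared_unwritten[of k inp] sized_zero[of k inp] by auto

lemma star_history_starred: "star_history (n * atoms_per_unit) starred_banks"
  unfolding starred_banks_def
  by (rule sem_select_stars[OF data_loaded_prepared_input]) (simp_all add: prepared_zero)

lemma starred_unwritten:
  "k \<notin> {NumSites..Weight} \<union> {LoopI, LoopJ} \<union> written select_stars \<Longrightarrow> starred_banks k = (\<lambda>_. 0)"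
  unfolding starred_banks_def using prepared_zero[of k] by (subst sem_unwritten) blast+

lemma clustered_banks_eq:
  "clustered_banks = sems inp [split_amounts, create_atoms, fill_pools, set_residuals,
      form_clusters] starred_banks"
  by (simp add: clustered_banks_def starred_banks_def solve_and_cluster_def)

lemma stars_cost_le:
  assumes "feasible I y x"
  shows "real (stars_cost starred_banks (n * atoms_per_unit)) \<le> cost_limit (real Q * cost I y x)"
  by (rule star_history_end[OF star_history_starred feasible_scaled_cost_nonneg[OF assms]
    feasible_dual_bound[OF assms]])

sublocale star_solution n m scaled_open_cost scaled_distance "demand I" "n * atoms_per_unit"
  "starred_banks StarAmount" "starred_banks StarSite" "members_of starred_banks"
proof -
  obtain y :: "nat \<Rightarrow> nat" and x where "feasible I y x" by (rule int_feasible_ex)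
  note feasible = feasible_real_of_nat[OF this]
  show "star_solution n m scaled_distance (demand I) (n * atoms_per_unit) (starred_banks StarAmount)
      (starred_banks StarSite) (members_of starred_banks)"
    by (rule star_history_end[OF star_history_starred feasible_scaled_cost_nonneg[OF feasible]
      feasible_dual_bound[OF feasible]])
qed

lemma stars_loaded_starred: "stars_loaded starred_banks"
  unfolding stars_loaded_def
proof (intro conjI)
  show "data_loaded starred_banks"
    by (rule data_loaded_cong[OF data_loaded_prepared_input(1)])
      (auto simp: starred_banks_def sem_unwritten)
qed (auto simp: members_of_def)

lemma clustered_state:
  "split_loaded clustered_banks"
  "bank_clustering_inv (n * (n * atoms_per_unit)) clustered_banks"
  unfolding clustered_banks_eq
  by (rule sem_cluster_stars[OF stars_loaded_starred]; rule starred_unwritten; auto)+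

lemma drawn_state:
  "split_loaded (drawn_banks \<omega>)" "drawn_banks \<omega> ClusterOf = clustered_banks ClusterOf"
  "drawn_banks \<omega> PositionOf = clustered_banks PositionOf" "drawn_banks \<omega> RandomOpen = (\<lambda>_. 0)"
  "drawn_banks \<omega> RandomConn = (\<lambda>_. 0)"
proof -
  show "split_loaded (drawn_banks \<omega>)"
    by (rule split_loaded_cong[OF clustered_state(1)]) (auto simp: drawn_banks_def)
  show "drawn_banks \<omega> RandomOpen = (\<lambda>_. 0)" "drawn_banks \<omega> RandomConn = (\<lambda>_. 0)"
    using sized_zero[of RandomOpen inp] sized_zero[of RandomConn inp]
    by (simp_all add: drawn_banks_def clustered_unwritten)
qed (simp_all add: drawn_banks_def)

lemma rounded_solution_ex:
  obtains center radius link reach where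
    "rounded_solution n m scaled_distance (demand I) (n * atoms_per_unit) (starred_banks StarAmount)
       (starred_banks StarSite) (members_of starred_banks) (n * (n * atoms_per_unit))
       (bank_pool clustered_banks)
       (clustered_banks ClusterOf) (clustered_banks PositionOf) center radius link reach
       (\<lambda>\<omega> i j. final_banks \<omega> RandomConn (i * n + j))"
proof -
  obtain center radius link reach where
    "is_clustering (n * (n * atoms_per_unit)) (bank_pool clustered_banks) (clustered_banks ClusterOf)
       (clustered_banks PositionOf) residual center radius link reach"
    by (rule clustering_inv_end[OF clustered_state(2) sum_residual_le])
  then interpret clustered_solution n m scaled_open_cost scaled_distance "demand I" "n * atoms_per_unit"
    "starred_banks StarAmount" "starred_banks StarSite" "members_of starred_banks"
      "n * (n * atoms_per_unit)"
    "bank_pool clustered_banks" "clustered_banks ClusterOf"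
      "clustered_banks PositionOf" center radius link reach
    by (intro clustered_solution.intro star_solution_axioms clustered_solution_axioms.intro)
  show ?thesis
  proof (rule that, rule rounded_solution.intro[OF clustered_solution_axioms
    rounded_solution_axioms.intro])
    fix \<omega> j assume "j < n"
    from sem_connect_and_write(1)[where inp = inp, OF drawn_state this]
    show "greedy_inv (random_open \<omega>) j (residual j) (\<lambda>i. final_banks \<omega> RandomConn (i * n + j))"
      by (simp add: final_banks_def drawn_banks_def)
  qed
qed

lemma output_correct:
  shows "\<omega> \<in> set_pmf \<Omega> \<Longrightarrow> i < m \<Longrightarrow> j < n \<Longrightarrow> output_conn \<omega> i j \<le> output_open \<omega> i"
    and "\<omega> \<in> set_pmf \<Omega> \<Longrightarrow> j < n \<Longrightarrow> demand I j \<le> (\<Sum>i<m. output_conn \<omega> i j)"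
    and "measure_pmf.expectation \<Omega> (\<lambda>\<omega>. real (output_cost \<omega>))
      \<le> real (stars_cost starred_banks (n * atoms_per_unit)) / real cluster_size"
proof -
  obtain center radius link reach where "rounded_solution n m scaled_distance (demand I)
      (n * atoms_per_unit)
      (starred_banks StarAmount) (starred_banks StarSite) (members_of starred_banks)
      (n * (n * atoms_per_unit))
      (bank_pool clustered_banks) (clustered_banks ClusterOf)
      (clustered_banks PositionOf) center radius link reach
      (\<lambda>\<omega> i j. final_banks \<omega> RandomConn (i * n + j))"
    by (rule rounded_solution_ex)
  then interpret rounded: rounded_solution n m scaled_open_cost scaled_distance "demand I"
    "n * atoms_per_unit"
    "starred_banks StarAmount" "starred_banks StarSite" "members_of starred_banks"
      "n * (n * atoms_per_unit)"
    "bank_pool clustered_banks" "clustered_banks ClusterOf"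
      "clustered_banks PositionOf" center radius link reach
    "\<lambda>\<omega> i j. final_banks \<omega> RandomConn (i * n + j)" .
  have count: "rounded.num_draws = draw_count" by (simp add: rounded.num_draws_def num_atoms_def)
  have drawn: "drawn_banks \<omega> RandomDraw = \<omega>" for \<omega> by (simp add: drawn_banks_def)
  note final = rounded.sem_connect_and_write[where inp = inp, OF drawn_state, folded
    final_banks_def, unfolded drawn]
  have open_eq: "output_open \<omega> i = rounded.total_open \<omega> i" if "i < m" for \<omega> i
    using final(2)[OF that] by (simp add: output_open_def rounded.total_open_def)
  have conn_eq: "output_conn \<omega> i j = rounded.total_conn \<omega> i j" if "i < m" "j < n" for \<omega> i j
    using final(3)[OF that] by (simp add: output_conn_def rounded.total_conn_def)
  show "\<omega> \<in> set_pmf \<Omega> \<Longrightarrow> i < m \<Longrightarrow> j < n \<Longrightarrow> output_conn \<omega> i j \<le> output_open \<omega> i"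
    using rounded.total_conn_le[unfolded count] by (simp add: conn_eq open_eq)
  show "\<omega> \<in> set_pmf \<Omega> \<Longrightarrow> j < n \<Longrightarrow> demand I j \<le> (\<Sum>i<m. output_conn \<omega> i j)"
    using rounded.demand_met[unfolded count] by (simp add: conn_eq)
  have "output_cost \<omega> = rounded.solution_cost \<omega>" for \<omega>
    by (simp add: output_cost_def rounded.solution_cost_def conn_eq open_eq)
  thus "measure_pmf.expectation \<Omega> (\<lambda>\<omega>. real (output_cost \<omega>))
      \<le> real (stars_cost starred_banks (n * atoms_per_unit)) / real cluster_size"
    using rounded.expected_solution_cost[unfolded count] by (simp add: stars_cost_def)
qed

lemma expected_output_cost:
  assumes "feasible I y x"
  shows "measure_pmf.expectation \<Omega> (\<lambda>\<omega>. real (output_cost \<omega>)) \<le> (1 + 2 / exp 1) * (real Q * cost I y x)"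
proof -
  note output_correct(3)
  also have "real (stars_cost starred_banks (n * atoms_per_unit)) / real cluster_size
      \<le> cost_limit (real Q * cost I y x) / real cluster_size"
    by (rule divide_right_mono[OF stars_cost_le[OF assms]]) simp
  also have "\<dots> \<le> (1 + 2 / exp 1) * (real Q * cost I y x)"
    by (rule cost_limit_le[OF feasible_scaled_cost_nonneg[OF assms]])
  finally show ?thesis .
qed

lemma program_feasible:
  assumes "m' \<in> set_pmf (outcome ftfp_program (encode I))"
  shows "feasible I (out_y I m') (out_x I m')"
  using assms output_correct(1,2) unfolding program_outcome
  by (auto simp: feasible_def out_output_memory)

lemma program_expected_cost:
  "measure_pmf.expectation (outcome ftfp_program (encode I)) (\<lambda>m. int_cost I (out_y I m) (out_x I m))
     \<le> (1 + 2 / exp 1) * LP_opt I"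
proof -
  let ?E = "measure_pmf.expectation (outcome ftfp_program (encode I))
      (\<lambda>m. int_cost I (out_y I m) (out_x I m))"
  let ?\<rho> = "1 + 2 / exp 1 :: real"
  have \<rho>_pos: "0 < ?\<rho>" by (simp add: add_pos_pos)
  have expectation: "real Q * ?E = measure_pmf.expectation \<Omega> (\<lambda>\<omega>. real (output_cost \<omega>))"
    by (simp add: program_outcome real_output_cost)
  have "?E / ?\<rho> \<le> LP_opt I"
  proof (rule LP_opt_greatest)
    fix y x assume "feasible I y (x :: nat \<Rightarrow> nat \<Rightarrow> real)"
    hence "real Q * ?E \<le> real Q * (?\<rho> * cost I y x)"
      unfolding expectation using expected_output_cost by (simp only: mult.left_commute)
    hence "?E \<le> ?\<rho> * cost I y x" using Q_pos by (simp only: mult_le_cancel_left_pos of_nat_0_less_iff)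
    thus "?E / ?\<rho> \<le> cost I y x" using \<rho>_pos by (simp only: divide_le_eq mult.commute if_True)
  qed
  thus ?thesis using \<rho>_pos by (simp only: divide_le_eq mult.commute if_True)
qed

end

theorem theorem12:
  "\<exists>P :: com.
     poly_time_on (encode ` {I. ftfp_instance I}) P \<and>
     (\<forall>I. ftfp_instance I \<longrightarrow>
        (\<forall>m \<in> set_pmf (outcome P (encode I)). feasible I (out_y I m) (out_x I m)) \<and>
        measure_pmf.expectation (outcome P (encode I)) (\<lambda>m. int_cost I (out_y I m) (out_x I m))
          \<le> (1 + 2 / exp 1) * LP_opt I \<and>
        (1 + 2 / exp 1) * LP_opt I \<le> (1 + 2 / exp 1) * OPT I)"
proof (intro exI[of _ ftfp_program] conjI allI impI ballI)
  obtain p :: "nat poly" where time_le: "\<And>x. program_time x \<le> poly p x"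
    using poly_bounded_program_time unfolding poly_bounded_def by blast
  have "halts_within ftfp_program (encode I) (poly p (input_size (encode I)))"
    if "ftfp_instance I" for I
    by (rule encoded_ftfp.program_halts_within[OF encoded_ftfp.intro[OF that] time_le])
  thus "poly_time_on (encode ` {I. ftfp_instance I}) ftfp_program" unfolding poly_time_on_def by blast
next
  fix I assume "ftfp_instance I"
  then interpret encoded_ftfp I by unfold_locales
  show "feasible I (out_y I m') (out_x I m')" if "m' \<in> set_pmf (outcome ftfp_program (encode I))" for m'
    by (rule program_feasible[OF that])
  show "measure_pmf.expectation (outcome ftfp_program (encode I))
      (\<lambda>m. int_cost I (out_y I m) (out_x I m))
      \<le> (1 + 2 / exp 1) * LP_opt I"
    by (rule program_expected_cost)
  show "(1 + 2 / exp 1) * LP_opt I \<le> (1 + 2 / exp 1) * OPT I"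
    by (rule mult_left_mono[OF LP_opt_le_OPT]) (simp add: add_nonneg_nonneg)
qed

end
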